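(* Let $X$ be a space (a strongly discrete metric space with bounded geometry) with Property A, let $E$ be a Banach space and let $p\in\{0\}\cup[1,\infty]$. Let $A$ be a rich band-dominated operator on $\ell^p_E(X)$. Then the following are equivalent: (1) $A$ is invertible at infinity; (2) $A$ is $\mathcal P$-Fredholm; (3) $A$ is invertible in $\mathcal A^p_E(X)$ modulo $\mathcal K^p_E(X)$, i.e. there is $B\in\mathcal A^p_E(X)$ with $AB-I,\ BA-I\in\mathcal K^p_E(X)$; (4) all the limit operators $\Phi_\omega(A)$, $\omega\in\partial X$, are invertible, and $\sup_{\omega\in\partial X}\|\Phi_\omega(A)^{-1}\|$ is finite; (5) all the limit operators $\Phi_\omega(A)$, $\omega\in\partial X$, are invertible.
   Context: Spaces. A metric space $X$ has bounded geometry if $\sup_{x\in X}\sharp B(x,R)<\infty$ for every $R$ ($B(x,R)$ is the closed ball); it is strongly discrete if $\{d(x,y):x,y\in X\}$ is a discrete subset of $\mathbb R$. A "space" is a strongly discrete metric space with bounded geometry. Sequence spaces. For $p\in[1,\infty)$, $\ell^p_E(X)=\ell^p(X;E)$ is the Banach space of $p$-summable functions $X\to E$; $\ell^\infty_E(X)$ is the Banach space of bounded functions $X\to E$; $\ell^0_E(X)=c_0(X;E)$ is the space of functions $X\to E$ vanishing at infinity, with the sup norm. $\mathfrak B(Y)$ denotes the bounded linear operators on $Y$. For finite $F\subseteq X$, $P_F$ is multiplication by the characteristic function of $F$ and $Q_F=I-P_F$. Limits $\lim_F$ are along the net of finite subsets of $X$ ordered by inclusion. Operator classes. $\mathcal K^p_E(X)$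 ($\mathcal P$-compact operators): $K\in\mathfrak B(\ell^p_E(X))$ with $\lim_F\|KQ_F\|=\lim_F\|Q_FK\|=0$. $\mathcal L^p_E(X)$: $T$ such that for every finite $F'\subseteq X$, $\lim_F\|P_{F'}TQ_F\|=\lim_F\|Q_FTP_{F'}\|=0$. $\mathcal S^p_E(X)$: $T$ such that for every finite $F'$, $\lim_F\|P_{F'}TQ_F\|=0$. An operator $A\in\mathcal L^p_E(X)$ is invertible at infinity if there is $B\in\mathfrak B(\ell^p_E(X))$ with $AB-I,BA-I\in\mathcal K^p_E(X)$; it is $\mathcal P$-Fredholm if such $B$ can be chosen in $\mathcal L^p_E(X)$. Matrix coefficients. For $x,y\in X$, $T_{xy}\in\mathfrak B(E)$ is $T_{xy}e=(T(e\delta_y))(x)$, where $e\delta_y$ takes value $e$ at $y$ and $0$ elsewhere. A band operator is an $X$-by-$X$ matrix $[A_{xy}]$ with entries in $\mathfrak B(E)$, $\sup_{x,y}\|A_{xy}\|<\infty$ and finite propagation $\mathrm{prop}(A)=\sup\{d(x,y):A_{xy}\ne0\}$; it acts as a bounded operator on $\ell^p_E(X)$ by matrix multiplication. $\mathcal A^p_E(X)$, the band-dominated operators, is the norm closure of the band operators in $\mathfrak B(\ell^p_E(X))$; one has $\mathcal K^p_E(X)\subseteq\mathcal A^p_E(X)\subseteq\mathcal L^p_E(X)\subseteq\mathcal S^p_E(X)$. Limit spaces. $\beta X$ is the set of ultrafilters on $X$ (viewed as $\{0,1\}$-valued finitely additive measures) and $\partial X=\beta X\setminus X$ is the set of non-principal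 ones. A partial translation is a bijection $t:D\to R$ between subsets of $X$ with $\sup_{x\in D}d(x,t(x))<\infty$. It is compatible with $\omega\in\beta X$ if $\omega(D)=1$; then $t(\omega):=\lim_\omega t\in\beta X$, i.e. $t(\omega)(S)=1$ iff $\omega(t^{-1}(S\cap R))=1$. $X(\omega)$ is the set of ultrafilters $\alpha$ of the form $\alpha=t(\omega)$ for some $t$ compatible with $\omega$. A compatible family for $\omega$ is a choice, for each $\alpha\in X(\omega)$, of a partial translation $t_\alpha$ compatible with $\omega$ with $t_\alpha(\omega)=\alpha$. $X(\omega)$ carries the metric $d_\omega(\alpha,\beta)=\lim_{x\to\omega}d(t_\alpha(x),t_\beta(x))$ (independent of the family); $(X(\omega),d_\omega)$ is again a space. Limit operators. $A\in\mathcal A^p_E(X)$ is rich at $\omega\in\partial X$ if for all partial translations $t,s$ compatible with $\omega$ the limit $\lim_{x\to\omega}A_{t(x)s(x)}$ exists in the norm of $\mathfrak B(E)$; $A$ is rich if it is rich at every $\omega\in\partial X$. If $A$ is rich at $\omega$, $\Phi_\omega(A)$ is the $X(\omega)$-by-$X(\omega)$ matrix $\Phi_\omega(A)_{\alpha\beta}=\lim_{x\to\omega}A_{t_\alpha(x)t_\beta(x)}$ (independent of the compatible family). For $p\in\{0\}\cup[1,\infty)$ it acts as a bounded operator on $\ell^p_E(X(\omega))$ by matrix multiplication; for $p=\infty$, $\Phi_\omega(A)$ denotes the unique operator in $\mathcal S^\infty_E(X(\omega))$ with these matrix coefficients. Property A. For $p\in[1,\infty)$, a metric $p$-partition of unity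 on $X$ is a family $\{\phi_i:X\to[0,1]\}_{i\in I}$ such that: there is $N\in\mathbb N$ such that for each $x$ at most $N$ of the $\phi_i(x)$ are non-zero; $\sup_i\mathrm{diam}\{x:\phi_i(x)\neq0\}<\infty$; and $\sum_i\phi_i(x)^p=1$ for all $x$. It has $(r,\epsilon)$-variation if $\sum_i|\phi_i(x)-\phi_i(y)|^p<\epsilon^p$ whenever $d(x,y)\le r$. $X$ has Property A if for all $r,\epsilon>0$ there is a metric $p$-partition of unity with $(r,\epsilon)$-variation (this condition does not depend on $p\in[1,\infty)$). *)

theory Defs
  imports "HOL-Analysis.Analysis"
begin

section \<open>Spaces and Property A\<close>

definition bounded_geometry :: "'a set \<Rightarrow> ('a \<Rightarrow> 'a \<Rightarrow> real) \<Rightarrow> bool" where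
  "bounded_geometry X d \<longleftrightarrow>
     (\<forall>R. \<exists>N::nat. \<forall>x\<in>X. finite (Metric_space.mcball X d x R) \<and> card (Metric_space.mcball X d x R) \<le> N)"

definition strongly_discrete :: "'a set \<Rightarrow> ('a \<Rightarrow> 'a \<Rightarrow> real) \<Rightarrow> bool" where
  "strongly_discrete X d \<longleftrightarrow> discrete {d x y | x y. x \<in> X \<and> y \<in> X}"

definition is_space :: "'a set \<Rightarrow> ('a \<Rightarrow> 'a \<Rightarrow> real) \<Rightarrow> bool" where
  "is_space X d \<longleftrightarrow> Metric_space X d \<and> strongly_discrete X d \<and> bounded_geometry X d"

text \<open>The index set of a partition of unity is taken to be the natural numbers. This loses nothing:
  a space is countable (it is a countable union of finite balls) and each point lies in the support
  of finitely many members, so only countably many members are non-zero; conversely a family may be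
  padded with zero functions.\<close>

definition metric_partition_of_unity ::
    "real \<Rightarrow> 'a set \<Rightarrow> ('a \<Rightarrow> 'a \<Rightarrow> real) \<Rightarrow> (nat \<Rightarrow> 'a \<Rightarrow> real) \<Rightarrow> bool" where
  "metric_partition_of_unity q X d \<phi> \<longleftrightarrow>
     (\<forall>i. \<forall>x\<in>X. 0 \<le> \<phi> i x \<and> \<phi> i x \<le> 1) \<and>
     (\<exists>N::nat. \<forall>x\<in>X. finite {i. \<phi> i x \<noteq> 0} \<and> card {i. \<phi> i x \<noteq> 0} \<le> N) \<and>
     (\<exists>D. \<forall>i. \<forall>x\<in>X. \<forall>y\<in>X. \<phi> i x \<noteq> 0 \<and> \<phi> i y \<noteq> 0 \<longrightarrow> d x y \<le> D) \<and>
     (\<forall>x\<in>X. (\<Sum>\<^sub>\<infinity>i. \<phi> i x powr q) = 1)"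

definition has_variation ::
    "real \<Rightarrow> 'a set \<Rightarrow> ('a \<Rightarrow> 'a \<Rightarrow> real) \<Rightarrow> real \<Rightarrow> real \<Rightarrow> (nat \<Rightarrow> 'a \<Rightarrow> real) \<Rightarrow> bool" where
  "has_variation q X d r \<epsilon> \<phi> \<longleftrightarrow>
     (\<forall>x\<in>X. \<forall>y\<in>X. d x y \<le> r \<longrightarrow> (\<Sum>\<^sub>\<infinity>i. \<bar>\<phi> i x - \<phi> i y\<bar> powr q) < \<epsilon> powr q)"

text \<open>The condition does not depend on the exponent \<open>q \<in> [1,\<infinity>)\<close>.\<close>

definition property_A :: "real \<Rightarrow> 'a set \<Rightarrow> ('a \<Rightarrow> 'a \<Rightarrow> real) \<Rightarrow> bool" where
  "property_A q X d \<longleftrightarrow>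
     (\<forall>r>0. \<forall>\<epsilon>>0. \<exists>\<phi>. metric_partition_of_unity q X d \<phi> \<and> has_variation q X d r \<epsilon> \<phi>)"


section \<open>Banach spaces over a scalar field\<close>

text \<open>The library class \<open>banach\<close> is the class of real Banach spaces. To cover complex Banach spaces as
  well (with complex-linear operators), the scalar multiplication \<open>sc\<close> of \<open>E\<close> is a parameter, with
  scalars in any normed field over the reals: \<open>sc = scaleR\<close> gives real Banach spaces and
  \<open>'k = complex\<close> gives complex ones.\<close>

definition banach_scaling :: "('k::real_normed_field \<Rightarrow> 'e::banach \<Rightarrow> 'e) \<Rightarrow> bool" where
  "banach_scaling sc \<longleftrightarrow> vector_space sc \<and> (\<forall>r e. sc (of_real r) e = r *\<^sub>R e) \<and>
     (\<forall>c e. norm (sc c e) = norm c * norm e)"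

definition coeff_ops :: "('k::real_normed_field \<Rightarrow> 'e::banach \<Rightarrow> 'e) \<Rightarrow> ('e \<Rightarrow>\<^sub>L 'e) set" where
  "coeff_ops sc = {a. \<forall>c e. blinfun_apply a (sc c e) = sc c (blinfun_apply a e)}"


section \<open>Sequence spaces and their operators\<close>

text \<open>Functions \<open>S \<rightarrow> E\<close> are represented by functions on the ambient type that vanish off \<open>S\<close>, so that
  sums and suprema over \<open>S\<close> may be taken over the whole type. The exponent ranges over
  \<open>{0} \<union> [1,\<infinity>]\<close>, where the exponent \<open>0\<close> stands for \<open>c\<^sub>0\<close>; sets such as \<open>S\<close> carry the discrete topology.\<close>

definition lp_norm :: "ennreal \<Rightarrow> ('i \<Rightarrow> 'e::banach) \<Rightarrow> real" where
  "lp_norm p f =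
     (if p = 0 \<or> p = \<infinity> then (SUP x. norm (f x))
      else (\<Sum>\<^sub>\<infinity>x. norm (f x) powr enn2real p) powr (1 / enn2real p))"

definition lp_space :: "ennreal \<Rightarrow> 'i set \<Rightarrow> ('i \<Rightarrow> 'e::banach) set" where
  "lp_space p S = {f. (\<forall>x. x \<notin> S \<longrightarrow> f x = 0) \<and>
     (if p = 0 then (\<forall>\<epsilon>>0. finite {x. norm (f x) \<ge> \<epsilon>})
      else if p = \<infinity> then bounded (range f)
      else (\<lambda>x. norm (f x) powr enn2real p) summable_on UNIV)}"

text \<open>An operator on \<open>lp_space p S\<close> is represented by a function whose values off \<open>lp_space p S\<close> are
  irrelevant.\<close>

definition lp_ops :: "('k::real_normed_field \<Rightarrow> 'e::banach \<Rightarrow> 'e) \<Rightarrow> ennreal \<Rightarrow> 'i set \<Rightarrow>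
    (('i \<Rightarrow> 'e) \<Rightarrow> ('i \<Rightarrow> 'e)) set" where
  "lp_ops sc p S = {T. T \<in> lp_space p S \<rightarrow> lp_space p S \<and>
     (\<forall>f\<in>lp_space p S. \<forall>g\<in>lp_space p S. T (\<lambda>x. f x + g x) = (\<lambda>x. T f x + T g x)) \<and>
     (\<forall>c. \<forall>f\<in>lp_space p S. T (\<lambda>x. sc c (f x)) = (\<lambda>x. sc c (T f x))) \<and>
     (\<exists>C. \<forall>f\<in>lp_space p S. lp_norm p (T f) \<le> C * lp_norm p f)}"

definition op_norm :: "ennreal \<Rightarrow> 'i set \<Rightarrow> (('i \<Rightarrow> 'e::banach) \<Rightarrow> ('i \<Rightarrow> 'e)) \<Rightarrow> real" where
  "op_norm p S T = (SUP f\<in>{f \<in> lp_space p S. lp_norm p f \<le> 1}. lp_norm p (T f))"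

definition op_diff :: "(('i \<Rightarrow> 'e::banach) \<Rightarrow> ('i \<Rightarrow> 'e)) \<Rightarrow> (('i \<Rightarrow> 'e) \<Rightarrow> ('i \<Rightarrow> 'e)) \<Rightarrow>
    (('i \<Rightarrow> 'e) \<Rightarrow> ('i \<Rightarrow> 'e))" where
  "op_diff T U = (\<lambda>f x. T f x - U f x)"

definition proj :: "'i set \<Rightarrow> ('i \<Rightarrow> 'e::banach) \<Rightarrow> ('i \<Rightarrow> 'e)" where
  "proj F f = (\<lambda>x. if x \<in> F then f x else 0)"

definition coproj :: "'i set \<Rightarrow> ('i \<Rightarrow> 'e::banach) \<Rightarrow> ('i \<Rightarrow> 'e)" where
  "coproj F = op_diff id (proj F)"

definition ops_K :: "('k::real_normed_field \<Rightarrow> 'e::banach \<Rightarrow> 'e) \<Rightarrow> ennreal \<Rightarrow> 'i set \<Rightarrow>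
    (('i \<Rightarrow> 'e) \<Rightarrow> ('i \<Rightarrow> 'e)) set" where
  "ops_K sc p S = {K \<in> lp_ops sc p S.
     ((\<lambda>F. op_norm p S (K \<circ> coproj F)) \<longlongrightarrow> 0) (finite_subsets_at_top S) \<and>
     ((\<lambda>F. op_norm p S (coproj F \<circ> K)) \<longlongrightarrow> 0) (finite_subsets_at_top S)}"

definition ops_L :: "('k::real_normed_field \<Rightarrow> 'e::banach \<Rightarrow> 'e) \<Rightarrow> ennreal \<Rightarrow> 'i set \<Rightarrow>
    (('i \<Rightarrow> 'e) \<Rightarrow> ('i \<Rightarrow> 'e)) set" where
  "ops_L sc p S = {T \<in> lp_ops sc p S. \<forall>F'. finite F' \<and> F' \<subseteq> S \<longrightarrow>
     ((\<lambda>F. op_norm p S (proj F' \<circ> T \<circ> coproj F)) \<longlongrightarrow> 0) (finite_subsets_at_top S) \<and>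
     ((\<lambda>F. op_norm p S (coproj F \<circ> T \<circ> proj F')) \<longlongrightarrow> 0) (finite_subsets_at_top S)}"

definition ops_S :: "('k::real_normed_field \<Rightarrow> 'e::banach \<Rightarrow> 'e) \<Rightarrow> ennreal \<Rightarrow> 'i set \<Rightarrow>
    (('i \<Rightarrow> 'e) \<Rightarrow> ('i \<Rightarrow> 'e)) set" where
  "ops_S sc p S = {T \<in> lp_ops sc p S. \<forall>F'. finite F' \<and> F' \<subseteq> S \<longrightarrow>
     ((\<lambda>F. op_norm p S (proj F' \<circ> T \<circ> coproj F)) \<longlongrightarrow> 0) (finite_subsets_at_top S)}"

definition inverse_mod_K :: "('k::real_normed_field \<Rightarrow> 'e::banach \<Rightarrow> 'e) \<Rightarrow> ennreal \<Rightarrow> 'i set \<Rightarrow>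
    (('i \<Rightarrow> 'e) \<Rightarrow> ('i \<Rightarrow> 'e)) \<Rightarrow> (('i \<Rightarrow> 'e) \<Rightarrow> ('i \<Rightarrow> 'e)) \<Rightarrow> bool" where
  "inverse_mod_K sc p S A B \<longleftrightarrow>
     op_diff (A \<circ> B) id \<in> ops_K sc p S \<and> op_diff (B \<circ> A) id \<in> ops_K sc p S"

definition invertible_at_infinity :: "('k::real_normed_field \<Rightarrow> 'e::banach \<Rightarrow> 'e) \<Rightarrow> ennreal \<Rightarrow> 'i set \<Rightarrow>
    (('i \<Rightarrow> 'e) \<Rightarrow> ('i \<Rightarrow> 'e)) \<Rightarrow> bool" where
  "invertible_at_infinity sc p S A \<longleftrightarrow>
     A \<in> ops_L sc p S \<and> (\<exists>B\<in>lp_ops sc p S. inverse_mod_K sc p S A B)"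

definition P_Fredholm :: "('k::real_normed_field \<Rightarrow> 'e::banach \<Rightarrow> 'e) \<Rightarrow> ennreal \<Rightarrow> 'i set \<Rightarrow>
    (('i \<Rightarrow> 'e) \<Rightarrow> ('i \<Rightarrow> 'e)) \<Rightarrow> bool" where
  "P_Fredholm sc p S A \<longleftrightarrow>
     A \<in> ops_L sc p S \<and> (\<exists>B\<in>ops_L sc p S. inverse_mod_K sc p S A B)"

definition invertible_op :: "('k::real_normed_field \<Rightarrow> 'e::banach \<Rightarrow> 'e) \<Rightarrow> ennreal \<Rightarrow> 'i set \<Rightarrow>
    (('i \<Rightarrow> 'e) \<Rightarrow> ('i \<Rightarrow> 'e)) \<Rightarrow> bool" where
  "invertible_op sc p S T \<longleftrightarrow> T \<in> lp_ops sc p S \<and>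
     (\<exists>B\<in>lp_ops sc p S. \<forall>f\<in>lp_space p S. B (T f) = f \<and> T (B f) = f)"

abbreviation op_inverse :: "ennreal \<Rightarrow> 'i set \<Rightarrow> (('i \<Rightarrow> 'e::banach) \<Rightarrow> ('i \<Rightarrow> 'e)) \<Rightarrow>
    (('i \<Rightarrow> 'e) \<Rightarrow> ('i \<Rightarrow> 'e))" where
  "op_inverse p S T \<equiv> inv_into (lp_space p S) T"


section \<open>Matrices and band-dominated operators\<close>

definition delta :: "'i \<Rightarrow> 'e::banach \<Rightarrow> ('i \<Rightarrow> 'e)" where
  "delta y e = (\<lambda>z. if z = y then e else 0)"

definition matrix_coeff :: "(('i \<Rightarrow> 'e::banach) \<Rightarrow> ('i \<Rightarrow> 'e)) \<Rightarrow> 'i \<Rightarrow> 'i \<Rightarrow> ('e \<Rightarrow>\<^sub>L 'e)" where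
  "matrix_coeff T x y = Blinfun (\<lambda>e. T (delta y e) x)"

definition matrix_op :: "'i set \<Rightarrow> ('i \<Rightarrow> 'i \<Rightarrow> ('e::banach \<Rightarrow>\<^sub>L 'e)) \<Rightarrow> ('i \<Rightarrow> 'e) \<Rightarrow> ('i \<Rightarrow> 'e)" where
  "matrix_op S a f = (\<lambda>x. if x \<in> S then \<Sum>\<^sub>\<infinity>y\<in>S. blinfun_apply (a x y) (f y) else 0)"

definition band_matrix :: "('k::real_normed_field \<Rightarrow> 'e::banach \<Rightarrow> 'e) \<Rightarrow> 'i set \<Rightarrow> ('i \<Rightarrow> 'i \<Rightarrow> real) \<Rightarrow>
    ('i \<Rightarrow> 'i \<Rightarrow> ('e \<Rightarrow>\<^sub>L 'e)) \<Rightarrow> bool" where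
  "band_matrix sc S d a \<longleftrightarrow>
     (\<forall>x\<in>S. \<forall>y\<in>S. a x y \<in> coeff_ops sc) \<and>
     (\<exists>C. \<forall>x\<in>S. \<forall>y\<in>S. norm (a x y) \<le> C) \<and>
     (\<exists>R. \<forall>x\<in>S. \<forall>y\<in>S. a x y \<noteq> 0 \<longrightarrow> d x y \<le> R)"

definition band_ops :: "('k::real_normed_field \<Rightarrow> 'e::banach \<Rightarrow> 'e) \<Rightarrow> ennreal \<Rightarrow> 'i set \<Rightarrow>
    ('i \<Rightarrow> 'i \<Rightarrow> real) \<Rightarrow> (('i \<Rightarrow> 'e) \<Rightarrow> ('i \<Rightarrow> 'e)) set" where
  "band_ops sc p S d = {T \<in> lp_ops sc p S.
     \<exists>a. band_matrix sc S d a \<and> (\<forall>f\<in>lp_space p S. T f = matrix_op S a f)}"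

definition ops_A :: "('k::real_normed_field \<Rightarrow> 'e::banach \<Rightarrow> 'e) \<Rightarrow> ennreal \<Rightarrow> 'i set \<Rightarrow>
    ('i \<Rightarrow> 'i \<Rightarrow> real) \<Rightarrow> (('i \<Rightarrow> 'e) \<Rightarrow> ('i \<Rightarrow> 'e)) set" where
  "ops_A sc p S d = {T \<in> lp_ops sc p S.
     \<forall>\<epsilon>>0. \<exists>U\<in>band_ops sc p S d. op_norm p S (op_diff T U) < \<epsilon>}"


section \<open>Limit spaces and limit operators\<close>

text \<open>An ultrafilter \<open>\<omega>\<close> on \<open>X\<close> is represented as a filter containing \<open>X\<close>: the measure \<open>\<omega>(D) = 1\<close> is
  \<open>\<forall>\<^sub>F x in \<omega>. x \<in> D\<close>, the limit along \<open>\<omega>\<close> is the limit of the filter, and the push-forward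
  \<open>t(\<omega>)\<close> is \<open>filtermap t \<omega>\<close>. Values of \<open>t\<close> off its domain play no role in any of these, because
  the domain of a translation compatible with \<open>\<omega>\<close> belongs to \<open>\<omega>\<close>.\<close>

definition beta :: "'a set \<Rightarrow> 'a filter set" where
  "beta X = {\<omega>. \<omega> \<noteq> bot \<and> \<omega> \<le> principal X \<and>
     (\<forall>D. (\<forall>\<^sub>F x in \<omega>. x \<in> D) \<or> (\<forall>\<^sub>F x in \<omega>. x \<notin> D))}"

definition beta_boundary :: "'a set \<Rightarrow> 'a filter set" where
  "beta_boundary X = {\<omega> \<in> beta X. \<forall>x\<in>X. \<omega> \<noteq> principal {x}}"

definition partial_translation ::
    "'a set \<Rightarrow> ('a \<Rightarrow> 'a \<Rightarrow> real) \<Rightarrow> ('a \<Rightarrow> 'a) \<Rightarrow> 'a set \<Rightarrow> 'a set \<Rightarrow> bool" where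
  "partial_translation X d t D R \<longleftrightarrow>
     D \<subseteq> X \<and> R \<subseteq> X \<and> bij_betw t D R \<and> (\<exists>C. \<forall>x\<in>D. d x (t x) \<le> C)"

definition compatible :: "'a set \<Rightarrow> ('a \<Rightarrow> 'a \<Rightarrow> real) \<Rightarrow> 'a filter \<Rightarrow> ('a \<Rightarrow> 'a) \<Rightarrow> bool" where
  "compatible X d \<omega> t \<longleftrightarrow> (\<exists>D R. partial_translation X d t D R \<and> (\<forall>\<^sub>F x in \<omega>. x \<in> D))"

definition limit_space :: "'a set \<Rightarrow> ('a \<Rightarrow> 'a \<Rightarrow> real) \<Rightarrow> 'a filter \<Rightarrow> 'a filter set" where
  "limit_space X d \<omega> = {filtermap t \<omega> | t. compatible X d \<omega> t}"

text \<open>The metric of the limit space is not needed: the sequence spaces over it and the operator classes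
  used for the limit operators depend on its underlying set only.\<close>

definition is_compatible_family ::
    "'a set \<Rightarrow> ('a \<Rightarrow> 'a \<Rightarrow> real) \<Rightarrow> 'a filter \<Rightarrow> ('a filter \<Rightarrow> 'a \<Rightarrow> 'a) \<Rightarrow> bool" where
  "is_compatible_family X d \<omega> \<tau> \<longleftrightarrow>
     (\<forall>\<alpha>\<in>limit_space X d \<omega>. compatible X d \<omega> (\<tau> \<alpha>) \<and> filtermap (\<tau> \<alpha>) \<omega> = \<alpha>)"

definition compatible_family ::
    "'a set \<Rightarrow> ('a \<Rightarrow> 'a \<Rightarrow> real) \<Rightarrow> 'a filter \<Rightarrow> 'a filter \<Rightarrow> 'a \<Rightarrow> 'a" where
  "compatible_family X d \<omega> = (SOME \<tau>. is_compatible_family X d \<omega> \<tau>)"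

definition rich_at :: "'a set \<Rightarrow> ('a \<Rightarrow> 'a \<Rightarrow> real) \<Rightarrow> 'a filter \<Rightarrow>
    (('a \<Rightarrow> 'e::banach) \<Rightarrow> ('a \<Rightarrow> 'e)) \<Rightarrow> bool" where
  "rich_at X d \<omega> A \<longleftrightarrow> (\<forall>t s. compatible X d \<omega> t \<and> compatible X d \<omega> s \<longrightarrow>
     (\<exists>L. ((\<lambda>x. matrix_coeff A (t x) (s x)) \<longlongrightarrow> L) \<omega>))"

definition rich :: "'a set \<Rightarrow> ('a \<Rightarrow> 'a \<Rightarrow> real) \<Rightarrow> (('a \<Rightarrow> 'e::banach) \<Rightarrow> ('a \<Rightarrow> 'e)) \<Rightarrow> bool" where
  "rich X d A \<longleftrightarrow> (\<forall>\<omega>\<in>beta_boundary X. rich_at X d \<omega> A)"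

definition limit_matrix :: "'a set \<Rightarrow> ('a \<Rightarrow> 'a \<Rightarrow> real) \<Rightarrow> 'a filter \<Rightarrow>
    (('a \<Rightarrow> 'e::banach) \<Rightarrow> ('a \<Rightarrow> 'e)) \<Rightarrow> 'a filter \<Rightarrow> 'a filter \<Rightarrow> ('e \<Rightarrow>\<^sub>L 'e)" where
  "limit_matrix X d \<omega> A \<alpha> \<beta> =
     Lim \<omega> (\<lambda>x. matrix_coeff A (compatible_family X d \<omega> \<alpha> x) (compatible_family X d \<omega> \<beta> x))"

text \<open>For \<open>p = \<infinity>\<close> the requirement \<open>extensional\<close> normalises the irrelevant values off the sequence
  space, without which no representing function would be unique.\<close>

definition limit_op :: "('k::real_normed_field \<Rightarrow> 'e::banach \<Rightarrow> 'e) \<Rightarrow> ennreal \<Rightarrow> 'a set \<Rightarrow>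
    ('a \<Rightarrow> 'a \<Rightarrow> real) \<Rightarrow> 'a filter \<Rightarrow> (('a \<Rightarrow> 'e) \<Rightarrow> ('a \<Rightarrow> 'e)) \<Rightarrow>
    ('a filter \<Rightarrow> 'e) \<Rightarrow> ('a filter \<Rightarrow> 'e)" where
  "limit_op sc p X d \<omega> A =
     (if p = \<infinity> then
        (THE T. T \<in> ops_S sc \<infinity> (limit_space X d \<omega>) \<and>
           T \<in> extensional (lp_space \<infinity> (limit_space X d \<omega>)) \<and>
           (\<forall>\<alpha>\<in>limit_space X d \<omega>. \<forall>\<beta>\<in>limit_space X d \<omega>.
              matrix_coeff T \<alpha> \<beta> = limit_matrix X d \<omega> A \<alpha> \<beta>))
      else matrix_op (limit_space X d \<omega>) (limit_matrix X d \<omega> A))"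

end

theory Submission imports Defs begin

text \<open>
  For a band-dominated operator \<open>A\<close>, being bounded below at infinity on \<open>X\<close> and bounded below on all limit
  spaces are related in both directions. If \<open>A\<close> is not bounded below at infinity, Property A localises the
  almost-null vectors: multiplying with a slowly varying partition of unity almost commutes with \<open>A\<close>, so
  some localised vector is again almost null. Doing this repeatedly at coarser and coarser scales gives points
  tending to infinity around which \<open>A\<close> is almost singular at every scale, and along an ultrafilter of such
  points the limit operator is not bounded below. Hence invertibility of all limit operators already bounds
  their inverses uniformly. The local right inverses obtained from the inverses of the limit operators are then
  glued with the partition of unity to a right inverse modulo \<open>\<K>\<close> up to an error of norm at most one half,
  which a Neumann series removes; a right inverse modulo \<open>\<K>\<close> of an operator that is bounded below at
  infinity is two-sided.

  Conversely, an operator that is invertible at infinity is bounded below there, hence so are its limit operators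
  (with the same bound). A preimage of \<open>g\<close> under a limit operator is found by transporting finite pieces of
  \<open>g\<close> to \<open>X\<close>, applying the inverse at infinity, and transporting back: the lower bound makes
  the resulting net of approximate solutions converge pointwise.
\<close>

section \<open>Sequence spaces\<close>

text \<open>Duality and weak limits would not treat \<open>p = 0\<close> and
  \<open>p = \<infinity>\<close> on the same footing as the other exponents, and for
  \<open>p = \<infinity>\<close> finitely supported vectors are not dense. Norms are therefore
  controlled through bounds on all finite pieces, and limits are taken pointwise. The passage from
  (5) to (4) has to exclude that every single limit operator is bounded below while the constants
  tend to 0. Localising separately at each scale would give unrelated points, hence different
  ultrafilters, and no contradiction. Nesting the localisations puts all scales at one point, so
  that one ultrafilter sees them all; each localisation costs a factor 2, whence the thresholds
  \<open>(1/2) ^ m\<close>. In the implication from (1) to (5) the inverse \<open>B\<close> at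
  infinity is merely bounded, so there is no limit operator of \<open>B\<close> to work with. It is
  applied only to copies of vectors, and its output is truncated to a finite set before it is
  transported back.\<close>

locale lp_exponent =
  fixes p :: ennreal
  assumes exponent: "p = 0 \<or> 1 \<le> p"
begin

section \<open>Norm bounds on arbitrary functions, for all exponents at once\<close>

definition sup_type :: bool where "sup_type \<longleftrightarrow> p = 0 \<or> p = \<infinity>"

definition P :: real where "P = enn2real p"

lemma P_ge1: "\<not> sup_type \<Longrightarrow> 1 \<le> P"
  using exponent unfolding sup_type_def P_def
  by (metis enn2real_1 enn2real_mono infinity_ennreal_def top.not_eq_extremum)

lemma P_pos: "\<not> sup_type \<Longrightarrow> 0 < P"
  using P_ge1 by fastforce

lemma powr_P_le_iff:
  assumes "\<not> sup_type" "0 \<le> a" "0 \<le> b"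
  shows "a powr P \<le> b powr P \<longleftrightarrow> a \<le> b"
  using assms P_pos[OF assms(1)] powr_less_mono2[of P b a] powr_mono2[of P a b]
  by (metis less_eq_real_def linorder_not_le)

text \<open>Unlike \<open>lp_norm\<close>, this is also meaningful for functions outside the sequence space.\<close>

definition lp_le :: "('i \<Rightarrow> 'v::real_normed_vector) \<Rightarrow> real \<Rightarrow> bool" where
  "lp_le f M \<longleftrightarrow> 0 \<le> M \<and>
     (if sup_type then \<forall>x. norm (f x) \<le> M
      else \<forall>F. finite F \<longrightarrow> (\<Sum>x\<in>F. norm (f x) powr P) \<le> M powr P)"

lemma lp_le_nonneg: "lp_le f M \<Longrightarrow> 0 \<le> M"
  by (simp add: lp_le_def)

lemma lp_le_point:
  assumes "lp_le f M" shows "norm (f x) \<le> M"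
proof (cases sup_type)
  case True then show ?thesis using assms by (simp add: lp_le_def)
next
  case False
  have "(\<Sum>y\<in>{x}. norm (f y) powr P) \<le> M powr P"
    using assms False unfolding lp_le_def by (meson finite.emptyI finite.insertI)
  then show ?thesis using powr_P_le_iff[OF False] lp_le_nonneg[OF assms] by simp
qed

lemma lp_le_mono:
  assumes "lp_le g M" and "\<And>x. norm (f x) \<le> norm (g x)"
  shows "lp_le f M"
proof (cases sup_type)
  case True then show ?thesis using assms unfolding lp_le_def by (meson order_trans)
next
  case False
  have "(\<Sum>x\<in>F. norm (f x) powr P) \<le> M powr P" if "finite F" for F
  proof -
    have "(\<Sum>x\<in>F. norm (f x) powr P) \<le> (\<Sum>x\<in>F. norm (g x) powr P)"
      using P_pos[OF False] by (intro sum_mono powr_mono2 assms(2)) auto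
    also have "\<dots> \<le> M powr P" using assms(1) that False unfolding lp_le_def by auto
    finally show ?thesis .
  qed
  then show ?thesis using assms(1) False by (simp add: lp_le_def)
qed

lemma lp_le_weaken: "lp_le f M \<Longrightarrow> M \<le> M' \<Longrightarrow> lp_le f M'"
  using lp_le_nonneg[of f M] less_imp_le[OF P_pos] powr_mono2[of P M M'] unfolding lp_le_def
  by (auto split: if_splits intro: order_trans)

lemma lp_le_zero: "0 \<le> M \<Longrightarrow> lp_le (\<lambda>x. 0) M"
  by (auto simp: lp_le_def)

lemma lp_le_scale:
  assumes "lp_le f M" "0 \<le> c" and "\<And>x. norm (g x) \<le> c * norm (f x)"
  shows "lp_le g (c * M)"
proof (cases sup_type)
  case True
  have "norm (g x) \<le> c * M" for x
    using assms(3)[of x] mult_left_mono[OF lp_le_point[OF assms(1), of x] assms(2)] by linarith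
  then show ?thesis using True assms lp_le_nonneg[OF assms(1)] by (simp add: lp_le_def)
next
  case False
  have "(\<Sum>x\<in>F. norm (g x) powr P) \<le> (c * M) powr P" if "finite F" for F
  proof -
    have "(\<Sum>x\<in>F. norm (g x) powr P) \<le> (\<Sum>x\<in>F. (c * norm (f x)) powr P)"
      using P_pos[OF False] by (intro sum_mono powr_mono2 assms(3)) auto
    also have "\<dots> = c powr P * (\<Sum>x\<in>F. norm (f x) powr P)"
      using assms(2) by (simp add: powr_mult sum_distrib_left)
    also have "\<dots> \<le> c powr P * M powr P"
      using assms(1) that False unfolding lp_le_def by (intro mult_left_mono) auto
    also have "\<dots> = (c * M) powr P"
      using assms(2) lp_le_nonneg[OF assms(1)] by (simp add: powr_mult)
    finally show ?thesis .
  qed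
  then show ?thesis using False assms lp_le_nonneg[OF assms(1)] by (simp add: lp_le_def)
qed

text \<open>If \<open>a\<close> or \<open>b\<close> is zero, the claim reduces to
  \<open>s powr P \<le> s\<close> or its analogue for \<open>t\<close>, valid as both weights lie
  below 1 and \<open>1 \<le> P\<close>; otherwise it is convexity of the power.\<close>

lemma powr_P_convex:
  assumes "\<not> sup_type" "0 \<le> a" "0 \<le> b" "0 < s" "0 < t" "s + t = 1"
  shows "(s * a + t * b) powr P \<le> s * a powr P + t * b powr P"
proof -
  have le: "s powr P \<le> s" "t powr P \<le> t"
    using powr_mono'[of 1 P s] powr_mono'[of 1 P t] P_ge1[OF assms(1)] assms by auto
  consider "a = 0" | "b = 0" | "0 < a" "0 < b" using assms by linarith
  then show ?thesis
  proof cases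
    case 1
    then show ?thesis using le(2) assms P_pos
      by (simp add: powr_mult mult_right_mono)
  next
    case 2
    then show ?thesis using le(1) assms P_pos
      by (simp add: powr_mult mult_right_mono)
  next
    case 3
    show ?thesis using powr_convex[OF P_ge1[OF assms(1)]] 3 assms
      unfolding convex_on_def by (auto simp: algebra_simps)
  qed
qed

text \<open>Minkowski's inequality. \<open>f + g\<close> is \<open>M + N\<close> times a convex
  combination of \<open>f / M\<close> and \<open>g / N\<close> with weights
  \<open>M / (M + N)\<close> and \<open>N / (M + N)\<close>, so convexity of the power suffices. If
  a bound is 0, that summand vanishes.\<close>

lemma lp_le_add:
  assumes "lp_le f M" "lp_le g N"
  shows "lp_le (\<lambda>x. f x + g x) (M + N)"
proof -
  note nn = lp_le_nonneg[OF assms(1)] lp_le_nonneg[OF assms(2)]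
  consider "M = 0" | "N = 0" | "sup_type" | "0 < M" "0 < N" "\<not> sup_type"
    using nn by linarith
  then show ?thesis
  proof cases
    case 1
    then have "f x = 0" for x using lp_le_point[OF assms(1), of x] by simp
    then show ?thesis using 1 assms(2) by simp
  next
    case 2
    then have "g x = 0" for x using lp_le_point[OF assms(2), of x] by simp
    then show ?thesis using 2 assms(1) by simp
  next
    case 3
    have "norm (f x + g x) \<le> M + N" for x
      using norm_triangle_ineq[of "f x" "g x"] lp_le_point[OF assms(1), of x]
        lp_le_point[OF assms(2), of x] by linarith
    then show ?thesis using nn 3 by (simp add: lp_le_def)
  next
    case 4
    define s t where "s = M / (M + N)" and "t = N / (M + N)"
    have st: "0 < s" "0 < t" "s + t = 1"
      using 4 unfolding s_def t_def by (auto simp: add_divide_distrib[symmetric])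
    have st_eq: "(M + N) * (s * (a / M)) = a" "(M + N) * (t * (b / N)) = b" for a b
      using 4 by (simp_all add: s_def t_def)
    have key: "norm (f x + g x) powr P \<le>
       (M + N) powr P * (s / M powr P * norm (f x) powr P + t / N powr P * norm (g x) powr P)" for x
    proof -
      have "norm (f x + g x) \<le> norm (f x) + norm (g x)" by (rule norm_triangle_ineq)
      also have "\<dots> = (M + N) * (s * (norm (f x) / M) + t * (norm (g x) / N))"
        unfolding distrib_left[of "M + N"] st_eq ..
      finally have "norm (f x + g x) powr P \<le> ((M + N) * (s * (norm (f x) / M) + t * (norm (g x) / N))) powr P"
        using P_pos[OF 4(3)] by (intro powr_mono2) auto
      also have "\<dots> = (M + N) powr P * (s * (norm (f x) / M) + t * (norm (g x) / N)) powr P"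
        using 4 st by (simp add: powr_mult)
      also have "\<dots> \<le> (M + N) powr P * (s * (norm (f x) / M) powr P + t * (norm (g x) / N) powr P)"
        using 4 st by (intro mult_left_mono powr_P_convex) auto
      also have "\<dots> = (M + N) powr P * (s / M powr P * norm (f x) powr P + t / N powr P * norm (g x) powr P)"
        using 4 by (simp add: powr_divide)
      finally show ?thesis .
    qed
    have "(\<Sum>x\<in>F. norm (f x + g x) powr P) \<le> (M + N) powr P" if F: "finite F" for F
    proof -
      have "(\<Sum>x\<in>F. norm (f x + g x) powr P) \<le> (\<Sum>x\<in>F. (M + N) powr P *
          (s / M powr P * norm (f x) powr P + t / N powr P * norm (g x) powr P))"
        by (intro sum_mono key)
      also have "\<dots> = (M + N) powr P * (s / M powr P * (\<Sum>x\<in>F. norm (f x) powr P) +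
          t / N powr P * (\<Sum>x\<in>F. norm (g x) powr P))"
        by (simp add: sum_distrib_left sum.distrib algebra_simps)
      also have "\<dots> \<le> (M + N) powr P * (s / M powr P * M powr P + t / N powr P * N powr P)"
        using assms F 4 st unfolding lp_le_def
        by (intro mult_left_mono add_mono) auto
      also have "\<dots> = (M + N) powr P" using 4 st by simp
      finally show ?thesis .
    qed
    then show ?thesis using 4 by (simp add: lp_le_def)
  qed
qed

lemma lp_le_sum:
  assumes "finite I" "\<And>i. i \<in> I \<Longrightarrow> lp_le (f i) (M i)"
  shows "lp_le (\<lambda>x. \<Sum>i\<in>I. f i x) (\<Sum>i\<in>I. M i)"
  using assms
  by (induction rule: finite_induct) (auto intro: lp_le_zero lp_le_add)

lemma lp_le_uminus: "lp_le f M \<Longrightarrow> lp_le (\<lambda>x. - f x) M"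
  by (rule lp_le_mono) auto

lemma lp_le_diff:
  assumes "lp_le f M" "lp_le g N"
  shows "lp_le (\<lambda>x. f x - g x) (M + N)"
  using lp_le_add[OF assms(1) lp_le_uminus[OF assms(2)]] by simp

text \<open>Transport along an injection; it is applied to slices of a product and to copies of
  finite pieces between \<open>X\<close> and a limit space.\<close>

lemma lp_le_inj:
  assumes "lp_le f M" "inj_on s D"
    and "\<And>x. x \<in> D \<Longrightarrow> norm (g x) \<le> norm (f (s x))" "\<And>x. x \<notin> D \<Longrightarrow> g x = 0"
  shows "lp_le g M"
proof (cases sup_type)
  case True
  have "norm (g x) \<le> M" for x
    using assms lp_le_nonneg[OF assms(1)] lp_le_point[OF assms(1), of "s x"]
    by (cases "x \<in> D") (auto intro: order_trans)
  then show ?thesis using True lp_le_nonneg[OF assms(1)] by (simp add: lp_le_def)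
next
  case False
  have "(\<Sum>x\<in>F. norm (g x) powr P) \<le> M powr P" if F: "finite F" for F
  proof -
    have "(\<Sum>x\<in>F. norm (g x) powr P) = (\<Sum>x\<in>F \<inter> D. norm (g x) powr P)"
      using F assms(4) by (intro sum.mono_neutral_right) auto
    also have "\<dots> \<le> (\<Sum>x\<in>F \<inter> D. norm (f (s x)) powr P)"
      using P_pos[OF False] assms(3) by (intro sum_mono powr_mono2) auto
    also have "\<dots> = (\<Sum>y\<in>s ` (F \<inter> D). norm (f y) powr P)"
      using inj_on_subset[OF assms(2), of "F \<inter> D"] by (subst sum.reindex) auto
    also have "\<dots> \<le> M powr P" using assms(1) F False unfolding lp_le_def by auto
    finally show ?thesis .
  qed
  then show ?thesis using False lp_le_nonneg[OF assms(1)] by (simp add: lp_le_def)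
qed

text \<open>The sum is at most \<open>N\<close> times its largest term. This crude form of Hoelder's
  inequality suffices, since only a bound in terms of \<open>N\<close> matters.\<close>

lemma sum_powr_le:
  assumes "\<not> sup_type" "finite B" "card B \<le> N" "\<And>y. y \<in> B \<Longrightarrow> 0 \<le> a y"
  shows "(\<Sum>y\<in>B. a y) powr P \<le> real N powr P * (\<Sum>y\<in>B. a y powr P)"
proof (cases "B = {}")
  case True then show ?thesis using P_pos[OF assms(1)] by simp
next
  case False
  define m where "m = Max (a ` B)"
  have m: "a y \<le> m" if "y \<in> B" for y using that assms(2) by (simp add: m_def)
  have "m \<in> a ` B" using assms(2) False unfolding m_def by (intro Max_in) auto
  then obtain z where z: "z \<in> B" "m = a z" by auto
  have m0: "0 \<le> m" using z assms(4) by simp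
  have "(\<Sum>y\<in>B. a y) \<le> real (card B) * m"
    using m by (intro sum_bounded_above) auto
  also have "\<dots> \<le> real N * m" using assms(3) m0 by (intro mult_right_mono) auto
  finally have "(\<Sum>y\<in>B. a y) powr P \<le> (real N * m) powr P"
    using P_pos[OF assms(1)] assms(4) by (intro powr_mono2 sum_nonneg) auto
  also have "\<dots> = real N powr P * a z powr P" using m0 z by (simp add: powr_mult)
  also have "\<dots> \<le> real N powr P * (\<Sum>y\<in>B. a y powr P)"
    using z assms(2) by (intro mult_left_mono member_le_sum) auto
  finally show ?thesis .
qed

text \<open>A Schur test with a crude constant: for finite exponents one factor \<open>N\<close>
  comes from \<open>sum_powr_le\<close>, the other from counting, for each \<open>y\<close>, the
  sets \<open>n x\<close> that contain it.\<close>

lemma lp_le_average: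
  assumes g: "lp_le g M"
    and n: "\<And>x. finite (n x) \<and> card (n x) \<le> N"
    and n': "\<And>y. finite {x. y \<in> n x} \<and> card {x. y \<in> n x} \<le> N"
    and f: "\<And>x. norm (f x) \<le> (\<Sum>y\<in>n x. norm (g y))"
  shows "lp_le f (real N * real N * M)"
proof (cases sup_type)
  case True
  have "norm (f x) \<le> real N * real N * M" for x
  proof -
    have "norm (f x) \<le> real (card (n x)) * M"
      using f[of x] sum_bounded_above[of "n x" "\<lambda>y. norm (g y)" M] lp_le_point[OF g] by fastforce
    also have "\<dots> \<le> real N * M" using n lp_le_nonneg[OF g] by (intro mult_right_mono) auto
    also have "\<dots> \<le> real N * (real N * M)"
      using lp_le_nonneg[OF g] mult_right_mono[of 1 "real N" "real N * M"] by (cases "N = 0") auto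
    finally show ?thesis by (simp add: mult.assoc)
  qed
  then show ?thesis using True lp_le_nonneg[OF g] by (simp add: lp_le_def)
next
  case False
  have "(\<Sum>x\<in>F. norm (f x) powr P) \<le> (real N * real N * M) powr P" if F: "finite F" for F
  proof -
    define H where "H = (\<Union>x\<in>F. n x)"
    have H: "finite H" using F n by (auto simp: H_def)
    have "(\<Sum>x\<in>F. norm (f x) powr P) \<le> (\<Sum>x\<in>F. (\<Sum>y\<in>n x. norm (g y)) powr P)"
      using P_pos[OF False] f by (intro sum_mono powr_mono2) auto
    also have "\<dots> \<le> (\<Sum>x\<in>F. real N powr P * (\<Sum>y\<in>n x. norm (g y) powr P))"
      using n by (intro sum_mono sum_powr_le[OF False]) auto
    also have "\<dots> = real N powr P * (\<Sum>x\<in>F. \<Sum>y\<in>n x. norm (g y) powr P)"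
      by (simp add: sum_distrib_left)
    also have "(\<Sum>x\<in>F. \<Sum>y\<in>n x. norm (g y) powr P)
        = (\<Sum>x\<in>F. \<Sum>y\<in>H. if y \<in> n x then norm (g y) powr P else 0)"
    proof (rule sum.cong[OF refl])
      fix x assume "x \<in> F"
      then have "n x = {y \<in> H. y \<in> n x}" by (auto simp: H_def)
      then show "(\<Sum>y\<in>n x. norm (g y) powr P) = (\<Sum>y\<in>H. if y \<in> n x then norm (g y) powr P else 0)"
        using sum.inter_filter[OF H, of "\<lambda>y. norm (g y) powr P" "\<lambda>y. y \<in> n x"] by simp
    qed
    also have "\<dots> = (\<Sum>y\<in>H. \<Sum>x\<in>F. if y \<in> n x then norm (g y) powr P else 0)"
      by (rule sum.swap)
    also have "\<dots> = (\<Sum>y\<in>H. real (card {x \<in> F. y \<in> n x}) * norm (g y) powr P)"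
      using F by (intro sum.cong refl) (simp add: sum.inter_filter[symmetric])
    also have "\<dots> \<le> (\<Sum>y\<in>H. real N * norm (g y) powr P)"
    proof (intro sum_mono mult_right_mono)
      fix y
      have "card {x \<in> F. y \<in> n x} \<le> card {x. y \<in> n x}" using n' by (intro card_mono) auto
      then show "real (card {x \<in> F. y \<in> n x}) \<le> real N" using n'[of y] by linarith
    qed auto
    also have "\<dots> = real N * (\<Sum>y\<in>H. norm (g y) powr P)" by (simp add: sum_distrib_left)
    also have "real N powr P * (real N * (\<Sum>y\<in>H. norm (g y) powr P))
        \<le> real N powr P * (real N powr P * M powr P)"
    proof (intro mult_left_mono mult_mono)
      \<comment> \<open>The counting factor \<open>N\<close> has to be moved inside the power
        \<open>P\<close>, which is possible because \<open>N\<close> is 0 or at least 1.\<close>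
      show "real N \<le> real N powr P"
        using P_ge1[OF False] powr_mono[of 1 P "real N"] by (cases "N = 0") auto
    qed (use g False H in \<open>auto simp: lp_le_def intro: sum_nonneg\<close>)
    also have "\<dots> = (real N * real N * M) powr P"
      using lp_le_nonneg[OF g] by (simp add: powr_mult)
    finally show ?thesis by (simp add: mult_left_mono)
  qed
  then show ?thesis using False lp_le_nonneg[OF g] by (simp add: lp_le_def)
qed

text \<open>Together with \<open>lp_le_fibre\<close> this is Fubini for the p-norm on a product. A
  family of functions indexed by a partition of unity can thus be measured in the points first or in
  the index first.\<close>

lemma lp_le_joint:
  assumes "\<And>x. lp_le (\<lambda>i. f i x) (m x)" and "lp_le m M"
  shows "lp_le (\<lambda>(i, x). f i x) M"
proof (cases sup_type)
  case True
  have "norm (f i x) \<le> M" for i x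
    using lp_le_point[OF assms(1), of i x] lp_le_point[OF assms(2), of x] by simp
  then show ?thesis using True lp_le_nonneg[OF assms(2)] by (auto simp: lp_le_def)
next
  case False
  have "(\<Sum>z\<in>W. norm (case z of (i, x) \<Rightarrow> f i x) powr P) \<le> M powr P" if W: "finite W" for W
  proof -
    have "(\<Sum>z\<in>W. norm (case z of (i, x) \<Rightarrow> f i x) powr P)
       \<le> (\<Sum>z\<in>fst ` W \<times> snd ` W. norm (case z of (i, x) \<Rightarrow> f i x) powr P)"
      using W by (intro sum_mono2) (auto intro: rev_image_eqI)
    also have "\<dots> = (\<Sum>x\<in>snd ` W. \<Sum>i\<in>fst ` W. norm (f i x) powr P)"
      by (subst sum.swap) (simp add: sum.cartesian_product case_prod_unfold)
    also have "\<dots> \<le> (\<Sum>x\<in>snd ` W. norm (m x) powr P)"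
      using assms(1) lp_le_nonneg[OF assms(1)] W False unfolding lp_le_def by (intro sum_mono) auto
    also have "\<dots> \<le> M powr P" using assms(2) W False unfolding lp_le_def by auto
    finally show ?thesis .
  qed
  then show ?thesis using False lp_le_nonneg[OF assms(2)] by (simp add: lp_le_def)
qed

section \<open>Norms and membership in the sequence spaces\<close>

lemma lp_norm_le: "lp_le f M \<Longrightarrow> lp_norm p f \<le> M"
proof (cases sup_type)
  case True
  assume "lp_le f M"
  then show ?thesis using True by (auto simp: lp_norm_def sup_type_def lp_le_def intro!: cSUP_least)
next
  case False
  assume f: "lp_le f M"
  have "(\<Sum>\<^sub>\<infinity>x. norm (f x) powr P) \<le> M powr P"
  proof (cases "(\<lambda>x. norm (f x) powr P) summable_on UNIV")
    case True
    then show ?thesis using f False unfolding lp_le_def by (intro infsum_le_finite_sums) auto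
  qed (simp add: infsum_not_exists)
  then have "(\<Sum>\<^sub>\<infinity>x. norm (f x) powr P) powr (1 / P) \<le> (M powr P) powr (1 / P)"
    using P_pos[OF False] by (intro powr_mono2 infsum_nonneg) auto
  also have "\<dots> = M" using P_pos[OF False] lp_le_nonneg[OF f] by (simp add: powr_powr)
  finally show ?thesis using False by (simp add: lp_norm_def sup_type_def P_def)
qed

lemma lp_le_norm:
  assumes "f \<in> lp_space p S" shows "lp_le f (lp_norm p f)"
proof (cases sup_type)
  case True
  have "bdd_above (range (\<lambda>x. norm (f x)))"
  proof (cases "p = 0")
    case True
    then have "finite {x. 1 \<le> norm (f x)}" using assms by (auto simp: lp_space_def)
    then have "bdd_above ((\<lambda>x. norm (f x)) ` {x. 1 \<le> norm (f x)})" by simp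
    then obtain B where "\<forall>x. 1 \<le> norm (f x) \<longrightarrow> norm (f x) \<le> B"
      unfolding bdd_above_def by auto
    then have "norm (f x) \<le> max 1 B" for x by (meson linear max.coboundedI1 max.coboundedI2)
    then show ?thesis by (meson bdd_aboveI2)
  next
    case False
    then show ?thesis using assms True
      by (auto simp: lp_space_def sup_type_def bounded_iff bdd_above_def)
  qed
  then have *: "norm (f x) \<le> lp_norm p f" for x
    using True by (auto simp: lp_norm_def sup_type_def intro: cSUP_upper)
  moreover have "0 \<le> lp_norm p f" using *[of undefined] norm_ge_zero[of "f undefined"] by linarith
  ultimately show ?thesis using True by (simp add: lp_le_def)
next
  case False
  then have s: "(\<lambda>x. norm (f x) powr P) summable_on UNIV"
    using assms by (auto simp: lp_space_def sup_type_def P_def)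
  have "(\<Sum>x\<in>F. norm (f x) powr P) \<le> lp_norm p f powr P" if "finite F" for F
  proof -
    have "(\<Sum>x\<in>F. norm (f x) powr P) \<le> (\<Sum>\<^sub>\<infinity>x. norm (f x) powr P)"
      using s that by (intro finite_sum_le_infsum) auto
    also have "\<dots> = ((\<Sum>\<^sub>\<infinity>x. norm (f x) powr P) powr (1 / P)) powr P"
      using P_pos[OF False] by (simp add: powr_powr infsum_nonneg)
    finally show ?thesis using False by (simp add: lp_norm_def sup_type_def P_def)
  qed
  moreover have "0 \<le> lp_norm p f" using False by (simp add: lp_norm_def sup_type_def)
  ultimately show ?thesis using False by (simp add: lp_le_def)
qed

lemma lp_norm_nonneg: "f \<in> lp_space p S \<Longrightarrow> 0 \<le> lp_norm p f"
  by (rule lp_le_nonneg[OF lp_le_norm])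

lemma lp_norm_point: "f \<in> lp_space p S \<Longrightarrow> norm (f x) \<le> lp_norm p f"
  by (rule lp_le_point[OF lp_le_norm])

lemma lp_space_supp: "f \<in> lp_space p S \<Longrightarrow> x \<notin> S \<Longrightarrow> f x = 0"
  by (simp add: lp_space_def)

lemma lp_spaceI0:
  assumes "lp_le f M" "\<And>x. x \<notin> S \<Longrightarrow> f x = 0"
    and "\<And>\<epsilon>. p = 0 \<Longrightarrow> 0 < \<epsilon> \<Longrightarrow> \<exists>F. finite F \<and> (\<forall>x. x \<notin> F \<longrightarrow> norm (f x) < \<epsilon>)"
  shows "f \<in> lp_space p S"
proof -
  have "finite {x. \<epsilon> \<le> norm (f x)}" if "p = 0" "0 < \<epsilon>" for \<epsilon>
  proof -
    obtain F where F: "finite F" "\<forall>x. x \<notin> F \<longrightarrow> norm (f x) < \<epsilon>" using assms(3) \<open>p = 0\<close> \<open>0 < \<epsilon>\<close> by blast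
    have "{x. \<epsilon> \<le> norm (f x)} \<subseteq> F"
    proof
      fix x assume "x \<in> {x. \<epsilon> \<le> norm (f x)}"
      then have "\<not> norm (f x) < \<epsilon>" by simp
      then show "x \<in> F" using F(2) by blast
    qed
    then show ?thesis using F(1) by (rule finite_subset)
  qed
  moreover have "bounded (range f)" using lp_le_point[OF assms(1)] unfolding bounded_iff by blast
  moreover have "(\<lambda>x. norm (f x) powr P) summable_on UNIV" if "\<not> sup_type"
  proof (rule nonneg_bdd_above_summable_on)
    show "bdd_above (sum (\<lambda>x. norm (f x) powr P) ` {F. F \<subseteq> UNIV \<and> finite F})"
      using assms(1) that unfolding lp_le_def bdd_above_def by auto
  qed auto
  ultimately show ?thesis using assms(2) by (auto simp: lp_space_def sup_type_def P_def)
qed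

lemma lp_spaceI: "p \<noteq> 0 \<Longrightarrow> lp_le f M \<Longrightarrow> (\<And>x. x \<notin> S \<Longrightarrow> f x = 0) \<Longrightarrow> f \<in> lp_space p S"
  by (rule lp_spaceI0) auto

text \<open>For \<open>p = 0\<close> the points with large values form \<open>F\<close>; for finite
  exponents \<open>F\<close> carries all but a small part of the norm.\<close>

lemma lp_space_vanish:
  assumes "f \<in> lp_space p S" "p \<noteq> \<infinity>" "0 < \<epsilon>"
  shows "\<exists>F. finite F \<and> F \<subseteq> S \<and> (\<forall>x. x \<notin> F \<longrightarrow> norm (f x) < \<epsilon>) \<and> lp_le (coproj F f) \<epsilon>"
proof (cases "p = 0")
  case True
  define F where "F = {x. \<epsilon> \<le> norm (f x)}"
  have "finite F" using assms True by (auto simp: lp_space_def F_def)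
  moreover have "F \<subseteq> S" using assms(1,3) by (fastforce simp: lp_space_def F_def)
  moreover have "norm (f x) < \<epsilon>" if "x \<notin> F" for x using that by (simp add: F_def)
  moreover have "lp_le (coproj F f) \<epsilon>"
  proof -
    have sup_type unfolding sup_type_def by (rule disjI1[OF True])
    then show ?thesis using assms(3)
      unfolding lp_le_def by (auto simp: coproj_def op_diff_def proj_def F_def)
  qed
  ultimately show ?thesis by blast
next
  case False
  then have st: "\<not> sup_type" using assms by (simp add: sup_type_def)
  then have s: "(\<lambda>x. norm (f x) powr P) summable_on UNIV"
    using assms by (auto simp: lp_space_def sup_type_def P_def)
  then obtain F0 where F0: "finite F0"
      "dist (\<Sum>x\<in>F0. norm (f x) powr P) (\<Sum>\<^sub>\<infinity>x. norm (f x) powr P) \<le> (\<epsilon> / 2) powr P"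
    using infsum_finite_approximation[OF s, of "(\<epsilon> / 2) powr P"] assms(3) by auto
  \<comment> \<open>Cutting \<open>F0\<close> down to \<open>S\<close> leaves the sum unchanged. The
    tail is bounded with \<open>\<epsilon> / 2\<close>, so that the pointwise estimate off
    \<open>F\<close> becomes strict.\<close>
  define F where "F = F0 \<inter> S"
  have 0: "(\<Sum>x\<in>F. norm (f x) powr P) = (\<Sum>x\<in>F0. norm (f x) powr P)"
    using F0 assms(1) P_pos[OF st] unfolding F_def
    by (intro sum.mono_neutral_left) (auto simp: lp_space_def)
  have F: "finite F" "F \<subseteq> S" using F0 by (auto simp: F_def)
  have le: "(\<Sum>x\<in>G. norm (coproj F f x) powr P) \<le> (\<epsilon> / 2) powr P" if G: "finite G" for G
  proof -
    have "(\<Sum>x\<in>G. norm (coproj F f x) powr P) = (\<Sum>x\<in>G - F. norm (f x) powr P)"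
      using G P_pos[OF st] by (intro sum.mono_neutral_cong_right)
        (auto simp: coproj_def op_diff_def proj_def)
    moreover have "(\<Sum>x\<in>G - F. norm (f x) powr P) + (\<Sum>x\<in>F. norm (f x) powr P)
        = (\<Sum>x\<in>(G - F) \<union> F. norm (f x) powr P)"
      using G F by (intro sum.union_disjoint[symmetric]) auto
    moreover have "(\<Sum>x\<in>(G - F) \<union> F. norm (f x) powr P) \<le> (\<Sum>\<^sub>\<infinity>x. norm (f x) powr P)"
      using s G F by (intro finite_sum_le_infsum) auto
    ultimately show ?thesis using F0(2) 0 by (simp add: dist_real_def)
  qed
  then have co: "lp_le (coproj F f) (\<epsilon> / 2)"
    using st assms(3) by (simp add: lp_le_def)
  have "norm (f x) < \<epsilon>" if "x \<notin> F" for x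
    using lp_le_point[OF co, of x] that assms(3) by (simp add: coproj_def op_diff_def proj_def)
  moreover have "lp_le (coproj F f) \<epsilon>" using lp_le_weaken[OF co] assms(3) by simp
  ultimately show ?thesis using F by blast
qed

lemma p0_ne_inf: "p = 0 \<Longrightarrow> p \<noteq> \<infinity>"
  by simp

lemma lp_space_dom:
  assumes "g \<in> lp_space p S'" "\<And>x. norm (f x) \<le> norm (g x)" "\<And>x. x \<notin> S \<Longrightarrow> f x = 0"
  shows "f \<in> lp_space p S"
proof (rule lp_spaceI0)
  show "lp_le f (lp_norm p g)" using lp_le_mono[OF lp_le_norm[OF assms(1)] assms(2)] .
  fix \<epsilon> :: real assume "p = 0" "0 < \<epsilon>"
  then obtain F where F: "finite F" "\<And>x. x \<notin> F \<Longrightarrow> norm (g x) < \<epsilon>"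
    using lp_space_vanish[OF assms(1) p0_ne_inf, of \<epsilon>] by blast
  then show "\<exists>F. finite F \<and> (\<forall>x. x \<notin> F \<longrightarrow> norm (f x) < \<epsilon>)"
    using assms(2) le_less_trans by blast
qed (use assms in auto)

lemma lp_norm_dom:
  assumes "g \<in> lp_space p S'" "\<And>x. norm (f x) \<le> norm (g x)"
  shows "lp_norm p f \<le> lp_norm p g"
  using lp_norm_le[OF lp_le_mono[OF lp_le_norm[OF assms(1)] assms(2)]] .

lemma lp_space_scale:
  assumes "g \<in> lp_space p S'" "\<And>x. norm (f x) \<le> c * norm (g x)" "\<And>x. x \<notin> S \<Longrightarrow> f x = 0"
  shows "f \<in> lp_space p S"
proof (rule lp_spaceI0)
  have "norm (f x) \<le> max c 0 * norm (g x)" for x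
    using assms(2)[of x] mult_right_mono[of c "max c 0" "norm (g x)"] by simp
  then show "lp_le f (max c 0 * lp_norm p g)" by (intro lp_le_scale[OF lp_le_norm[OF assms(1)]]) auto
  fix \<epsilon> :: real assume \<epsilon>: "p = 0" "0 < \<epsilon>"
  have c: "0 < \<bar>c\<bar> + 1" by linarith
  then obtain F where F: "finite F" "\<And>x. x \<notin> F \<Longrightarrow> norm (g x) < \<epsilon> / (\<bar>c\<bar> + 1)"
    using lp_space_vanish[OF assms(1) p0_ne_inf[OF \<epsilon>(1)], of "\<epsilon> / (\<bar>c\<bar> + 1)"] \<epsilon>(2)
    by (meson divide_pos_pos)
  have "norm (f x) < \<epsilon>" if "x \<notin> F" for x
  proof -
    have "norm (f x) \<le> (\<bar>c\<bar> + 1) * norm (g x)"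
      using assms(2)[of x] mult_right_mono[of c "\<bar>c\<bar> + 1" "norm (g x)"] abs_ge_self[of c] norm_ge_zero[of "g x"] by linarith
    also have "\<dots> < \<epsilon>" using F(2)[OF that] c by (simp add: field_simps)
    finally show ?thesis .
  qed
  then show "\<exists>F. finite F \<and> (\<forall>x. x \<notin> F \<longrightarrow> norm (f x) < \<epsilon>)" using F(1) by blast
qed (use assms in auto)

lemma lp_space_add:
  assumes "f \<in> lp_space p S" "g \<in> lp_space p S"
  shows "(\<lambda>x. f x + g x) \<in> lp_space p S"
proof (rule lp_spaceI0[OF lp_le_add[OF lp_le_norm[OF assms(1)] lp_le_norm[OF assms(2)]]])
  fix \<epsilon> :: real assume e: "p = 0" "0 < \<epsilon>"
  obtain F where F: "finite F" "\<And>x. x \<notin> F \<Longrightarrow> norm (f x) < \<epsilon> / 2"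
    using lp_space_vanish[OF assms(1) p0_ne_inf[OF e(1)], of "\<epsilon> / 2"] e(2) by (meson half_gt_zero)
  obtain G where G: "finite G" "\<And>x. x \<notin> G \<Longrightarrow> norm (g x) < \<epsilon> / 2"
    using lp_space_vanish[OF assms(2) p0_ne_inf[OF e(1)], of "\<epsilon> / 2"] e(2) by (meson half_gt_zero)
  have "norm (f x + g x) < \<epsilon>" if "x \<notin> F \<union> G" for x
    using norm_triangle_ineq[of "f x" "g x"] F(2)[of x] G(2)[of x] that by auto
  then show "\<exists>F. finite F \<and> (\<forall>x. x \<notin> F \<longrightarrow> norm (f x + g x) < \<epsilon>)"
    using F G by (meson finite_UnI)
qed (use assms in \<open>auto simp: lp_space_def\<close>)

lemma lp_norm_add:
  assumes "f \<in> lp_space p S" "g \<in> lp_space p S'"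
  shows "lp_norm p (\<lambda>x. f x + g x) \<le> lp_norm p f + lp_norm p g"
  using lp_norm_le[OF lp_le_add[OF lp_le_norm[OF assms(1)] lp_le_norm[OF assms(2)]]] .

lemma lp_norm_diff:
  assumes "f \<in> lp_space p S" "g \<in> lp_space p S'"
  shows "lp_norm p (\<lambda>x. f x - g x) \<le> lp_norm p f + lp_norm p g"
  using lp_norm_le[OF lp_le_diff[OF lp_le_norm[OF assms(1)] lp_le_norm[OF assms(2)]]] .

lemma lp_space_uminus: "f \<in> lp_space p S \<Longrightarrow> (\<lambda>x. - f x) \<in> lp_space p S"
  by (rule lp_space_dom) (auto simp: lp_space_def)

lemma lp_space_diff:
  "f \<in> lp_space p S \<Longrightarrow> g \<in> lp_space p S \<Longrightarrow> (\<lambda>x. f x - g x) \<in> lp_space p S"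
  using lp_space_add[OF _ lp_space_uminus, of f S g] by simp

lemma lp_space_zero: "(\<lambda>x. 0) \<in> lp_space p S"
  by (rule lp_spaceI0[OF lp_le_zero[of 0]]) auto

lemma lp_norm_zero: "lp_norm p (\<lambda>x. 0) = 0"
  by (rule antisym[OF lp_norm_le[OF lp_le_zero[OF order_refl]] lp_norm_nonneg[OF lp_space_zero]])

lemma lp_space_sum:
  "(\<And>i. i \<in> I \<Longrightarrow> f i \<in> lp_space p S) \<Longrightarrow> (\<lambda>x. \<Sum>i\<in>I. f i x) \<in> lp_space p S"
  by (induction I rule: infinite_finite_induct) (auto intro: lp_space_zero lp_space_add)

lemma lp_norm_sum:
  assumes "\<And>i. i \<in> I \<Longrightarrow> f i \<in> lp_space p S"
  shows "lp_norm p (\<lambda>x. \<Sum>i\<in>I. f i x) \<le> (\<Sum>i\<in>I. lp_norm p (f i))"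
proof (cases "finite I")
  case True
  then show ?thesis using assms by (intro lp_norm_le lp_le_sum lp_le_norm) auto
qed (simp add: lp_norm_zero)

lemma lp_norm_scaleR:
  fixes f :: "'i \<Rightarrow> 'v::banach"
  assumes "f \<in> lp_space p S"
  shows "lp_norm p (\<lambda>x. c *\<^sub>R f x) = \<bar>c\<bar> * lp_norm p f"
proof -
  have le: "lp_norm p (\<lambda>x. c *\<^sub>R f x) \<le> \<bar>c\<bar> * lp_norm p f"
    if "f \<in> lp_space p S" for c and f :: "'i \<Rightarrow> 'v"
    by (rule lp_norm_le[OF lp_le_scale[OF lp_le_norm[OF that]]]) auto
  show ?thesis
  proof (cases "c = 0")
    case False
    have m: "(\<lambda>x. c *\<^sub>R f x) \<in> lp_space p S"
      by (rule lp_space_scale[OF assms, of _ "\<bar>c\<bar>"]) (use assms in \<open>auto simp: lp_space_def\<close>)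
    have "lp_norm p f \<le> \<bar>inverse c\<bar> * lp_norm p (\<lambda>x. c *\<^sub>R f x)"
      using le[OF m, of "inverse c"] False by simp
    then have "\<bar>c\<bar> * lp_norm p f \<le> lp_norm p (\<lambda>x. c *\<^sub>R f x)"
      using False by (simp add: field_simps)
    then show ?thesis using le[OF assms, of c] by linarith
  qed (simp add: lp_norm_zero)
qed

lemma lp_space_finite_support:
  assumes "finite F" "F \<subseteq> S" "\<And>x. x \<notin> F \<Longrightarrow> f x = 0"
  shows "f \<in> lp_space p S"
proof (rule lp_spaceI0)
  have "lp_le (\<lambda>x. \<Sum>y\<in>F. delta y (f y) x) (\<Sum>y\<in>F. norm (f y))"
  proof (rule lp_le_sum[OF assms(1)])
    fix y
    have "(\<Sum>x\<in>G. norm (delta y (f y) x) powr P) \<le> norm (f y) powr P" if "finite G" for G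
    proof -
      have "(\<Sum>x\<in>G. norm (delta y (f y) x) powr P) = (\<Sum>x\<in>G. if x = y then norm (f y) powr P else 0)"
        by (intro sum.cong) (auto simp: delta_def)
      then show ?thesis using that by (simp add: sum.delta')
    qed
    then show "lp_le (delta y (f y)) (norm (f y))" by (auto simp: lp_le_def delta_def)
  qed
  moreover have "(\<lambda>x. \<Sum>y\<in>F. delta y (f y) x) = f"
    using assms by (auto simp: delta_def fun_eq_iff)
  ultimately show "lp_le f (\<Sum>y\<in>F. norm (f y))" by simp
  show "\<exists>F. finite F \<and> (\<forall>x. x \<notin> F \<longrightarrow> norm (f x) < \<epsilon>)" if "0 < \<epsilon>" for \<epsilon>
    using assms that by (intro exI[of _ F]) auto
qed (use assms in auto)

lemma lp_le_delta: "lp_le (delta y e) (norm e)"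
proof -
  have "(\<Sum>x\<in>G. norm (delta y e x) powr P) \<le> norm e powr P" if "finite G" for G
  proof -
    have "(\<Sum>x\<in>G. norm (delta y e x) powr P) = (\<Sum>x\<in>G. if x = y then norm e powr P else 0)"
      by (intro sum.cong) (auto simp: delta_def)
    then show ?thesis using that by (simp add: sum.delta')
  qed
  then show ?thesis by (auto simp: lp_le_def delta_def)
qed

lemma delta_in_lp: "y \<in> S \<Longrightarrow> delta y e \<in> lp_space p S"
  by (rule lp_space_finite_support[of "{y}"]) (auto simp: delta_def)

lemma lp_norm_delta: "lp_norm p (delta y e) = norm e"
  using lp_norm_le[OF lp_le_delta[of y e]] lp_norm_point[OF delta_in_lp[of y UNIV e], of y]
  by (intro antisym) (auto simp: delta_def)

text \<open>It turns entrywise estimates on a fixed finite set, or on one ball, into norm estimates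
  for every exponent.\<close>

lemma lp_le_finite_l1:
  fixes f :: "'i \<Rightarrow> 'v::banach"
  assumes "finite F" "\<And>x. x \<notin> F \<Longrightarrow> f x = 0"
  shows "lp_le f (\<Sum>y\<in>F. norm (f y))"
proof -
  have "lp_le (\<lambda>x. \<Sum>y\<in>F. delta y (f y) x) (\<Sum>y\<in>F. norm (f y))"
    by (rule lp_le_sum[OF assms(1) lp_le_delta])
  moreover have "(\<lambda>x. \<Sum>y\<in>F. delta y (f y) x) = f"
    using assms by (auto simp: delta_def fun_eq_iff)
  ultimately show ?thesis by simp
qed

lemma proj_in_lp: "f \<in> lp_space p S \<Longrightarrow> proj F f \<in> lp_space p S"
  by (rule lp_space_dom) (auto simp: proj_def lp_space_def)

lemma coproj_in_lp: "f \<in> lp_space p S \<Longrightarrow> coproj F f \<in> lp_space p S"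
  by (rule lp_space_dom) (auto simp: coproj_def op_diff_def proj_def lp_space_def)

lemma lp_norm_proj: "f \<in> lp_space p S \<Longrightarrow> lp_norm p (proj F f) \<le> lp_norm p f"
  by (rule lp_norm_dom) (auto simp: proj_def)

lemma lp_norm_coproj: "f \<in> lp_space p S \<Longrightarrow> lp_norm p (coproj F f) \<le> lp_norm p f"
  by (rule lp_norm_dom) (auto simp: coproj_def op_diff_def proj_def)

text \<open>This includes \<open>p = \<infinity>\<close>, where finite pieces do not approximate
  \<open>f\<close> in norm; estimates on finite pieces therefore suffice for all exponents.\<close>

lemma lp_le_finite_pieces:
  assumes "0 \<le> M" "\<And>F. finite F \<Longrightarrow> lp_le (proj F f) M"
  shows "lp_le f M"
proof (cases sup_type)
  case True
  have "norm (f x) \<le> M" for x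
    using lp_le_point[OF assms(2)[of "{x}"], of x] by (simp add: proj_def)
  then show ?thesis using True assms by (simp add: lp_le_def)
next
  case False
  have "(\<Sum>x\<in>F. norm (f x) powr P) \<le> M powr P" if "finite F" for F
  proof -
    have "(\<Sum>x\<in>F. norm (proj F f x) powr P) \<le> M powr P"
      using assms(2)[OF that] that False by (auto simp: lp_le_def)
    then show ?thesis by (simp add: proj_def)
  qed
  then show ?thesis using False assms by (simp add: lp_le_def)
qed

text \<open>The other half of Fubini. For finite exponents a finite sum over \<open>i\<close> is
  interchanged with the infinite sum in each fibre norm, which is legitimate since every slice is
  summable.\<close>

lemma lp_le_fibre:
  fixes f :: "'i \<Rightarrow> 'x \<Rightarrow> 'v::banach"
  assumes "lp_le (\<lambda>(i, x). f i x) M"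
  shows "lp_le (\<lambda>i. lp_norm p (f i)) M"
proof -
  have fi: "lp_le (f i) M" for i
    by (rule lp_le_inj[OF assms, where s = "\<lambda>x. (i, x)" and D = UNIV]) (auto simp: inj_on_def)
  show ?thesis
  proof (cases sup_type)
    case True
    have bdd: "bdd_above (range (\<lambda>x. norm (f i x)))" for i
      using lp_le_point[OF fi] by (meson bdd_aboveI2)
    have "norm (f i undefined) \<le> lp_norm p (f i)" for i
      using True bdd by (auto simp: lp_norm_def sup_type_def intro: cSUP_upper)
    then have "0 \<le> lp_norm p (f i)" for i 
      by (rule order_trans[OF norm_ge_zero])
    then show ?thesis using True lp_norm_le[OF fi] lp_le_nonneg[OF assms] by (simp add: lp_le_def)
  next
    case False
    then have p0: "p \<noteq> 0" by (auto simp: sup_type_def)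
    have mem: "f i \<in> lp_space p UNIV" for i using lp_spaceI[OF p0 fi] by auto
    have s: "(\<lambda>x. norm (f i x) powr P) summable_on UNIV" for i
      using mem[of i] False by (auto simp: lp_space_def sup_type_def P_def)
    have "(\<Sum>i\<in>I. norm (lp_norm p (f i)) powr P) \<le> M powr P" if I: "finite I" for I
    proof -
      have eq: "norm (lp_norm p (f i)) powr P = (\<Sum>\<^sub>\<infinity>x. norm (f i x) powr P)" for i
      proof -
        have "lp_norm p (f i) = (\<Sum>\<^sub>\<infinity>x. norm (f i x) powr P) powr (1 / P)"
          using False by (simp add: lp_norm_def sup_type_def P_def)
        then show ?thesis using P_pos[OF False] by (simp add: powr_powr infsum_nonneg)
      qed
      have "(\<Sum>i\<in>I. \<Sum>\<^sub>\<infinity>x. norm (f i x) powr P) = (\<Sum>\<^sub>\<infinity>x. \<Sum>i\<in>I. norm (f i x) powr P)"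
        using I s
      proof (induction I rule: finite_induct)
        case (insert j I)
        have "(\<lambda>x. \<Sum>i\<in>I. norm (f i x) powr P) summable_on UNIV"
          using insert.hyps(1) by (induction I rule: finite_induct) (auto intro: summable_on_add s)
        then show ?case using insert s by (simp add: infsum_add)
      qed simp
      also have "\<dots> \<le> M powr P"
      proof (rule infsum_le_finite_sums)
        show "(\<lambda>x. \<Sum>i\<in>I. norm (f i x) powr P) summable_on UNIV"
          using I by (induction I rule: finite_induct) (auto intro: summable_on_add s)
        fix F :: "'x set" assume F: "finite F"
        have "(\<Sum>x\<in>F. \<Sum>i\<in>I. norm (f i x) powr P) = (\<Sum>(i, x)\<in>I \<times> F. norm (f i x) powr P)"
          by (subst sum.swap) (simp add: sum.cartesian_product)
        also have "\<dots> = (\<Sum>z\<in>I \<times> F. norm (case z of (i, x) \<Rightarrow> f i x) powr P)"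
          by (intro sum.cong) auto
        also have "\<dots> \<le> M powr P" using assms I F False by (auto simp: lp_le_def)
        finally show "(\<Sum>x\<in>F. \<Sum>i\<in>I. norm (f i x) powr P) \<le> M powr P" .
      qed
      finally show ?thesis by (simp only: eq)
    qed
    then show ?thesis using False lp_le_nonneg[OF assms] by (simp add: lp_le_def)
  qed
qed

end

section \<open>Operators on sequence spaces\<close>

locale lp_operators = lp_exponent p for p :: ennreal +
  fixes sc :: "'k::real_normed_field \<Rightarrow> 'e::banach \<Rightarrow> 'e"
  assumes scaling: "banach_scaling sc"
begin

abbreviation lps :: "'i set \<Rightarrow> ('i \<Rightarrow> 'e) set" where
  "lps S \<equiv> lp_space p S"

lemma sc_add: "sc c (x + y) = sc c x + sc c y"
  using scaling by (simp add: banach_scaling_def vector_space.vector_space_assms(1))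

lemma sc_sc: "sc a (sc b x) = sc (a * b) x"
  using scaling by (simp add: banach_scaling_def vector_space.vector_space_assms(3))

lemma sc_of_real: "sc (of_real r) x = r *\<^sub>R x"
  using scaling by (simp add: banach_scaling_def)

lemma norm_sc: "norm (sc c x) = norm c * norm x"
  using scaling by (simp add: banach_scaling_def)

lemma sc_scaleR: "sc c (r *\<^sub>R x) = r *\<^sub>R sc c x"
  by (simp add: sc_of_real[symmetric] sc_sc mult.commute)

lemma bounded_linear_sc: "bounded_linear (sc c)"
  by (rule bounded_linear_intro[where K = "norm c"]) (auto simp: sc_add sc_scaleR norm_sc)

lemma sc_zero [simp]: "sc c 0 = 0"
  using bounded_linear_sc by (rule linear_simps)

lemma sc_diff: "sc c (x - y) = sc c x - sc c y"
  using bounded_linear_sc by (rule linear_simps)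

lemma sc_sum: "sc c (\<Sum>i\<in>I. f i) = (\<Sum>i\<in>I. sc c (f i))"
  by (induction I rule: infinite_finite_induct) (auto simp: sc_add)

lemma sc_lp: "f \<in> lps S \<Longrightarrow> (\<lambda>x. sc c (f x)) \<in> lps S"
  by (rule lp_space_scale[where c = "norm c"]) (auto simp: norm_sc lp_space_def)

lemma lp_opsI:
  assumes "\<And>f. f \<in> lps S \<Longrightarrow> T f \<in> lps S"
    and "\<And>f g. f \<in> lps S \<Longrightarrow> g \<in> lps S \<Longrightarrow> T (\<lambda>x. f x + g x) = (\<lambda>x. T f x + T g x)"
    and "\<And>c f. f \<in> lps S \<Longrightarrow> T (\<lambda>x. sc c (f x)) = (\<lambda>x. sc c (T f x))"
    and "\<And>f. f \<in> lps S \<Longrightarrow> lp_norm p (T f) \<le> C * lp_norm p f"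
  shows "T \<in> lp_ops sc p S"
  using assms unfolding lp_ops_def by blast

context
  fixes S :: "'i set" and T :: "('i \<Rightarrow> 'e) \<Rightarrow> ('i \<Rightarrow> 'e)"
  assumes T: "T \<in> lp_ops sc p S"
begin

lemma lp_ops_mem: "f \<in> lps S \<Longrightarrow> T f \<in> lps S"
  using T by (auto simp: lp_ops_def)

lemma lp_ops_add:
  "f \<in> lps S \<Longrightarrow> g \<in> lps S \<Longrightarrow> T (\<lambda>x. f x + g x) = (\<lambda>x. T f x + T g x)"
  using T by (auto simp: lp_ops_def)

lemma lp_ops_sc: "f \<in> lps S \<Longrightarrow> T (\<lambda>x. sc c (f x)) = (\<lambda>x. sc c (T f x))"
  using T by (auto simp: lp_ops_def)

lemma lp_ops_scaleR: "f \<in> lps S \<Longrightarrow> T (\<lambda>x. r *\<^sub>R f x) = (\<lambda>x. r *\<^sub>R T f x)"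
  using lp_ops_sc[of f "of_real r"] by (simp add: sc_of_real)

lemma lp_ops_zero: "T (\<lambda>x. 0) = (\<lambda>x. 0)"
  using lp_ops_scaleR[OF lp_space_zero, of 0] by simp

lemma lp_ops_diff:
  assumes "f \<in> lps S" "g \<in> lps S"
  shows "T (\<lambda>x. f x - g x) = (\<lambda>x. T f x - T g x)"
proof -
  have m: "(\<lambda>x. (-1) *\<^sub>R g x) \<in> lps S" using lp_space_uminus[OF assms(2)] by simp
  show ?thesis using lp_ops_add[OF assms(1) m] lp_ops_scaleR[OF assms(2), of "-1"] by simp
qed

lemma lp_ops_sum:
  "(\<And>i. i \<in> I \<Longrightarrow> f i \<in> lps S) \<Longrightarrow> T (\<lambda>x. \<Sum>i\<in>I. f i x) = (\<lambda>x. \<Sum>i\<in>I. T (f i) x)"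
  by (induction I rule: infinite_finite_induct)
    (auto simp: lp_ops_zero lp_ops_add lp_space_sum)

lemma lp_ops_bound: "\<exists>C\<ge>0. \<forall>f\<in>lps S. lp_norm p (T f) \<le> C * lp_norm p f"
proof -
  obtain C where C: "\<forall>f\<in>lps S. lp_norm p (T f) \<le> C * lp_norm p f"
    using T by (auto simp: lp_ops_def)
  have "lp_norm p (T f) \<le> max C 0 * lp_norm p f" if "f \<in> lps S" for f
    using C that lp_norm_nonneg[OF that] mult_right_mono[of C "max C 0" "lp_norm p f"] by fastforce
  then show ?thesis by (meson max.cobounded2)
qed

lemma op_norm_unit: "f \<in> lps S \<Longrightarrow> lp_norm p f \<le> 1 \<Longrightarrow> lp_norm p (T f) \<le> op_norm p S T"
proof -
  assume f: "f \<in> lps S" "lp_norm p f \<le> 1"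
  obtain C where C: "C \<ge> 0" "\<forall>f\<in>lps S. lp_norm p (T f) \<le> C * lp_norm p f"
    using lp_ops_bound by blast
  have "lp_norm p (T g) \<le> C" if "g \<in> lps S" "lp_norm p g \<le> 1" for g
    using C that mult_left_mono[of "lp_norm p g" 1 C] by fastforce
  then have "bdd_above ((\<lambda>f. lp_norm p (T f)) ` {f \<in> lps S. lp_norm p f \<le> 1})"
    by (auto simp: bdd_above_def)
  then show ?thesis unfolding op_norm_def using f by (intro cSUP_upper) auto
qed

lemma op_norm_nonneg: "0 \<le> op_norm p S T"
  using op_norm_unit[OF lp_space_zero] by (simp add: lp_norm_zero lp_ops_zero)

lemma op_norm_bound:
  assumes f: "f \<in> lps S" shows "lp_norm p (T f) \<le> op_norm p S T * lp_norm p f"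
proof (cases "lp_norm p f = 0")
  case True
  then have "f = (\<lambda>x. 0)" using lp_norm_point[OF f] by fastforce
  then show ?thesis by (simp add: lp_ops_zero lp_norm_zero)
next
  case False
  then have pos: "0 < lp_norm p f" using lp_norm_nonneg[OF f] by simp
  let ?g = "\<lambda>x. (1 / lp_norm p f) *\<^sub>R f x"
  have g: "?g \<in> lps S"
    by (rule lp_space_scale[OF f, where c = "1 / lp_norm p f"])
      (use pos in \<open>auto simp: lp_space_supp[OF f]\<close>)
  have "lp_norm p ?g \<le> 1" using pos lp_norm_scaleR[OF f, of "1 / lp_norm p f"] by simp
  then have "lp_norm p (T ?g) \<le> op_norm p S T" by (rule op_norm_unit[OF g])
  moreover have "lp_norm p (T ?g) = lp_norm p (T f) / lp_norm p f"
    using lp_ops_scaleR[OF f, of "1 / lp_norm p f"] lp_norm_scaleR[OF lp_ops_mem[OF f], of "1 / lp_norm p f"] pos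
    by simp
  ultimately show ?thesis using pos by (simp add: field_simps)
qed

end

lemma op_norm_le:
  assumes "0 \<le> C" "\<And>f. f \<in> lps S \<Longrightarrow> lp_norm p (T f) \<le> C * lp_norm p f"
  shows "op_norm p S T \<le> C"
  unfolding op_norm_def
proof (rule cSUP_least)
  show "{f \<in> lps S. lp_norm p f \<le> 1} \<noteq> {}"
    using lp_space_zero lp_norm_zero by (metis (mono_tags, lifting) empty_iff mem_Collect_eq zero_le_one)
  fix f assume "f \<in> {f \<in> lps S. lp_norm p f \<le> 1}"
  then show "lp_norm p (T f) \<le> C"
    using assms(1) assms(2)[of f] mult_left_mono[of "lp_norm p f" 1 C] by simp
qed

lemma lp_ops_cong:
  assumes "T \<in> lp_ops sc p S" "\<And>f. f \<in> lps S \<Longrightarrow> U f = T f"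
  shows "U \<in> lp_ops sc p S"
proof -
  obtain C where C: "\<forall>f\<in>lps S. lp_norm p (T f) \<le> C * lp_norm p f"
    using lp_ops_bound[OF assms(1)] by blast
  show ?thesis
    by (rule lp_opsI[where C = C])
      (use C in \<open>simp_all add: assms(2) lp_ops_mem[OF assms(1)] lp_ops_add[OF assms(1)] lp_ops_sc[OF assms(1)]
         sc_lp lp_space_add\<close>)
qed

lemma lp_ops_id: "id \<in> lp_ops sc p S"
  by (rule lp_opsI[where C = 1]) auto

lemma lp_ops_comp:
  assumes "T \<in> lp_ops sc p S" "U \<in> lp_ops sc p S"
  shows "T \<circ> U \<in> lp_ops sc p S"
proof (rule lp_opsI[where C = "op_norm p S T * op_norm p S U"])
  fix f assume f: "f \<in> lps S"
  have "lp_norm p ((T \<circ> U) f) \<le> op_norm p S T * lp_norm p (U f)"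
    using op_norm_bound[OF assms(1) lp_ops_mem[OF assms(2) f]] by simp
  also have "\<dots> \<le> op_norm p S T * (op_norm p S U * lp_norm p f)"
    by (intro mult_left_mono op_norm_bound[OF assms(2) f] op_norm_nonneg[OF assms(1)])
  finally show "lp_norm p ((T \<circ> U) f) \<le> op_norm p S T * op_norm p S U * lp_norm p f"
    by (simp add: mult.assoc)
qed (auto simp: lp_ops_mem[OF assms(1)] lp_ops_mem[OF assms(2)] lp_ops_add[OF assms(1)]
    lp_ops_add[OF assms(2)] lp_ops_sc[OF assms(1)] lp_ops_sc[OF assms(2)])

lemma lp_ops_plus:
  assumes "T \<in> lp_ops sc p S" "U \<in> lp_ops sc p S"
  shows "(\<lambda>f x. T f x + U f x) \<in> lp_ops sc p S"
proof (rule lp_opsI[where C = "op_norm p S T + op_norm p S U"])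
  fix f assume f: "f \<in> lps S"
  show "(\<lambda>x. T f x + U f x) \<in> lps S"
    using f assms by (simp add: lp_ops_mem lp_space_add)
  show "lp_norm p (\<lambda>x. T f x + U f x) \<le> (op_norm p S T + op_norm p S U) * lp_norm p f"
    using lp_norm_add[OF lp_ops_mem[OF assms(1) f] lp_ops_mem[OF assms(2) f]]
      op_norm_bound[OF assms(1) f] op_norm_bound[OF assms(2) f] by (simp add: distrib_right)
qed (auto simp: lp_ops_add[OF assms(1)] lp_ops_add[OF assms(2)] lp_ops_sc[OF assms(1)]
    lp_ops_sc[OF assms(2)] sc_add)

lemma lp_ops_op_diff:
  assumes "T \<in> lp_ops sc p S" "U \<in> lp_ops sc p S"
  shows "op_diff T U \<in> lp_ops sc p S"
proof (rule lp_opsI[where C = "op_norm p S T + op_norm p S U"])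
  fix f assume f: "f \<in> lps S"
  show "op_diff T U f \<in> lps S"
    using f assms by (simp add: op_diff_def lp_ops_mem lp_space_diff)
  show "lp_norm p (op_diff T U f) \<le> (op_norm p S T + op_norm p S U) * lp_norm p f"
    using lp_norm_diff[OF lp_ops_mem[OF assms(1) f] lp_ops_mem[OF assms(2) f]]
      op_norm_bound[OF assms(1) f] op_norm_bound[OF assms(2) f] by (simp add: op_diff_def distrib_right)
qed (auto simp: op_diff_def lp_ops_add[OF assms(1)] lp_ops_add[OF assms(2)] lp_ops_sc[OF assms(1)]
    lp_ops_sc[OF assms(2)] sc_diff)

definition mul :: "('i \<Rightarrow> real) \<Rightarrow> ('i \<Rightarrow> 'e) \<Rightarrow> ('i \<Rightarrow> 'e)" where
  "mul h f = (\<lambda>x. h x *\<^sub>R f x)"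

lemma mul_lp: "(\<And>x. \<bar>h x\<bar> \<le> C) \<Longrightarrow> f \<in> lps S \<Longrightarrow> mul h f \<in> lps S"
  by (rule lp_space_scale[where c = C]) (auto simp: mul_def lp_space_def intro: mult_right_mono)

lemma norm_mul: "(\<And>x. \<bar>h x\<bar> \<le> C) \<Longrightarrow> f \<in> lps S \<Longrightarrow> lp_norm p (mul h f) \<le> C * lp_norm p f"
  by (rule lp_norm_le[OF lp_le_scale[OF lp_le_norm, where c = C]])
    (auto simp: mul_def intro!: mult_right_mono intro: order_trans[OF abs_ge_zero])

lemma lp_ops_mul:
  assumes "\<And>x. \<bar>h x\<bar> \<le> C"
  shows "mul h \<in> lp_ops sc p S"
proof (rule lp_opsI[where C = C])
  fix f assume f: "f \<in> lps S"
  show "mul h f \<in> lps S" by (rule mul_lp[OF assms f])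
  show "lp_norm p (mul h f) \<le> C * lp_norm p f" by (rule norm_mul[OF assms f])
qed (auto simp: mul_def scaleR_add_right sc_scaleR)

lemma proj_mul: "proj F = mul (indicator F)"
  by (auto simp: proj_def mul_def fun_eq_iff)

lemma lp_ops_proj: "proj F \<in> lp_ops sc p S"
  unfolding proj_mul by (rule lp_ops_mul[where C = 1]) (auto simp: indicator_def)

lemma lp_ops_coproj: "coproj F \<in> lp_ops sc p S"
  unfolding coproj_def by (rule lp_ops_op_diff[OF lp_ops_id lp_ops_proj])

section \<open>The operator classes in terms of single finite sets\<close>

lemma coproj_apply: "coproj F f = (\<lambda>x. if x \<in> F then 0 else f x)"
  by (auto simp: coproj_def op_diff_def proj_def)

lemma coproj_coproj: "coproj F (coproj G f) = coproj (F \<union> G) f"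
  by (auto simp: coproj_apply)

text \<open>Along an antitone net one small value suffices. This turns the limits in the definitions
  of the operator classes into the existence of one finite set for each
  \<open>\<epsilon>\<close>.\<close>

lemma tendsto_finite_subsets_zero_iff:
  fixes g :: "'i set \<Rightarrow> real"
  assumes nn: "\<And>F. 0 \<le> g F" and anti: "\<And>F G. F \<subseteq> G \<Longrightarrow> g G \<le> g F"
  shows "(g \<longlongrightarrow> 0) (finite_subsets_at_top S) \<longleftrightarrow> (\<forall>\<epsilon>>0. \<exists>F. finite F \<and> F \<subseteq> S \<and> g F \<le> \<epsilon>)"
proof
  assume "(g \<longlongrightarrow> 0) (finite_subsets_at_top S)"
  then have *: "\<forall>\<epsilon>>0. \<forall>\<^sub>F F in finite_subsets_at_top S. \<bar>g F\<bar> < \<epsilon>"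
    by (simp add: tendsto_iff dist_real_def)
  show "\<forall>\<epsilon>>0. \<exists>F. finite F \<and> F \<subseteq> S \<and> g F \<le> \<epsilon>"
  proof (intro allI impI)
    fix \<epsilon> :: real assume "0 < \<epsilon>"
    with * have "\<forall>\<^sub>F F in finite_subsets_at_top S. \<bar>g F\<bar> < \<epsilon>" by blast
    then obtain F where "finite F" "F \<subseteq> S" "\<bar>g F\<bar> < \<epsilon>"
      unfolding eventually_finite_subsets_at_top by blast
    then show "\<exists>F. finite F \<and> F \<subseteq> S \<and> g F \<le> \<epsilon>" by (intro exI[of _ F]) auto
  qed
next
  assume *: "\<forall>\<epsilon>>0. \<exists>F. finite F \<and> F \<subseteq> S \<and> g F \<le> \<epsilon>"
  have "\<forall>\<^sub>F F in finite_subsets_at_top S. \<bar>g F\<bar> < \<epsilon>" if "0 < \<epsilon>" for \<epsilon>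
  proof -
    obtain F where F: "finite F" "F \<subseteq> S" "g F \<le> \<epsilon> / 2" using * \<open>0 < \<epsilon>\<close> by (meson half_gt_zero)
    have "\<bar>g G\<bar> < \<epsilon>" if "F \<subseteq> G" for G using anti[OF that] nn[of G] F(3) \<open>0 < \<epsilon>\<close> by linarith
    then show ?thesis unfolding eventually_finite_subsets_at_top using F(1,2) by blast
  qed
  then show "(g \<longlongrightarrow> 0) (finite_subsets_at_top S)" by (simp add: tendsto_iff dist_real_def)
qed

lemma op_norm_le_iff:
  assumes "T \<in> lp_ops sc p S" "0 \<le> C"
  shows "op_norm p S T \<le> C \<longleftrightarrow> (\<forall>f\<in>lps S. lp_norm p (T f) \<le> C * lp_norm p f)"
proof
  assume le: "op_norm p S T \<le> C"
  show "\<forall>f\<in>lps S. lp_norm p (T f) \<le> C * lp_norm p f"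
  proof
    fix f assume f: "f \<in> lps S"
    show "lp_norm p (T f) \<le> C * lp_norm p f"
      using op_norm_bound[OF assms(1) f] mult_right_mono[OF le lp_norm_nonneg[OF f]] by linarith
  qed
qed (use assms(2) in \<open>auto intro: op_norm_le\<close>)

lemma right_coproj_tendsto_iff:
  assumes T: "T \<in> lp_ops sc p S"
  shows "((\<lambda>F. op_norm p S (T \<circ> coproj F)) \<longlongrightarrow> 0) (finite_subsets_at_top S) \<longleftrightarrow>
    (\<forall>\<epsilon>>0. \<exists>F. finite F \<and> F \<subseteq> S \<and> (\<forall>f\<in>lps S. lp_norm p (T (coproj F f)) \<le> \<epsilon> * lp_norm p f))"
proof -
  have C: "T \<circ> coproj F \<in> lp_ops sc p S" for F by (rule lp_ops_comp[OF T lp_ops_coproj])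
  have anti: "op_norm p S (T \<circ> coproj G) \<le> op_norm p S (T \<circ> coproj F)" if "F \<subseteq> G" for F G
  proof (rule op_norm_le[OF op_norm_nonneg[OF C]])
    fix f assume f: "f \<in> lps S"
    have "(T \<circ> coproj G) f = (T \<circ> coproj F) (coproj G f)"
      using that by (simp add: coproj_coproj Un_absorb1)
    then have "lp_norm p ((T \<circ> coproj G) f) \<le> op_norm p S (T \<circ> coproj F) * lp_norm p (coproj G f)"
      using op_norm_bound[OF C coproj_in_lp[OF f]] by simp
    also have "\<dots> \<le> op_norm p S (T \<circ> coproj F) * lp_norm p f"
      by (intro mult_left_mono lp_norm_coproj[OF f] op_norm_nonneg[OF C])
    finally show "lp_norm p ((T \<circ> coproj G) f) \<le> op_norm p S (T \<circ> coproj F) * lp_norm p f" .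
  qed
  show ?thesis
    using tendsto_finite_subsets_zero_iff[where g = "\<lambda>F. op_norm p S (T \<circ> coproj F)" and S = S, OF op_norm_nonneg[OF C] anti]
    by (simp add: op_norm_le_iff[OF C less_imp_le])
qed

lemma left_coproj_tendsto_iff:
  assumes T: "T \<in> lp_ops sc p S"
  shows "((\<lambda>F. op_norm p S (coproj F \<circ> T)) \<longlongrightarrow> 0) (finite_subsets_at_top S) \<longleftrightarrow>
    (\<forall>\<epsilon>>0. \<exists>F. finite F \<and> F \<subseteq> S \<and> (\<forall>f\<in>lps S. lp_norm p (coproj F (T f)) \<le> \<epsilon> * lp_norm p f))"
proof -
  have C: "coproj F \<circ> T \<in> lp_ops sc p S" for F by (rule lp_ops_comp[OF lp_ops_coproj T])
  have anti: "op_norm p S (coproj G \<circ> T) \<le> op_norm p S (coproj F \<circ> T)" if "F \<subseteq> G" for F G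
  proof (rule op_norm_le[OF op_norm_nonneg[OF C]])
    fix f assume f: "f \<in> lps S"
    have "(coproj G \<circ> T) f = coproj G ((coproj F \<circ> T) f)"
      using that by (simp add: coproj_coproj Un_absorb2)
    then have "lp_norm p ((coproj G \<circ> T) f) \<le> lp_norm p ((coproj F \<circ> T) f)"
      using lp_norm_coproj[OF lp_ops_mem[OF C f]] by metis
    also have "\<dots> \<le> op_norm p S (coproj F \<circ> T) * lp_norm p f"
      by (rule op_norm_bound[OF C f])
    finally show "lp_norm p ((coproj G \<circ> T) f) \<le> op_norm p S (coproj F \<circ> T) * lp_norm p f" .
  qed
  show ?thesis
    using tendsto_finite_subsets_zero_iff[where g = "\<lambda>F. op_norm p S (coproj F \<circ> T)" and S = S, OF op_norm_nonneg[OF C] anti]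
    by (simp add: op_norm_le_iff[OF C less_imp_le])
qed

lemma ops_K_iff:
  "K \<in> ops_K sc p S \<longleftrightarrow> K \<in> lp_ops sc p S \<and>
    (\<forall>\<epsilon>>0. \<exists>F. finite F \<and> F \<subseteq> S \<and> (\<forall>f\<in>lps S. lp_norm p (K (coproj F f)) \<le> \<epsilon> * lp_norm p f)) \<and>
    (\<forall>\<epsilon>>0. \<exists>F. finite F \<and> F \<subseteq> S \<and> (\<forall>f\<in>lps S. lp_norm p (coproj F (K f)) \<le> \<epsilon> * lp_norm p f))"
  by (simp add: ops_K_def right_coproj_tendsto_iff left_coproj_tendsto_iff cong: conj_cong)

lemma ops_S_iff:
  "T \<in> ops_S sc p S \<longleftrightarrow> T \<in> lp_ops sc p S \<and> (\<forall>F'. finite F' \<and> F' \<subseteq> S \<longrightarrow>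
    (\<forall>\<epsilon>>0. \<exists>F. finite F \<and> F \<subseteq> S \<and> (\<forall>f\<in>lps S. lp_norm p (proj F' (T (coproj F f))) \<le> \<epsilon> * lp_norm p f)))"
proof -
  have "((\<lambda>F. op_norm p S (proj F' \<circ> T \<circ> coproj F)) \<longlongrightarrow> 0) (finite_subsets_at_top S) \<longleftrightarrow>
    (\<forall>\<epsilon>>0. \<exists>F. finite F \<and> F \<subseteq> S \<and> (\<forall>f\<in>lps S. lp_norm p (proj F' (T (coproj F f))) \<le> \<epsilon> * lp_norm p f))"
    if "T \<in> lp_ops sc p S" for F'
    using right_coproj_tendsto_iff[OF lp_ops_comp[OF lp_ops_proj[of F'] that]] by simp
  then show ?thesis by (simp add: ops_S_def cong: conj_cong)
qed

lemma ops_L_iff: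
  "T \<in> ops_L sc p S \<longleftrightarrow> T \<in> lp_ops sc p S \<and> (\<forall>F'. finite F' \<and> F' \<subseteq> S \<longrightarrow>
    (\<forall>\<epsilon>>0. \<exists>F. finite F \<and> F \<subseteq> S \<and> (\<forall>f\<in>lps S. lp_norm p (proj F' (T (coproj F f))) \<le> \<epsilon> * lp_norm p f)) \<and>
    (\<forall>\<epsilon>>0. \<exists>F. finite F \<and> F \<subseteq> S \<and> (\<forall>f\<in>lps S. lp_norm p (coproj F (T (proj F' f))) \<le> \<epsilon> * lp_norm p f)))"
proof -
  have 1: "((\<lambda>F. op_norm p S (proj F' \<circ> T \<circ> coproj F)) \<longlongrightarrow> 0) (finite_subsets_at_top S) \<longleftrightarrow>
    (\<forall>\<epsilon>>0. \<exists>F. finite F \<and> F \<subseteq> S \<and> (\<forall>f\<in>lps S. lp_norm p (proj F' (T (coproj F f))) \<le> \<epsilon> * lp_norm p f))"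
    if "T \<in> lp_ops sc p S" for F'
    using right_coproj_tendsto_iff[OF lp_ops_comp[OF lp_ops_proj[of F'] that]] by simp
  have 2: "((\<lambda>F. op_norm p S (coproj F \<circ> T \<circ> proj F')) \<longlongrightarrow> 0) (finite_subsets_at_top S) \<longleftrightarrow>
    (\<forall>\<epsilon>>0. \<exists>F. finite F \<and> F \<subseteq> S \<and> (\<forall>f\<in>lps S. lp_norm p (coproj F (T (proj F' f))) \<le> \<epsilon> * lp_norm p f))"
    if "T \<in> lp_ops sc p S" for F'
    using left_coproj_tendsto_iff[OF lp_ops_comp[OF that lp_ops_proj[of F']]] by (simp add: comp_assoc)
  show ?thesis by (simp add: ops_L_def 1 2 cong: conj_cong)
qed

lemma ops_K_D:
  assumes "K \<in> ops_K sc p S"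
  shows "K \<in> lp_ops sc p S"
    and "0 < \<epsilon> \<Longrightarrow> \<exists>F. finite F \<and> F \<subseteq> S \<and> (\<forall>f\<in>lps S. lp_norm p (K (coproj F f)) \<le> \<epsilon> * lp_norm p f)"
    and "0 < \<epsilon> \<Longrightarrow> \<exists>F. finite F \<and> F \<subseteq> S \<and> (\<forall>f\<in>lps S. lp_norm p (coproj F (K f)) \<le> \<epsilon> * lp_norm p f)"
  using assms[unfolded ops_K_iff] by simp_all

lemma ops_K_I:
  assumes "K \<in> lp_ops sc p S"
    and "\<And>\<epsilon>. 0 < \<epsilon> \<Longrightarrow> \<exists>F. finite F \<and> F \<subseteq> S \<and> (\<forall>f\<in>lps S. lp_norm p (K (coproj F f)) \<le> \<epsilon> * lp_norm p f)"
    and "\<And>\<epsilon>. 0 < \<epsilon> \<Longrightarrow> \<exists>F. finite F \<and> F \<subseteq> S \<and> (\<forall>f\<in>lps S. lp_norm p (coproj F (K f)) \<le> \<epsilon> * lp_norm p f)"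
  shows "K \<in> ops_K sc p S"
  using assms by (simp add: ops_K_iff)

lemma ops_L_D:
  assumes "T \<in> ops_L sc p S"
  shows "T \<in> lp_ops sc p S"
    and "finite F' \<Longrightarrow> F' \<subseteq> S \<Longrightarrow> 0 < \<epsilon> \<Longrightarrow> \<exists>F. finite F \<and> F \<subseteq> S \<and>
      (\<forall>f\<in>lps S. lp_norm p (proj F' (T (coproj F f))) \<le> \<epsilon> * lp_norm p f)"
  using assms[unfolded ops_L_iff] by simp_all

lemma ops_K_cong:
  assumes "K \<in> ops_K sc p S" "\<And>f. f \<in> lps S \<Longrightarrow> K' f = K f"
  shows "K' \<in> ops_K sc p S"
  by (rule ops_K_I)
    (use ops_K_D[OF assms(1)] lp_ops_cong[OF ops_K_D(1)[OF assms(1)] assms(2)] in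
      \<open>simp_all add: assms(2) coproj_in_lp\<close>)

text \<open>Since \<open>T\<close> lies in \<open>ops_L\<close>, a vector supported far out has an
  image almost off a given finite set \<open>F1\<close>, and \<open>K\<close> nearly annihilates
  what lies off \<open>F1\<close>. Smallness on the left is inherited from \<open>K\<close>.\<close>

lemma ops_K_comp_L:
  assumes K: "K \<in> ops_K sc p S" and T: "T \<in> ops_L sc p S"
  shows "K \<circ> T \<in> ops_K sc p S"
proof -
  have KO: "K \<in> lp_ops sc p S" and TO: "T \<in> lp_ops sc p S" using ops_K_D(1)[OF K] ops_L_D(1)[OF T] by auto
  have nn: "0 \<le> op_norm p S K" "0 \<le> op_norm p S T" using op_norm_nonneg KO TO by auto
  have "\<exists>F. finite F \<and> F \<subseteq> S \<and> (\<forall>f\<in>lps S. lp_norm p ((K \<circ> T) (coproj F f)) \<le> \<epsilon> * lp_norm p f)"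
    if e: "0 < \<epsilon>" for \<epsilon>
  proof -
    \<comment> \<open>The part off \<open>F1\<close> costs \<open>\<eta>\<close> times the norm of
      \<open>T\<close>, the part on \<open>F1\<close> costs the norm of \<open>K\<close> times
      \<open>\<eta>\<close>; the \<open>+ 1\<close> keeps the denominator positive.\<close>
    define \<eta> where "\<eta> = \<epsilon> / (op_norm p S K + op_norm p S T + 1)"
    have \<eta>: "0 < \<eta>" using e nn by (simp add: \<eta>_def)
    obtain F1 where F1: "finite F1" "F1 \<subseteq> S"
        "\<And>f. f \<in> lps S \<Longrightarrow> lp_norm p (K (coproj F1 f)) \<le> \<eta> * lp_norm p f"
      using ops_K_D(2)[OF K \<eta>] by auto
    obtain F where F: "finite F" "F \<subseteq> S"
        "\<And>f. f \<in> lps S \<Longrightarrow> lp_norm p (proj F1 (T (coproj F f))) \<le> \<eta> * lp_norm p f"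
      using ops_L_D(2)[OF T F1(1,2) \<eta>] by auto
    have "lp_norm p (K (T (coproj F f))) \<le> \<epsilon> * lp_norm p f" if f: "f \<in> lps S" for f
    proof -
      define g where "g = T (coproj F f)"
      have g: "g \<in> lps S" unfolding g_def by (intro lp_ops_mem[OF TO] coproj_in_lp f)
      have ng: "lp_norm p g \<le> op_norm p S T * lp_norm p f"
        using op_norm_bound[OF TO coproj_in_lp[OF f, of F]] lp_norm_coproj[OF f, of F]
          mult_left_mono[OF lp_norm_coproj[OF f, of F] nn(2)] by (simp add: g_def)
      have "g = (\<lambda>x. coproj F1 g x + proj F1 g x)" by (auto simp: coproj_apply proj_def)
      then have "K g = (\<lambda>x. K (coproj F1 g) x + K (proj F1 g) x)"
        using lp_ops_add[OF KO coproj_in_lp[OF g] proj_in_lp[OF g], of F1 F1] by simp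
      then have "lp_norm p (K g) \<le> lp_norm p (K (coproj F1 g)) + lp_norm p (K (proj F1 g))"
        using lp_norm_add[OF lp_ops_mem[OF KO coproj_in_lp[OF g]] lp_ops_mem[OF KO proj_in_lp[OF g]], of F1 F1] by simp
      also have "\<dots> \<le> \<eta> * lp_norm p g + op_norm p S K * lp_norm p (proj F1 g)"
        by (intro add_mono F1(3) g op_norm_bound[OF KO] proj_in_lp)
      also have "\<dots> \<le> \<eta> * (op_norm p S T * lp_norm p f) + op_norm p S K * (\<eta> * lp_norm p f)"
        using ng F(3)[OF f] \<eta> nn by (intro add_mono mult_left_mono) (auto simp: g_def)
      also have "\<dots> = \<eta> * (op_norm p S K + op_norm p S T) * lp_norm p f" by (simp add: algebra_simps)
      also have "\<dots> \<le> \<epsilon> * lp_norm p f"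
        using e nn lp_norm_nonneg[OF f] by (intro mult_right_mono) (auto simp: \<eta>_def field_simps)
      finally show ?thesis by (simp add: g_def)
    qed
    then show ?thesis using F(1,2) by auto
  qed
  moreover have "\<exists>F. finite F \<and> F \<subseteq> S \<and> (\<forall>f\<in>lps S. lp_norm p (coproj F ((K \<circ> T) f)) \<le> \<epsilon> * lp_norm p f)"
    if e: "0 < \<epsilon>" for \<epsilon>
  proof -
    define \<eta> where "\<eta> = \<epsilon> / (op_norm p S T + 1)"
    have \<eta>: "0 < \<eta>" using e nn by (simp add: \<eta>_def)
    obtain F where F: "finite F" "F \<subseteq> S"
        "\<And>f. f \<in> lps S \<Longrightarrow> lp_norm p (coproj F (K f)) \<le> \<eta> * lp_norm p f"
      using ops_K_D(3)[OF K \<eta>] by auto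
    have "lp_norm p (coproj F ((K \<circ> T) f)) \<le> \<epsilon> * lp_norm p f" if f: "f \<in> lps S" for f
    proof -
      have "lp_norm p (coproj F ((K \<circ> T) f)) \<le> \<eta> * lp_norm p (T f)"
        using F(3)[OF lp_ops_mem[OF TO f]] by simp
      also have "\<dots> \<le> \<eta> * (op_norm p S T * lp_norm p f)"
        using \<eta> op_norm_bound[OF TO f] by (intro mult_left_mono) auto
      also have "\<dots> = \<eta> * op_norm p S T * lp_norm p f" by simp
      also have "\<dots> \<le> \<epsilon> * lp_norm p f"
        using e nn lp_norm_nonneg[OF f] by (intro mult_right_mono) (auto simp: \<eta>_def field_simps)
      finally show ?thesis .
    qed
    then show ?thesis using F(1,2) by blast
  qed
  ultimately show ?thesis by (intro ops_K_I lp_ops_comp[OF KO TO])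
qed

lemma mul_finite_support_in_K:
  assumes "finite H" "H \<subseteq> S" "\<And>x. x \<notin> H \<Longrightarrow> h x = 0"
  shows "mul h \<in> ops_K sc p S"
proof -
  have "\<exists>C. \<forall>x. \<bar>h x\<bar> \<le> C"
    using assms(1,3) by (intro exI[of _ "\<Sum>x\<in>H. \<bar>h x\<bar>"])
      (metis abs_ge_zero abs_zero member_le_sum sum_nonneg)
  then obtain C where C: "\<And>x. \<bar>h x\<bar> \<le> C" by blast
  have "mul h (coproj H f) = (\<lambda>x. 0)" "coproj H (mul h f) = (\<lambda>x. 0)" for f
    using assms(3) by (auto simp: mul_def coproj_apply)
  then show ?thesis
    using assms(1,2)
    by (intro ops_K_I lp_ops_mul[of h C S, OF C]; intro exI[of _ H])
      (auto simp: lp_norm_zero lp_ops_zero[OF lp_ops_mul[of h C S, OF C]] lp_norm_nonneg)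
qed

lemma ops_L_I:
  assumes "T \<in> lp_ops sc p S"
    and "\<And>F' \<epsilon>. finite F' \<Longrightarrow> F' \<subseteq> S \<Longrightarrow> 0 < \<epsilon> \<Longrightarrow> \<exists>F. finite F \<and> F \<subseteq> S \<and>
      (\<forall>f\<in>lps S. lp_norm p (proj F' (T (coproj F f))) \<le> \<epsilon> * lp_norm p f \<and>
         lp_norm p (coproj F (T (proj F' f))) \<le> \<epsilon> * lp_norm p f)"
  shows "T \<in> ops_L sc p S"
  unfolding ops_L_iff using assms(1)
proof (intro conjI allI impI)
  fix F' \<epsilon> assume "finite F' \<and> F' \<subseteq> S" "0 < (\<epsilon>::real)"
  then obtain F where F: "finite F" "F \<subseteq> S"
    "\<forall>f\<in>lps S. lp_norm p (proj F' (T (coproj F f))) \<le> \<epsilon> * lp_norm p f \<and>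
         lp_norm p (coproj F (T (proj F' f))) \<le> \<epsilon> * lp_norm p f"
    using assms(2)[of F' \<epsilon>] by auto
  show "\<exists>F. finite F \<and> F \<subseteq> S \<and> (\<forall>f\<in>lps S. lp_norm p (proj F' (T (coproj F f))) \<le> \<epsilon> * lp_norm p f)"
    using F by auto
  show "\<exists>F. finite F \<and> F \<subseteq> S \<and> (\<forall>f\<in>lps S. lp_norm p (coproj F (T (proj F' f))) \<le> \<epsilon> * lp_norm p f)"
    using F by auto
qed

text \<open>The series for the inverse of \<open>I + T\<close> is summed pointwise, by completeness
  of \<open>E\<close>, and the norm bounds on its tails pass to the limit on finite sets. The tail
  estimate is part of the conclusion because it later shows that \<open>V\<close> is
  band-dominated.\<close>

lemma neumann:
  assumes T: "T \<in> lp_ops sc p S" and small: "\<And>f. f \<in> lps S \<Longrightarrow> lp_norm p (T f) \<le> lp_norm p f / 2"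
  obtains V where "V \<in> lp_ops sc p S"
    "\<And>f. f \<in> lps S \<Longrightarrow> (\<lambda>x. V f x + T (V f) x) = f"
    "\<And>f n. f \<in> lps S \<Longrightarrow>
       lp_norm p (\<lambda>x. V f x - (\<Sum>k<n. (-1) ^ k *\<^sub>R (T ^^ k) f x)) \<le> 2 * (1/2) ^ n * lp_norm p f"
proof -
  define U where "U k f = (\<lambda>x. (-1) ^ k *\<^sub>R (T ^^ k) f x)" for k f
  have Tk: "T ^^ k \<in> lp_ops sc p S" for k
  proof (induction k)
    case (Suc k) then show ?case using lp_ops_comp[OF T Suc] by (simp add: comp_def)
  qed (use lp_ops_id in \<open>simp add: id_def\<close>)
  have U: "U k f \<in> lps S" if "f \<in> lps S" for k f
    unfolding U_def by (rule lp_space_dom[OF lp_ops_mem[OF Tk that]])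
      (auto simp: lp_space_supp[OF lp_ops_mem[OF Tk that]])
  have Tkn: "lp_norm p ((T ^^ k) f) \<le> (1/2) ^ k * lp_norm p f" if f: "f \<in> lps S" for k f
  proof (induction k)
    case (Suc k)
    then show ?case using small[OF lp_ops_mem[OF Tk f], of k] by simp
  qed simp
  have Un: "lp_norm p (U k f) \<le> (1/2) ^ k * lp_norm p f" if f: "f \<in> lps S" for k f
    using Tkn[OF f] lp_norm_scaleR[OF lp_ops_mem[OF Tk f], of "(-1) ^ k"] by (simp add: U_def power_abs)
  define V where "V f = (\<lambda>x. \<Sum>k. U k f x)" for f
  have ptw: "norm (U k f x) \<le> (1/2) ^ k * lp_norm p f" if "f \<in> lps S" for k f x
    by (rule order_trans[OF lp_norm_point[OF U[OF that]] Un[OF that]])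
  have summ: "summable (\<lambda>k. U k f x)" if "f \<in> lps S" for f x
    by (rule summable_comparison_test'[OF summable_mult2[OF summable_geometric] ptw[OF that]]) simp
  have lim: "(\<lambda>n. \<Sum>k<n. U k f x) \<longlonglongrightarrow> V f x" if "f \<in> lps S" for f x
    unfolding V_def using summable_LIMSEQ[OF summ[OF that]] .
  have partial: "(\<lambda>x. \<Sum>k\<in>{n..<m}. U k f x) \<in> lps S" if "f \<in> lps S" for n m f
    using U[OF that] by (rule lp_space_sum)
  have geo: "(\<Sum>k\<in>{n..<m}. (1/2::real) ^ k) \<le> 2 * (1/2) ^ n" for n m
  proof (cases "n \<le> m")
    case True
    have "(\<Sum>k\<in>{n..<n+j}. (1/2::real) ^ k) = 2 * (1/2) ^ n - 2 * (1/2) ^ (n+j)" for j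
      by (induction j) auto
    from this[of "m - n"] True show ?thesis by simp
  qed simp
  have partn: "lp_norm p (\<lambda>x. \<Sum>k\<in>{n..<m}. U k f x) \<le> 2 * (1/2) ^ n * lp_norm p f"
    if f: "f \<in> lps S" for n m f
  proof -
    have "lp_norm p (\<lambda>x. \<Sum>k\<in>{n..<m}. U k f x) \<le> (\<Sum>k\<in>{n..<m}. lp_norm p (U k f))"
      using U[OF f] by (intro lp_norm_sum) auto
    also have "\<dots> \<le> (\<Sum>k\<in>{n..<m}. (1/2) ^ k) * lp_norm p f"
      unfolding sum_distrib_right by (intro sum_mono Un[OF f])
    also have "\<dots> \<le> 2 * (1/2) ^ n * lp_norm p f"
      using geo lp_norm_nonneg[OF f] by (intro mult_right_mono) auto
    finally show ?thesis .
  qed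
  have tail: "lp_le (\<lambda>x. V f x - (\<Sum>k<n. U k f x)) (2 * (1/2) ^ n * lp_norm p f)"
    if f: "f \<in> lps S" for n f
  proof (rule lp_le_finite_pieces)
    show "0 \<le> 2 * (1/2) ^ n * lp_norm p f" using lp_norm_nonneg[OF f] by simp
    fix F :: "'a set" assume F: "finite F"
    have lims: "(\<lambda>m. \<Sum>k\<in>{n..<m}. U k f x) \<longlonglongrightarrow> V f x - (\<Sum>k<n. U k f x)" for x
    proof -
      have "\<forall>\<^sub>F m in sequentially. (\<Sum>k<m. U k f x) - (\<Sum>k<n. U k f x) = (\<Sum>k\<in>{n..<m}. U k f x)"
        using eventually_ge_at_top[of n]
        by eventually_elim (metis sum_diff_nat_ivl atLeast0LessThan zero_le)
      then show ?thesis using tendsto_diff[OF lim[OF f, of x] tendsto_const, of "\<Sum>k<n. U k f x"]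
        by (rule Lim_transform_eventually[rotated])
    qed
    have le: "lp_le (\<lambda>x. \<Sum>k\<in>{n..<m}. U k f x) (2 * (1/2) ^ n * lp_norm p f)" for m
      using lp_le_weaken[OF lp_le_norm[OF partial[OF f]] partn[OF f]] .
    show "lp_le (proj F (\<lambda>x. V f x - (\<Sum>k<n. U k f x))) (2 * (1/2) ^ n * lp_norm p f)"
    proof (cases sup_type)
      case True
      have "norm (V f x - (\<Sum>k<n. U k f x)) \<le> 2 * (1/2) ^ n * lp_norm p f" for x
        using lp_le_point[OF le] by (intro LIMSEQ_le_const2[OF tendsto_norm[OF lims]]) auto
      then show ?thesis using True lp_le_nonneg[OF le] by (auto simp: lp_le_def proj_def)
    next
      case False
      have "(\<Sum>x\<in>G. norm (V f x - (\<Sum>k<n. U k f x)) powr P) \<le> (2 * (1/2) ^ n * lp_norm p f) powr P"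
        if G: "finite G" for G
      proof (rule LIMSEQ_le_const2)
        show "(\<lambda>m. \<Sum>x\<in>G. norm (\<Sum>k\<in>{n..<m}. U k f x) powr P)
          \<longlonglongrightarrow> (\<Sum>x\<in>G. norm (V f x - (\<Sum>k<n. U k f x)) powr P)"
          using P_pos[OF False] by (intro tendsto_sum tendsto_powr' tendsto_norm lims tendsto_const) auto
      qed (use le G False in \<open>auto simp: lp_le_def\<close>)
      then have "lp_le (\<lambda>x. V f x - (\<Sum>k<n. U k f x)) (2 * (1/2) ^ n * lp_norm p f)"
        using False lp_le_nonneg[OF le] by (simp add: lp_le_def)
      then show ?thesis by (rule lp_le_mono) (auto simp: proj_def)
    qed
  qed
  have VS: "V f x = 0" if "f \<in> lps S" "x \<notin> S" for f x
    using lp_space_supp[OF U[OF that(1)] that(2)] by (simp add: V_def)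
  have Vmem: "V f \<in> lps S" if f: "f \<in> lps S" for f
  proof (rule lp_spaceI0)
    show "lp_le (V f) (2 * lp_norm p f)" using tail[OF f, of 0] by simp
    \<comment> \<open>For \<open>p = 0\<close> the limit vanishes at infinity because the partial
      sums do and the tails are small uniformly in \<open>x\<close>.\<close>
    fix \<epsilon> :: real assume e: "p = 0" "0 < \<epsilon>"
    obtain n where n: "2 * (1/2) ^ n * lp_norm p f < \<epsilon> / 2"
    proof -
      have "(\<lambda>n. 2 * (1/2) ^ n * lp_norm p f) \<longlonglongrightarrow> 2 * 0 * lp_norm p f"
        by (intro tendsto_intros LIMSEQ_power_zero) auto
      then have "\<forall>\<^sub>F n in sequentially. 2 * (1/2) ^ n * lp_norm p f < \<epsilon> / 2"
        using e by (intro order_tendstoD) auto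
      then show ?thesis using that eventually_sequentially by auto
    qed
    have g: "(\<lambda>x. \<Sum>k<n. U k f x) \<in> lps S" using partial[OF f, of 0 n] by (simp add: atLeast0LessThan)
    obtain F where F: "finite F" "\<And>x. x \<notin> F \<Longrightarrow> norm (\<Sum>k<n. U k f x) < \<epsilon> / 2"
      using lp_space_vanish[OF g p0_ne_inf[OF e(1)], of "\<epsilon> / 2"] e(2) by (meson half_gt_zero)
    have "norm (V f x) < \<epsilon>" if "x \<notin> F" for x
      using norm_triangle_ineq[of "V f x - (\<Sum>k<n. U k f x)" "\<Sum>k<n. U k f x"] F(2)[OF that]
        lp_le_point[OF tail[OF f, of n], of x] n by simp
    then show "\<exists>F. finite F \<and> (\<forall>x. x \<notin> F \<longrightarrow> norm (V f x) < \<epsilon>)" using F(1) by blast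
  qed (use VS f in auto)
  have VO: "V \<in> lp_ops sc p S"
  proof (rule lp_opsI[where C = 2])
    fix f g assume fg: "f \<in> lps S" "g \<in> lps S"
    have "U k (\<lambda>x. f x + g x) = (\<lambda>x. U k f x + U k g x)" for k
      unfolding U_def using lp_ops_add[OF Tk fg] by (simp add: scaleR_add_right)
    then show "V (\<lambda>x. f x + g x) = (\<lambda>x. V f x + V g x)"
      unfolding V_def using suminf_add[OF summ[OF fg(1)] summ[OF fg(2)]] by simp
  next
    fix c f assume f: "f \<in> lps S"
    have "U k (\<lambda>x. sc c (f x)) = (\<lambda>x. sc c (U k f x))" for k
      unfolding U_def using lp_ops_sc[OF Tk f] by (simp add: sc_scaleR)
    then show "V (\<lambda>x. sc c (f x)) = (\<lambda>x. sc c (V f x))"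
      unfolding V_def using bounded_linear.suminf[OF bounded_linear_sc summ[OF f]] by simp
  next
    fix f assume f: "f \<in> lps S"
    show "lp_norm p (V f) \<le> 2 * lp_norm p f" using lp_norm_le[OF tail[OF f, of 0]] by simp
  qed (rule Vmem)
  show ?thesis
  proof (rule that[OF VO])
    fix f n assume f: "f \<in> lps S"
    show "lp_norm p (\<lambda>x. V f x - (\<Sum>k<n. (-1) ^ k *\<^sub>R (T ^^ k) f x)) \<le> 2 * (1/2) ^ n * lp_norm p f"
      using lp_norm_le[OF tail[OF f, of n]] by (simp add: U_def)
  next
    fix f assume f: "f \<in> lps S"
    show "(\<lambda>x. V f x + T (V f) x) = f"
    proof
      fix x
      define r where "r n = (\<lambda>x. V f x - (\<Sum>k<n. U k f x))" for n
      have g: "(\<lambda>x. \<Sum>k<n. U k f x) \<in> lps S" for n using partial[OF f, of 0 n] by (simp add: atLeast0LessThan)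
      have r: "r n \<in> lps S" for n unfolding r_def by (rule lp_space_diff[OF Vmem[OF f] g])
      have rn: "lp_norm p (r n) \<le> 2 * (1/2) ^ n * lp_norm p f" for n
        using lp_norm_le[OF tail[OF f, of n]] by (simp add: r_def)
      have TU: "T (U k f) x = - U (Suc k) f x" for k x
        unfolding U_def using lp_ops_scaleR[OF T lp_ops_mem[OF Tk f]] by simp
      \<comment> \<open>Applied to a partial sum, \<open>I + T\<close> telescopes to
        \<open>f - U n f\<close>; what remains is \<open>I + T\<close> applied to the tail
        \<open>r n\<close>.\<close>
      have eq: "V f x + T (V f) x - f x = r n x + T (r n) x + - U n f x" for n
      proof -
        have a: "T (r n) x = T (V f) x - (\<Sum>k<n. T (U k f) x)"
          unfolding r_def using lp_ops_diff[OF T Vmem[OF f] g] lp_ops_sum[OF T, of "{..<n}" "\<lambda>k. U k f"] U[OF f] by simp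
        have "(\<Sum>k<n. T (U k f) x) + (\<Sum>k<n. U k f x) = f x + - U n f x"
          unfolding TU by (induction n) (auto simp: U_def add.assoc[symmetric])
        then have b: "f x = (\<Sum>k<n. T (U k f) x) + (\<Sum>k<n. U k f x) + U n f x" by simp
        have c: "r n x = V f x - (\<Sum>k<n. U k f x)" by (simp add: r_def)
        show ?thesis unfolding a b c by simp
      qed
      have le: "norm (V f x + T (V f) x - f x) \<le> 4 * (1/2) ^ n * lp_norm p f" for n
      proof -
        have "norm (T (r n) x) \<le> lp_norm p (r n) / 2"
          using lp_norm_point[OF lp_ops_mem[OF T r], of n x] small[OF r, of n] by linarith
        moreover have "norm (r n x) \<le> lp_norm p (r n)" by (rule lp_norm_point[OF r])
        moreover have "norm (U n f x) \<le> (1/2) ^ n * lp_norm p f" by (rule ptw[OF f])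
        ultimately have "norm (r n x + T (r n) x + - U n f x) \<le> 3/2 * lp_norm p (r n) + (1/2) ^ n * lp_norm p f"
          using norm_triangle_ineq[of "r n x + T (r n) x" "- U n f x"] norm_triangle_ineq[of "r n x" "T (r n) x"]
          by simp
        also have "\<dots> \<le> 3/2 * (2 * (1/2) ^ n * lp_norm p f) + (1/2) ^ n * lp_norm p f"
          using rn[of n] by (intro add_right_mono mult_left_mono) auto
        also have "\<dots> = 4 * (1/2) ^ n * lp_norm p f" by (simp add: algebra_simps)
        finally show ?thesis unfolding eq[of n] .
      qed
      have "(\<lambda>n. 4 * (1/2) ^ n * lp_norm p f) \<longlonglongrightarrow> 4 * 0 * lp_norm p f"
        by (intro tendsto_intros LIMSEQ_power_zero) auto
      then have "norm (V f x + T (V f) x - f x) \<le> 4 * 0 * lp_norm p f"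
        by (rule LIMSEQ_le_const) (intro exI[of _ 0] allI impI le)
      then show "V f x + T (V f) x = f x" by simp
    qed
  qed
qed

end

section \<open>Band-dominated operators on a space of bounded geometry\<close>

context lp_operators
begin

context
  fixes S :: "'i set" and T :: "('i \<Rightarrow> 'e) \<Rightarrow> ('i \<Rightarrow> 'e)"
  assumes T: "T \<in> lp_ops sc p S"
begin

lemma norm_T_delta: "y \<in> S \<Longrightarrow> norm (T (delta y e) x) \<le> norm e * op_norm p S T"
  using lp_norm_point[OF lp_ops_mem[OF T delta_in_lp], of y e x] op_norm_bound[OF T delta_in_lp, of y e]
  by (simp add: lp_norm_delta mult.commute)

lemma matrix_coeff_apply:
  assumes y: "y \<in> S"
  shows "blinfun_apply (matrix_coeff T x y) e = T (delta y e) x"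
proof -
  have "bounded_linear (\<lambda>e. T (delta y e) x)"
  proof (rule bounded_linear_intro[where K = "op_norm p S T"])
    fix e e' :: 'e and r :: real
    have "delta y (e + e') = (\<lambda>x. delta y e x + delta y e' x)" by (auto simp: delta_def)
    then show "T (delta y (e + e')) x = T (delta y e) x + T (delta y e') x"
      using lp_ops_add[OF T delta_in_lp[OF y] delta_in_lp[OF y]] by metis
    have "delta y (r *\<^sub>R e) = (\<lambda>x. r *\<^sub>R delta y e x)" by (auto simp: delta_def)
    then show "T (delta y (r *\<^sub>R e)) x = r *\<^sub>R T (delta y e) x"
      using lp_ops_scaleR[OF T delta_in_lp[OF y]] by metis
    show "norm (T (delta y e) x) \<le> norm e * op_norm p S T" by (rule norm_T_delta[OF y])
  qed
  then show ?thesis by (simp add: matrix_coeff_def bounded_linear_Blinfun_apply)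
qed

lemma norm_matrix_coeff: "y \<in> S \<Longrightarrow> norm (matrix_coeff T x y) \<le> op_norm p S T"
  using norm_T_delta op_norm_nonneg[OF T]
  by (intro norm_blinfun_bound) (auto simp: matrix_coeff_apply mult.commute)

lemma matrix_coeff_in_coeff_ops:
  assumes y: "y \<in> S" shows "matrix_coeff T x y \<in> coeff_ops sc"
proof -
  have "T (delta y (sc c e)) x = sc c (T (delta y e) x)" for c e
  proof -
    have "delta y (sc c e) = (\<lambda>x. sc c (delta y e x))" by (auto simp: delta_def)
    then show ?thesis using lp_ops_sc[OF T delta_in_lp[OF y]] by metis
  qed
  then show ?thesis by (simp add: coeff_ops_def matrix_coeff_apply[OF y])
qed

lemma lp_ops_finite_support:
  assumes "finite F" "F \<subseteq> S"
  shows "T (proj F f) x = (\<Sum>y\<in>F. blinfun_apply (matrix_coeff T x y) (f y))"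
proof -
  have "proj F f = (\<lambda>x. \<Sum>y\<in>F. delta y (f y) x)"
    using assms(1) by (auto simp: proj_def delta_def fun_eq_iff)
  moreover have "T (\<lambda>x. \<Sum>y\<in>F. delta y (f y) x) = (\<lambda>x. \<Sum>y\<in>F. T (delta y (f y)) x)"
    by (rule lp_ops_sum[OF T]) (use assms(2) in \<open>auto intro: delta_in_lp\<close>)
  ultimately show ?thesis
    using assms(2) by (auto simp: matrix_coeff_apply subset_iff intro!: sum.cong)
qed

end

end

locale bg_space = lp_operators p sc + Metric_space X d
  for p :: ennreal and sc :: "'k::real_normed_field \<Rightarrow> 'e::banach \<Rightarrow> 'e"
    and X :: "'a set" and d :: "'a \<Rightarrow> 'a \<Rightarrow> real" +
  assumes bg: "bounded_geometry X d"
begin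

section \<open>Balls, neighbourhoods and colourings\<close>

definition nb :: "real \<Rightarrow> 'a \<Rightarrow> 'a set" where "nb R x = {y \<in> X. d x y \<le> R}"

definition nbs :: "real \<Rightarrow> 'a set \<Rightarrow> 'a set" where "nbs R F = (\<Union>x\<in>F. nb R x)"

lemma nb_bound: "\<exists>N. \<forall>x\<in>X. finite (nb R x) \<and> card (nb R x) \<le> N"
proof -
  have "nb R x = mcball x R" if "x \<in> X" for x using that by (auto simp: nb_def mcball_def)
  then show ?thesis using bg unfolding bounded_geometry_def by (metis (no_types, lifting))
qed

definition deg :: "real \<Rightarrow> nat" where
  "deg R = (SOME N. \<forall>x\<in>X. finite (nb R x) \<and> card (nb R x) \<le> N)"

lemma deg: "x \<in> X \<Longrightarrow> finite (nb R x) \<and> card (nb R x) \<le> deg R"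
  using someI_ex[OF nb_bound[of R]] unfolding deg_def by blast

lemma nb_sub: "nb R x \<subseteq> X" by (auto simp: nb_def)

lemma nbs_sub: "nbs R F \<subseteq> X" by (auto simp: nbs_def nb_def)

lemma finite_nbs: "finite F \<Longrightarrow> F \<subseteq> X \<Longrightarrow> finite (nbs R F)"
  unfolding nbs_def using deg by blast

lemma nbs_mem: "y \<in> nbs R F \<longleftrightarrow> y \<in> X \<and> (\<exists>x\<in>F. d x y \<le> R)"
  by (auto simp: nbs_def nb_def)

text \<open>Greedy colouring along a well-ordering of the points.\<close>

lemma coloring:
  "\<exists>(c::'a \<Rightarrow> nat) N. (\<forall>x\<in>X. c x \<le> N) \<and> (\<forall>x\<in>X. \<forall>y\<in>X. x \<noteq> y \<and> d x y \<le> R \<longrightarrow> c x \<noteq> c y)"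
proof -
  obtain r :: "'a rel" where r: "Well_order r" "Field r = UNIV"
    using well_ordering[where 'a = 'a] by (elim exE conjE)
  define s where "s = r - Id"
  have wf: "wf s" using r(1) by (simp add: s_def well_order_on_def)
  have total: "(x, y) \<in> s \<or> (y, x) \<in> s" if "x \<noteq> y" for x y
    using r that unfolding well_order_on_def linear_order_on_def total_on_def s_def by auto
  define G where "G c x = (LEAST k::nat. \<forall>y\<in>nb R x. (y, x) \<in> s \<longrightarrow> c y \<noteq> k)" for c x
  define c where "c = wfrec s G"
  have c: "c x = (LEAST k. \<forall>y\<in>nb R x. (y, x) \<in> s \<longrightarrow> c y \<noteq> k)" for x
  proof -
    have "c x = G (cut c s x) x" unfolding c_def by (rule wfrec[OF wf])
    also have "\<dots> = G c x"
    proof -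
      have "(\<forall>y\<in>nb R x. (y, x) \<in> s \<longrightarrow> cut c s x y \<noteq> k) = (\<forall>y\<in>nb R x. (y, x) \<in> s \<longrightarrow> c y \<noteq> k)" for k
        by (auto simp: cut_apply)
      then show ?thesis by (simp add: G_def)
    qed
    finally show ?thesis by (simp add: G_def)
  qed
  have ex: "\<exists>k\<le>deg R. \<forall>y\<in>nb R x. (y, x) \<in> s \<longrightarrow> c y \<noteq> k" if x: "x \<in> X" for x
  proof -
    \<comment> \<open>Pigeonhole: at most \<open>deg R\<close> neighbours cannot occupy all of the
      \<open>deg R + 1\<close> colours up to \<open>deg R\<close>.\<close>
    have "card (c ` nb R x) < card {..deg R}"
      using deg[OF x, of R] card_image_le[of "nb R x" c] by auto
    then have "\<not> {..deg R} \<subseteq> c ` nb R x"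
      using deg[OF x, of R] by (metis card_mono finite_imageI not_le)
    then show ?thesis by blast
  qed
  have bound: "c x \<le> deg R" if x: "x \<in> X" for x
  proof -
    obtain k where k: "k \<le> deg R" "\<forall>y\<in>nb R x. (y, x) \<in> s \<longrightarrow> c y \<noteq> k" using ex[OF x] by blast
    have "c x \<le> k" unfolding c[of x] by (rule Least_le) (rule k(2))
    then show ?thesis using k(1) by (rule order_trans)
  qed
  have neq: "c y \<noteq> c x" if "x \<in> X" "y \<in> nb R x" "(y, x) \<in> s" for x y
  proof -
    have "\<exists>k. \<forall>y\<in>nb R x. (y, x) \<in> s \<longrightarrow> c y \<noteq> k" using ex[OF that(1)] by blast
    then have "\<forall>y\<in>nb R x. (y, x) \<in> s \<longrightarrow> c y \<noteq> c x" unfolding c[of x] by (rule LeastI_ex)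
    then show ?thesis using that by blast
  qed
  have "c x \<noteq> c y" if "x \<in> X" "y \<in> X" "x \<noteq> y" "d x y \<le> R" for x y
    using total[OF that(3)] neq[of x y] neq[of y x] that by (auto simp: nb_def commute)
  then show ?thesis using bound by blast
qed

text \<open>By symmetry of \<open>d\<close> a point lies in at most \<open>deg R\<close> of the
  balls, so \<open>lp_le_average\<close> applies.\<close>

lemma nb_average:
  assumes g: "lp_le g M" and f: "\<And>x. x \<in> X \<Longrightarrow> norm (f x) \<le> (\<Sum>y\<in>nb R x. norm (g y))"
    and f0: "\<And>x. x \<notin> X \<Longrightarrow> f x = 0"
  shows "lp_le f (real (deg R) * real (deg R) * M)"
proof (rule lp_le_average[OF g, where n = "\<lambda>x. if x \<in> X then nb R x else {}"])
  fix y
  have "{x. y \<in> (if x \<in> X then nb R x else {})} \<subseteq> (if y \<in> X then nb R y else {})"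
    by (auto simp: nb_def commute split: if_splits)
  then show "finite {x. y \<in> (if x \<in> X then nb R x else {})} \<and>
      card {x. y \<in> (if x \<in> X then nb R x else {})} \<le> deg R"
    using deg[of y R] by (auto split: if_splits dest: finite_subset intro: card_mono order_trans)
qed (use f f0 deg in auto)

text \<open>Finite propagation stated for the operator instead of its matrix. By
  \<open>band_opsI\<close> and \<open>band_opsD\<close> the bounded operators with this property for
  some radius are exactly the band operators, and propagation adds up under composition by the
  triangle inequality, without matrix products.\<close>

definition local_op :: "real \<Rightarrow> (('a \<Rightarrow> 'e) \<Rightarrow> ('a \<Rightarrow> 'e)) \<Rightarrow> bool" where
  "local_op R T \<longleftrightarrow> (\<forall>f\<in>lps X. \<forall>g\<in>lps X. \<forall>x\<in>X. (\<forall>y\<in>X. d x y \<le> R \<longrightarrow> f y = g y) \<longrightarrow> T f x = T g x)"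

lemma local_opD:
  "local_op R T \<Longrightarrow> f \<in> lps X \<Longrightarrow> g \<in> lps X \<Longrightarrow> x \<in> X \<Longrightarrow>
    (\<And>y. y \<in> X \<Longrightarrow> d x y \<le> R \<Longrightarrow> f y = g y) \<Longrightarrow> T f x = T g x"
  unfolding local_op_def by blast

lemma local_op_proj:
  assumes "local_op R T" "f \<in> lps X" "x \<in> X" "nb R x \<subseteq> F"
  shows "T f x = T (proj F f) x"
  using assms by (intro local_opD[OF assms(1,2) proj_in_lp[OF assms(2)] assms(3)])
    (auto simp: proj_def nb_def)

lemma local_op_mono: "local_op R T \<Longrightarrow> R \<le> R' \<Longrightarrow> local_op R' T"
  unfolding local_op_def by (meson order_trans)

lemma local_op_comp:
  assumes T: "local_op R T" and U: "local_op R' U" "U \<in> lp_ops sc p X"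
  shows "local_op (R + R') (T \<circ> U)"
  unfolding local_op_def
proof (intro ballI impI)
  fix f g x assume fg: "f \<in> lps X" "g \<in> lps X" and x: "x \<in> X"
    and eq: "\<forall>y\<in>X. d x y \<le> R + R' \<longrightarrow> f y = g y"
  have "U f y = U g y" if "y \<in> X" "d x y \<le> R" for y
  proof (rule local_opD[OF U(1) fg that(1)])
    fix z assume "z \<in> X" "d y z \<le> R'"
    then show "f z = g z" using eq triangle[OF x that(1), of z] that by simp
  qed
  then show "(T \<circ> U) f x = (T \<circ> U) g x"
    using local_opD[OF T lp_ops_mem[OF U(2) fg(1)] lp_ops_mem[OF U(2) fg(2)] x] by simp
qed

lemma local_op_plus: "local_op R T \<Longrightarrow> local_op R U \<Longrightarrow> local_op R (\<lambda>f x. T f x + U f x)"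
  unfolding local_op_def by metis

lemma local_op_mul: "0 \<le> R \<Longrightarrow> local_op R (mul h)"
  unfolding local_op_def mul_def by simp

lemma local_op_id: "0 \<le> R \<Longrightarrow> local_op R id"
  unfolding local_op_def by simp

lemma band_opsI:
  assumes T: "T \<in> lp_ops sc p X" and loc: "local_op R T"
  shows "T \<in> band_ops sc p X d"
proof -
  define a where "a = matrix_coeff T"
  have a0: "a x y = 0" if "x \<in> X" "y \<in> X" "\<not> d x y \<le> R" for x y
  proof (rule blinfun_eqI)
    fix e
    have "T (delta y e) x = T (\<lambda>x. 0) x"
      by (rule local_opD[OF loc delta_in_lp[OF that(2)] lp_space_zero that(1)])
        (use that in \<open>auto simp: delta_def\<close>)
    then show "blinfun_apply (a x y) e = blinfun_apply 0 e"
      by (simp add: a_def matrix_coeff_apply[OF T that(2)] lp_ops_zero[OF T])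
  qed
  have "T f = matrix_op X a f" if f: "f \<in> lps X" for f
  proof
    fix x
    show "T f x = matrix_op X a f x"
    proof (cases "x \<in> X")
      case True
      have "T f x = T (proj (nb R x) f) x" by (rule local_op_proj[OF loc f True order_refl])
      also have "\<dots> = (\<Sum>y\<in>nb R x. blinfun_apply (a x y) (f y))"
        unfolding a_def using deg[OF True] nb_sub by (intro lp_ops_finite_support[OF T]) auto
      also have "\<dots> = (\<Sum>\<^sub>\<infinity>y\<in>nb R x. blinfun_apply (a x y) (f y))"
        using deg[OF True] by simp
      also have "\<dots> = (\<Sum>\<^sub>\<infinity>y\<in>X. blinfun_apply (a x y) (f y))"
        using a0[OF True] by (intro infsum_cong_neutral) (auto simp: nb_def)
      finally show ?thesis using True by (simp add: matrix_op_def)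
    next
      case False
      then show ?thesis using lp_space_supp[OF lp_ops_mem[OF T f]] by (simp add: matrix_op_def)
    qed
  qed
  moreover have "band_matrix sc X d a"
    unfolding band_matrix_def a_def
    using matrix_coeff_in_coeff_ops[OF T] norm_matrix_coeff[OF T] a0[unfolded a_def] by blast
  ultimately show ?thesis using T unfolding band_ops_def by blast
qed

lemma band_opsD:
  assumes "T \<in> band_ops sc p X d"
  shows "T \<in> lp_ops sc p X" and "\<exists>R\<ge>0. local_op R T"
proof -
  show "T \<in> lp_ops sc p X" using assms by (simp add: band_ops_def)
  obtain a where a: "band_matrix sc X d a" "\<And>f. f \<in> lps X \<Longrightarrow> T f = matrix_op X a f"
    using assms by (auto simp: band_ops_def)
  then obtain R where R: "\<And>x y. x \<in> X \<Longrightarrow> y \<in> X \<Longrightarrow> a x y \<noteq> 0 \<Longrightarrow> d x y \<le> R"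
    unfolding band_matrix_def by blast
  have "local_op (max R 0) T"
    unfolding local_op_def
  proof (intro ballI impI)
    fix f g x assume fg: "f \<in> lps X" "g \<in> lps X" and x: "x \<in> X"
      and eq: "\<forall>y\<in>X. d x y \<le> max R 0 \<longrightarrow> f y = g y"
    have "blinfun_apply (a x y) (f y) = blinfun_apply (a x y) (g y)" if "y \<in> X" for y
      using R[OF x that] eq that by (cases "a x y = 0") auto
    then show "T f x = T g x"
      by (simp add: a(2)[OF fg(1)] a(2)[OF fg(2)] matrix_op_def cong: infsum_cong)
  qed
  then show "\<exists>R\<ge>0. local_op R T" by (meson max.cobounded2)
qed

text \<open>The value at \<open>x\<close> sees only the finite part of \<open>f\<close> on the ball,
  whose norm is at most the sum of its pointwise norms.\<close>

lemma local_op_point: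
  assumes T: "T \<in> lp_ops sc p X" "local_op R T" and f: "f \<in> lps X" and x: "x \<in> X"
  shows "norm (T f x) \<le> op_norm p X T * (\<Sum>y\<in>nb R x. norm (f y))"
proof -
  have "T f x = T (proj (nb R x) f) x" by (rule local_op_proj[OF T(2) f x order_refl])
  then have "norm (T f x) \<le> lp_norm p (T (proj (nb R x) f))"
    using lp_norm_point[OF lp_ops_mem[OF T(1) proj_in_lp[OF f]]] by simp
  also have "\<dots> \<le> op_norm p X T * lp_norm p (proj (nb R x) f)"
    by (rule op_norm_bound[OF T(1) proj_in_lp[OF f]])
  also have "lp_norm p (proj (nb R x) f) \<le> (\<Sum>y\<in>nb R x. norm (proj (nb R x) f y))"
    by (rule lp_norm_le[OF lp_le_finite_l1]) (use deg[OF x] in \<open>auto simp: proj_def\<close>)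
  also have "\<dots> = (\<Sum>y\<in>nb R x. norm (f y))" by (simp add: proj_def)
  finally show ?thesis using op_norm_nonneg[OF T(1)] by (simp add: mult_left_mono)
qed

definition comm :: "(('a \<Rightarrow> 'e) \<Rightarrow> ('a \<Rightarrow> 'e)) \<Rightarrow> ('a \<Rightarrow> real) \<Rightarrow> ('a \<Rightarrow> 'e) \<Rightarrow> ('a \<Rightarrow> 'e)" where
  "comm T h f = (\<lambda>x. T (mul h f) x - mul h (T f) x)"

text \<open>At the point \<open>x\<close> the commutator is unchanged if the constant
  \<open>h x\<close> is subtracted from \<open>h\<close>; only the increments of \<open>h\<close>
  within distance \<open>R\<close> remain.\<close>

lemma comm_point:
  assumes T: "T \<in> lp_ops sc p X" "local_op R T" and f: "f \<in> lps X" and x: "x \<in> X"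
    and h: "\<And>x. \<bar>h x\<bar> \<le> C"
  shows "norm (comm T h f x) \<le> op_norm p X T * (\<Sum>y\<in>nb R x. \<bar>h y - h x\<bar> * norm (f y))"
proof -
  have hf: "mul h f \<in> lps X" by (rule mul_lp[OF h f])
  have hx: "(\<lambda>y. h x *\<^sub>R f y) \<in> lps X" using mul_lp[of "\<lambda>_. h x" C, OF h f] by (simp add: mul_def)
  have "comm T h f x = T (\<lambda>y. mul h f y - h x *\<^sub>R f y) x"
    using lp_ops_diff[OF T(1) hf hx] lp_ops_scaleR[OF T(1) f, of "h x"] by (simp add: comm_def mul_def)
  also have "norm \<dots> \<le> op_norm p X T * (\<Sum>y\<in>nb R x. norm (mul h f y - h x *\<^sub>R f y))"
    by (rule local_op_point[OF T lp_space_diff[OF hf hx] x])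
  also have "(\<Sum>y\<in>nb R x. norm (mul h f y - h x *\<^sub>R f y)) = (\<Sum>y\<in>nb R x. \<bar>h y - h x\<bar> * norm (f y))"
    by (intro sum.cong) (simp_all add: mul_def scaleR_diff_left[symmetric])
  finally show ?thesis .
qed

section \<open>The algebra of band-dominated operators\<close>

lemma ops_A_iff:
  "T \<in> ops_A sc p X d \<longleftrightarrow> T \<in> lp_ops sc p X \<and>
    (\<forall>\<epsilon>>0. \<exists>U\<in>band_ops sc p X d. \<forall>f\<in>lps X. lp_norm p (op_diff T U f) \<le> \<epsilon> * lp_norm p f)"
proof (cases "T \<in> lp_ops sc p X")
  case T: True
  have "(\<exists>U\<in>band_ops sc p X d. op_norm p X (op_diff T U) < \<epsilon>)"
    if ex: "\<exists>U\<in>band_ops sc p X d. \<forall>f\<in>lps X. lp_norm p (op_diff T U f) \<le> (\<epsilon>/2) * lp_norm p f" and e: "0 < \<epsilon>" for \<epsilon>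
  proof -
    obtain U where U: "U \<in> band_ops sc p X d" "\<forall>f\<in>lps X. lp_norm p (op_diff T U f) \<le> (\<epsilon>/2) * lp_norm p f"
      using ex by blast
    have "op_norm p X (op_diff T U) \<le> \<epsilon> / 2" using U(2) e by (intro op_norm_le) auto
    then show ?thesis using U(1) e by (intro bexI[of _ U]) auto
  qed
  moreover have "\<exists>U\<in>band_ops sc p X d. \<forall>f\<in>lps X. lp_norm p (op_diff T U f) \<le> \<epsilon> * lp_norm p f"
    if ex: "\<exists>U\<in>band_ops sc p X d. op_norm p X (op_diff T U) < \<epsilon>" and e: "0 < \<epsilon>" for \<epsilon>
  proof -
    obtain U where U: "U \<in> band_ops sc p X d" "op_norm p X (op_diff T U) < \<epsilon>" using ex by blast
    then show ?thesis
      using op_norm_le_iff[OF lp_ops_op_diff[OF T band_opsD(1)[OF U(1)]], of \<epsilon>] e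
      by (intro bexI[of _ U]) auto
  qed
  ultimately have "(\<forall>\<epsilon>>0. \<exists>U\<in>band_ops sc p X d. op_norm p X (op_diff T U) < \<epsilon>) \<longleftrightarrow>
    (\<forall>\<epsilon>>0. \<exists>U\<in>band_ops sc p X d. \<forall>f\<in>lps X. lp_norm p (op_diff T U f) \<le> \<epsilon> * lp_norm p f)"
    by (meson half_gt_zero)
  then show ?thesis using T by (simp add: ops_A_def)
qed (simp add: ops_A_def)

lemma ops_A_D:
  assumes "T \<in> ops_A sc p X d"
  shows "T \<in> lp_ops sc p X"
    and "0 < \<epsilon> \<Longrightarrow> \<exists>U R. U \<in> lp_ops sc p X \<and> 0 \<le> R \<and> local_op R U \<and>
      (\<forall>f\<in>lps X. lp_norm p (op_diff T U f) \<le> \<epsilon> * lp_norm p f)"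
proof -
  show "T \<in> lp_ops sc p X" using assms by (simp add: ops_A_def)
  assume "0 < \<epsilon>"
  then obtain U where U: "U \<in> band_ops sc p X d" "\<forall>f\<in>lps X. lp_norm p (op_diff T U f) \<le> \<epsilon> * lp_norm p f"
    using assms unfolding ops_A_iff by auto
  then show "\<exists>U R. U \<in> lp_ops sc p X \<and> 0 \<le> R \<and> local_op R U \<and>
      (\<forall>f\<in>lps X. lp_norm p (op_diff T U f) \<le> \<epsilon> * lp_norm p f)"
    using band_opsD[OF U(1)] by blast
qed

lemma ops_A_I:
  assumes "T \<in> lp_ops sc p X"
    and "\<And>\<epsilon>. 0 < \<epsilon> \<Longrightarrow> \<exists>U R. U \<in> lp_ops sc p X \<and> local_op R U \<and>
      (\<forall>f\<in>lps X. lp_norm p (op_diff T U f) \<le> \<epsilon> * lp_norm p f)"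
  shows "T \<in> ops_A sc p X d"
  unfolding ops_A_iff using assms(1)
proof (intro conjI allI impI)
  fix \<epsilon> :: real assume "0 < \<epsilon>"
  then obtain U R where "U \<in> lp_ops sc p X" "local_op R U"
      "\<forall>f\<in>lps X. lp_norm p (op_diff T U f) \<le> \<epsilon> * lp_norm p f"
    using assms(2)[OF \<open>0 < \<epsilon>\<close>] by blast
  then show "\<exists>U\<in>band_ops sc p X d. \<forall>f\<in>lps X. lp_norm p (op_diff T U f) \<le> \<epsilon> * lp_norm p f"
    using band_opsI by blast
qed

lemma ops_A_local: "T \<in> lp_ops sc p X \<Longrightarrow> local_op R T \<Longrightarrow> T \<in> ops_A sc p X d"
  by (rule ops_A_I) (auto simp: op_diff_def lp_norm_zero lp_norm_nonneg intro!: exI[of _ T] exI[of _ R])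

lemma ops_A_approx:
  assumes T: "T \<in> lp_ops sc p X"
    and ap: "\<And>\<epsilon>. 0 < \<epsilon> \<Longrightarrow> \<exists>V\<in>ops_A sc p X d. \<forall>f\<in>lps X. lp_norm p (op_diff T V f) \<le> \<epsilon> * lp_norm p f"
  shows "T \<in> ops_A sc p X d"
proof (rule ops_A_I[OF T])
  fix \<epsilon> :: real assume e: "0 < \<epsilon>"
  then obtain V where V: "V \<in> ops_A sc p X d" "\<forall>f\<in>lps X. lp_norm p (op_diff T V f) \<le> \<epsilon>/2 * lp_norm p f"
    using ap[of "\<epsilon>/2"] by auto
  obtain U R where U: "U \<in> lp_ops sc p X" "local_op R U"
      "\<forall>f\<in>lps X. lp_norm p (op_diff V U f) \<le> \<epsilon>/2 * lp_norm p f"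
    using ops_A_D(2)[OF V(1), of "\<epsilon>/2"] e by auto
  have "lp_norm p (op_diff T U f) \<le> \<epsilon> * lp_norm p f" if f: "f \<in> lps X" for f
  proof -
    note VO = ops_A_D(1)[OF V(1)]
    have eq: "op_diff T U f = (\<lambda>x. op_diff T V f x + op_diff V U f x)" by (simp add: op_diff_def)
    have "lp_norm p (op_diff T U f) \<le> lp_norm p (op_diff T V f) + lp_norm p (op_diff V U f)"
      unfolding eq using lp_norm_add[OF lp_ops_mem[OF lp_ops_op_diff[OF T VO] f] lp_ops_mem[OF lp_ops_op_diff[OF VO U(1)] f]] .
    also have "\<dots> \<le> \<epsilon>/2 * lp_norm p f + \<epsilon>/2 * lp_norm p f" using V(2) U(3) f by (intro add_mono) auto
    finally show ?thesis by simp
  qed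
  then show "\<exists>U R. U \<in> lp_ops sc p X \<and> local_op R U \<and>
      (\<forall>f\<in>lps X. lp_norm p (op_diff T U f) \<le> \<epsilon> * lp_norm p f)" using U(1,2) by blast
qed

lemma ops_A_comp:
  assumes T: "T \<in> ops_A sc p X d" and V: "V \<in> ops_A sc p X d"
  shows "T \<circ> V \<in> ops_A sc p X d"
proof (rule ops_A_I)
  note TO = ops_A_D(1)[OF T] and VO = ops_A_D(1)[OF V]
  show "T \<circ> V \<in> lp_ops sc p X" by (rule lp_ops_comp[OF TO VO])
  fix \<epsilon> :: real assume e: "0 < \<epsilon>"
  define \<eta> where "\<eta> = \<epsilon> / (2 * (op_norm p X V + 1))"
  have \<eta>: "0 < \<eta>" using e op_norm_nonneg[OF VO] by (simp add: \<eta>_def)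
  obtain T' R where T': "T' \<in> lp_ops sc p X" "local_op R T'"
      "\<And>f. f \<in> lps X \<Longrightarrow> lp_norm p (op_diff T T' f) \<le> \<eta> * lp_norm p f"
    using ops_A_D(2)[OF T \<eta>] by auto
  \<comment> \<open>The approximation of \<open>V\<close> is chosen after that of \<open>T\<close>,
    because its error is multiplied by the norm of \<open>T'\<close>.\<close>
  define \<theta> where "\<theta> = \<epsilon> / (2 * (op_norm p X T' + 1))"
  have \<theta>: "0 < \<theta>" using e op_norm_nonneg[OF T'(1)] by (simp add: \<theta>_def)
  obtain V' R' where V': "V' \<in> lp_ops sc p X" "local_op R' V'"
      "\<And>f. f \<in> lps X \<Longrightarrow> lp_norm p (op_diff V V' f) \<le> \<theta> * lp_norm p f"
    using ops_A_D(2)[OF V \<theta>] by auto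
  have "lp_norm p (op_diff (T \<circ> V) (T' \<circ> V') f) \<le> \<epsilon> * lp_norm p f" if f: "f \<in> lps X" for f
  proof -
    have m: "V f \<in> lps X" "op_diff V V' f \<in> lps X" "V' f \<in> lps X"
      using lp_ops_mem[OF VO f] lp_ops_mem[OF lp_ops_op_diff[OF VO V'(1)] f] lp_ops_mem[OF V'(1) f] by auto
    have eq: "op_diff (T \<circ> V) (T' \<circ> V') f = (\<lambda>x. op_diff T T' (V f) x + T' (op_diff V V' f) x)"
      using lp_ops_diff[OF T'(1) m(1) m(3)] by (simp add: op_diff_def)
    have "lp_norm p (op_diff (T \<circ> V) (T' \<circ> V') f) \<le> lp_norm p (op_diff T T' (V f)) + lp_norm p (T' (op_diff V V' f))"
      unfolding eq using lp_norm_add[OF lp_ops_mem[OF lp_ops_op_diff[OF TO T'(1)] m(1)] lp_ops_mem[OF T'(1) m(2)]] .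
    also have "\<dots> \<le> \<eta> * (op_norm p X V * lp_norm p f) + op_norm p X T' * (\<theta> * lp_norm p f)"
    proof (rule add_mono)
      show "lp_norm p (op_diff T T' (V f)) \<le> \<eta> * (op_norm p X V * lp_norm p f)"
        using T'(3)[OF m(1)] mult_left_mono[OF op_norm_bound[OF VO f], of \<eta>] \<eta> by linarith
      show "lp_norm p (T' (op_diff V V' f)) \<le> op_norm p X T' * (\<theta> * lp_norm p f)"
        using op_norm_bound[OF T'(1) m(2)] mult_left_mono[OF V'(3)[OF f] op_norm_nonneg[OF T'(1)]] by linarith
    qed
    also have "\<dots> = (\<eta> * op_norm p X V + op_norm p X T' * \<theta>) * lp_norm p f" by (simp add: algebra_simps)
    also have "\<dots> \<le> (\<epsilon> / 2 + \<epsilon> / 2) * lp_norm p f"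
    proof (intro mult_right_mono add_mono lp_norm_nonneg[OF f])
      show "\<eta> * op_norm p X V \<le> \<epsilon> / 2" "op_norm p X T' * \<theta> \<le> \<epsilon> / 2"
        using e op_norm_nonneg[OF VO] op_norm_nonneg[OF T'(1)] by (simp_all add: \<eta>_def \<theta>_def field_simps)
    qed
    finally show ?thesis by simp
  qed
  then show "\<exists>U R. U \<in> lp_ops sc p X \<and> local_op R U \<and>
      (\<forall>f\<in>lps X. lp_norm p (op_diff (T \<circ> V) U f) \<le> \<epsilon> * lp_norm p f)"
    using lp_ops_comp[OF T'(1) V'(1)] local_op_comp[OF T'(2) V'(2,1)] by blast
qed

lemma ops_A_plus:
  assumes T: "T \<in> ops_A sc p X d" and V: "V \<in> ops_A sc p X d"
  shows "(\<lambda>f x. T f x + V f x) \<in> ops_A sc p X d"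
proof (rule ops_A_I)
  note TO = ops_A_D(1)[OF T] and VO = ops_A_D(1)[OF V]
  show "(\<lambda>f x. T f x + V f x) \<in> lp_ops sc p X" by (rule lp_ops_plus[OF TO VO])
  fix \<epsilon> :: real assume e: "0 < \<epsilon>"
  then have e2: "0 < \<epsilon>/2" by simp
  obtain T' R where T': "T' \<in> lp_ops sc p X" "local_op R T'"
      "\<And>f. f \<in> lps X \<Longrightarrow> lp_norm p (op_diff T T' f) \<le> \<epsilon>/2 * lp_norm p f"
    using ops_A_D(2)[OF T e2] by auto
  obtain V' R' where V': "V' \<in> lp_ops sc p X" "local_op R' V'"
      "\<And>f. f \<in> lps X \<Longrightarrow> lp_norm p (op_diff V V' f) \<le> \<epsilon>/2 * lp_norm p f"
    using ops_A_D(2)[OF V e2] by auto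
  have loc: "local_op (max R R') (\<lambda>f x. T' f x + V' f x)"
    by (intro local_op_plus local_op_mono[OF T'(2)] local_op_mono[OF V'(2)]) auto
  have "lp_norm p (op_diff (\<lambda>f x. T f x + V f x) (\<lambda>f x. T' f x + V' f x) f) \<le> \<epsilon> * lp_norm p f"
    if f: "f \<in> lps X" for f
  proof -
    have eq: "op_diff (\<lambda>f x. T f x + V f x) (\<lambda>f x. T' f x + V' f x) f = (\<lambda>x. op_diff T T' f x + op_diff V V' f x)"
      by (auto simp: op_diff_def)
    show ?thesis unfolding eq
      using lp_norm_add[OF lp_ops_mem[OF lp_ops_op_diff[OF TO T'(1)] f] lp_ops_mem[OF lp_ops_op_diff[OF VO V'(1)] f]]
        T'(3)[OF f] V'(3)[OF f] by simp
  qed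
  then show "\<exists>U R. U \<in> lp_ops sc p X \<and> local_op R U \<and>
      (\<forall>f\<in>lps X. lp_norm p (op_diff (\<lambda>f x. T f x + V f x) U f) \<le> \<epsilon> * lp_norm p f)"
    using lp_ops_plus[OF T'(1) V'(1)] loc by blast
qed

lemma ops_A_mul: "(\<And>x. \<bar>h x\<bar> \<le> C) \<Longrightarrow> mul h \<in> ops_A sc p X d"
  using ops_A_local[OF lp_ops_mul local_op_mul[OF order_refl]] .

lemma ops_A_id: "id \<in> ops_A sc p X d"
  using ops_A_local[OF lp_ops_id local_op_id[OF order_refl]] .

lemma ops_A_scaleR: "T \<in> ops_A sc p X d \<Longrightarrow> (\<lambda>f x. r *\<^sub>R T f x) \<in> ops_A sc p X d"
  using ops_A_comp[OF ops_A_mul[of "\<lambda>_. r" "\<bar>r\<bar>"], of T] by (simp add: comp_def mul_def)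

lemma ops_A_op_diff:
  assumes "T \<in> ops_A sc p X d" "V \<in> ops_A sc p X d"
  shows "op_diff T V \<in> ops_A sc p X d"
  using ops_A_plus[OF assms(1) ops_A_scaleR[OF assms(2), of "-1"]] by (simp add: op_diff_def[abs_def])

lemma ops_A_sum:
  "(\<And>i. i \<in> I \<Longrightarrow> T i \<in> ops_A sc p X d) \<Longrightarrow> (\<lambda>f x. \<Sum>i\<in>I. T i f x) \<in> ops_A sc p X d"
proof (induction I rule: infinite_finite_induct)
  case (insert i I) then show ?case using ops_A_plus[of "T i"] by simp
qed (use ops_A_mul[of "\<lambda>_. 0" 0] in \<open>simp_all add: mul_def[abs_def]\<close>)

lemma ops_A_power: "T \<in> ops_A sc p X d \<Longrightarrow> T ^^ k \<in> ops_A sc p X d"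
proof (induction k)
  case 0 then show ?case using ops_A_id by (simp add: id_def)
next
  case (Suc k) then show ?case using ops_A_comp[of T "T ^^ k"] by (simp add: comp_def)
qed

text \<open>The partial sums of the Neumann series are band-dominated and converge to
  \<open>V\<close> in operator norm.\<close>

lemma ops_A_neumann:
  assumes T: "T \<in> ops_A sc p X d" and small: "\<And>f. f \<in> lps X \<Longrightarrow> lp_norm p (T f) \<le> lp_norm p f / 2"
  shows "\<exists>V\<in>ops_A sc p X d. \<forall>f\<in>lps X. (\<lambda>x. V f x + T (V f) x) = f"
proof -
  obtain V where V: "V \<in> lp_ops sc p X"
    "\<And>f. f \<in> lps X \<Longrightarrow> (\<lambda>x. V f x + T (V f) x) = f"
    "\<And>f n. f \<in> lps X \<Longrightarrow>
       lp_norm p (\<lambda>x. V f x - (\<Sum>k<n. (-1) ^ k *\<^sub>R (T ^^ k) f x)) \<le> 2 * (1/2) ^ n * lp_norm p f"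
    by (rule neumann[OF ops_A_D(1)[OF T] small], assumption) (rule that)
  have "V \<in> ops_A sc p X d"
  proof (rule ops_A_approx[OF V(1)])
    fix \<epsilon> :: real assume e: "0 < \<epsilon>"
    have "(\<lambda>n. 2 * (1/2::real) ^ n) \<longlonglongrightarrow> 2 * 0" by (intro tendsto_intros LIMSEQ_power_zero) auto
    then have "\<forall>\<^sub>F n in sequentially. 2 * (1/2::real) ^ n < \<epsilon>" using e by (intro order_tendstoD) auto
    then obtain n where n: "2 * (1/2::real) ^ n < \<epsilon>" using eventually_sequentially by auto
    let ?W = "\<lambda>f x. \<Sum>k<n. (-1) ^ k *\<^sub>R (T ^^ k) f x"
    have "?W \<in> ops_A sc p X d" by (intro ops_A_sum ops_A_scaleR ops_A_power T)
    moreover have "lp_norm p (op_diff V ?W f) \<le> \<epsilon> * lp_norm p f" if f: "f \<in> lps X" for f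
      using V(3)[OF f, of n] mult_right_mono[OF less_imp_le[OF n] lp_norm_nonneg[OF f]]
      by (simp add: op_diff_def)
    ultimately show "\<exists>W\<in>ops_A sc p X d. \<forall>f\<in>lps X. lp_norm p (op_diff V W f) \<le> \<epsilon> * lp_norm p f" by blast
  qed
  then show ?thesis using V(2) by blast
qed

text \<open>The band approximation vanishes exactly between \<open>F\<close> and the complement of
  its \<open>R\<close>-neighbourhood, so only the remainder contributes. The radius is the same for
  all \<open>F\<close>; this uniformity is what survives the passage to limit operators.\<close>

lemma ops_A_quasilocal:
  assumes A: "A \<in> ops_A sc p X d" and e: "0 < \<epsilon>"
  shows "\<exists>R\<ge>0. \<forall>F f. F \<subseteq> X \<longrightarrow> f \<in> lps X \<longrightarrow>
    lp_norm p (proj F (A (coproj (nbs R F) f))) \<le> \<epsilon> * lp_norm p f \<and>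
    lp_norm p (coproj (nbs R F) (A (proj F f))) \<le> \<epsilon> * lp_norm p f"
proof -
  obtain U R where U: "U \<in> lp_ops sc p X" "0 \<le> R" "local_op R U"
      "\<And>f. f \<in> lps X \<Longrightarrow> lp_norm p (op_diff A U f) \<le> \<epsilon> * lp_norm p f"
    using ops_A_D(2)[OF A e] by auto
  note AO = ops_A_D(1)[OF A]
  have 1: "lp_norm p (proj F (A (coproj (nbs R F) f))) \<le> \<epsilon> * lp_norm p f"
    if F: "F \<subseteq> X" and f: "f \<in> lps X" for F f
  proof -
    have "U (coproj (nbs R F) f) x = 0" if "x \<in> F" for x
    proof -
      have "U (coproj (nbs R F) f) x = U (\<lambda>x. 0) x"
        using that F by (intro local_opD[OF U(3) coproj_in_lp[OF f] lp_space_zero])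
          (auto simp: coproj_apply nbs_mem)
      then show ?thesis by (simp add: lp_ops_zero[OF U(1)])
    qed
    then have "proj F (A (coproj (nbs R F) f)) = proj F (op_diff A U (coproj (nbs R F) f))"
      by (auto simp: proj_def op_diff_def)
    then have "lp_norm p (proj F (A (coproj (nbs R F) f))) \<le> lp_norm p (op_diff A U (coproj (nbs R F) f))"
      using lp_norm_proj[OF lp_ops_mem[OF lp_ops_op_diff[OF AO U(1)] coproj_in_lp[OF f]]] by metis
    also have "\<dots> \<le> \<epsilon> * lp_norm p (coproj (nbs R F) f)" by (rule U(4)[OF coproj_in_lp[OF f]])
    also have "\<dots> \<le> \<epsilon> * lp_norm p f" using e by (intro mult_left_mono lp_norm_coproj[OF f]) auto
    finally show ?thesis .
  qed
  have 2: "lp_norm p (coproj (nbs R F) (A (proj F f))) \<le> \<epsilon> * lp_norm p f"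
    if F: "F \<subseteq> X" and f: "f \<in> lps X" for F f
  proof -
    have "U (proj F f) x = 0" if "x \<notin> nbs R F" for x
    proof (cases "x \<in> X")
      case True
      have "U (proj F f) x = U (\<lambda>x. 0) x"
        using that F True by (intro local_opD[OF U(3) proj_in_lp[OF f] lp_space_zero])
          (auto simp: proj_def nbs_mem commute)
      then show ?thesis by (simp add: lp_ops_zero[OF U(1)])
    qed (use lp_space_supp[OF lp_ops_mem[OF U(1) proj_in_lp[OF f]]] in auto)
    then have "coproj (nbs R F) (A (proj F f)) = coproj (nbs R F) (op_diff A U (proj F f))"
      by (auto simp: coproj_apply op_diff_def)
    then have "lp_norm p (coproj (nbs R F) (A (proj F f))) \<le> lp_norm p (op_diff A U (proj F f))"
      using lp_norm_coproj[OF lp_ops_mem[OF lp_ops_op_diff[OF AO U(1)] proj_in_lp[OF f]]] by metis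
    also have "\<dots> \<le> \<epsilon> * lp_norm p (proj F f)" by (rule U(4)[OF proj_in_lp[OF f]])
    also have "\<dots> \<le> \<epsilon> * lp_norm p f" using e by (intro mult_left_mono lp_norm_proj[OF f]) auto
    finally show ?thesis .
  qed
  show ?thesis using 1 2 U(2) by blast
qed

lemma ops_A_subset_L:
  assumes A: "A \<in> ops_A sc p X d" shows "A \<in> ops_L sc p X"
proof (rule ops_L_I[OF ops_A_D(1)[OF A]])
  fix F' and \<epsilon> :: real assume F': "finite F'" "F' \<subseteq> X" and e: "0 < \<epsilon>"
  obtain R where R: "0 \<le> R" "\<And>F f. F \<subseteq> X \<Longrightarrow> f \<in> lps X \<Longrightarrow>
    lp_norm p (proj F (A (coproj (nbs R F) f))) \<le> \<epsilon> * lp_norm p f \<and>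
    lp_norm p (coproj (nbs R F) (A (proj F f))) \<le> \<epsilon> * lp_norm p f"
    using ops_A_quasilocal[OF A e] by auto
  show "\<exists>F. finite F \<and> F \<subseteq> X \<and>
      (\<forall>f\<in>lps X. lp_norm p (proj F' (A (coproj F f))) \<le> \<epsilon> * lp_norm p f \<and>
         lp_norm p (coproj F (A (proj F' f))) \<le> \<epsilon> * lp_norm p f)"
    using R(2)[OF F'(2)] finite_nbs[OF F'] nbs_sub by (intro exI[of _ "nbs R F'"]) auto
qed

section \<open>Slowly varying functions and commutators\<close>

definition slow :: "real \<Rightarrow> ('a \<Rightarrow> real) \<Rightarrow> bool" where
  "slow L h \<longleftrightarrow> (\<forall>x. 0 \<le> h x \<and> h x \<le> 1) \<and> (\<forall>x\<in>X. \<forall>y\<in>X. \<bar>h x - h y\<bar> \<le> L * d x y)"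

lemma slow_abs: "slow L h \<Longrightarrow> \<bar>h x\<bar> \<le> 1"
  by (simp add: slow_def)

lemma slow_compl: "slow L h \<Longrightarrow> slow L (\<lambda>x. 1 - h x)"
  by (auto simp: slow_def abs_minus_commute)

lemma comm_mem:
  assumes "T \<in> lp_ops sc p X" "\<And>x. \<bar>h x\<bar> \<le> C" "f \<in> lps X"
  shows "comm T h f \<in> lps X"
  unfolding comm_def
  by (intro lp_space_diff mul_lp[OF assms(2)] lp_ops_mem[OF assms(1)] assms(3))

text \<open>After a band operator \<open>U\<close> is split off, its commutator is controlled by the
  variation of \<open>h\<close> over distance \<open>R\<close>, at most \<open>L * R\<close>, while
  the remainder enters twice with \<open>\<epsilon> / 4\<close>. Hence one \<open>L\<close> serves
  all \<open>h\<close>.\<close>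

lemma comm_small:
  assumes A: "A \<in> ops_A sc p X d" and e: "0 < \<epsilon>"
  shows "\<exists>L>0. \<forall>h f. slow L h \<longrightarrow> f \<in> lps X \<longrightarrow> lp_norm p (comm A h f) \<le> \<epsilon> * lp_norm p f"
proof -
  have e4: "0 < \<epsilon>/4" using e by simp
  obtain U R where U: "U \<in> lp_ops sc p X" "0 \<le> R" "local_op R U"
      "\<And>f. f \<in> lps X \<Longrightarrow> lp_norm p (op_diff A U f) \<le> \<epsilon>/4 * lp_norm p f"
    using ops_A_D(2)[OF A e4] by auto
  note AO = ops_A_D(1)[OF A]
  define c where "c = op_norm p X U * R * (real (deg R) * real (deg R))"
  have c: "0 \<le> c" using op_norm_nonneg[OF U(1)] U(2) by (simp add: c_def)
  define L where "L = \<epsilon> / (2 * (c + 1))"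
  have L: "0 < L" "c * L \<le> \<epsilon> / 2" using e c by (auto simp: L_def field_simps)
  have "lp_norm p (comm A h f) \<le> \<epsilon> * lp_norm p f" if h: "slow L h" and f: "f \<in> lps X" for h f
  proof -
    have habs: "\<bar>h x\<bar> \<le> 1" for x using slow_abs[OF h] .
    let ?D = "op_diff A U"
    have DO: "?D \<in> lp_ops sc p X" by (rule lp_ops_op_diff[OF AO U(1)])
    have mf: "mul h f \<in> lps X" by (rule mul_lp[OF habs f])
    have "lp_norm p (comm U h f) \<le> real (deg R) * real (deg R) * (op_norm p X U * (L * R) * lp_norm p f)"
    proof (rule lp_norm_le, rule nb_average)
      show "lp_le (\<lambda>y. (op_norm p X U * (L * R)) *\<^sub>R f y) (op_norm p X U * (L * R) * lp_norm p f)"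
        using L(1) U(2) op_norm_nonneg[OF U(1)] by (intro lp_le_scale[OF lp_le_norm[OF f]]) auto
      fix x assume x: "x \<in> X"
      have "norm (comm U h f x) \<le> op_norm p X U * (\<Sum>y\<in>nb R x. \<bar>h y - h x\<bar> * norm (f y))"
        by (rule comm_point[OF U(1,3) f x habs])
      also have "\<dots> \<le> op_norm p X U * (\<Sum>y\<in>nb R x. (L * R) * norm (f y))"
      proof (intro mult_left_mono sum_mono mult_right_mono op_norm_nonneg[OF U(1)])
        fix y assume y: "y \<in> nb R x"
        then have "\<bar>h y - h x\<bar> \<le> L * d y x" using h x by (auto simp: slow_def nb_def)
        also have "\<dots> \<le> L * R" using y L(1) by (intro mult_left_mono) (auto simp: nb_def commute)
        finally show "\<bar>h y - h x\<bar> \<le> L * R" .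
      qed auto
      also have "\<dots> = (\<Sum>y\<in>nb R x. norm ((op_norm p X U * (L * R)) *\<^sub>R f y))"
        using L(1) U(2) op_norm_nonneg[OF U(1)] by (simp add: sum_distrib_left abs_mult mult.assoc)
      finally show "norm (comm U h f x) \<le> (\<Sum>y\<in>nb R x. norm ((op_norm p X U * (L * R)) *\<^sub>R f y))" .
    qed (use lp_space_supp[OF comm_mem[OF U(1) habs f]] in auto)
    also have "\<dots> = (c * L) * lp_norm p f" by (simp add: c_def algebra_simps)
    also have "\<dots> \<le> \<epsilon> / 2 * lp_norm p f" by (intro mult_right_mono L(2) lp_norm_nonneg[OF f])
    finally have 1: "lp_norm p (comm U h f) \<le> \<epsilon> / 2 * lp_norm p f" .
    have "lp_norm p (comm ?D h f) \<le> lp_norm p (?D (mul h f)) + lp_norm p (mul h (?D f))"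
      unfolding comm_def by (rule lp_norm_diff[OF lp_ops_mem[OF DO mf] mul_lp[OF habs lp_ops_mem[OF DO f]]])
    also have "\<dots> \<le> \<epsilon>/4 * lp_norm p (mul h f) + 1 * lp_norm p (?D f)"
      by (intro add_mono U(4)[OF mf] norm_mul[OF habs lp_ops_mem[OF DO f]])
    also have "\<dots> \<le> \<epsilon>/4 * (1 * lp_norm p f) + 1 * (\<epsilon>/4 * lp_norm p f)"
      using e U(4)[OF f] norm_mul[OF habs f] by (intro add_mono mult_left_mono) auto
    finally have 2: "lp_norm p (comm ?D h f) \<le> \<epsilon> / 2 * lp_norm p f" by simp
    have "comm A h f = (\<lambda>x. comm U h f x + comm ?D h f x)"
      by (simp add: comm_def op_diff_def mul_def algebra_simps)
    then show ?thesis
      using lp_norm_add[OF comm_mem[of U h, OF U(1) habs f] comm_mem[of ?D h, OF DO habs f]] 1 2 by simp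
  qed
  then show ?thesis using L(1) by blast
qed

text \<open>A trapezoid: 1 on the ball of radius \<open>\<rho>\<close> about \<open>c\<close>, then
  falling with slope \<open>L\<close>, and 0 beyond radius \<open>\<rho> + 1 / L\<close>.\<close>

definition cutoff :: "'a \<Rightarrow> real \<Rightarrow> real \<Rightarrow> 'a \<Rightarrow> real" where
  "cutoff c \<rho> L y = max 0 (min 1 (1 + L * \<rho> - L * d c y))"

lemma slow_cutoff:
  assumes "c \<in> X" "0 < L" shows "slow L (cutoff c \<rho> L)"
proof -
  have "\<bar>cutoff c \<rho> L x - cutoff c \<rho> L y\<bar> \<le> L * d x y" if "x \<in> X" "y \<in> X" for x y
  proof -
    have "\<bar>cutoff c \<rho> L x - cutoff c \<rho> L y\<bar> \<le> \<bar>L * d c x - L * d c y\<bar>"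
      unfolding cutoff_def by linarith
    also have "\<dots> = L * \<bar>d c x - d c y\<bar>" using assms(2) by (simp add: right_diff_distrib[symmetric] abs_mult)
    also have "\<dots> \<le> L * d x y"
      using assms that triangle[of c x y] triangle[of c y x] by (intro mult_left_mono) (auto simp: commute)
    finally show ?thesis .
  qed
  then show ?thesis by (auto simp: slow_def cutoff_def)
qed

lemma cutoff_one: "0 < L \<Longrightarrow> d c y \<le> \<rho> \<Longrightarrow> cutoff c \<rho> L y = 1"
  using mult_left_mono[of "d c y" \<rho> L] by (simp add: cutoff_def)

lemma cutoff_zero: "0 < L \<Longrightarrow> \<rho> + 1 / L < d c y \<Longrightarrow> cutoff c \<rho> L y = 0"
  using mult_strict_left_mono[of "\<rho> + 1 / L" "d c y" L] by (simp add: cutoff_def distrib_left)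

end

section \<open>Partitions of unity from Property A\<close>

lemma infsum_finite_support:
  fixes f :: "'i \<Rightarrow> real"
  assumes "finite F" "\<And>i. i \<notin> F \<Longrightarrow> f i = 0"
  shows "infsum f UNIV = sum f F"
  using infsum_cong_neutral[of F UNIV f f] assms by auto

text \<open>A substitute for the Hoelder inequality in passing from the exponent \<open>q\<close> to \<open>1\<close>: either \<open>a\<close> and \<open>b\<close>
  are close relative to their size, or their difference controls both.\<close>

lemma powr_diff_threshold:
  fixes a b q \<kappa> :: real
  assumes "0 \<le> a" "0 \<le> b" "1 \<le> q" "0 < \<kappa>" "\<kappa> < 1"
  defines "\<eta> \<equiv> 1 - (1 - \<kappa>) powr (1 / q)"
  shows "\<bar>a powr q - b powr q\<bar> \<le> \<kappa> * (a powr q + b powr q) + \<bar>a - b\<bar> powr q / \<eta> powr q"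
proof -
  have \<eta>: "0 < \<eta>"
    using assms powr_less_mono2[of "1 / q" "1 - \<kappa>" 1] by (simp add: \<eta>_def)
  \<comment> \<open>\<open>\<eta>\<close> is chosen for this identity: if
    \<open>a - b \<le> \<eta> * a\<close>, then \<open>b\<close> is at least
    \<open>(1 - \<eta>) * a\<close>, and the powers differ by at most the fraction
    \<open>\<kappa>\<close>.\<close>
  have 1: "(1 - \<eta>) powr q = 1 - \<kappa>" using assms by (simp add: \<eta>_def powr_powr)
  have *: "a powr q - b powr q \<le> \<kappa> * a powr q + (a - b) powr q / \<eta> powr q"
    if "0 \<le> b" "b \<le> a" for a b
  proof (cases "a - b \<le> \<eta> * a")
    case True
    have "(1 - \<kappa>) * a powr q = ((1 - \<eta>) * a) powr q"
      using that \<eta> assms(3-5) by (simp add: powr_mult 1)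
    also have "\<dots> \<le> b powr q"
      using True that assms by (intro powr_mono2) (auto simp: algebra_simps \<eta>_def)
    finally have "a powr q - b powr q \<le> \<kappa> * a powr q" by (simp add: algebra_simps)
    moreover have "0 \<le> (a - b) powr q / \<eta> powr q" by simp
    ultimately show ?thesis by linarith
  next
    case False
    have "\<eta> powr q * a powr q = (\<eta> * a) powr q" using \<eta> that by (simp add: powr_mult)
    also have "\<dots> \<le> (a - b) powr q" using False \<eta> that assms(3) by (intro powr_mono2) auto
    finally have "a powr q \<le> (a - b) powr q / \<eta> powr q" using \<eta> by (simp add: field_simps)
    moreover have "0 \<le> \<kappa> * a powr q" "0 \<le> b powr q" using assms(4) by auto
    ultimately show ?thesis by linarith
  qed
  show ?thesis
  proof (cases "b \<le> a")
    case True
    have "0 \<le> \<kappa> * b powr q" using assms(4) by simp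
    then show ?thesis using *[OF assms(2) True] True powr_mono2[of q b a] assms(2,3)
      by (simp add: distrib_left)
  next
    case False
    have "0 \<le> \<kappa> * a powr q" using assms(4) by simp
    then show ?thesis using *[OF assms(1), of b] False powr_mono2[of q a b] assms(1,3)
      by (simp add: distrib_left abs_minus_commute)
  qed
qed

text \<open>After division by \<open>b + c\<close> both quotients lie in the unit interval, where a
  number is at most its power with exponent \<open>s \<le> 1\<close>.\<close>

lemma powr_subadd:
  fixes b c s :: real
  assumes "0 \<le> b" "0 \<le> c" "0 < s" "s \<le> 1"
  shows "(b + c) powr s \<le> b powr s + c powr s"
proof (cases "b + c = 0")
  case False
  then have pos: "0 < b + c" using assms by linarith
  have le: "x / (b + c) \<le> x powr s / (b + c) powr s" if "0 \<le> x" "x \<le> b + c" for x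
  proof (cases "x = 0")
    case False
    then have "0 < x / (b + c)" "x / (b + c) \<le> 1" using that pos by auto
    then have "(x / (b + c)) powr 1 \<le> (x / (b + c)) powr s"
      using assms by (intro powr_mono') auto
    then show ?thesis using that pos by (simp add: powr_divide)
  qed simp
  have "b / (b + c) + c / (b + c) \<le> b powr s / (b + c) powr s + c powr s / (b + c) powr s"
    using assms by (intro add_mono le) auto
  then have "1 \<le> (b powr s + c powr s) / (b + c) powr s"
    using pos by (simp add: add_divide_distrib[symmetric])
  then show ?thesis using pos by (simp add: field_simps)
qed (use assms in auto)

text \<open>Hoelder continuity of the root. It converts the variation of a partition of unity in
  exponent 1 into that of its powers in exponent \<open>1 / s\<close>.\<close>

lemma powr_root_diff:
  fixes a b s :: real
  assumes "0 \<le> a" "0 \<le> b" "0 < s" "s \<le> 1"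
  shows "\<bar>a powr s - b powr s\<bar> powr (1 / s) \<le> \<bar>a - b\<bar>"
proof -
  have *: "\<bar>a powr s - b powr s\<bar> \<le> \<bar>a - b\<bar> powr s"
  proof (cases "b \<le> a")
    case True
    then show ?thesis using powr_subadd[of b "a - b" s] powr_mono2[of s b a] assms by auto
  next
    case False
    then show ?thesis using powr_subadd[of a "b - a" s] powr_mono2[of s a b] assms by auto
  qed
  have "\<bar>a powr s - b powr s\<bar> powr (1 / s) \<le> (\<bar>a - b\<bar> powr s) powr (1 / s)"
    using * assms by (intro powr_mono2) auto
  then show ?thesis using assms by (simp add: powr_powr)
qed

context lp_exponent
begin

text \<open>Hoelder's inequality up to a factor 2, with \<open>1 / (1 - 1 / P)\<close> the exponent
  conjugate to \<open>P\<close>. Young's inequality is applied to each product after division by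
  \<open>t\<close> and \<open>M\<close>; the 2 arises because the factors \<open>1 / P\<close> and
  \<open>1 / q\<close> are dropped.\<close>

lemma sum_weighted_le:
  assumes st: "\<not> sup_type" and P1: "1 < P" and t: "0 < t" and u: "\<And>i. i \<in> I \<Longrightarrow> 0 \<le> u i"
    and I: "finite I" and su: "(\<Sum>i\<in>I. u i powr (1 / (1 - 1 / P))) \<le> t powr (1 / (1 - 1 / P))"
    and a: "lp_le a M"
  shows "(\<Sum>i\<in>I. u i * norm (a i)) \<le> 2 * t * M"
proof (cases "M = 0")
  case True
  then have "norm (a i) = 0" for i using lp_le_point[OF a, of i] by simp
  then show ?thesis using True by simp
next
  case False
  then have M: "0 < M" using lp_le_nonneg[OF a] by simp
  define q where "q = 1 / (1 - 1 / P)"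
  have q: "1 < q" "1 / P + 1 / q = 1" using P1 by (auto simp: q_def)
  have young: "x * y \<le> x powr q + y powr P" if "0 \<le> x" "0 \<le> y" for x y
  proof -
    have "y * x \<le> y powr P / P + x powr q / q" using Youngs_inequality[OF P1 q that(2,1)] .
    also have "\<dots> \<le> y powr P + x powr q"
    proof (intro add_mono)
      show "y powr P / P \<le> y powr P" using P1 mult_left_mono[of 1 P "y powr P"] by (simp add: field_simps)
      show "x powr q / q \<le> x powr q" using q(1) mult_left_mono[of 1 q "x powr q"] by (simp add: field_simps)
    qed
    finally show ?thesis by (simp add: mult.commute add.commute)
  qed
  have "(\<Sum>i\<in>I. u i * norm (a i)) = (\<Sum>i\<in>I. t * M * ((u i / t) * (norm (a i) / M)))"
    using t M by simp
  also have "\<dots> \<le> (\<Sum>i\<in>I. t * M * ((u i / t) powr q + (norm (a i) / M) powr P))"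
    using t M u by (intro sum_mono mult_left_mono young) auto
  also have "\<dots> = t * M * ((\<Sum>i\<in>I. u i powr q) / t powr q + (\<Sum>i\<in>I. norm (a i) powr P) / M powr P)"
    using t M u by (simp add: sum_distrib_left[symmetric] sum.distrib sum_divide_distrib powr_divide cong: sum.cong)
  also have "\<dots> \<le> t * M * (1 + 1)"
    using t M su a I st unfolding lp_le_def q_def
    by (intro mult_left_mono add_mono) auto
  finally show ?thesis by (simp add: algebra_simps)
qed

end

context bg_space
begin

text \<open>Property A in exponent 1. Bounding the variation over arbitrary finite index sets avoids
  infinite sums, and letting \<open>\<psi>\<close> vanish off \<open>X\<close> makes the bounds hold
  on the whole type.\<close>

definition unit_partition :: "real \<Rightarrow> real \<Rightarrow> (nat \<Rightarrow> 'a \<Rightarrow> real) \<Rightarrow> real \<Rightarrow> bool" where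
  "unit_partition r \<epsilon> \<psi> D \<longleftrightarrow> (\<forall>i x. 0 \<le> \<psi> i x) \<and> (\<forall>x. finite {i. \<psi> i x \<noteq> 0}) \<and>
     (\<forall>i x. x \<notin> X \<longrightarrow> \<psi> i x = 0) \<and>
     (\<forall>i. \<forall>x\<in>X. \<forall>y\<in>X. \<psi> i x \<noteq> 0 \<and> \<psi> i y \<noteq> 0 \<longrightarrow> d x y \<le> D) \<and>
     (\<forall>x\<in>X. (\<Sum>i | \<psi> i x \<noteq> 0. \<psi> i x) = 1) \<and>
     (\<forall>x\<in>X. \<forall>y\<in>X. \<forall>I. d x y \<le> r \<longrightarrow> finite I \<longrightarrow> (\<Sum>i\<in>I. \<bar>\<psi> i x - \<psi> i y\<bar>) \<le> \<epsilon>)"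

lemma unit_partitionD:
  assumes "unit_partition r \<epsilon> \<psi> D"
  shows "0 \<le> \<psi> i x" "finite {i. \<psi> i x \<noteq> 0}" "x \<notin> X \<Longrightarrow> \<psi> i x = 0"
    "x \<in> X \<Longrightarrow> y \<in> X \<Longrightarrow> \<psi> i x \<noteq> 0 \<Longrightarrow> \<psi> i y \<noteq> 0 \<Longrightarrow> d x y \<le> D"
    "x \<in> X \<Longrightarrow> (\<Sum>i | \<psi> i x \<noteq> 0. \<psi> i x) = 1"
    "x \<in> X \<Longrightarrow> y \<in> X \<Longrightarrow> d x y \<le> r \<Longrightarrow> finite I \<Longrightarrow> (\<Sum>i\<in>I. \<bar>\<psi> i x - \<psi> i y\<bar>) \<le> \<epsilon>"
    "finite I \<Longrightarrow> (\<Sum>i\<in>I. \<psi> i x) \<le> 1" "\<psi> i x \<le> 1"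
proof -
  show \<psi>0: "\<And>i x. 0 \<le> \<psi> i x" and \<psi>fin: "\<And>x. finite {i. \<psi> i x \<noteq> 0}"
    and \<psi>X: "\<And>x i. x \<notin> X \<Longrightarrow> \<psi> i x = 0"
    and \<psi>1: "\<And>x. x \<in> X \<Longrightarrow> (\<Sum>i | \<psi> i x \<noteq> 0. \<psi> i x) = 1"
    and "x \<in> X \<Longrightarrow> y \<in> X \<Longrightarrow> \<psi> i x \<noteq> 0 \<Longrightarrow> \<psi> i y \<noteq> 0 \<Longrightarrow> d x y \<le> D"
    and "x \<in> X \<Longrightarrow> y \<in> X \<Longrightarrow> d x y \<le> r \<Longrightarrow> finite I \<Longrightarrow> (\<Sum>i\<in>I. \<bar>\<psi> i x - \<psi> i y\<bar>) \<le> \<epsilon>"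
    using assms unfolding unit_partition_def by blast+
  show \<psi>sum: "(\<Sum>i\<in>I. \<psi> i x) \<le> 1" if "finite I" for I x
  proof (cases "x \<in> X")
    case True
    have "(\<Sum>i\<in>I. \<psi> i x) \<le> (\<Sum>i\<in>I \<union> {i. \<psi> i x \<noteq> 0}. \<psi> i x)"
      using \<psi>fin[of x] \<psi>0 that by (intro sum_mono2) auto
    also have "\<dots> = (\<Sum>i | \<psi> i x \<noteq> 0. \<psi> i x)"
      using \<psi>fin[of x] that by (intro sum.mono_neutral_right) auto
    finally show ?thesis using \<psi>1[OF True] by simp
  qed (simp add: \<psi>X)
  show "\<psi> i x \<le> 1" using \<psi>sum[of "{i}" x] by simp
qed

lemma property_A_partition:
  assumes q: "1 \<le> q" and A: "property_A q X d" and r: "0 < r" and e: "0 < \<epsilon>"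
  shows "\<exists>\<psi> D. unit_partition r \<epsilon> \<psi> D"
proof -
  \<comment> \<open>In \<open>powr_diff_threshold\<close> the first term then sums to at most
    \<open>2 * \<kappa> \<le> \<epsilon> / 2\<close>, and \<open>\<delta>\<close> below is chosen so
    that the second sums to at most \<open>\<epsilon> / 2\<close>.\<close>
  define \<kappa> where "\<kappa> = min (\<epsilon> / 4) (1 / 2)"
  define \<eta> where "\<eta> = 1 - (1 - \<kappa>) powr (1 / q)"
  have \<kappa>: "0 < \<kappa>" "\<kappa> < 1" "\<kappa> \<le> \<epsilon> / 4" using e by (auto simp: \<kappa>_def)
  have \<eta>: "0 < \<eta>" using \<kappa> q powr_less_mono2[of "1 / q" "1 - \<kappa>" 1] by (simp add: \<eta>_def)
  define \<delta> where "\<delta> = \<eta> * (\<epsilon> / 2) powr (1 / q)"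
  have \<delta>: "0 < \<delta>" using \<eta> e by (simp add: \<delta>_def)
  have \<delta>q: "\<delta> powr q = \<eta> powr q * (\<epsilon> / 2)" using \<eta> e q by (simp add: \<delta>_def powr_mult powr_powr)
  obtain \<phi> where \<phi>: "metric_partition_of_unity q X d \<phi>" "has_variation q X d r \<delta> \<phi>"
    using A r \<delta> unfolding property_A_def by blast
  have \<phi>1: "0 \<le> \<phi> i x" if "x \<in> X" for i x
    using \<phi>(1) that unfolding metric_partition_of_unity_def by blast
  have \<phi>2: "finite {i. \<phi> i x \<noteq> 0}" if "x \<in> X" for x
    using \<phi>(1) that unfolding metric_partition_of_unity_def by blast
  obtain D where \<phi>3: "\<And>i x y. x \<in> X \<Longrightarrow> y \<in> X \<Longrightarrow> \<phi> i x \<noteq> 0 \<Longrightarrow> \<phi> i y \<noteq> 0 \<Longrightarrow> d x y \<le> D"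
    using \<phi>(1) unfolding metric_partition_of_unity_def by blast
  have \<phi>4: "(\<Sum>i | \<phi> i x \<noteq> 0. \<phi> i x powr q) = 1" if "x \<in> X" for x
  proof -
    have "(\<Sum>\<^sub>\<infinity>i. \<phi> i x powr q) = 1"
      using \<phi>(1) that unfolding metric_partition_of_unity_def by blast
    then show ?thesis
      using infsum_finite_support[OF \<phi>2[OF that], of "\<lambda>i. \<phi> i x powr q"] by simp
  qed
  have \<phi>5: "(\<Sum>i\<in>I. \<bar>\<phi> i x - \<phi> i y\<bar> powr q) \<le> \<delta> powr q"
    if "x \<in> X" "y \<in> X" "d x y \<le> r" "finite I" for x y I
  proof -
    let ?F = "{i. \<phi> i x \<noteq> 0} \<union> {i. \<phi> i y \<noteq> 0}"
    have F: "finite ?F" using \<phi>2 that by simp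
    have "(\<Sum>i\<in>I. \<bar>\<phi> i x - \<phi> i y\<bar> powr q) \<le> (\<Sum>i\<in>I \<union> ?F. \<bar>\<phi> i x - \<phi> i y\<bar> powr q)"
      using F that(4) by (intro sum_mono2) auto
    also have "\<dots> = (\<Sum>i\<in>?F. \<bar>\<phi> i x - \<phi> i y\<bar> powr q)"
      using F that(4) by (intro sum.mono_neutral_right) auto
    also have "\<dots> = (\<Sum>\<^sub>\<infinity>i. \<bar>\<phi> i x - \<phi> i y\<bar> powr q)"
      by (rule infsum_finite_support[OF F, symmetric]) auto
    also have "\<dots> < \<delta> powr q" using \<phi>(2) that unfolding has_variation_def by blast
    finally show ?thesis by simp
  qed
  have \<phi>6: "(\<Sum>i\<in>I. \<phi> i x powr q) \<le> 1" if "x \<in> X" "finite I" for x I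
  proof -
    have "(\<Sum>i\<in>I. \<phi> i x powr q) \<le> (\<Sum>i\<in>I \<union> {i. \<phi> i x \<noteq> 0}. \<phi> i x powr q)"
      using \<phi>2[OF that(1)] that(2) by (intro sum_mono2) auto
    also have "\<dots> = (\<Sum>i | \<phi> i x \<noteq> 0. \<phi> i x powr q)"
      using \<phi>2[OF that(1)] that(2) by (intro sum.mono_neutral_right) auto
    finally show ?thesis using \<phi>4[OF that(1)] by simp
  qed
  define \<psi> where "\<psi> i x = (if x \<in> X then \<phi> i x powr q else 0)" for i x
  have supp: "\<psi> i x \<noteq> 0 \<longleftrightarrow> x \<in> X \<and> \<phi> i x \<noteq> 0" for i x by (simp add: \<psi>_def)
  have var: "(\<Sum>i\<in>I. \<bar>\<psi> i x - \<psi> i y\<bar>) \<le> \<epsilon>" if xy: "x \<in> X" "y \<in> X" "d x y \<le> r" and I: "finite I" for x y I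
  proof -
    have "(\<Sum>i\<in>I. \<bar>\<psi> i x - \<psi> i y\<bar>) \<le>
      (\<Sum>i\<in>I. \<kappa> * (\<phi> i x powr q + \<phi> i y powr q) + \<bar>\<phi> i x - \<phi> i y\<bar> powr q / \<eta> powr q)"
      using powr_diff_threshold[OF \<phi>1[OF xy(1)] \<phi>1[OF xy(2)] q \<kappa>(1,2)] xy
      by (intro sum_mono) (simp add: \<psi>_def \<eta>_def)
    also have "\<dots> = \<kappa> * ((\<Sum>i\<in>I. \<phi> i x powr q) + (\<Sum>i\<in>I. \<phi> i y powr q))
        + (\<Sum>i\<in>I. \<bar>\<phi> i x - \<phi> i y\<bar> powr q) / \<eta> powr q"
      by (simp add: sum.distrib sum_distrib_left sum_divide_distrib distrib_left)
    also have "\<dots> \<le> \<kappa> * (1 + 1) + \<delta> powr q / \<eta> powr q"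
      using \<kappa>(1) \<phi>6[OF xy(1) I] \<phi>6[OF xy(2) I] \<phi>5[OF xy I]
      by (intro add_mono mult_left_mono divide_right_mono) auto
    also have "\<dots> \<le> \<epsilon>" using \<kappa>(3) \<eta> by (simp add: \<delta>q)
    finally show ?thesis .
  qed
  have sum1: "(\<Sum>i | \<psi> i x \<noteq> 0. \<psi> i x) = 1" if "x \<in> X" for x
    using \<phi>4[OF that] that by (simp add: supp) (simp add: \<psi>_def)
  have fin: "finite {i. \<psi> i x \<noteq> 0}" for x
    using \<phi>2[of x] by (cases "x \<in> X") (simp_all add: supp)
  show ?thesis
    unfolding unit_partition_def
  proof (intro exI[of _ \<psi>] exI[of _ D] conjI allI ballI impI)
    fix i x y assume "x \<in> X" "y \<in> X" "\<psi> i x \<noteq> 0 \<and> \<psi> i y \<noteq> 0"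
    then show "d x y \<le> D" using \<phi>3[of x y i] by (simp add: supp)
  qed (use var sum1 fin in \<open>auto simp: \<psi>_def\<close>)
qed

text \<open>Multiplication by the row \<open>\<mu>\<close> has to map p-summable sequences boundedly
  to \<open>E\<close>, and multiplication by the column \<open>\<rho>\<close> has to map back. The
  two sum conditions on \<open>\<mu>\<close> test this against every sequence, which treats all
  \<open>p\<close> alike without naming the conjugate exponent; the factor 2 is that of
  \<open>sum_weighted_le\<close>.\<close>

definition weights :: "real \<Rightarrow> real \<Rightarrow> (nat \<Rightarrow> 'a \<Rightarrow> real) \<Rightarrow> (nat \<Rightarrow> 'a \<Rightarrow> real) \<Rightarrow> real \<Rightarrow> bool" where
  "weights R \<epsilon> \<mu> \<rho> D \<longleftrightarrow>
     (\<forall>i x. 0 \<le> \<mu> i x \<and> \<mu> i x \<le> 1 \<and> 0 \<le> \<rho> i x \<and> \<rho> i x \<le> 1) \<and>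
     (\<forall>i x. x \<notin> X \<longrightarrow> \<mu> i x = 0 \<and> \<rho> i x = 0) \<and>
     (\<forall>x. finite {i. \<mu> i x \<noteq> 0}) \<and>
     (\<forall>x (a::nat \<Rightarrow> 'e) M I. finite I \<longrightarrow> lp_le a M \<longrightarrow> (\<Sum>i\<in>I. \<mu> i x * norm (a i)) \<le> 2 * M) \<and>
     (\<forall>x\<in>X. \<forall>y\<in>X. \<forall>(a::nat \<Rightarrow> 'e) M I. d x y \<le> R \<longrightarrow> finite I \<longrightarrow> lp_le a M \<longrightarrow>
        (\<Sum>i\<in>I. \<bar>\<mu> i y - \<mu> i x\<bar> * norm (a i)) \<le> \<epsilon> * M) \<and>
     (\<forall>x. lp_le (\<lambda>i. \<rho> i x) 1) \<and>
     (\<forall>x\<in>X. (\<Sum>i | \<mu> i x \<noteq> 0. \<mu> i x * \<rho> i x) = 1) \<and>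
     (\<forall>i. \<forall>x\<in>X. \<forall>y\<in>X. (\<mu> i x \<noteq> 0 \<or> \<rho> i x \<noteq> 0) \<and> (\<mu> i y \<noteq> 0 \<or> \<rho> i y \<noteq> 0) \<longrightarrow> d x y \<le> D)"

text \<open>The weights \<open>\<mu>\<close> are multiplied on the left of a family of local operators and \<open>\<rho>\<close> on the right. For
  \<open>1 < p < \<infinity>\<close> they have to be split as \<open>\<psi>\<^sup>1\<^sup>-\<^sup>1\<^sup>/\<^sup>p\<close> and \<open>\<psi>\<^sup>1\<^sup>/\<^sup>p\<close>; for \<open>p = 1\<close> the left weight is instead a slowly
  varying function that is \<open>1\<close> on the support of \<open>\<psi>\<close>.\<close>

lemma weights_exist:
  assumes q: "1 \<le> q" and A: "property_A q X d" and R: "0 < R" and e: "0 < \<epsilon>"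
  shows "\<exists>\<mu> \<rho> D. weights R \<epsilon> \<mu> \<rho> D"
proof -
  \<comment> \<open>For \<open>P > 1\<close> the left weights are powers of \<open>\<psi>\<close>
    whose variation is measured in the exponent conjugate to \<open>P\<close>, hence the outer
    power; the half anticipates the factor 2 in \<open>sum_weighted_le\<close>.\<close>
  define \<delta> where "\<delta> = (if sup_type \<or> P \<le> 1 then \<epsilon> else (\<epsilon> / 2) powr (1 / (1 - 1 / P)))"
  have \<delta>: "0 < \<delta>" using e by (simp add: \<delta>_def)
  obtain \<psi> D where \<psi>: "unit_partition R (\<delta>) \<psi> D"
    using property_A_partition[OF q A R \<delta>] by blast
  note \<psi>0 = unit_partitionD(1)[OF \<psi>] and \<psi>fin = unit_partitionD(2)[OF \<psi>] and \<psi>X = unit_partitionD(3)[OF \<psi>]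
    and \<psi>D = unit_partitionD(4)[OF \<psi>] and \<psi>1 = unit_partitionD(5)[OF \<psi>] and \<psi>var = unit_partitionD(6)[OF \<psi>]
    and \<psi>sum = unit_partitionD(7)[OF \<psi>] and \<psi>le = unit_partitionD(8)[OF \<psi>]
  consider (sup) sup_type | (one) "\<not> sup_type" "P = 1" | (gt) "\<not> sup_type" "1 < P"
    using P_ge1 by fastforce
  then show ?thesis
  proof cases
    case sup
    \<comment> \<open>For sup norms the row \<open>\<psi>\<close> acts with norm at most 1, so the
      right weight can be the indicator of its support.\<close>
    define \<rho> where "\<rho> i x = (if \<psi> i x = 0 then 0 else 1::real)" for i x
    have "weights R \<epsilon> \<psi> \<rho> D"
      unfolding weights_def
    proof (intro conjI allI ballI impI)
      fix x M and I :: "nat set" and a :: "nat \<Rightarrow> 'e" assume I: "finite I" and a: "lp_le a M"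
      have "(\<Sum>i\<in>I. \<psi> i x * norm (a i)) \<le> (\<Sum>i\<in>I. \<psi> i x * M)"
        using lp_le_point[OF a] \<psi>0 by (intro sum_mono mult_left_mono) auto
      also have "\<dots> \<le> 1 * M"
        unfolding sum_distrib_right[symmetric] using \<psi>sum[OF I] lp_le_nonneg[OF a] by (intro mult_right_mono)
      finally show "(\<Sum>i\<in>I. \<psi> i x * norm (a i)) \<le> 2 * M" using lp_le_nonneg[OF a] by simp
    next
      fix x y M and I :: "nat set" and a :: "nat \<Rightarrow> 'e" assume xy: "x \<in> X" "y \<in> X" "d x y \<le> R" and I: "finite I" and a: "lp_le a M"
      have "(\<Sum>i\<in>I. \<bar>\<psi> i y - \<psi> i x\<bar> * norm (a i)) \<le> (\<Sum>i\<in>I. \<bar>\<psi> i y - \<psi> i x\<bar> * M)"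
        using lp_le_point[OF a] by (intro sum_mono mult_left_mono) auto
      also have "\<dots> \<le> \<epsilon> * M"
        unfolding sum_distrib_right[symmetric]
        using \<psi>var[OF xy(2,1) _ I] xy(3) sup lp_le_nonneg[OF a]
        by (intro mult_right_mono) (auto simp: \<delta>_def commute)
      finally show "(\<Sum>i\<in>I. \<bar>\<psi> i y - \<psi> i x\<bar> * norm (a i)) \<le> \<epsilon> * M" .
    next
      fix x show "lp_le (\<lambda>i. \<rho> i x) 1" using sup by (auto simp: lp_le_def \<rho>_def)
    next
      fix x assume x: "x \<in> X"
      have "\<psi> i x * \<rho> i x = \<psi> i x" for i by (simp add: \<rho>_def)
      then show "(\<Sum>i | \<psi> i x \<noteq> 0. \<psi> i x * \<rho> i x) = 1" using \<psi>1[OF x] by (simp only:)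
    next
      fix i x y assume "x \<in> X" "y \<in> X" "(\<psi> i x \<noteq> 0 \<or> \<rho> i x \<noteq> 0) \<and> (\<psi> i y \<noteq> 0 \<or> \<rho> i y \<noteq> 0)"
      then show "d x y \<le> D" using \<psi>D[of x y i] by (auto simp: \<rho>_def split: if_splits)
    qed (use \<psi>0 \<psi>le \<psi>fin \<psi>X in \<open>auto simp: \<rho>_def\<close>)
    then show ?thesis by blast
  next
    case one
    \<comment> \<open>This slope bounds the change of each cutoff over distance \<open>R\<close> by
      \<open>\<epsilon>\<close>; for \<open>P = 1\<close> such a bound, uniform in \<open>i\<close>,
      is the dual condition.\<close>
    define L where "L = \<epsilon> / R"
    have L: "0 < L" using e R by (simp add: L_def)
    define c where "c i = (SOME x. \<psi> i x \<noteq> 0)" for i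
    have c: "\<psi> i (c i) \<noteq> 0" "c i \<in> X" if "\<psi> i x \<noteq> 0" for i x
    proof -
      show "\<psi> i (c i) \<noteq> 0" unfolding c_def using that by (rule someI)
      then show "c i \<in> X" using \<psi>X by blast
    qed
    define \<mu> where "\<mu> i x = (if x \<in> X \<and> (\<exists>z. \<psi> i z \<noteq> 0) then cutoff (c i) D L x else 0)" for i x
    have \<mu>01: "0 \<le> \<mu> i x" "\<mu> i x \<le> 1" for i x by (auto simp: \<mu>_def cutoff_def)
    have \<mu>1: "\<mu> i x = 1" if "\<psi> i x \<noteq> 0" for i x
      using that \<psi>X[of x i] cutoff_one[OF L, of "c i" x D] \<psi>D[OF c(2)[OF that], of x] c[OF that]
      by (auto simp: \<mu>_def)
    have \<mu>D: "d (c i) x \<le> D + 1 / L \<and> c i \<in> X \<and> x \<in> X \<and> \<psi> i (c i) \<noteq> 0" if "\<mu> i x \<noteq> 0" for i x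
      using that cutoff_zero[OF L, of D "c i" x] c by (force simp: \<mu>_def split: if_splits)
    have fin: "finite {i. \<mu> i x \<noteq> 0}" for x
    proof (cases "x \<in> X")
      case True
      \<comment> \<open>The cutoffs overlap more than the supports of \<open>\<psi>\<close>, but
        finiteness survives: if the cutoff of \<open>i\<close> reaches \<open>x\<close>, its centre
        lies in a ball about \<open>x\<close>, and \<open>\<psi> i\<close> is nonzero at that
        centre.\<close>
      have "{i. \<mu> i x \<noteq> 0} \<subseteq> (\<Union>y\<in>nb (D + 1 / L) x. {i. \<psi> i y \<noteq> 0})"
      proof
        fix i assume "i \<in> {i. \<mu> i x \<noteq> 0}"
        then have "c i \<in> nb (D + 1 / L) x" "\<psi> i (c i) \<noteq> 0"
          using \<mu>D[of i x] by (auto simp: nb_def commute[of x])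
        then show "i \<in> (\<Union>y\<in>nb (D + 1 / L) x. {i. \<psi> i y \<noteq> 0})" by blast
      qed
      then show ?thesis using deg[OF True] \<psi>fin by (meson finite_UN_I finite_subset)
    qed (simp add: \<mu>_def)
    have "weights R \<epsilon> \<mu> \<psi> (2 * (\<bar>D\<bar> + 1 / L))"
      unfolding weights_def
    proof (intro conjI allI ballI impI)
      fix x M and I :: "nat set" and a :: "nat \<Rightarrow> 'e" assume I: "finite I" and a: "lp_le a M"
      have s: "(\<Sum>i\<in>I. norm (a i)) \<le> M" using a I one lp_le_nonneg[OF a] by (auto simp: lp_le_def)
      have "(\<Sum>i\<in>I. \<mu> i x * norm (a i)) \<le> (\<Sum>i\<in>I. 1 * norm (a i))"
        using \<mu>01 by (intro sum_mono mult_right_mono) auto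
      then show "(\<Sum>i\<in>I. \<mu> i x * norm (a i)) \<le> 2 * M" using s lp_le_nonneg[OF a] by simp
    next
      fix x y M and I :: "nat set" and a :: "nat \<Rightarrow> 'e" assume xy: "x \<in> X" "y \<in> X" "d x y \<le> R" and I: "finite I" and a: "lp_le a M"
      have s: "(\<Sum>i\<in>I. norm (a i)) \<le> M" using a I one lp_le_nonneg[OF a] by (auto simp: lp_le_def)
      have v: "\<bar>\<mu> i y - \<mu> i x\<bar> \<le> \<epsilon>" for i
      proof (cases "\<exists>z. \<psi> i z \<noteq> 0")
        case True
        then have "c i \<in> X" using c by blast
        then have "\<bar>\<mu> i y - \<mu> i x\<bar> \<le> L * d y x"
          using slow_cutoff[OF _ L, of "c i" D] xy True by (simp add: slow_def \<mu>_def)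
        also have "\<dots> \<le> L * R" using xy L by (intro mult_left_mono) (auto simp: commute)
        finally show ?thesis using R by (simp add: L_def)
      qed (use e in \<open>simp add: \<mu>_def\<close>)
      have "(\<Sum>i\<in>I. \<bar>\<mu> i y - \<mu> i x\<bar> * norm (a i)) \<le> (\<Sum>i\<in>I. \<epsilon> * norm (a i))"
        using v by (intro sum_mono mult_right_mono) auto
      also have "\<dots> \<le> \<epsilon> * M" unfolding sum_distrib_left[symmetric] using s e by (intro mult_left_mono) auto
      finally show "(\<Sum>i\<in>I. \<bar>\<mu> i y - \<mu> i x\<bar> * norm (a i)) \<le> \<epsilon> * M" .
    next
      fix x show "lp_le (\<lambda>i. \<psi> i x) 1" using one \<psi>sum \<psi>0 by (auto simp: lp_le_def)
    next
      fix x assume x: "x \<in> X"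
      have "(\<Sum>i | \<mu> i x \<noteq> 0. \<mu> i x * \<psi> i x) = (\<Sum>i | \<psi> i x \<noteq> 0. \<psi> i x)"
        using fin \<mu>1 by (intro sum.mono_neutral_cong_right) auto
      then show "(\<Sum>i | \<mu> i x \<noteq> 0. \<mu> i x * \<psi> i x) = 1" using \<psi>1[OF x] by (simp only:)
    next
      fix i x y assume xy: "x \<in> X" "y \<in> X" "(\<mu> i x \<noteq> 0 \<or> \<psi> i x \<noteq> 0) \<and> (\<mu> i y \<noteq> 0 \<or> \<psi> i y \<noteq> 0)"
      then have "\<mu> i x \<noteq> 0" "\<mu> i y \<noteq> 0" using \<mu>1[of i x] \<mu>1[of i y] by auto
      then have "d (c i) x \<le> D + 1 / L" "d (c i) y \<le> D + 1 / L" "c i \<in> X" using \<mu>D[of i x] \<mu>D[of i y] by auto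
      then show "d x y \<le> 2 * (\<bar>D\<bar> + 1 / L)"
        using triangle[OF xy(1), of "c i" y] xy(2) commute[of x "c i"] by simp
    qed (use \<mu>01 \<psi>0 \<psi>le fin \<psi>X in \<open>auto simp: \<mu>_def\<close>)
    then show ?thesis by blast
  next
    case gt
    define s where "s = 1 - 1 / P"
    have s: "0 < s" "s < 1" "0 < 1 / P" "1 / P \<le> 1" using gt by (auto simp: s_def)
    define \<mu> where "\<mu> i x = \<psi> i x powr s" for i x
    define \<rho> where "\<rho> i x = \<psi> i x powr (1 / P)" for i x
    have "weights R \<epsilon> \<mu> \<rho> D"
      unfolding weights_def
    proof (intro conjI allI ballI impI)
      fix x M and I :: "nat set" and a :: "nat \<Rightarrow> 'e" assume I: "finite I" and a: "lp_le a M"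
      have "(\<Sum>i\<in>I. \<mu> i x powr (1 / s)) \<le> 1 powr (1 / s)"
        using \<psi>sum[OF I, of x] s \<psi>0 by (simp add: \<mu>_def powr_powr)
      then show "(\<Sum>i\<in>I. \<mu> i x * norm (a i)) \<le> 2 * M"
        using sum_weighted_le[OF gt(1,2) zero_less_one _ I _ a, of "\<lambda>i. \<mu> i x"] by (simp add: s_def \<mu>_def)
    next
      fix x y M and I :: "nat set" and a :: "nat \<Rightarrow> 'e" assume xy: "x \<in> X" "y \<in> X" "d x y \<le> R" and I: "finite I" and a: "lp_le a M"
      have "(\<Sum>i\<in>I. \<bar>\<mu> i y - \<mu> i x\<bar> powr (1 / s)) \<le> (\<Sum>i\<in>I. \<bar>\<psi> i y - \<psi> i x\<bar>)"
        unfolding \<mu>_def using s \<psi>0 by (intro sum_mono powr_root_diff) auto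
      also have "\<dots> \<le> (\<epsilon> / 2) powr (1 / s)"
        using \<psi>var[OF xy(2,1) _ I] xy(3) gt by (simp add: \<delta>_def s_def commute)
      finally have "(\<Sum>i\<in>I. \<bar>\<mu> i y - \<mu> i x\<bar> * norm (a i)) \<le> 2 * (\<epsilon> / 2) * M"
        using e by (intro sum_weighted_le[OF gt(1,2) _ _ I _ a]) (auto simp: s_def)
      then show "(\<Sum>i\<in>I. \<bar>\<mu> i y - \<mu> i x\<bar> * norm (a i)) \<le> \<epsilon> * M" by simp
    next
      fix x show "lp_le (\<lambda>i. \<rho> i x) 1"
        using gt \<psi>sum \<psi>0 by (auto simp: lp_le_def \<rho>_def powr_powr)
    next
      fix x assume x: "x \<in> X"
      have "\<mu> i x * \<rho> i x = \<psi> i x" for i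
        using \<psi>0[of i x] by (cases "\<psi> i x = 0") (auto simp: \<mu>_def \<rho>_def s_def powr_add[symmetric])
      moreover have "\<mu> i x \<noteq> 0 \<longleftrightarrow> \<psi> i x \<noteq> 0" for i by (simp add: \<mu>_def)
      ultimately show "(\<Sum>i | \<mu> i x \<noteq> 0. \<mu> i x * \<rho> i x) = 1" using \<psi>1[OF x] by (simp only:)
    next
      fix i x y assume "x \<in> X" "y \<in> X" "(\<mu> i x \<noteq> 0 \<or> \<rho> i x \<noteq> 0) \<and> (\<mu> i y \<noteq> 0 \<or> \<rho> i y \<noteq> 0)"
      then show "d x y \<le> D" using \<psi>D[of x y i] by (auto simp: \<mu>_def \<rho>_def)
    qed (use \<psi>0 \<psi>le \<psi>fin \<psi>X s gt in \<open>auto simp: \<mu>_def \<rho>_def powr_le1\<close>)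
    then show ?thesis by blast
  qed
qed

text \<open>A family \<open>\<phi>\<close> with \<open>\<Sum>\<^sub>i \<phi>\<^sub>i\<^sup>p = 1\<close>, so that \<open>v \<mapsto> (\<phi>\<^sub>i v)\<^sub>i\<close> is isometric.\<close>

lemma isometric_partition:
  assumes q: "1 \<le> q" and A: "property_A q X d" and R: "0 < R" and e: "0 < \<epsilon>" and st: "\<not> sup_type"
  shows "\<exists>(\<phi>::nat \<Rightarrow> 'a \<Rightarrow> real) D. (\<forall>i x. 0 \<le> \<phi> i x \<and> \<phi> i x \<le> 1) \<and> (\<forall>i x. x \<notin> X \<longrightarrow> \<phi> i x = 0) \<and>
     (\<forall>i. \<forall>x\<in>X. \<forall>y\<in>X. \<phi> i x \<noteq> 0 \<and> \<phi> i y \<noteq> 0 \<longrightarrow> d x y \<le> D) \<and>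
     (\<forall>x. lp_le (\<lambda>i. \<phi> i x) 1) \<and>
     (\<forall>x\<in>X. \<forall>(v::'e). norm v \<le> lp_norm p (\<lambda>i. \<phi> i x *\<^sub>R v)) \<and>
     (\<forall>x\<in>X. \<forall>y\<in>X. d x y \<le> R \<longrightarrow> lp_le (\<lambda>i. \<phi> i x - \<phi> i y) \<epsilon>)"
proof -
  \<comment> \<open>The root with exponent \<open>1 / P\<close> turns variation
    \<open>\<epsilon> powr P\<close> of \<open>\<psi>\<close> into p-variation
    \<open>\<epsilon>\<close> of \<open>\<phi>\<close>, by \<open>powr_root_diff\<close>.\<close>
  have eP: "0 < \<epsilon> powr P" using e by simp
  obtain \<psi> D where \<psi>: "unit_partition R (\<epsilon> powr P) \<psi> D"
    using property_A_partition[OF q A R eP] by blast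
  note \<psi>0 = unit_partitionD(1)[OF \<psi>] and \<psi>fin = unit_partitionD(2)[OF \<psi>] and \<psi>X = unit_partitionD(3)[OF \<psi>]
    and \<psi>D = unit_partitionD(4)[OF \<psi>] and \<psi>1 = unit_partitionD(5)[OF \<psi>] and \<psi>var = unit_partitionD(6)[OF \<psi>]
    and \<psi>sum = unit_partitionD(7)[OF \<psi>] and \<psi>le = unit_partitionD(8)[OF \<psi>]
  have P: "0 < P" "1 \<le> P" using P_ge1[OF st] by auto
  define \<phi> where "\<phi> i x = \<psi> i x powr (1 / P)" for i x
  have \<phi>P: "\<phi> i x powr P = \<psi> i x" for i x using P \<psi>0 by (simp add: \<phi>_def powr_powr)
  have norm: "norm v \<le> lp_norm p (\<lambda>i. \<phi> i x *\<^sub>R v)" if x: "x \<in> X" for x and v :: 'e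
  proof -
    let ?f = "\<lambda>i. \<phi> i x *\<^sub>R v"
    have f: "?f \<in> lp_space p UNIV"
      by (rule lp_space_finite_support[OF \<psi>fin[of x]]) (auto simp: \<phi>_def)
    have "(\<Sum>i | \<psi> i x \<noteq> 0. norm (?f i) powr P) \<le> lp_norm p ?f powr P"
      using lp_le_norm[OF f] st \<psi>fin[of x] by (simp add: lp_le_def)
    moreover have "(\<Sum>i | \<psi> i x \<noteq> 0. norm (?f i) powr P) = (\<Sum>i | \<psi> i x \<noteq> 0. \<psi> i x) * norm v powr P"
      unfolding sum_distrib_right using \<phi>P by (intro sum.cong) (auto simp: powr_mult \<phi>_def)
    ultimately have "norm v powr P \<le> lp_norm p ?f powr P" using \<psi>1[OF x] by simp
    then show ?thesis using powr_P_le_iff[OF st _ lp_norm_nonneg[OF f]] by simp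
  qed
  have var: "lp_le (\<lambda>i. \<phi> i x - \<phi> i y) \<epsilon>" if xy: "x \<in> X" "y \<in> X" "d x y \<le> R" for x y
  proof -
    have "(\<Sum>i\<in>I. norm (\<phi> i x - \<phi> i y) powr P) \<le> \<epsilon> powr P" if I: "finite I" for I
    proof -
      have "(\<Sum>i\<in>I. norm (\<phi> i x - \<phi> i y) powr P) \<le> (\<Sum>i\<in>I. \<bar>\<psi> i x - \<psi> i y\<bar>)"
        using powr_root_diff[of "\<psi> i x" "\<psi> i y" "1 / P" for i] P \<psi>0 by (intro sum_mono) (simp add: \<phi>_def)
      then show ?thesis using \<psi>var[OF xy I] by simp
    qed
    then show ?thesis using st e by (simp add: lp_le_def)
  qed
  have one: "lp_le (\<lambda>i. \<phi> i x) 1" for x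
    using st \<psi>sum \<phi>P by (auto simp: lp_le_def) (simp add: \<phi>_def)
  show ?thesis
  proof (intro exI[of _ \<phi>] exI[of _ D] conjI allI ballI impI)
    fix i x y assume "x \<in> X" "y \<in> X" "\<phi> i x \<noteq> 0 \<and> \<phi> i y \<noteq> 0"
    then show "d x y \<le> D" using \<psi>D[of x y i] by (simp add: \<phi>_def)
  qed (use norm var one \<psi>0 \<psi>le \<psi>X P in \<open>auto simp: \<phi>_def powr_le1\<close>)
qed

end

section \<open>Limit spaces\<close>

lemma mult_div_succ_le:
  fixes c e :: real
  assumes "0 \<le> c" "0 \<le> e" shows "c * (e / (c + 1)) \<le> e"
  using assms by (simp add: field_simps)

text \<open>Completeness for nets rather than sequences; it serves unordered infinite sums and the
  net of approximate solutions.\<close>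

lemma cauchy_net_converges:
  fixes f :: "'i \<Rightarrow> 'v::complete_space"
  assumes ne: "F \<noteq> bot"
    and c: "\<And>\<epsilon>. 0 < \<epsilon> \<Longrightarrow> \<exists>Q. eventually Q F \<and> (\<forall>x y. Q x \<longrightarrow> Q y \<longrightarrow> dist (f x) (f y) < \<epsilon>)"
  shows "\<exists>l. (f \<longlongrightarrow> l) F"
proof -
  have "cauchy_filter (filtermap f F)"
    unfolding cauchy_filter_iff
  proof (intro allI impI)
    fix Pr :: "'v \<times> 'v \<Rightarrow> bool" assume "eventually Pr uniformity"
    then obtain e where e: "0 < e" "\<And>x y. dist x y < e \<Longrightarrow> Pr (x, y)"
      unfolding eventually_uniformity_metric by auto
    obtain Q where Q: "eventually Q F" "\<And>x y. Q x \<Longrightarrow> Q y \<Longrightarrow> dist (f x) (f y) < e"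
      using c[OF e(1)] by auto
    show "\<exists>Y. eventually (\<lambda>x. x \<in> Y) (filtermap f F) \<and> (\<forall>z\<in>Y \<times> Y. Pr z)"
    proof (intro exI[of _ "f ` Collect Q"] conjI ballI)
      show "eventually (\<lambda>x. x \<in> f ` Collect Q) (filtermap f F)"
        unfolding eventually_filtermap by (rule eventually_mono[OF Q(1)]) auto
      fix z assume "z \<in> f ` Collect Q \<times> f ` Collect Q"
      then show "Pr z" using e(2) Q(2) by auto
    qed
  qed
  moreover have "filtermap f F \<noteq> bot" using ne by (simp add: filtermap_bot_iff)
  ultimately have "convergent_filter (filtermap f F)" by (intro cauchy_filter_convergent)
  then show ?thesis unfolding convergent_filter_iff filterlim_def by blast
qed

context lp_exponent
begin

text \<open>A Fatou lemma for nets: the bound is a condition on finitely many points at a time, so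
  it survives pointwise limits.\<close>

lemma lp_le_limit:
  fixes f :: "'n \<Rightarrow> 'i \<Rightarrow> 'v::real_normed_vector"
  assumes ne: "F \<noteq> bot" and le: "\<forall>\<^sub>F n in F. lp_le (f n) M" and lim: "\<And>x. ((\<lambda>n. f n x) \<longlongrightarrow> g x) F"
  shows "lp_le g M"
proof -
  have M: "0 \<le> M" using eventually_happens'[OF ne le] lp_le_nonneg by blast
  show ?thesis
  proof (cases sup_type)
    case True
    have "norm (g x) \<le> M" for x
      by (rule tendsto_upperbound[OF tendsto_norm[OF lim] _ ne])
        (rule eventually_mono[OF le], rule lp_le_point)
    then show ?thesis using True M by (simp add: lp_le_def)
  next
    case False
    have "(\<Sum>x\<in>G. norm (g x) powr P) \<le> M powr P" if G: "finite G" for G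
    proof (rule tendsto_upperbound[OF _ _ ne])
      show "((\<lambda>n. \<Sum>x\<in>G. norm (f n x) powr P) \<longlongrightarrow> (\<Sum>x\<in>G. norm (g x) powr P)) F"
        using P_pos[OF False] by (intro tendsto_sum tendsto_powr' tendsto_norm lim tendsto_const) auto
      show "\<forall>\<^sub>F n in F. (\<Sum>x\<in>G. norm (f n x) powr P) \<le> M powr P"
        by (rule eventually_mono[OF le]) (use False G in \<open>auto simp: lp_le_def\<close>)
    qed
    then show ?thesis using False M by (simp add: lp_le_def)
  qed
qed

end

locale limit_point = bg_space p sc X d
  for p :: ennreal and sc :: "'k::real_normed_field \<Rightarrow> 'e::banach \<Rightarrow> 'e"
    and X :: "'a set" and d :: "'a \<Rightarrow> 'a \<Rightarrow> real" +
  fixes \<omega> :: "'a filter"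
  assumes boundary: "\<omega> \<in> beta_boundary X"
begin

section \<open>Compatible translations and points of the limit space\<close>

lemma omega_nontrivial: "\<omega> \<noteq> bot" and omega_X: "\<forall>\<^sub>F x in \<omega>. x \<in> X"
  using boundary by (auto simp: beta_boundary_def beta_def le_principal)

lemma ultra: "\<not> eventually Q \<omega> \<Longrightarrow> \<forall>\<^sub>F x in \<omega>. \<not> Q x"
  using boundary by (auto simp: beta_boundary_def beta_def dest!: spec[of _ "Collect Q"])

lemma ultra_finite_union:
  "finite I \<Longrightarrow> \<forall>\<^sub>F x in \<omega>. \<exists>i\<in>I. Q i x \<Longrightarrow> \<exists>i\<in>I. \<forall>\<^sub>F x in \<omega>. Q i x"
proof (induction I rule: finite_induct)
  case empty
  then show ?case using omega_nontrivial by (simp add: trivial_limit_def)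
next
  case (insert i I)
  show ?case
  proof (cases "eventually (Q i) \<omega>")
    case False
    from insert.prems ultra[OF this] have "\<forall>\<^sub>F x in \<omega>. \<exists>i\<in>I. Q i x"
      by eventually_elim auto
    then show ?thesis using insert.IH by auto
  qed auto
qed

lemma ultra_constant:
  fixes c :: "'a \<Rightarrow> nat"
  assumes "\<forall>\<^sub>F x in \<omega>. c x \<le> N"
  shows "\<exists>k. \<forall>\<^sub>F x in \<omega>. c x = k"
  using ultra_finite_union[of "{..N}" "\<lambda>k x. c x = k"] assms by auto

lemma not_eventually_constant:
  assumes "z \<in> X" shows "\<not> (\<forall>\<^sub>F x in \<omega>. x = z)"
proof
  assume z: "\<forall>\<^sub>F x in \<omega>. x = z"
  have "eventually Q \<omega> \<longleftrightarrow> Q z" for Q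
  proof
    assume "eventually Q \<omega>"
    with z have "\<forall>\<^sub>F x in \<omega>. Q z" by eventually_elim auto
    then show "Q z" using omega_nontrivial by (simp add: eventually_const)
  next
    assume "Q z" then show "eventually Q \<omega>" by (intro eventually_mono[OF z]) auto
  qed
  then have "\<omega> = principal {z}" by (simp add: filter_eq_iff eventually_principal)
  then show False using boundary assms by (auto simp: beta_boundary_def)
qed

text \<open>Colour \<open>X\<close> so that distinct points within \<open>2 * C\<close> differ. One
  colour class belongs to \<open>\<omega>\<close>, and on it \<open>s\<close> is injective, since
  \<open>s x = s y\<close> forces \<open>d x y \<le> 2 * C\<close>. So every selection of bounded
  displacement gives a point of the limit space.\<close>

lemma compatibleI:
  assumes "\<forall>\<^sub>F x in \<omega>. s x \<in> X \<and> d x (s x) \<le> C"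
  shows "compatible X d \<omega> s"
proof -
  obtain c :: "'a \<Rightarrow> nat" and N where c1: "\<forall>x\<in>X. c x \<le> N"
      and c2: "\<forall>x\<in>X. \<forall>y\<in>X. x \<noteq> y \<and> d x y \<le> 2 * C \<longrightarrow> c x \<noteq> c y"
    using coloring[of "2 * C"] by (elim exE conjE) (rule that)
  note c = c1[rule_format] c2[rule_format, OF _ _ conjI]
  have "\<forall>\<^sub>F x in \<omega>. c x \<le> N" using omega_X by eventually_elim (rule c(1))
  then obtain k where k: "\<forall>\<^sub>F x in \<omega>. c x = k" using ultra_constant by blast
  define D where "D = {x \<in> X. s x \<in> X \<and> d x (s x) \<le> C \<and> c x = k}"
  have "inj_on s D"
  proof (rule inj_onI)
    fix x y assume xy: "x \<in> D" "y \<in> D" "s x = s y"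
    then have "d x y \<le> d x (s x) + d (s x) y" by (intro triangle) (auto simp: D_def)
    also have "\<dots> \<le> 2 * C" using xy by (auto simp: D_def commute)
    finally show "x = y" using c(2)[of x y] xy by (auto simp: D_def)
  qed
  then have "partial_translation X d s D (s ` D)"
    unfolding partial_translation_def by (auto simp: bij_betw_def D_def)
  moreover have "\<forall>\<^sub>F x in \<omega>. x \<in> D" using omega_X k assms by eventually_elim (auto simp: D_def)
  ultimately show ?thesis unfolding compatible_def by blast
qed

lemma compatibleD:
  assumes "compatible X d \<omega> s"
  shows "\<exists>C. \<forall>\<^sub>F x in \<omega>. x \<in> X \<and> s x \<in> X \<and> d x (s x) \<le> C"
proof -
  obtain D R C where D: "D \<subseteq> X" "R \<subseteq> X" "bij_betw s D R" "\<forall>x\<in>D. d x (s x) \<le> C" "\<forall>\<^sub>F x in \<omega>. x \<in> D"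
    using assms unfolding compatible_def partial_translation_def by auto
  have "\<forall>\<^sub>F x in \<omega>. x \<in> X \<and> s x \<in> X \<and> d x (s x) \<le> C"
    using D(5) by eventually_elim (use D in \<open>auto simp: bij_betw_def\<close>)
  then show ?thesis ..
qed

text \<open>The values \<open>s x\<close> and \<open>t x\<close> lie within \<open>C + C'\<close> of
  each other. The common image ultrafilter picks one class of a colouring for that distance, so both
  values eventually have the same colour and hence coincide.\<close>

lemma compatible_eq:
  assumes s: "compatible X d \<omega> s" and t: "compatible X d \<omega> t" and eq: "filtermap s \<omega> = filtermap t \<omega>"
  shows "\<forall>\<^sub>F x in \<omega>. s x = t x"
proof -
  obtain C where C: "\<forall>\<^sub>F x in \<omega>. x \<in> X \<and> s x \<in> X \<and> d x (s x) \<le> C" using compatibleD[OF s] ..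
  obtain C' where C': "\<forall>\<^sub>F x in \<omega>. x \<in> X \<and> t x \<in> X \<and> d x (t x) \<le> C'" using compatibleD[OF t] ..
  obtain c :: "'a \<Rightarrow> nat" and N where c1: "\<forall>x\<in>X. c x \<le> N"
      and c2: "\<forall>x\<in>X. \<forall>y\<in>X. x \<noteq> y \<and> d x y \<le> C + C' \<longrightarrow> c x \<noteq> c y"
    using coloring[of "C + C'"] by (elim exE conjE) (rule that)
  note c = c1[rule_format] c2[rule_format, OF _ _ conjI]
  have "\<forall>\<^sub>F x in \<omega>. c (s x) \<le> N" using C by eventually_elim (use c(1) in auto)
  then obtain k where k: "\<forall>\<^sub>F x in \<omega>. c (s x) = k" using ultra_constant[of "\<lambda>x. c (s x)"] by blast
  then have "eventually (\<lambda>y. c y = k) (filtermap s \<omega>)" by (simp add: eventually_filtermap)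
  then have "\<forall>\<^sub>F x in \<omega>. c (t x) = k" unfolding eq by (simp add: eventually_filtermap)
  with k C C' show ?thesis
  proof eventually_elim
    case (elim x)
    have "d (s x) (t x) \<le> d (s x) x + d x (t x)" using elim by (intro triangle) auto
    then have "d (s x) (t x) \<le> C + C'" using elim by (auto simp: commute)
    then show ?case using c(2)[of "s x" "t x"] elim by auto
  qed
qed

abbreviation Xw :: "'a filter set" where "Xw \<equiv> limit_space X d \<omega>"
abbreviation V :: "'a filter \<Rightarrow> 'a \<Rightarrow> 'a" where "V \<equiv> compatible_family X d \<omega>"

lemma V_compatible: "\<alpha> \<in> Xw \<Longrightarrow> compatible X d \<omega> (V \<alpha>)"
  and filtermap_V: "\<alpha> \<in> Xw \<Longrightarrow> filtermap (V \<alpha>) \<omega> = \<alpha>"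
proof -
  have "\<forall>\<alpha>\<in>Xw. \<exists>t. compatible X d \<omega> t \<and> filtermap t \<omega> = \<alpha>" by (auto simp: limit_space_def)
  then have "\<exists>\<tau>. is_compatible_family X d \<omega> \<tau>" unfolding is_compatible_family_def by metis
  then have "is_compatible_family X d \<omega> V" unfolding compatible_family_def by (rule someI_ex)
  then show "\<alpha> \<in> Xw \<Longrightarrow> compatible X d \<omega> (V \<alpha>)" "\<alpha> \<in> Xw \<Longrightarrow> filtermap (V \<alpha>) \<omega> = \<alpha>"
    by (auto simp: is_compatible_family_def)
qed

lemma V_hits:
  assumes "compatible X d \<omega> s"
  shows "filtermap s \<omega> \<in> Xw" and "\<forall>\<^sub>F x in \<omega>. V (filtermap s \<omega>) x = s x"
proof -
  show m: "filtermap s \<omega> \<in> Xw" using assms by (auto simp: limit_space_def)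
  show "\<forall>\<^sub>F x in \<omega>. V (filtermap s \<omega>) x = s x"
    by (rule compatible_eq[OF V_compatible[OF m] assms filtermap_V[OF m]])
qed

lemma V_distinct:
  assumes "\<alpha> \<in> Xw" "\<beta> \<in> Xw" "\<alpha> \<noteq> \<beta>"
  shows "\<forall>\<^sub>F x in \<omega>. V \<alpha> x \<noteq> V \<beta> x"
proof (rule ultra, rule notI)
  assume eq: "\<forall>\<^sub>F x in \<omega>. V \<alpha> x = V \<beta> x"
  have "filtermap (V \<alpha>) \<omega> = filtermap (V \<beta>) \<omega>"
  proof (rule filter_eqI)
    fix Q
    have "(\<forall>\<^sub>F x in \<omega>. Q (V \<alpha> x)) \<longleftrightarrow> (\<forall>\<^sub>F x in \<omega>. Q (V \<beta> x))"
      by (rule eventually_cong[OF eq]) simp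
    then show "eventually Q (filtermap (V \<alpha>) \<omega>) \<longleftrightarrow> eventually Q (filtermap (V \<beta>) \<omega>)"
      by (simp add: eventually_filtermap)
  qed
  then show False using assms filtermap_V by simp
qed

text \<open>Otherwise \<open>V \<alpha> x\<close> would be constant along \<open>\<omega>\<close>,
  and \<open>x\<close> would stay in a finite ball, against \<open>\<omega>\<close> being
  non-principal.\<close>

lemma V_avoids:
  assumes "\<alpha> \<in> Xw" "finite F" "F \<subseteq> X"
  shows "\<forall>\<^sub>F x in \<omega>. V \<alpha> x \<notin> F"
proof (rule ultra, rule notI)
  assume "\<forall>\<^sub>F x in \<omega>. V \<alpha> x \<in> F"
  then obtain z where z: "z \<in> F" "\<forall>\<^sub>F x in \<omega>. V \<alpha> x = z"
    using ultra_finite_union[OF assms(2), of "\<lambda>z x. V \<alpha> x = z"] by auto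
  obtain C where C: "\<forall>\<^sub>F x in \<omega>. x \<in> X \<and> V \<alpha> x \<in> X \<and> d x (V \<alpha> x) \<le> C"
    using compatibleD[OF V_compatible[OF assms(1)]] ..
  have "\<forall>\<^sub>F x in \<omega>. x \<in> nb C z" using z(2) C
  proof eventually_elim
    case (elim x) then show ?case by (auto simp: nb_def commute)
  qed
  then obtain y where "y \<in> nb C z" "\<forall>\<^sub>F x in \<omega>. x = y"
    using ultra_finite_union[of "nb C z" "\<lambda>y x. x = y"] deg[of z C] z(1) assms(3) by auto
  then show False using not_eventually_constant[of y] by (auto simp: nb_def)
qed

text \<open>Finite pieces \<open>G\<close> of the limit space are copied to \<open>X\<close>, for \<open>x\<close> far out along \<open>\<omega>\<close>, by the
  compatible family.\<close>

definition img :: "'a filter set \<Rightarrow> 'a \<Rightarrow> 'a set" where "img G x = (\<lambda>\<alpha>. V \<alpha> x) ` G"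

definition good :: "'a filter set \<Rightarrow> 'a \<Rightarrow> bool" where
  "good G x \<longleftrightarrow> inj_on (\<lambda>\<alpha>. V \<alpha> x) G \<and> img G x \<subseteq> X"

lemma img_mono: "G \<subseteq> G' \<Longrightarrow> img G x \<subseteq> img G' x"
  by (auto simp: img_def)

lemma finite_img: "finite G \<Longrightarrow> finite (img G x)"
  by (simp add: img_def)

lemma good_mono: "good G' x \<Longrightarrow> G \<subseteq> G' \<Longrightarrow> good G x"
  unfolding good_def using img_mono inj_on_subset by blast

lemma eventually_good:
  assumes "finite G" "G \<subseteq> Xw" shows "\<forall>\<^sub>F x in \<omega>. good G x"
proof -
  have "\<forall>\<^sub>F x in \<omega>. \<forall>\<alpha>\<in>G. \<forall>\<beta>\<in>G. \<alpha> \<noteq> \<beta> \<longrightarrow> V \<alpha> x \<noteq> V \<beta> x"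
    using assms V_distinct
    by (intro eventually_ball_finite ballI) (auto intro: eventually_mono simp: subset_iff)
  moreover have "\<forall>\<^sub>F x in \<omega>. \<forall>\<alpha>\<in>G. V \<alpha> x \<in> X"
  proof (intro eventually_ball_finite ballI assms)
    fix \<alpha> assume "\<alpha> \<in> G"
    then obtain C where "\<forall>\<^sub>F x in \<omega>. x \<in> X \<and> V \<alpha> x \<in> X \<and> d x (V \<alpha> x) \<le> C"
      using compatibleD[OF V_compatible] assms(2) by blast
    then show "\<forall>\<^sub>F x in \<omega>. V \<alpha> x \<in> X" by (rule eventually_mono) auto
  qed
  ultimately show ?thesis
    by eventually_elim (auto simp: good_def img_def inj_on_def)
qed

lemma eventually_avoids:
  assumes "finite G" "G \<subseteq> Xw" "finite F" "F \<subseteq> X"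
  shows "\<forall>\<^sub>F x in \<omega>. img G x \<inter> F = {}"
proof -
  have "\<forall>\<^sub>F x in \<omega>. \<forall>\<alpha>\<in>G. V \<alpha> x \<notin> F"
    using assms V_avoids by (intro eventually_ball_finite ballI) auto
  then show ?thesis by eventually_elim (auto simp: img_def)
qed

text \<open>The identity is a compatible translation. Around this base point of the limit space,
  vectors localised near \<open>x\<close> are copied.\<close>

lemma base_point: "\<omega> \<in> Xw" "\<forall>\<^sub>F x in \<omega>. V \<omega> x = x"
proof -
  have c: "compatible X d \<omega> (\<lambda>x. x)"
    by (rule compatibleI[where C = 0]) (use omega_X in eventually_elim, auto)
  have "filtermap (\<lambda>x. x) \<omega> = \<omega>" by (simp add: filtermap_ident)
  then show "\<omega> \<in> Xw" "\<forall>\<^sub>F x in \<omega>. V \<omega> x = x" using V_hits[OF c] by simp_all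
qed

text \<open>The balls of the limit space are those of \<open>X\<close> far out along \<open>\<omega>\<close>; its metric itself is not used.\<close>

lemma cover:
  assumes G: "finite G" "G \<subseteq> Xw" and R: "0 \<le> R"
  shows "\<exists>G'. finite G' \<and> G' \<subseteq> Xw \<and> G \<subseteq> G' \<and> (\<forall>\<^sub>F x in \<omega>. nbs R (img G x) \<subseteq> img G' x)"
proof -
  \<comment> \<open>Each ball of radius \<open>R\<close> is listed by \<open>deg R\<close>
    selections, with its centre as default value, which lies in the ball because
    \<open>0 \<le> R\<close>. Composed with \<open>V \<alpha>\<close>, a selection has bounded
    displacement and yields a point of the limit space.\<close>
  have "\<exists>e. \<forall>i. (e i \<in> nb R y) \<and> nb R y \<subseteq> e ` {..<deg R}" if y: "y \<in> X" for y
  proof -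
    obtain h where h: "bij_betw h {0..<card (nb R y)} (nb R y)"
      using ex_bij_betw_nat_finite deg[OF y] by blast
    define e where "e i = (if i < card (nb R y) then h i else y)" for i
    have "y \<in> nb R y" using R y by (simp add: nb_def)
    then have "e i \<in> nb R y" for i using h by (auto simp: e_def bij_betw_def)
    moreover have "nb R y \<subseteq> e ` {..<deg R}"
    proof
      fix z assume "z \<in> nb R y"
      then have "z \<in> h ` {0..<card (nb R y)}" using bij_betw_imp_surj_on[OF h] by simp
      then obtain i where "i < card (nb R y)" "z = h i" by auto
      then show "z \<in> e ` {..<deg R}" using deg[OF y, of R] by (intro image_eqI[of _ _ i]) (auto simp: e_def)
    qed
    ultimately show ?thesis by blast
  qed
  then obtain e where e: "\<And>y i. y \<in> X \<Longrightarrow> e y i \<in> nb R y" "\<And>y. y \<in> X \<Longrightarrow> nb R y \<subseteq> e y ` {..<deg R}"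
    by metis
  define s where "s \<alpha> i x = e (V \<alpha> x) i" for \<alpha> i x
  have s: "compatible X d \<omega> (s \<alpha> i)" if \<alpha>: "\<alpha> \<in> G" for \<alpha> i
  proof -
    obtain C where C: "\<forall>\<^sub>F x in \<omega>. x \<in> X \<and> V \<alpha> x \<in> X \<and> d x (V \<alpha> x) \<le> C"
      using compatibleD[OF V_compatible] \<alpha> G(2) by blast
    show ?thesis
    proof (rule compatibleI[where C = "C + R"])
      show "\<forall>\<^sub>F x in \<omega>. s \<alpha> i x \<in> X \<and> d x (s \<alpha> i x) \<le> C + R" using C
      proof eventually_elim
        case (elim x)
        then have "s \<alpha> i x \<in> X" "d (V \<alpha> x) (s \<alpha> i x) \<le> R"
          using e(1)[of "V \<alpha> x" i] by (auto simp: s_def nb_def)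
        then show ?case using triangle[of x "V \<alpha> x" "s \<alpha> i x"] elim by auto
      qed
    qed
  qed
  define G' where "G' = G \<union> (\<lambda>(\<alpha>, i). filtermap (s \<alpha> i) \<omega>) ` (G \<times> {..<deg R})"
  have "\<forall>\<^sub>F x in \<omega>. \<forall>\<alpha>\<in>G. \<forall>i\<in>{..<deg R}. V (filtermap (s \<alpha> i) \<omega>) x = s \<alpha> i x"
    using G(1) V_hits(2)[OF s] by (intro eventually_ball_finite ballI) auto
  with eventually_good[OF G] have "\<forall>\<^sub>F x in \<omega>. nbs R (img G x) \<subseteq> img G' x"
  proof eventually_elim
    case (elim x)
    show ?case
    proof
      fix z assume "z \<in> nbs R (img G x)"
      then obtain \<alpha> where \<alpha>: "\<alpha> \<in> G" "z \<in> nb R (V \<alpha> x)" by (auto simp: nbs_def img_def)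
      then have "V \<alpha> x \<in> X" using elim by (auto simp: good_def img_def)
      then obtain i where i: "i < deg R" "z = s \<alpha> i x" using e(2) \<alpha>(2) by (fastforce simp: s_def)
      then have "z = V (filtermap (s \<alpha> i) \<omega>) x" using elim \<alpha>(1) by auto
      then show "z \<in> img G' x" using i(1) \<alpha>(1) by (force simp: img_def G'_def)
    qed
  qed
  moreover have "finite G'" "G' \<subseteq> Xw" "G \<subseteq> G'"
    using G V_hits(1)[OF s] by (auto simp: G'_def)
  ultimately show ?thesis by blast
qed

section \<open>Transport of finite pieces between a limit space and \<open>X\<close>\<close>

definition push :: "'a \<Rightarrow> 'a filter set \<Rightarrow> ('a filter \<Rightarrow> 'e) \<Rightarrow> ('a \<Rightarrow> 'e)" where
  "push x G u = (\<lambda>y. if y \<in> img G x then u (inv_into G (\<lambda>\<alpha>. V \<alpha> x) y) else 0)"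

definition pull :: "'a \<Rightarrow> 'a filter set \<Rightarrow> ('a \<Rightarrow> 'e) \<Rightarrow> ('a filter \<Rightarrow> 'e)" where
  "pull x G f = (\<lambda>\<alpha>. if \<alpha> \<in> G then f (V \<alpha> x) else 0)"

lemma push_V: "good G x \<Longrightarrow> \<alpha> \<in> G \<Longrightarrow> push x G u (V \<alpha> x) = u \<alpha>"
  using inv_into_f_f[of "\<lambda>\<alpha>. V \<alpha> x" G \<alpha>] by (auto simp: push_def img_def good_def)

lemma push_lp: "good G x \<Longrightarrow> finite G \<Longrightarrow> push x G u \<in> lps X"
  by (rule lp_space_finite_support[of "img G x"]) (auto simp: good_def img_def push_def)

lemma pull_lp: "finite G \<Longrightarrow> G \<subseteq> Xw \<Longrightarrow> pull x G f \<in> lps Xw"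
  by (rule lp_space_finite_support[of G]) (auto simp: pull_def)

lemma lp_le_push: "good G x \<Longrightarrow> lp_le u M \<Longrightarrow> lp_le (push x G u) M"
  by (rule lp_le_inj[where f = u and s = "inv_into G (\<lambda>\<alpha>. V \<alpha> x)" and D = "img G x"])
    (auto simp: push_def img_def intro: inj_on_inv_into)

lemma lp_le_pull: "good G x \<Longrightarrow> lp_le f M \<Longrightarrow> lp_le (pull x G f) M"
  by (rule lp_le_inj[where f = f and s = "\<lambda>\<alpha>. V \<alpha> x" and D = G]) (auto simp: pull_def good_def)

lemma norm_push: "good G x \<Longrightarrow> u \<in> lps Xw \<Longrightarrow> lp_norm p (push x G u) \<le> lp_norm p u"
  by (rule lp_norm_le[OF lp_le_push[OF _ lp_le_norm]])

lemma norm_pull: "good G x \<Longrightarrow> f \<in> lps X \<Longrightarrow> lp_norm p (pull x G f) \<le> lp_norm p f"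
  by (rule lp_norm_le[OF lp_le_pull[OF _ lp_le_norm]])

lemma pull_push: "good G' x \<Longrightarrow> G \<subseteq> G' \<Longrightarrow> pull x G (push x G' u) = proj G u"
  using push_V[of G' x] by (auto simp: pull_def proj_def fun_eq_iff subset_iff)

lemma push_pull:
  assumes g: "good G x"
  shows "push x G (pull x G f) = proj (img G x) f"
proof
  fix y
  show "push x G (pull x G f) y = proj (img G x) f y"
  proof (cases "y \<in> img G x")
    case True
    then obtain \<alpha> where \<alpha>: "\<alpha> \<in> G" "y = V \<alpha> x" by (auto simp: img_def)
    then show ?thesis using push_V[OF g \<alpha>(1)] True by (simp add: pull_def proj_def)
  qed (simp add: push_def proj_def)
qed

lemma norm_proj_img:
  assumes "good G x" "finite G" "G \<subseteq> Xw"
  shows "lp_norm p (proj (img G x) f) \<le> lp_norm p (pull x G f)"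
  using norm_push[OF assms(1) pull_lp[OF assms(2,3)], of x f] push_pull[OF assms(1), of f] by simp

lemma norm_pull_proj:
  assumes "good G x" "finite G"
  shows "lp_norm p (pull x G f) \<le> lp_norm p (proj (img G x) f)"
proof -
  have "pull x G (proj (img G x) f) = pull x G f" by (auto simp: pull_def proj_def img_def)
  moreover have "proj (img G x) f \<in> lps X"
    using assms by (intro lp_space_finite_support[of "img G x"]) (auto simp: good_def img_def proj_def)
  ultimately show ?thesis using norm_pull[OF assms(1), of "proj (img G x) f"] by simp
qed

end

section \<open>Limit operators\<close>

locale limit_operator = limit_point p sc X d \<omega>
  for p :: ennreal and sc :: "'k::real_normed_field \<Rightarrow> 'e::banach \<Rightarrow> 'e"
    and X :: "'a set" and d :: "'a \<Rightarrow> 'a \<Rightarrow> real" and \<omega> :: "'a filter" +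
  fixes A :: "('a \<Rightarrow> 'e) \<Rightarrow> ('a \<Rightarrow> 'e)"
  assumes A: "A \<in> ops_A sc p X d" and rich: "rich_at X d \<omega> A"
begin

lemmas AO = ops_A_D(1)[OF A]

abbreviation nA :: real where "nA \<equiv> op_norm p X A"

lemma nA: "0 \<le> nA" by (rule op_norm_nonneg[OF AO])

abbreviation a where "a \<equiv> limit_matrix X d \<omega> A"

abbreviation \<Phi> :: "('a filter \<Rightarrow> 'e) \<Rightarrow> ('a filter \<Rightarrow> 'e)" where "\<Phi> \<equiv> matrix_op Xw a"

lemma entries_tendsto:
  assumes "\<alpha> \<in> Xw" "\<beta> \<in> Xw"
  shows "((\<lambda>x. matrix_coeff A (V \<alpha> x) (V \<beta> x)) \<longlongrightarrow> a \<alpha> \<beta>) \<omega>"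
proof -
  obtain l where l: "((\<lambda>x. matrix_coeff A (V \<alpha> x) (V \<beta> x)) \<longlongrightarrow> l) \<omega>"
    using rich V_compatible assms unfolding rich_at_def by blast
  then show ?thesis unfolding limit_matrix_def using tendsto_Lim[OF omega_nontrivial l] by simp
qed

lemma entries_linear:
  assumes "\<alpha> \<in> Xw" "\<beta> \<in> Xw"
  shows "blinfun_apply (a \<alpha> \<beta>) (sc c e) = sc c (blinfun_apply (a \<alpha> \<beta>) e)"
proof (rule tendsto_unique[OF omega_nontrivial])
  let ?m = "\<lambda>x. matrix_coeff A (V \<alpha> x) (V \<beta> x)"
  have m: "((\<lambda>x. blinfun_apply (?m x) e) \<longlongrightarrow> blinfun_apply (a \<alpha> \<beta>) e) \<omega>" for e
    by (rule blinfun.tendsto[OF entries_tendsto[OF assms] tendsto_const])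
  show "((\<lambda>x. blinfun_apply (?m x) (sc c e)) \<longlongrightarrow> blinfun_apply (a \<alpha> \<beta>) (sc c e)) \<omega>" by (rule m)
  have "((\<lambda>x. sc c (blinfun_apply (?m x) e)) \<longlongrightarrow> sc c (blinfun_apply (a \<alpha> \<beta>) e)) \<omega>"
    by (rule bounded_linear.tendsto[OF bounded_linear_sc m])
  moreover have "\<forall>\<^sub>F x in \<omega>. sc c (blinfun_apply (?m x) e) = blinfun_apply (?m x) (sc c e)"
  proof -
    have "\<forall>\<^sub>F x in \<omega>. good {\<beta>} x" using assms(2) by (intro eventually_good) auto
    then show ?thesis
    proof eventually_elim
      case (elim x)
      then have "V \<beta> x \<in> X" by (simp add: good_def img_def)
      from matrix_coeff_in_coeff_ops[OF AO this, of "V \<alpha> x"] show ?case by (simp add: coeff_ops_def)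
    qed
  qed
  ultimately show "((\<lambda>x. blinfun_apply (?m x) (sc c e)) \<longlongrightarrow> sc c (blinfun_apply (a \<alpha> \<beta>) e)) \<omega>"
    by (rule Lim_transform_eventually)
qed

lemma Phi_finite:
  assumes "finite G" "G \<subseteq> Xw" "\<alpha> \<in> Xw"
  shows "\<Phi> (proj G u) \<alpha> = (\<Sum>\<beta>\<in>G. blinfun_apply (a \<alpha> \<beta>) (u \<beta>))"
proof -
  have "(\<Sum>\<^sub>\<infinity>\<beta>\<in>Xw. blinfun_apply (a \<alpha> \<beta>) (proj G u \<beta>)) = (\<Sum>\<^sub>\<infinity>\<beta>\<in>G. blinfun_apply (a \<alpha> \<beta>) (u \<beta>))"
    using assms(2) by (intro infsum_cong_neutral) (auto simp: proj_def)
  then show ?thesis using assms by (simp add: matrix_op_def)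
qed

lemma Phi_off: "\<alpha> \<notin> Xw \<Longrightarrow> \<Phi> u \<alpha> = 0"
  by (simp add: matrix_op_def)

text \<open>Only finitely many matrix entries are involved, and by richness they converge in norm;
  hence each \<open>x\<close> far out works for all \<open>u\<close> at once. This uniformity
  permits vectors that are chosen after \<open>x\<close>.\<close>

lemma approximation:
  assumes G1: "finite G1" "G1 \<subseteq> Xw" and G2: "finite G2" "G2 \<subseteq> Xw" and e: "0 < \<epsilon>"
  shows "\<forall>\<^sub>F x in \<omega>. good (G1 \<union> G2) x \<and> (\<forall>u\<in>lps Xw.
    lp_norm p (\<lambda>\<alpha>. pull x G1 (A (push x G2 u)) \<alpha> - proj G1 (\<Phi> (proj G2 u)) \<alpha>) \<le> \<epsilon> * lp_norm p u)"
proof -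
  \<comment> \<open>Each of the \<open>card G1\<close> values is a sum of \<open>card G2\<close>
    terms, and the norm on \<open>G1\<close> is bounded by the sum of the values.\<close>
  define \<eta> where "\<eta> = \<epsilon> / (real (card G1) * real (card G2) + 1)"
  have \<eta>: "0 < \<eta>" using e unfolding \<eta>_def by (intro divide_pos_pos add_nonneg_pos) auto
  let ?m = "\<lambda>x \<alpha> \<beta>. matrix_coeff A (V \<alpha> x) (V \<beta> x)"
  have "\<forall>\<^sub>F x in \<omega>. \<forall>\<alpha>\<in>G1. \<forall>\<beta>\<in>G2. dist (?m x \<alpha> \<beta>) (a \<alpha> \<beta>) < \<eta>"
  proof (intro eventually_ball_finite ballI G1(1) G2(1))
    fix \<alpha> \<beta> assume "\<alpha> \<in> G1" "\<beta> \<in> G2"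
    then have "\<alpha> \<in> Xw" "\<beta> \<in> Xw" using G1 G2 by auto
    from tendstoD[OF entries_tendsto[OF this] \<eta>]
    show "\<forall>\<^sub>F x in \<omega>. dist (?m x \<alpha> \<beta>) (a \<alpha> \<beta>) < \<eta>" .
  qed
  moreover have "\<forall>\<^sub>F x in \<omega>. good (G1 \<union> G2) x" using G1 G2 by (intro eventually_good) auto
  ultimately show ?thesis
  proof eventually_elim
    case (elim x)
    then have g: "good (G1 \<union> G2) x" "good G1 x" "good G2 x" using good_mono[of "G1 \<union> G2" x] by auto
    have "lp_norm p (\<lambda>\<alpha>. pull x G1 (A (push x G2 u)) \<alpha> - proj G1 (\<Phi> (proj G2 u)) \<alpha>) \<le> \<epsilon> * lp_norm p u"
      if u: "u \<in> lps Xw" for u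
    proof -
      let ?D = "\<lambda>\<alpha>. pull x G1 (A (push x G2 u)) \<alpha> - proj G1 (\<Phi> (proj G2 u)) \<alpha>"
      have "norm (?D \<alpha>) \<le> real (card G2) * (\<eta> * lp_norm p u)" if \<alpha>: "\<alpha> \<in> G1" for \<alpha>
      proof -
        have "push x G2 u = proj (img G2 x) (push x G2 u)" by (auto simp: proj_def push_def)
        then have "A (push x G2 u) (V \<alpha> x) =
            (\<Sum>y\<in>img G2 x. blinfun_apply (matrix_coeff A (V \<alpha> x) y) (push x G2 u y))"
          using lp_ops_finite_support[OF AO finite_img[OF G2(1), of x]] g(3) by (metis good_def)
        also have "\<dots> = (\<Sum>\<beta>\<in>G2. blinfun_apply (?m x \<alpha> \<beta>) (u \<beta>))"
          unfolding img_def using g(3) by (subst sum.reindex) (auto simp: good_def push_V[OF g(3)])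
        finally have "?D \<alpha> = (\<Sum>\<beta>\<in>G2. blinfun_apply (?m x \<alpha> \<beta> - a \<alpha> \<beta>) (u \<beta>))"
          using \<alpha> G1(2) Phi_finite[OF G2, of \<alpha> u]
          by (auto simp: pull_def proj_def[of G1] blinfun.diff_left sum_subtractf)
        also have "norm \<dots> \<le> (\<Sum>\<beta>\<in>G2. \<eta> * lp_norm p u)"
        proof (rule sum_norm_le)
          fix \<beta> assume \<beta>: "\<beta> \<in> G2"
          have "norm (blinfun_apply (?m x \<alpha> \<beta> - a \<alpha> \<beta>) (u \<beta>)) \<le> norm (?m x \<alpha> \<beta> - a \<alpha> \<beta>) * norm (u \<beta>)"
            by (rule norm_blinfun)
          also have "\<dots> \<le> \<eta> * lp_norm p u"
            using elim(1) \<alpha> \<beta> \<eta> lp_norm_point[OF u, of \<beta>]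
            by (intro mult_mono) (auto simp: dist_norm intro: less_imp_le)
          finally show "norm (blinfun_apply (?m x \<alpha> \<beta> - a \<alpha> \<beta>) (u \<beta>)) \<le> \<eta> * lp_norm p u" .
        qed
        finally show ?thesis by simp
      qed
      then have "(\<Sum>\<alpha>\<in>G1. norm (?D \<alpha>)) \<le> (\<Sum>\<alpha>\<in>G1. real (card G2) * (\<eta> * lp_norm p u))"
        by (rule sum_mono)
      moreover have "lp_norm p ?D \<le> (\<Sum>\<alpha>\<in>G1. norm (?D \<alpha>))"
        by (rule lp_norm_le[OF lp_le_finite_l1[OF G1(1)]]) (simp add: pull_def proj_def)
      ultimately have "lp_norm p ?D \<le> (real (card G1) * real (card G2) * \<eta>) * lp_norm p u"
        by (simp add: mult.assoc)
      also have "\<dots> \<le> \<epsilon> * lp_norm p u"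
        using mult_div_succ_le[of "real (card G1) * real (card G2)" \<epsilon>] e
        by (intro mult_right_mono lp_norm_nonneg[OF u]) (auto simp: \<eta>_def)
      finally show ?thesis .
    qed
    then show ?case using g(1) by blast
  qed
qed

lemma approximation_ex:
  assumes "finite G1" "G1 \<subseteq> Xw" "finite G2" "G2 \<subseteq> Xw" "0 < \<epsilon>" "\<forall>\<^sub>F x in \<omega>. Q x"
  shows "\<exists>x. Q x \<and> good (G1 \<union> G2) x \<and> good G1 x \<and> good G2 x \<and> (\<forall>u\<in>lps Xw.
    lp_norm p (\<lambda>\<alpha>. pull x G1 (A (push x G2 u)) \<alpha> - proj G1 (\<Phi> (proj G2 u)) \<alpha>) \<le> \<epsilon> * lp_norm p u \<and>
    lp_norm p (proj G1 (\<Phi> (proj G2 u))) \<le> lp_norm p (pull x G1 (A (push x G2 u))) + \<epsilon> * lp_norm p u \<and>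
    lp_norm p (pull x G1 (A (push x G2 u))) \<le> lp_norm p (proj G1 (\<Phi> (proj G2 u))) + \<epsilon> * lp_norm p u)"
proof -
  have "\<forall>\<^sub>F x in \<omega>. Q x \<and> good (G1 \<union> G2) x \<and> (\<forall>u\<in>lps Xw.
    lp_norm p (\<lambda>\<alpha>. pull x G1 (A (push x G2 u)) \<alpha> - proj G1 (\<Phi> (proj G2 u)) \<alpha>) \<le> \<epsilon> * lp_norm p u)"
    using assms(6) approximation[OF assms(1-5)] by (rule eventually_conj)
  then obtain x where x: "Q x" "good (G1 \<union> G2) x"
    and le: "\<And>u. u \<in> lps Xw \<Longrightarrow> lp_norm p (\<lambda>\<alpha>. pull x G1 (A (push x G2 u)) \<alpha> - proj G1 (\<Phi> (proj G2 u)) \<alpha>) \<le> \<epsilon> * lp_norm p u"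
    using eventually_happens'[OF omega_nontrivial] by blast
  show ?thesis
  proof (intro exI[of _ x] conjI ballI x)
    show "good G1 x" "good G2 x" using good_mono[OF x(2)] by auto
    fix u assume u: "u \<in> lps Xw"
    let ?a = "pull x G1 (A (push x G2 u))" and ?b = "proj G1 (\<Phi> (proj G2 u))"
    have a: "?a \<in> lps Xw" by (rule pull_lp[OF assms(1,2)])
    have b: "?b \<in> lps Xw"
      using assms(1,2) by (intro lp_space_finite_support[of G1]) (auto simp: proj_def)
    show "lp_norm p (\<lambda>\<alpha>. ?a \<alpha> - ?b \<alpha>) \<le> \<epsilon> * lp_norm p u" by (rule le[OF u])
    have "?b = (\<lambda>\<alpha>. ?a \<alpha> - (?a \<alpha> - ?b \<alpha>))" by simp
    then have "lp_norm p ?b \<le> lp_norm p ?a + lp_norm p (\<lambda>\<alpha>. ?a \<alpha> - ?b \<alpha>)"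
      using lp_norm_diff[OF a lp_space_diff[OF a b]] by metis
    then show "lp_norm p ?b \<le> lp_norm p ?a + \<epsilon> * lp_norm p u" using le[OF u] by simp
    have "?a = (\<lambda>\<alpha>. ?b \<alpha> + (?a \<alpha> - ?b \<alpha>))" by simp
    then have "lp_norm p ?a \<le> lp_norm p ?b + lp_norm p (\<lambda>\<alpha>. ?a \<alpha> - ?b \<alpha>)"
      using lp_norm_add[OF b lp_space_diff[OF a b]] by metis
    then show "lp_norm p ?a \<le> lp_norm p ?b + \<epsilon> * lp_norm p u" using le[OF u] by simp
  qed
qed

lemma le_of_le_add:
  fixes r s t :: real
  assumes "0 \<le> t" "\<And>\<epsilon>. 0 < \<epsilon> \<Longrightarrow> r \<le> s + \<epsilon> * t"
  shows "r \<le> s"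
proof (rule field_le_epsilon)
  fix e :: real assume e: "0 < e"
  have "r \<le> s + e / (t + 1) * t" using assms e by (intro assms(2)) auto
  also have "e / (t + 1) * t \<le> e" using assms(1) e by (simp add: field_simps)
  finally show "r \<le> s + e" by simp
qed

lemma Phi_finite_bound:
  assumes G1: "finite G1" "G1 \<subseteq> Xw" and G2: "finite G2" "G2 \<subseteq> Xw" and u: "u \<in> lps Xw"
  shows "lp_norm p (proj G1 (\<Phi> (proj G2 u))) \<le> nA * lp_norm p u"
proof (rule le_of_le_add[OF lp_norm_nonneg[OF u]])
  fix \<epsilon> :: real assume e: "0 < \<epsilon>"
  obtain x where x: "good G1 x" "good G2 x"
    "\<And>u. u \<in> lps Xw \<Longrightarrow> lp_norm p (proj G1 (\<Phi> (proj G2 u))) \<le> lp_norm p (pull x G1 (A (push x G2 u))) + \<epsilon> * lp_norm p u"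
    using approximation_ex[OF G1 G2 e eventually_True] by blast
  have w: "push x G2 u \<in> lps X" by (rule push_lp[OF x(2) G2(1)])
  have "lp_norm p (pull x G1 (A (push x G2 u))) \<le> lp_norm p (A (push x G2 u))"
    by (rule norm_pull[OF x(1) lp_ops_mem[OF AO w]])
  also have "\<dots> \<le> nA * lp_norm p (push x G2 u)" by (rule op_norm_bound[OF AO w])
  also have "\<dots> \<le> nA * lp_norm p u" by (intro mult_left_mono nA norm_push[OF x(2) u])
  finally show "lp_norm p (proj G1 (\<Phi> (proj G2 u))) \<le> nA * lp_norm p u + \<epsilon> * lp_norm p u"
    using x(3)[OF u] by simp
qed

text \<open>Quasi-locality of \<open>A\<close>, read off on copies. The inclusion along
  \<open>\<omega>\<close> expresses that \<open>G2\<close> contains the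
  \<open>R\<close>-neighbourhood of \<open>G1\<close> in the limit space. \<open>G3\<close> makes
  the far part finite, so that it can be copied, and does not enter the bound.\<close>

lemma Phi_quasilocal_finite:
  assumes e: "0 < \<epsilon>"
  shows "\<exists>R\<ge>0. \<forall>G1 G2 G3 u. finite G1 \<longrightarrow> G1 \<subseteq> Xw \<longrightarrow> finite G3 \<longrightarrow> G3 \<subseteq> Xw \<longrightarrow>
    finite G2 \<longrightarrow> G2 \<subseteq> Xw \<longrightarrow>
    (\<forall>\<^sub>F x in \<omega>. nbs R (img G1 x) \<subseteq> img G2 x) \<longrightarrow> u \<in> lps Xw \<longrightarrow>
    lp_norm p (proj G1 (\<Phi> (proj (G3 - G2) u))) \<le> \<epsilon> * lp_norm p u \<and>
    lp_norm p (proj (G3 - G2) (\<Phi> (proj G1 u))) \<le> \<epsilon> * lp_norm p u"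
proof -
  obtain R where R: "0 \<le> R" "\<And>F f. F \<subseteq> X \<Longrightarrow> f \<in> lps X \<Longrightarrow>
    lp_norm p (proj F (A (coproj (nbs R F) f))) \<le> \<epsilon> * lp_norm p f \<and>
    lp_norm p (coproj (nbs R F) (A (proj F f))) \<le> \<epsilon> * lp_norm p f"
    using ops_A_quasilocal[OF A e] by auto
  have "lp_norm p (proj G1 (\<Phi> (proj (G3 - G2) u))) \<le> \<epsilon> * lp_norm p u \<and>
    lp_norm p (proj (G3 - G2) (\<Phi> (proj G1 u))) \<le> \<epsilon> * lp_norm p u"
    if G1: "finite G1" "G1 \<subseteq> Xw" and G3: "finite G3" "G3 \<subseteq> Xw" and G2: "finite G2" "G2 \<subseteq> Xw"
      and nb: "\<forall>\<^sub>F x in \<omega>. nbs R (img G1 x) \<subseteq> img G2 x" and u: "u \<in> lps Xw" for G1 G2 G3 u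
  proof -
    have H: "finite (G3 - G2)" "G3 - G2 \<subseteq> Xw" using G3 by auto
    have ev: "\<forall>\<^sub>F x in \<omega>. nbs R (img G1 x) \<subseteq> img G2 x \<and> good (G2 \<union> G3) x"
      using nb eventually_good[of "G2 \<union> G3"] G2 G3 by (intro eventually_conj) auto
    have disj: "img (G3 - G2) x \<inter> nbs R (img G1 x) = {}"
      if "nbs R (img G1 x) \<subseteq> img G2 x \<and> good (G2 \<union> G3) x" for x
      using that unfolding good_def img_def inj_on_def by blast
    have 1: "lp_norm p (proj G1 (\<Phi> (proj (G3 - G2) u))) \<le> \<epsilon> * lp_norm p u"
    proof (rule le_of_le_add[OF lp_norm_nonneg[OF u]])
      fix \<eta> :: real assume \<eta>: "0 < \<eta>"
      obtain x where x: "nbs R (img G1 x) \<subseteq> img G2 x \<and> good (G2 \<union> G3) x" "good G1 x" "good (G3 - G2) x"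
        "\<And>u. u \<in> lps Xw \<Longrightarrow> lp_norm p (proj G1 (\<Phi> (proj (G3 - G2) u)))
            \<le> lp_norm p (pull x G1 (A (push x (G3 - G2) u))) + \<eta> * lp_norm p u"
        using approximation_ex[OF G1 H \<eta> ev] by blast
      let ?w = "push x (G3 - G2) u"
      have w: "?w \<in> lps X" by (rule push_lp[OF x(3) H(1)])
      have cw: "coproj (nbs R (img G1 x)) ?w = ?w"
        using disj[OF x(1)] by (auto simp: coproj_apply push_def fun_eq_iff)
      have "lp_norm p (pull x G1 (A ?w)) \<le> lp_norm p (proj (img G1 x) (A ?w))"
        by (rule norm_pull_proj[OF x(2) G1(1)])
      also have "\<dots> \<le> \<epsilon> * lp_norm p ?w"
        using R(2)[of "img G1 x" ?w] x(2) w cw by (auto simp: good_def)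
      also have "\<dots> \<le> \<epsilon> * lp_norm p u" using e by (intro mult_left_mono norm_push[OF x(3) u]) auto
      finally show "lp_norm p (proj G1 (\<Phi> (proj (G3 - G2) u))) \<le> \<epsilon> * lp_norm p u + \<eta> * lp_norm p u"
        using x(4)[OF u] by simp
    qed
    have 2: "lp_norm p (proj (G3 - G2) (\<Phi> (proj G1 u))) \<le> \<epsilon> * lp_norm p u"
    proof (rule le_of_le_add[OF lp_norm_nonneg[OF u]])
      fix \<eta> :: real assume \<eta>: "0 < \<eta>"
      obtain x where x: "nbs R (img G1 x) \<subseteq> img G2 x \<and> good (G2 \<union> G3) x" "good (G3 - G2) x" "good G1 x"
        "\<And>u. u \<in> lps Xw \<Longrightarrow> lp_norm p (proj (G3 - G2) (\<Phi> (proj G1 u)))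
            \<le> lp_norm p (pull x (G3 - G2) (A (push x G1 u))) + \<eta> * lp_norm p u"
        using approximation_ex[OF H G1 \<eta> ev] by blast
      let ?w = "push x G1 u"
      have w: "?w \<in> lps X" by (rule push_lp[OF x(3) G1(1)])
      have pw: "proj (img G1 x) ?w = ?w" by (auto simp: proj_def push_def)
      let ?c = "coproj (nbs R (img G1 x)) (A ?w)"
      have c: "?c \<in> lps X" by (rule coproj_in_lp[OF lp_ops_mem[OF AO w]])
      have "pull x (G3 - G2) (A ?w) = pull x (G3 - G2) ?c"
        using disj[OF x(1)] by (auto simp: pull_def coproj_apply img_def fun_eq_iff)
      then have "lp_norm p (pull x (G3 - G2) (A ?w)) \<le> lp_norm p ?c"
        using norm_pull[OF x(2) c] by simp
      also have "\<dots> \<le> \<epsilon> * lp_norm p ?w"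
        using R(2)[of "img G1 x" ?w] x(3) w pw by (auto simp: good_def)
      also have "\<dots> \<le> \<epsilon> * lp_norm p u" using e by (intro mult_left_mono norm_push[OF x(3) u]) auto
      finally show "lp_norm p (proj (G3 - G2) (\<Phi> (proj G1 u))) \<le> \<epsilon> * lp_norm p u + \<eta> * lp_norm p u"
        using x(4)[OF u] by simp
    qed
    show ?thesis using 1 2 by blast
  qed
  then show ?thesis using R(1) by blast
qed

abbreviation fin_top :: "'a filter set filter" where "fin_top \<equiv> finite_subsets_at_top Xw"

lemma eventually_fin_top: "\<forall>\<^sub>F G in fin_top. finite G \<and> G \<subseteq> Xw"
  by (simp add: eventually_finite_subsets_at_top_weakI)

text \<open>The finite sums are Cauchy because entries far from \<open>\<alpha>\<close> contribute
  little, by quasi-locality. This covers \<open>p = \<infinity>\<close>, where \<open>u\<close>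
  itself has no decay.\<close>

lemma Phi_summable:
  assumes u: "u \<in> lps Xw" and \<alpha>: "\<alpha> \<in> Xw"
  shows "(\<lambda>\<beta>. blinfun_apply (a \<alpha> \<beta>) (u \<beta>)) summable_on Xw"
proof -
  let ?s = "sum (\<lambda>\<beta>. blinfun_apply (a \<alpha> \<beta>) (u \<beta>))"
  have "\<exists>l. (?s \<longlongrightarrow> l) fin_top"
  proof (rule cauchy_net_converges)
    fix \<epsilon> :: real assume e: "0 < \<epsilon>"
    define \<eta> where "\<eta> = \<epsilon> / (4 * (lp_norm p u + 1))"
    have \<eta>: "0 < \<eta>" "\<eta> * lp_norm p u < \<epsilon> / 2"
      using e lp_norm_nonneg[OF u] by (auto simp: \<eta>_def field_simps intro!: add_pos_nonneg mult_nonneg_nonneg)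
    obtain R where R: "0 \<le> R" "\<And>G1 G2 G3 u. finite G1 \<Longrightarrow> G1 \<subseteq> Xw \<Longrightarrow> finite G3 \<Longrightarrow> G3 \<subseteq> Xw \<Longrightarrow>
      finite G2 \<Longrightarrow> G2 \<subseteq> Xw \<Longrightarrow> \<forall>\<^sub>F x in \<omega>. nbs R (img G1 x) \<subseteq> img G2 x \<Longrightarrow> u \<in> lps Xw \<Longrightarrow>
      lp_norm p (proj G1 (\<Phi> (proj (G3 - G2) u))) \<le> \<eta> * lp_norm p u"
      using Phi_quasilocal_finite[OF \<eta>(1)] by auto
    obtain G2 where G2: "finite G2" "G2 \<subseteq> Xw" "\<forall>\<^sub>F x in \<omega>. nbs R (img {\<alpha>} x) \<subseteq> img G2 x"
      using cover[of "{\<alpha>}" R] \<alpha> R(1) by auto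
    have near: "norm (?s G - ?s G2) < \<epsilon> / 2" if G: "finite G" "G2 \<subseteq> G" "G \<subseteq> Xw" for G
    proof -
      have "?s G - ?s G2 = ?s (G - G2)" using G by (simp add: sum_diff)
      also have "\<dots> = proj {\<alpha>} (\<Phi> (proj (G - G2) u)) \<alpha>"
      proof -
        have "finite (G - G2)" "G - G2 \<subseteq> Xw" using G by auto
        from Phi_finite[OF this \<alpha>, of u] show ?thesis by (simp add: proj_def[of "{\<alpha>}"])
      qed
      also have "norm \<dots> \<le> lp_norm p (proj {\<alpha>} (\<Phi> (proj (G - G2) u)))"
        by (rule lp_norm_point[where S = Xw], rule lp_space_finite_support[of "{\<alpha>}"])
          (use \<alpha> in \<open>auto simp: proj_def[of "{\<alpha>}"]\<close>)
      also have "\<dots> \<le> \<eta> * lp_norm p u" using R(2)[of "{\<alpha>}" G G2 u] \<alpha> G G2 u by auto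
      finally show ?thesis using \<eta>(2) by simp
    qed
    show "\<exists>Q. eventually Q fin_top \<and> (\<forall>x y. Q x \<longrightarrow> Q y \<longrightarrow> dist (?s x) (?s y) < \<epsilon>)"
    proof (intro exI[of _ "\<lambda>G. finite G \<and> G2 \<subseteq> G \<and> G \<subseteq> Xw"] conjI allI impI)
      show "\<forall>\<^sub>F G in fin_top. finite G \<and> G2 \<subseteq> G \<and> G \<subseteq> Xw"
        unfolding eventually_finite_subsets_at_top using G2 by blast
      fix G G' assume "finite G \<and> G2 \<subseteq> G \<and> G \<subseteq> Xw" "finite G' \<and> G2 \<subseteq> G' \<and> G' \<subseteq> Xw"
      then have "norm (?s G - ?s G2) < \<epsilon> / 2" "norm (?s G' - ?s G2) < \<epsilon> / 2" using near by auto
      then show "dist (?s G) (?s G') < \<epsilon>"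
        using norm_triangle_ineq4[of "?s G - ?s G2" "?s G' - ?s G2"] by (simp add: dist_norm)
    qed
  qed simp
  then show ?thesis by (auto simp: summable_on_def has_sum_def)
qed

text \<open>It takes the place of norm convergence of finite truncations, which fails for
  \<open>p = \<infinity>\<close>; with \<open>lp_le_limit\<close> it extends bounds from finite
  pieces to all vectors.\<close>

lemma Phi_tendsto:
  assumes u: "u \<in> lps Xw"
  shows "((\<lambda>G. \<Phi> (proj G u) \<alpha>) \<longlongrightarrow> \<Phi> u \<alpha>) fin_top"
proof (cases "\<alpha> \<in> Xw")
  case True
  have "((\<lambda>G. \<Sum>\<beta>\<in>G. blinfun_apply (a \<alpha> \<beta>) (u \<beta>)) \<longlongrightarrow> \<Phi> u \<alpha>) fin_top"
    using infsum_tendsto[OF Phi_summable[OF u True]] True by (simp add: matrix_op_def)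
  moreover have "\<forall>\<^sub>F G in fin_top. (\<Sum>\<beta>\<in>G. blinfun_apply (a \<alpha> \<beta>) (u \<beta>)) = \<Phi> (proj G u) \<alpha>"
    using eventually_fin_top by eventually_elim (simp add: Phi_finite True)
  ultimately show ?thesis by (rule Lim_transform_eventually)
qed (simp add: Phi_off)

lemma proj_Phi_lp: "finite G \<Longrightarrow> G \<subseteq> Xw \<Longrightarrow> proj G f \<in> lps Xw"
  by (rule lp_space_finite_support[of G]) (auto simp: proj_def)

lemma Phi_bound: "u \<in> lps Xw \<Longrightarrow> lp_le (\<Phi> u) (nA * lp_norm p u)"
proof -
  assume u: "u \<in> lps Xw"
  have "\<forall>\<^sub>F G in fin_top. lp_le (\<Phi> (proj G u)) (nA * lp_norm p u)"
    using eventually_fin_top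
  proof eventually_elim
    case (elim G)
    show ?case
    proof (rule lp_le_finite_pieces)
      fix F :: "'a filter set" assume F: "finite F"
      have "proj F (\<Phi> (proj G u)) = proj (F \<inter> Xw) (\<Phi> (proj G u))"
        by (auto simp: proj_def[of F] proj_def[of "F \<inter> Xw"] Phi_off)
      moreover have "lp_le (proj (F \<inter> Xw) (\<Phi> (proj G u))) (nA * lp_norm p u)"
        using F elim by (intro lp_le_weaken[OF lp_le_norm[OF proj_Phi_lp] Phi_finite_bound] u) auto
      ultimately show "lp_le (proj F (\<Phi> (proj G u))) (nA * lp_norm p u)" by simp
    qed (use nA lp_norm_nonneg[OF u] in auto)
  qed
  from lp_le_limit[OF finite_subsets_at_top_neq_bot this Phi_tendsto[OF u]] show ?thesis .
qed

lemma Phi_quasilocal: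
  assumes e: "0 < \<epsilon>"
  shows "\<exists>R\<ge>0. \<forall>G1 G2 u. finite G1 \<longrightarrow> G1 \<subseteq> Xw \<longrightarrow> finite G2 \<longrightarrow> G2 \<subseteq> Xw \<longrightarrow>
    (\<forall>\<^sub>F x in \<omega>. nbs R (img G1 x) \<subseteq> img G2 x) \<longrightarrow> u \<in> lps Xw \<longrightarrow>
    lp_le (proj G1 (\<Phi> (coproj G2 u))) (\<epsilon> * lp_norm p u) \<and>
    lp_le (coproj G2 (\<Phi> (proj G1 u))) (\<epsilon> * lp_norm p u)"
proof -
  obtain R where R: "0 \<le> R" "\<And>G1 G2 G3 u. finite G1 \<Longrightarrow> G1 \<subseteq> Xw \<Longrightarrow> finite G3 \<Longrightarrow> G3 \<subseteq> Xw \<Longrightarrow>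
      finite G2 \<Longrightarrow> G2 \<subseteq> Xw \<Longrightarrow> \<forall>\<^sub>F x in \<omega>. nbs R (img G1 x) \<subseteq> img G2 x \<Longrightarrow> u \<in> lps Xw \<Longrightarrow>
      lp_norm p (proj G1 (\<Phi> (proj (G3 - G2) u))) \<le> \<epsilon> * lp_norm p u \<and>
      lp_norm p (proj (G3 - G2) (\<Phi> (proj G1 u))) \<le> \<epsilon> * lp_norm p u"
    using Phi_quasilocal_finite[OF e] by auto
  have "lp_le (proj G1 (\<Phi> (coproj G2 u))) (\<epsilon> * lp_norm p u) \<and>
    lp_le (coproj G2 (\<Phi> (proj G1 u))) (\<epsilon> * lp_norm p u)"
    if G1: "finite G1" "G1 \<subseteq> Xw" and G2: "finite G2" "G2 \<subseteq> Xw"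
      and nb: "\<forall>\<^sub>F x in \<omega>. nbs R (img G1 x) \<subseteq> img G2 x" and u: "u \<in> lps Xw" for G1 G2 u
  proof
    have pc: "proj G (coproj G2 u) = proj (G - G2) u" for G by (auto simp: proj_def coproj_apply)
    show "lp_le (proj G1 (\<Phi> (coproj G2 u))) (\<epsilon> * lp_norm p u)"
    proof (rule lp_le_limit[where F = fin_top and f = "\<lambda>G. proj G1 (\<Phi> (proj G (coproj G2 u)))"])
      show "\<forall>\<^sub>F G in fin_top. lp_le (proj G1 (\<Phi> (proj G (coproj G2 u)))) (\<epsilon> * lp_norm p u)"
        using eventually_fin_top
      proof eventually_elim
        case (elim G)
        show ?case unfolding pc
          using lp_le_weaken[OF lp_le_norm[OF proj_Phi_lp[OF G1]]] R(2)[OF G1 _ _ G2 nb u, of G] elim by auto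
      qed
      show "((\<lambda>G. proj G1 (\<Phi> (proj G (coproj G2 u))) \<alpha>) \<longlongrightarrow> proj G1 (\<Phi> (coproj G2 u)) \<alpha>) fin_top" for \<alpha>
        using Phi_tendsto[OF coproj_in_lp[OF u, of G2], of \<alpha>] by (simp add: proj_def[of G1])
    qed simp
    show "lp_le (coproj G2 (\<Phi> (proj G1 u))) (\<epsilon> * lp_norm p u)"
    proof (rule lp_le_finite_pieces)
      fix F :: "'a filter set" assume F: "finite F"
      have "proj F (coproj G2 (\<Phi> (proj G1 u))) = proj (F \<inter> Xw - G2) (\<Phi> (proj G1 u))"
        by (auto simp: proj_def[of F] proj_def[of "F \<inter> Xw - G2"] coproj_apply Phi_off)
      then show "lp_le (proj F (coproj G2 (\<Phi> (proj G1 u)))) (\<epsilon> * lp_norm p u)"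
        using lp_le_weaken[OF lp_le_norm[OF proj_Phi_lp[of "F \<inter> Xw - G2"]]] R(2)[OF G1 _ _ G2 nb u, of "F \<inter> Xw"] F by auto
    qed (use e lp_norm_nonneg[OF u] in auto)
  qed
  then show ?thesis using R(1) by blast
qed

lemma Phi_local_ex:
  assumes e: "0 < \<epsilon>" and G: "finite G" "G \<subseteq> Xw"
  shows "\<exists>G'. finite G' \<and> G' \<subseteq> Xw \<and> G \<subseteq> G' \<and> (\<forall>u\<in>lps Xw.
    lp_le (proj G (\<Phi> (coproj G' u))) (\<epsilon> * lp_norm p u) \<and>
    lp_le (coproj G' (\<Phi> (proj G u))) (\<epsilon> * lp_norm p u))"
proof -
  obtain R where R: "0 \<le> R" "\<And>G1 G2 u. finite G1 \<Longrightarrow> G1 \<subseteq> Xw \<Longrightarrow> finite G2 \<Longrightarrow> G2 \<subseteq> Xw \<Longrightarrow>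
    \<forall>\<^sub>F x in \<omega>. nbs R (img G1 x) \<subseteq> img G2 x \<Longrightarrow> u \<in> lps Xw \<Longrightarrow>
    lp_le (proj G1 (\<Phi> (coproj G2 u))) (\<epsilon> * lp_norm p u) \<and>
    lp_le (coproj G2 (\<Phi> (proj G1 u))) (\<epsilon> * lp_norm p u)"
    using Phi_quasilocal[OF e] by auto
  obtain G' where G': "finite G'" "G' \<subseteq> Xw" "G \<subseteq> G'" "\<forall>\<^sub>F x in \<omega>. nbs R (img G x) \<subseteq> img G' x"
    using cover[OF G R(1)] by auto
  show ?thesis using G'(1-3) R(2)[OF G G'(1,2,4)] by blast
qed

lemma Phi_add:
  assumes "u \<in> lps Xw" "v \<in> lps Xw"
  shows "\<Phi> (\<lambda>\<alpha>. u \<alpha> + v \<alpha>) = (\<lambda>\<alpha>. \<Phi> u \<alpha> + \<Phi> v \<alpha>)"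
  using infsum_add[OF Phi_summable[OF assms(1)] Phi_summable[OF assms(2)]]
  by (auto simp: matrix_op_def blinfun.add_right)

lemma Phi_sc:
  assumes "u \<in> lps Xw"
  shows "\<Phi> (\<lambda>\<alpha>. sc c (u \<alpha>)) = (\<lambda>\<alpha>. sc c (\<Phi> u \<alpha>))"
proof
  fix \<alpha>
  show "\<Phi> (\<lambda>\<alpha>. sc c (u \<alpha>)) \<alpha> = sc c (\<Phi> u \<alpha>)"
  proof (cases "\<alpha> \<in> Xw")
    case True
    have "((\<lambda>\<beta>. sc c (blinfun_apply (a \<alpha> \<beta>) (u \<beta>))) has_sum sc c (\<Phi> u \<alpha>)) Xw"
      using has_sum_bounded_linear[OF bounded_linear_sc has_sum_infsum[OF Phi_summable[OF assms True]]] True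
      by (simp add: matrix_op_def)
    then have "(\<Sum>\<^sub>\<infinity>\<beta>\<in>Xw. sc c (blinfun_apply (a \<alpha> \<beta>) (u \<beta>))) = sc c (\<Phi> u \<alpha>)" by (rule infsumI)
    then show ?thesis using True by (simp add: matrix_op_def entries_linear cong: infsum_cong)
  qed (simp add: Phi_off)
qed

lemma Phi_ops: "\<Phi> \<in> lp_ops sc p Xw"
proof (rule lp_opsI[where C = nA])
  fix u assume u: "u \<in> lps Xw"
  show "lp_norm p (\<Phi> u) \<le> nA * lp_norm p u" by (rule lp_norm_le[OF Phi_bound[OF u]])
  show "\<Phi> u \<in> lps Xw"
  proof (rule lp_spaceI0[OF Phi_bound[OF u]])
    fix \<epsilon> :: real assume p0: "p = 0" and e: "0 < \<epsilon>"
    \<comment> \<open>For \<open>p = 0\<close>: off \<open>H\<close> the vector is small and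
      \<open>\<Phi>\<close> is bounded, while on \<open>H\<close> quasi-locality confines the image
      to \<open>G\<close> up to a small error. Each part contributes at most
      \<open>\<epsilon> / 4\<close>.\<close>
    have c: "0 < \<epsilon> / (4 * (nA + 1))" "0 < \<epsilon> / (4 * (lp_norm p u + 1))"
      using e nA lp_norm_nonneg[OF u] by auto
    obtain H where H: "finite H" "H \<subseteq> Xw" "lp_le (coproj H u) (\<epsilon> / (4 * (nA + 1)))"
      using lp_space_vanish[OF u p0_ne_inf[OF p0] c(1)] by blast
    obtain G where G: "finite G"
        "\<And>v. v \<in> lps Xw \<Longrightarrow> lp_le (coproj G (\<Phi> (proj H v))) (\<epsilon> / (4 * (lp_norm p u + 1)) * lp_norm p v)"
      using Phi_local_ex[OF c(2) H(1,2)] by blast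
    have "norm (\<Phi> u \<alpha>) < \<epsilon>" if \<alpha>: "\<alpha> \<notin> G" for \<alpha>
    proof -
      have "u = (\<lambda>\<alpha>. proj H u \<alpha> + coproj H u \<alpha>)" by (auto simp: proj_def coproj_apply)
      then have eq: "\<Phi> u = (\<lambda>\<alpha>. \<Phi> (proj H u) \<alpha> + \<Phi> (coproj H u) \<alpha>)"
        using Phi_add[OF proj_in_lp[OF u, of H] coproj_in_lp[OF u, of H]] by simp
      have "norm (\<Phi> (proj H u) \<alpha>) \<le> \<epsilon> / (4 * (lp_norm p u + 1)) * lp_norm p u"
        using lp_le_point[OF G(2)[OF u], of \<alpha>] \<alpha> by (simp add: coproj_apply)
      also have "\<dots> \<le> \<epsilon> / 4" using e lp_norm_nonneg[OF u] by (simp add: field_simps)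
      finally have 1: "norm (\<Phi> (proj H u) \<alpha>) \<le> \<epsilon> / 4" .
      have "norm (\<Phi> (coproj H u) \<alpha>) \<le> nA * lp_norm p (coproj H u)"
        by (rule lp_le_point[OF Phi_bound[OF coproj_in_lp[OF u]]])
      also have "\<dots> \<le> nA * (\<epsilon> / (4 * (nA + 1)))" by (intro mult_left_mono nA lp_norm_le[OF H(3)])
      also have "\<dots> \<le> \<epsilon> / 4" using e nA by (simp add: field_simps)
      finally have "norm (\<Phi> (coproj H u) \<alpha>) \<le> \<epsilon> / 4" .
      then have "norm (\<Phi> (proj H u) \<alpha> + \<Phi> (coproj H u) \<alpha>) \<le> \<epsilon> / 4 + \<epsilon> / 4"
        using 1 norm_triangle_ineq[of "\<Phi> (proj H u) \<alpha>" "\<Phi> (coproj H u) \<alpha>"] by linarith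
      then show ?thesis unfolding eq using e by simp
    qed
    then show "\<exists>F. finite F \<and> (\<forall>\<alpha>. \<alpha> \<notin> F \<longrightarrow> norm (\<Phi> u \<alpha>) < \<epsilon>)" using G(1) by blast
  qed (rule Phi_off)
qed (simp_all add: Phi_add Phi_sc)

end

section \<open>Cutoffs around finite sets and lower bounds at infinity\<close>

context bg_space
begin

text \<open>A maximum of cutoffs keeps the Lipschitz constant \<open>L\<close> however many points
  \<open>F\<close> has; a sum would not.\<close>

definition hat :: "'a set \<Rightarrow> real \<Rightarrow> 'a \<Rightarrow> real" where
  "hat F L y = Max (insert 0 ((\<lambda>c. cutoff c 0 L y) ` F))"

lemma slow_hat:
  assumes F: "finite F" "F \<subseteq> X" and L: "0 < L"
  shows "slow L (hat F L)"
proof -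
  have le: "hat F L x \<le> hat F L y + L * d x y" if "x \<in> X" "y \<in> X" for x y
  proof -
    have "hat F L x \<in> insert 0 ((\<lambda>c. cutoff c 0 L x) ` F)"
      unfolding hat_def using F(1) by (intro Max_in) auto
    then show ?thesis
    proof
      assume "hat F L x = 0"
      moreover have "0 \<le> hat F L y" unfolding hat_def using F(1) by (intro Max_ge) auto
      moreover have "0 \<le> L * d x y" using L by simp
      ultimately show ?thesis by linarith
    next
      assume "hat F L x \<in> (\<lambda>c. cutoff c 0 L x) ` F"
      then obtain c where c: "c \<in> F" "hat F L x = cutoff c 0 L x" by auto
      have "\<bar>cutoff c 0 L x - cutoff c 0 L y\<bar> \<le> L * d x y"
        using slow_cutoff[of c L 0] c F(2) L that unfolding slow_def by blast
      moreover have "cutoff c 0 L y \<le> hat F L y" unfolding hat_def using F(1) c(1) by (intro Max_ge) auto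
      ultimately show ?thesis using c(2) by linarith
    qed
  qed
  have "0 \<le> hat F L x \<and> hat F L x \<le> 1" for x
    unfolding hat_def using F(1) by (auto simp: Max_ge_iff cutoff_def)
  moreover have "\<bar>hat F L x - hat F L y\<bar> \<le> L * d x y" if "x \<in> X" "y \<in> X" for x y
    using le[OF that] le[OF that(2,1)] by (simp add: commute abs_le_iff)
  ultimately show ?thesis by (simp add: slow_def)
qed

lemma hat_one:
  assumes "finite F" "F \<subseteq> X" "0 < L" "y \<in> F" shows "hat F L y = 1"
proof -
  have "cutoff y 0 L y = 1" using assms by (intro cutoff_one) auto
  then have "1 \<in> insert 0 ((\<lambda>c. cutoff c 0 L y) ` F)" using assms(4) by force
  then have "1 \<le> hat F L y" unfolding hat_def using assms(1) by (intro Max_ge) auto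
  then show ?thesis using slow_hat[OF assms(1-3)] by (metis antisym slow_def)
qed

lemma hat_zero:
  assumes "finite F" "F \<subseteq> X" "0 < L" "y \<in> X" "y \<notin> nbs (1 / L) F" shows "hat F L y = 0"
proof -
  have "cutoff c 0 L y = 0" if "c \<in> F" for c
  proof (rule cutoff_zero[OF assms(3)])
    show "0 + 1 / L < d c y" using assms(4,5) that by (force simp: nbs_mem)
  qed
  then have *: "insert 0 ((\<lambda>c. cutoff c 0 L y) ` F) = {0}" by auto
  show ?thesis unfolding hat_def * by simp
qed

definition below_at_infinity :: "(('a \<Rightarrow> 'e) \<Rightarrow> ('a \<Rightarrow> 'e)) \<Rightarrow> real \<Rightarrow> bool" where
  "below_at_infinity A \<delta> \<longleftrightarrow> 0 < \<delta> \<and> (\<exists>F. finite F \<and> F \<subseteq> X \<and>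
     (\<forall>v\<in>lps X. (\<forall>x\<in>F. v x = 0) \<longrightarrow> \<delta> * lp_norm p v \<le> lp_norm p (A v)))"

end

section \<open>Uniqueness, lower bounds and almost null vectors of limit operators\<close>

context limit_operator
begin

lemma Phi_delta:
  assumes "\<alpha> \<in> Xw" "\<beta> \<in> Xw" shows "\<Phi> (delta \<beta> e) \<alpha> = blinfun_apply (a \<alpha> \<beta>) e"
proof -
  have "delta \<beta> e = proj {\<beta>} (\<lambda>_. e)" by (auto simp: delta_def proj_def)
  then show ?thesis using Phi_finite[of "{\<beta>}" \<alpha> "\<lambda>_. e"] assms by simp
qed

lemma Phi_in_S: "\<Phi> \<in> ops_S sc p Xw"
  unfolding ops_S_iff
proof (intro conjI allI impI Phi_ops)
  fix F' and \<epsilon> :: real assume F': "finite F' \<and> F' \<subseteq> Xw" and e: "0 < \<epsilon>"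
  then obtain G' where G': "finite G'" "G' \<subseteq> Xw"
      "\<forall>u\<in>lps Xw. lp_le (proj F' (\<Phi> (coproj G' u))) (\<epsilon> * lp_norm p u)"
    using Phi_local_ex[OF e, of F'] by blast
  then show "\<exists>F. finite F \<and> F \<subseteq> Xw \<and> (\<forall>u\<in>lps Xw. lp_norm p (proj F' (\<Phi> (coproj F u))) \<le> \<epsilon> * lp_norm p u)"
    using lp_norm_le by blast
qed

text \<open>For \<open>p = \<infinity>\<close> a matrix does not determine a bounded operator in
  general. Membership in \<open>ops_S\<close> makes the contribution of the far part of
  \<open>u\<close> at a given \<open>\<alpha>\<close> small, and the near part is finite and seen by
  the matrix.\<close>

lemma ops_S_determined:
  assumes T: "T \<in> ops_S sc p Xw" and u: "u \<in> lps Xw"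
    and m: "\<And>\<alpha> \<beta>. \<alpha> \<in> Xw \<Longrightarrow> \<beta> \<in> Xw \<Longrightarrow> matrix_coeff T \<alpha> \<beta> = a \<alpha> \<beta>"
  shows "T u = \<Phi> u"
proof
  fix \<alpha>
  have TO: "T \<in> lp_ops sc p Xw" using T by (simp add: ops_S_def)
  show "T u \<alpha> = \<Phi> u \<alpha>"
  proof (cases "\<alpha> \<in> Xw")
    case True
    have "norm (T u \<alpha> - \<Phi> u \<alpha>) \<le> 0"
    proof (rule le_of_le_add)
      fix \<epsilon> :: real assume e: "0 < \<epsilon>"
      have "finite {\<alpha>} \<and> {\<alpha>} \<subseteq> Xw" using True by simp
      then obtain F where F: "finite F" "F \<subseteq> Xw"
          "\<And>v. v \<in> lps Xw \<Longrightarrow> lp_norm p (proj {\<alpha>} (T (coproj F v))) \<le> \<epsilon> * lp_norm p v"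
        using T[unfolded ops_S_iff] e by meson
      have \<alpha>1: "finite {\<alpha>}" "{\<alpha>} \<subseteq> Xw" using True by auto
      obtain G where G: "finite G" "G \<subseteq> Xw"
          "\<And>v. v \<in> lps Xw \<Longrightarrow> lp_le (proj {\<alpha>} (\<Phi> (coproj G v))) (\<epsilon> * lp_norm p v)"
        using Phi_local_ex[OF e \<alpha>1] by blast
      define H where "H = F \<union> G"
      have H: "finite H" "H \<subseteq> Xw" using F G by (auto simp: H_def)
      have cu: "coproj H u \<in> lps Xw" and pu: "proj H u \<in> lps Xw" using coproj_in_lp[OF u] proj_in_lp[OF u] by auto
      have eq: "u = (\<lambda>\<alpha>. proj H u \<alpha> + coproj H u \<alpha>)" by (auto simp: proj_def coproj_apply)
      have "T u \<alpha> = T (proj H u) \<alpha> + T (coproj H u) \<alpha>"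
        using lp_ops_add[OF TO pu cu] eq by metis
      moreover have "\<Phi> u \<alpha> = \<Phi> (proj H u) \<alpha> + \<Phi> (coproj H u) \<alpha>"
        using Phi_add[OF pu cu] eq by metis
      moreover have "T (proj H u) \<alpha> = \<Phi> (proj H u) \<alpha>"
        using lp_ops_finite_support[OF TO H, of u \<alpha>] Phi_finite[OF H True, of u] m[OF True] H(2)
        by (auto intro!: sum.cong)
      moreover have "norm (T (coproj H u) \<alpha>) \<le> \<epsilon> * lp_norm p u"
      proof -
        have "coproj F (coproj H u) = coproj H u" by (simp add: coproj_coproj H_def Un_assoc[symmetric])
        then have "lp_norm p (proj {\<alpha>} (T (coproj H u))) \<le> \<epsilon> * lp_norm p (coproj H u)"
          using F(3)[OF cu] by simp
        moreover have "norm (proj {\<alpha>} (T (coproj H u)) \<alpha>) \<le> lp_norm p (proj {\<alpha>} (T (coproj H u)))"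
          by (rule lp_norm_point[OF proj_in_lp[OF lp_ops_mem[OF TO cu]]])
        moreover have "\<epsilon> * lp_norm p (coproj H u) \<le> \<epsilon> * lp_norm p u"
          using e by (intro mult_left_mono lp_norm_coproj[OF u]) auto
        ultimately show ?thesis by (simp add: proj_def[of "{\<alpha>}"])
      qed
      moreover have "norm (\<Phi> (coproj H u) \<alpha>) \<le> \<epsilon> * lp_norm p u"
      proof -
        have "coproj G (coproj H u) = coproj H u" by (auto simp: coproj_apply H_def)
        then have "norm (proj {\<alpha>} (\<Phi> (coproj H u)) \<alpha>) \<le> \<epsilon> * lp_norm p (coproj H u)"
          using lp_le_point[OF G(3)[OF cu], of \<alpha>] by simp
        moreover have "\<epsilon> * lp_norm p (coproj H u) \<le> \<epsilon> * lp_norm p u"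
          using e by (intro mult_left_mono lp_norm_coproj[OF u]) auto
        ultimately show ?thesis by (simp add: proj_def[of "{\<alpha>}"])
      qed
      ultimately show "norm (T u \<alpha> - \<Phi> u \<alpha>) \<le> 0 + \<epsilon> * (2 * lp_norm p u)"
        using norm_triangle_ineq4[of "T (coproj H u) \<alpha>" "\<Phi> (coproj H u) \<alpha>"] by simp
    qed (use lp_norm_nonneg[OF u] in simp)
    then show ?thesis by simp
  qed (use lp_space_supp[OF lp_ops_mem[OF TO u]] in \<open>simp add: Phi_off\<close>)
qed

text \<open>It replaces the definite description for \<open>p = \<infinity>\<close> by the matrix
  operator, so that all exponents are handled through \<open>\<Phi>\<close>.\<close>

lemma limit_op_apply:
  assumes u: "u \<in> lps Xw"
  shows "limit_op sc p X d \<omega> A u = \<Phi> u"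
proof (cases "p = \<infinity>")
  case True
  define T where "T = restrict \<Phi> (lps Xw)"
  have TS: "T \<in> ops_S sc p Xw"
    unfolding ops_S_iff
  proof (intro conjI allI impI)
    show "T \<in> lp_ops sc p Xw" by (rule lp_ops_cong[OF Phi_ops]) (simp add: T_def)
    fix F' and \<epsilon> :: real assume F': "finite F' \<and> F' \<subseteq> Xw" and e: "0 < \<epsilon>"
    then show "\<exists>F. finite F \<and> F \<subseteq> Xw \<and> (\<forall>u\<in>lps Xw. lp_norm p (proj F' (T (coproj F u))) \<le> \<epsilon> * lp_norm p u)"
      using Phi_in_S[unfolded ops_S_iff] by (simp add: T_def coproj_in_lp)
  qed
  then have TO: "T \<in> lp_ops sc p Xw" by (simp add: ops_S_def)
  have mT: "matrix_coeff T \<alpha> \<beta> = a \<alpha> \<beta>" if "\<alpha> \<in> Xw" "\<beta> \<in> Xw" for \<alpha> \<beta>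
  proof (rule blinfun_eqI)
    fix e
    have "delta \<beta> e \<in> lps Xw" by (rule delta_in_lp[OF that(2)])
    then show "blinfun_apply (matrix_coeff T \<alpha> \<beta>) e = blinfun_apply (a \<alpha> \<beta>) e"
      using matrix_coeff_apply[OF TO that(2), of \<alpha> e] Phi_delta[OF that, of e]
      by (simp add: T_def)
  qed
  have "limit_op sc p X d \<omega> A = T"
    unfolding limit_op_def if_P[OF True]
  proof (rule the_equality)
    show "T \<in> ops_S sc \<infinity> Xw \<and> T \<in> extensional (lp_space \<infinity> Xw) \<and>
      (\<forall>\<alpha>\<in>Xw. \<forall>\<beta>\<in>Xw. matrix_coeff T \<alpha> \<beta> = a \<alpha> \<beta>)"
      unfolding True[symmetric] using TS mT by (simp add: T_def)
    fix U assume U: "U \<in> ops_S sc \<infinity> Xw \<and> U \<in> extensional (lp_space \<infinity> Xw) \<and>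
      (\<forall>\<alpha>\<in>Xw. \<forall>\<beta>\<in>Xw. matrix_coeff U \<alpha> \<beta> = a \<alpha> \<beta>)"
    then have U': "U \<in> ops_S sc p Xw" "U \<in> extensional (lps Xw)"
        "\<And>\<alpha> \<beta>. \<alpha> \<in> Xw \<Longrightarrow> \<beta> \<in> Xw \<Longrightarrow> matrix_coeff U \<alpha> \<beta> = a \<alpha> \<beta>"
      unfolding True[symmetric] by auto
    show "U = T"
      by (rule extensionalityI[OF U'(2)])
        (use ops_S_determined[OF U'(1) _ U'(3)] in \<open>simp_all add: T_def\<close>)
  qed
  then show ?thesis using u by (simp add: T_def)
qed (simp add: limit_op_def)

lemma limit_op_ops: "limit_op sc p X d \<omega> A \<in> lp_ops sc p Xw"
  by (rule lp_ops_cong[OF Phi_ops limit_op_apply])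

text \<open>The lower bound is localised by a slow cutoff \<open>h\<close> around the copy of
  \<open>G0\<close>: far out the cut-off vector avoids the exceptional finite set, the commutator is
  small, and on \<open>X\<close> the cutoff vanishes off the copy of \<open>G\<close>. The local
  form is what makes nets of approximate solutions converge pointwise.\<close>

lemma local_lower_bound:
  assumes below: "below_at_infinity A \<delta>" and e: "0 < \<epsilon>"
  shows "\<exists>R\<ge>0. \<forall>G0 G u. finite G0 \<longrightarrow> G0 \<subseteq> Xw \<longrightarrow> finite G \<longrightarrow> G \<subseteq> Xw \<longrightarrow>
    (\<forall>\<^sub>F x in \<omega>. nbs R (img G0 x) \<subseteq> img G x) \<longrightarrow> u \<in> lps Xw \<longrightarrow>
    \<delta> * lp_norm p (proj G0 u) \<le> lp_norm p (proj G (\<Phi> u)) + \<epsilon> * lp_norm p u"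
proof -
  obtain F0 where \<delta>: "0 < \<delta>" and F0: "finite F0" "F0 \<subseteq> X"
      and low: "\<And>v. v \<in> lps X \<Longrightarrow> \<forall>x\<in>F0. v x = 0 \<Longrightarrow> \<delta> * lp_norm p v \<le> lp_norm p (A v)"
    using below unfolding below_at_infinity_def by blast
  \<comment> \<open>One third each for the commutator, for replacing \<open>A\<close> by
    \<open>\<Phi>\<close> on finite pieces, and for truncating \<open>u\<close> to a finite
    set.\<close>
  have e2: "0 < \<epsilon> / 3" using e by simp
  obtain L where L: "0 < L" "\<And>h f. slow L h \<Longrightarrow> f \<in> lps X \<Longrightarrow> lp_norm p (comm A h f) \<le> \<epsilon> / 3 * lp_norm p f"
    using comm_small[OF A e2] by blast
  have fin: "\<delta> * lp_norm p (proj G0 u) \<le> lp_norm p (proj G (\<Phi> (proj H u))) + 2 * \<epsilon> / 3 * lp_norm p u"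
    if G0: "finite G0" "G0 \<subseteq> Xw" and G: "finite G" "G \<subseteq> Xw" and H: "finite H" "H \<subseteq> Xw" "G0 \<subseteq> H"
      and nb: "\<forall>\<^sub>F x in \<omega>. nbs (1 / L) (img G0 x) \<subseteq> img G x" and u: "u \<in> lps Xw" for G0 G H u
  proof -
    have "\<forall>\<^sub>F x in \<omega>. nbs (1 / L) (img G0 x) \<subseteq> img G x \<and> img H x \<inter> F0 = {}"
      by (rule eventually_conj[OF nb eventually_avoids[OF H(1,2) F0]])
    then obtain x where x: "nbs (1 / L) (img G0 x) \<subseteq> img G x" "img H x \<inter> F0 = {}" "good G x" "good H x"
      and ap: "lp_norm p (pull x G (A (push x H u))) \<le> lp_norm p (proj G (\<Phi> (proj H u))) + \<epsilon> / 3 * lp_norm p u"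
      using approximation_ex[OF G H(1,2) e2] u by blast
    have g0: "good G0 x" by (rule good_mono[OF x(4) H(3)])
    then have i0: "finite (img G0 x)" "img G0 x \<subseteq> X" using finite_img[OF G0(1)] by (auto simp: good_def)
    define w where "w = push x H u"
    define h where "h = hat (img G0 x) L"
    have h: "slow L h" unfolding h_def by (rule slow_hat[OF i0 L(1)])
    note habs = slow_abs[OF h]
    have w: "w \<in> lps X" unfolding w_def by (rule push_lp[OF x(4) H(1)])
    have wn: "lp_norm p w \<le> lp_norm p u" unfolding w_def by (rule norm_push[OF x(4) u])
    have v: "mul h w \<in> lps X" by (rule mul_lp[OF habs w])
    have "\<forall>y\<in>F0. mul h w y = 0" using x(2) by (auto simp: mul_def w_def push_def)
    then have "\<delta> * lp_norm p (mul h w) \<le> lp_norm p (A (mul h w))" by (rule low[OF v])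
    also have "A (mul h w) = (\<lambda>y. comm A h w y + mul h (A w) y)" by (simp add: comm_def)
    also have "lp_norm p \<dots> \<le> lp_norm p (comm A h w) + lp_norm p (mul h (A w))"
      by (rule lp_norm_add[of _ X _ X, OF comm_mem[of A h, OF AO habs w] mul_lp[OF habs lp_ops_mem[OF AO w]]])
    also have "lp_norm p (comm A h w) \<le> \<epsilon> / 3 * lp_norm p w" by (rule L(2)[OF h w])
    also have "\<epsilon> / 3 * lp_norm p w \<le> \<epsilon> / 3 * lp_norm p u" using e wn by (intro mult_left_mono) auto
    also have "lp_norm p (mul h (A w)) \<le> lp_norm p (proj (img G x) (A w))"
    proof (rule lp_norm_dom[OF proj_in_lp[OF lp_ops_mem[OF AO w]]])
      fix y
      show "norm (mul h (A w) y) \<le> norm (proj (img G x) (A w) y)"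
      proof (cases "y \<in> img G x")
        case True
        then show ?thesis using habs[of y] mult_right_mono[of "\<bar>h y\<bar>" 1 "norm (A w y)"]
          by (simp add: mul_def proj_def)
      next
        case False
        then have "h y = 0 \<or> A w y = 0"
          using hat_zero[OF i0 L(1), of y] x(1) lp_space_supp[OF lp_ops_mem[OF AO w], of y]
          unfolding h_def by blast
        then show ?thesis by (auto simp: mul_def)
      qed
    qed
    also have "\<dots> \<le> lp_norm p (pull x G (A w))" by (rule norm_proj_img[OF x(3) G])
    also have "\<dots> \<le> lp_norm p (proj G (\<Phi> (proj H u))) + \<epsilon> / 3 * lp_norm p u" using ap by (simp add: w_def)
    finally have 1: "\<delta> * lp_norm p (mul h w) \<le>
        lp_norm p (proj G (\<Phi> (proj H u))) + 2 * \<epsilon> / 3 * lp_norm p u" by simp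
    have "pull x G0 (mul h w) = proj G0 u"
    proof
      fix \<alpha>
      show "pull x G0 (mul h w) \<alpha> = proj G0 u \<alpha>"
      proof (cases "\<alpha> \<in> G0")
        case True
        then have "h (V \<alpha> x) = 1" unfolding h_def by (intro hat_one[OF i0 L(1)]) (simp add: img_def)
        moreover have "w (V \<alpha> x) = u \<alpha>" unfolding w_def using push_V[OF x(4)] True H(3) by blast
        ultimately show ?thesis using True by (simp add: pull_def proj_def mul_def)
      qed (simp add: pull_def proj_def)
    qed
    then have "lp_norm p (proj G0 u) \<le> lp_norm p (mul h w)" using norm_pull[OF g0 v] by simp
    then have "\<delta> * lp_norm p (proj G0 u) \<le> \<delta> * lp_norm p (mul h w)" using \<delta> by (intro mult_left_mono) auto
    then show ?thesis using 1 by linarith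
  qed
  have "\<delta> * lp_norm p (proj G0 u) \<le> lp_norm p (proj G (\<Phi> u)) + \<epsilon> * lp_norm p u"
    if G0: "finite G0" "G0 \<subseteq> Xw" and G: "finite G" "G \<subseteq> Xw"
      and nb: "\<forall>\<^sub>F x in \<omega>. nbs (1 / L) (img G0 x) \<subseteq> img G x" and u: "u \<in> lps Xw" for G0 G u
  proof -
    obtain G' where G': "finite G'" "G' \<subseteq> Xw"
        "\<And>u. u \<in> lps Xw \<Longrightarrow> lp_le (proj G (\<Phi> (coproj G' u))) (\<epsilon> / 3 * lp_norm p u)"
      using Phi_local_ex[OF e2 G] by blast
    \<comment> \<open>\<open>G0\<close> is included so that \<open>u\<close> is seen there
      unchanged, \<open>G'\<close> so that the part of \<open>u\<close> off \<open>H\<close> is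
      hardly felt in \<open>G\<close>.\<close>
    define H where "H = G0 \<union> G'"
    have H: "finite H" "H \<subseteq> Xw" "G0 \<subseteq> H" using G0 G' by (auto simp: H_def)
    have pu: "proj H u \<in> lps Xw" and cu: "coproj H u \<in> lps Xw" using proj_in_lp[OF u] coproj_in_lp[OF u] by auto
    have "u = (\<lambda>\<alpha>. proj H u \<alpha> + coproj H u \<alpha>)" by (auto simp: proj_def coproj_apply)
    then have "\<Phi> u = (\<lambda>\<alpha>. \<Phi> (proj H u) \<alpha> + \<Phi> (coproj H u) \<alpha>)" using Phi_add[OF pu cu] by simp
    then have "proj G (\<Phi> (proj H u)) = (\<lambda>\<alpha>. proj G (\<Phi> u) \<alpha> - proj G (\<Phi> (coproj H u)) \<alpha>)"
      by (auto simp: proj_def[of G])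
    then have "lp_norm p (proj G (\<Phi> (proj H u))) \<le> lp_norm p (proj G (\<Phi> u)) + lp_norm p (proj G (\<Phi> (coproj H u)))"
      using lp_norm_diff[OF proj_Phi_lp[OF G] proj_Phi_lp[OF G]] by simp
    also have "lp_norm p (proj G (\<Phi> (coproj H u))) \<le> \<epsilon> / 3 * lp_norm p u"
    proof -
      have "coproj G' (coproj H u) = coproj H u" by (auto simp: coproj_apply H_def)
      then have "lp_norm p (proj G (\<Phi> (coproj H u))) \<le> \<epsilon> / 3 * lp_norm p (coproj H u)"
        using lp_norm_le[OF G'(3)[OF cu]] by simp
      also have "\<dots> \<le> \<epsilon> / 3 * lp_norm p u" using e by (intro mult_left_mono lp_norm_coproj[OF u]) auto
      finally show ?thesis .
    qed
    finally show ?thesis using fin[OF G0 G H nb u] by simp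
  qed
  then show ?thesis using L(1) by (intro exI[of _ "1 / L"]) auto
qed

text \<open>The constant \<open>\<delta>\<close> is the same for every \<open>\<omega>\<close>; this
  yields the uniform bound on the inverses.\<close>

lemma Phi_below:
  assumes below: "below_at_infinity A \<delta>" and u: "u \<in> lps Xw"
  shows "\<delta> * lp_norm p u \<le> lp_norm p (\<Phi> u)"
proof (rule le_of_le_add[OF lp_norm_nonneg[OF u]])
  fix \<epsilon> :: real assume e: "0 < \<epsilon>"
  have \<delta>: "0 < \<delta>" using below by (simp add: below_at_infinity_def)
  have Pu: "\<Phi> u \<in> lps Xw" by (rule lp_ops_mem[OF Phi_ops u])
  obtain R where R: "0 \<le> R" "\<And>G0 G u. finite G0 \<Longrightarrow> G0 \<subseteq> Xw \<Longrightarrow> finite G \<Longrightarrow> G \<subseteq> Xw \<Longrightarrow>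
    \<forall>\<^sub>F x in \<omega>. nbs R (img G0 x) \<subseteq> img G x \<Longrightarrow> u \<in> lps Xw \<Longrightarrow>
    \<delta> * lp_norm p (proj G0 u) \<le> lp_norm p (proj G (\<Phi> u)) + \<epsilon> * lp_norm p u"
    using local_lower_bound[OF below e] by blast
  let ?M = "(lp_norm p (\<Phi> u) + \<epsilon> * lp_norm p u) / \<delta>"
  have "lp_le u ?M"
  proof (rule lp_le_finite_pieces)
    show "0 \<le> ?M" using \<delta> e lp_norm_nonneg[OF u] lp_norm_nonneg[OF Pu] by simp
    fix F :: "'a filter set" assume F: "finite F"
    have eq: "proj F u = proj (F \<inter> Xw) u" using lp_space_supp[OF u] by (auto simp: proj_def)
    obtain G where G: "finite G" "G \<subseteq> Xw" "\<forall>\<^sub>F x in \<omega>. nbs R (img (F \<inter> Xw) x) \<subseteq> img G x"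
      using cover[of "F \<inter> Xw" R] F R(1) by auto
    have "\<delta> * lp_norm p (proj (F \<inter> Xw) u) \<le> lp_norm p (proj G (\<Phi> u)) + \<epsilon> * lp_norm p u"
      using F G by (intro R(2) u) auto
    also have "\<dots> \<le> lp_norm p (\<Phi> u) + \<epsilon> * lp_norm p u" using lp_norm_proj[OF Pu] by simp
    finally have "lp_norm p (proj F u) \<le> ?M" using \<delta> eq by (simp add: field_simps)
    then show "lp_le (proj F u) ?M" by (rule lp_le_weaken[OF lp_le_norm[OF proj_in_lp[OF u]]])
  qed
  then have "lp_norm p u \<le> ?M" by (rule lp_norm_le)
  then show "\<delta> * lp_norm p u \<le> lp_norm p (\<Phi> u) + \<epsilon> * lp_norm p u" using \<delta> by (simp add: field_simps)
qed

lemma approximation_upper: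
  assumes "finite G1" "G1 \<subseteq> Xw" "finite G2" "G2 \<subseteq> Xw" "0 < \<epsilon>" "\<forall>\<^sub>F x in \<omega>. Q x"
  shows "\<exists>x. Q x \<and> good G1 x \<and> good G2 x \<and> (\<forall>u\<in>lps Xw.
    lp_norm p (proj G1 (\<Phi> (proj G2 u))) \<le> lp_norm p (pull x G1 (A (push x G2 u))) + \<epsilon> * lp_norm p u)"
  using approximation_ex[OF assms] by blast

text \<open>The vectors \<open>v\<close> live in balls about \<open>x\<close>, which along
  \<open>\<omega>\<close> are contained in copies of one finite set \<open>G\<close> around the base
  point. \<open>G'\<close> is fixed before \<open>x\<close> and \<open>v\<close>, and controls the
  image off \<open>G'\<close> for all vectors on \<open>G\<close>.\<close>

lemma small_vector_transfer:
  assumes s: "0 \<le> s" and \<kappa>: "0 < \<kappa>"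
    and ev: "\<forall>\<^sub>F x in \<omega>. \<exists>v\<in>lps X. 0 < lp_norm p v \<and> (\<forall>y. v y \<noteq> 0 \<longrightarrow> y \<in> nb s x) \<and>
      lp_norm p (A v) \<le> \<kappa> * lp_norm p v"
  shows "\<exists>u\<in>lps Xw. 0 < lp_norm p u \<and> lp_norm p (\<Phi> u) \<le> 2 * \<kappa> * lp_norm p u"
proof -
  \<comment> \<open>The bound \<open>2 * \<kappa>\<close> consists of \<open>\<kappa>\<close> from
    \<open>v\<close> and \<open>\<kappa> / 2\<close> each for the approximation on \<open>G'\<close>
    and for the image off \<open>G'\<close>.\<close>
  have k4: "0 < \<kappa> / 2" using \<kappa> by simp
  obtain G where G: "finite G" "G \<subseteq> Xw" "\<forall>\<^sub>F x in \<omega>. nbs s (img {\<omega>} x) \<subseteq> img G x"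
    using cover[of "{\<omega>}" s] base_point(1) s by auto
  obtain G' where G': "finite G'" "G' \<subseteq> Xw"
      "\<And>u. u \<in> lps Xw \<Longrightarrow> lp_le (coproj G' (\<Phi> (proj G u))) (\<kappa> / 2 * lp_norm p u)"
    using Phi_local_ex[OF k4 G(1,2)] by blast
  have "\<forall>\<^sub>F x in \<omega>. nbs s (img {\<omega>} x) \<subseteq> img G x \<and> V \<omega> x = x \<and>
    (\<exists>v\<in>lps X. 0 < lp_norm p v \<and> (\<forall>y. v y \<noteq> 0 \<longrightarrow> y \<in> nb s x) \<and> lp_norm p (A v) \<le> \<kappa> * lp_norm p v)"
    using G(3) base_point(2) ev by eventually_elim blast
  then obtain x where x: "nbs s (img {\<omega>} x) \<subseteq> img G x" "V \<omega> x = x" "good G' x" "good G x"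
    and exv: "\<exists>v\<in>lps X. 0 < lp_norm p v \<and> (\<forall>y. v y \<noteq> 0 \<longrightarrow> y \<in> nb s x) \<and> lp_norm p (A v) \<le> \<kappa> * lp_norm p v"
    and ap: "\<forall>u\<in>lps Xw. lp_norm p (proj G' (\<Phi> (proj G u))) \<le> lp_norm p (pull x G' (A (push x G u))) + \<kappa> / 2 * lp_norm p u"
    by (elim approximation_upper[OF G'(1,2) G(1,2) k4, elim_format] exE conjE) (rule that)
  obtain v where v: "v \<in> lps X" "0 < lp_norm p v" "\<And>y. v y \<noteq> 0 \<Longrightarrow> y \<in> nb s x"
      "lp_norm p (A v) \<le> \<kappa> * lp_norm p v" using exv by blast
  define u where "u = pull x G v"
  have u: "u \<in> lps Xw" unfolding u_def by (rule pull_lp[OF G(1,2)])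
  have "nb s x \<subseteq> img G x" using x(1,2) by (auto simp: nbs_def img_def)
  then have pv: "proj (img G x) v = v" using v(3) by (auto simp: proj_def fun_eq_iff)
  have puv: "push x G u = v" unfolding u_def push_pull[OF x(4)] pv ..
  have pu: "proj G u = u" by (auto simp: u_def pull_def proj_def)
  have n: "lp_norm p u = lp_norm p v"
    using norm_pull[OF x(4) v(1)] norm_push[OF x(4) u] puv by (simp add: u_def)
  have Pu: "\<Phi> u \<in> lps Xw" by (rule lp_ops_mem[OF Phi_ops u])
  have "lp_norm p (\<Phi> u) \<le> lp_norm p (proj G' (\<Phi> u)) + lp_norm p (coproj G' (\<Phi> u))"
    using lp_norm_add[OF proj_in_lp[OF Pu] coproj_in_lp[OF Pu], of G' G']
    by (simp add: proj_def coproj_apply if_distrib cong: if_cong)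
  also have "lp_norm p (coproj G' (\<Phi> u)) \<le> \<kappa> / 2 * lp_norm p u" using lp_norm_le[OF G'(3)[OF u]] pu by simp
  also have "lp_norm p (proj G' (\<Phi> u)) \<le> lp_norm p (pull x G' (A v)) + \<kappa> / 2 * lp_norm p u"
    using bspec[OF ap u] pu puv by simp
  also have "lp_norm p (pull x G' (A v)) \<le> lp_norm p (A v)" by (rule norm_pull[OF x(3) lp_ops_mem[OF AO v(1)]])
  also have "\<dots> \<le> \<kappa> * lp_norm p v" by (rule v(4))
  finally have "lp_norm p (\<Phi> u) \<le> 2 * \<kappa> * lp_norm p u" using n by simp
  then show ?thesis using u v(2) unfolding n[symmetric] by (intro bexI[of _ u] conjI)
qed

end

section \<open>Localisation of the lower norm\<close>

text \<open>The order of filters reverses inclusion of their systems of sets, so Zorn's lemma is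
  applied to the latter; the union of a chain is the system of the infimum of its filters.\<close>

lemma ultrafilter_exists:
  assumes "F \<noteq> bot"
  shows "\<exists>U\<le>F. U \<noteq> bot \<and> (\<forall>D. (\<forall>\<^sub>F x in U. x \<in> D) \<or> (\<forall>\<^sub>F x in U. x \<notin> D))"
proof -
  define sets where "sets U = {D. \<forall>\<^sub>F x in U. x \<in> D}" for U :: "'a filter"
  have sets_mono: "sets U \<subseteq> sets W \<longleftrightarrow> W \<le> U" for U W
  proof
    assume s: "sets U \<subseteq> sets W"
    show "W \<le> U"
      unfolding le_filter_def
    proof (intro allI impI)
      fix Q assume "eventually Q U"
      then have "Collect Q \<in> sets U" by (simp add: sets_def)
      then have "Collect Q \<in> sets W" using s by blast
      then show "eventually Q W" by (simp add: sets_def)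
    qed
  qed (auto simp: sets_def le_filter_def)
  define \<A> where "\<A> = sets ` {U. U \<noteq> bot \<and> U \<le> F}"
  have "\<exists>M\<in>\<A>. \<forall>Y\<in>\<A>. M \<subseteq> Y \<longrightarrow> Y = M"
  proof (rule subset_Zorn_nonempty)
    show "\<A> \<noteq> {}" using assms by (auto simp: \<A>_def)
    fix \<C> assume \<C>: "\<C> \<noteq> {}" "subset.chain \<A> \<C>"
    define B where "B = {U. U \<noteq> bot \<and> U \<le> F \<and> sets U \<in> \<C>}"
    have CB: "\<C> = sets ` B" using \<C>(2) by (auto simp: B_def \<A>_def subset_chain_def)
    have Bne: "B \<noteq> {}" using CB \<C>(1) by auto
    have dir: "\<exists>x\<in>B. x \<le> inf U W" if "U \<in> B" "W \<in> B" for U W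
    proof -
      have "sets U \<subseteq> sets W \<or> sets W \<subseteq> sets U"
        using \<C>(2) that unfolding B_def subset_chain_def by blast
      then show ?thesis using that sets_mono by (metis inf.absorb1 inf.absorb2 order_refl)
    qed
    have ev: "eventually Q (Inf B) \<longleftrightarrow> (\<exists>b\<in>B. eventually Q b)" for Q
      by (rule eventually_Inf_base[OF Bne dir])
    have "Inf B \<noteq> bot" using ev[of "\<lambda>_. False"] by (auto simp: B_def trivial_limit_def)
    moreover have "Inf B \<le> F" using Bne by (auto simp: B_def intro: Inf_lower2)
    ultimately have "sets (Inf B) \<in> \<A>" by (auto simp: \<A>_def)
    moreover have "sets (Inf B) = \<Union>\<C>" unfolding CB sets_def ev by auto
    ultimately show "\<Union>\<C> \<in> \<A>" by simp
  qed
  then obtain U where U: "U \<noteq> bot" "U \<le> F"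
      "\<And>W. W \<noteq> bot \<Longrightarrow> W \<le> F \<Longrightarrow> sets U \<subseteq> sets W \<Longrightarrow> sets W = sets U"
    unfolding \<A>_def by auto
  have "(\<forall>\<^sub>F x in U. x \<in> D) \<or> (\<forall>\<^sub>F x in U. x \<notin> D)" for D
  proof (rule disjCI)
    assume nD: "\<not> (\<forall>\<^sub>F x in U. x \<notin> D)"
    \<comment> \<open>If the complement of \<open>D\<close> does not belong to \<open>U\<close>,
      adding \<open>D\<close> keeps the filter proper, so by maximality \<open>D\<close> belongs to
      \<open>U\<close> already.\<close>
    let ?W = "inf U (principal D)"
    have "?W \<noteq> bot" using nD by (simp add: trivial_limit_def eventually_inf_principal)
    moreover have "?W \<le> F" using U(2) by (simp add: le_infI1)
    ultimately have "sets ?W = sets U" using U(3) sets_mono by simp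
    moreover have "D \<in> sets ?W" by (simp add: sets_def eventually_inf_principal)
    ultimately show "\<forall>\<^sub>F x in U. x \<in> D" by (simp add: sets_def)
  qed
  then show ?thesis using U(1,2) by blast
qed

text \<open>The sets \<open>Y m\<close> with finite sets removed generate a filter. It is proper
  since they are infinite, and the removal of finite sets makes every ultrafilter refining it
  non-principal.\<close>

lemma boundary_point_exists:
  fixes Y :: "nat \<Rightarrow> 'a set"
  assumes sub: "\<And>m. Y m \<subseteq> X" and anti: "\<And>m n. m \<le> n \<Longrightarrow> Y n \<subseteq> Y m" and inf: "\<And>m. infinite (Y m)"
  shows "\<exists>\<omega>\<in>beta_boundary X. \<forall>m. \<forall>\<^sub>F x in \<omega>. x \<in> Y m"
proof -
  define B where "B = {(m::nat, E::'a set). finite E}"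
  define F where "F = (INF b\<in>B. principal (Y (fst b) - snd b))"
  have ev: "eventually Q F \<longleftrightarrow> (\<exists>b\<in>B. eventually Q (principal (Y (fst b) - snd b)))" for Q
    unfolding F_def
  proof (rule eventually_INF_base)
    show "B \<noteq> {}" by (auto simp: B_def)
    fix b c assume "b \<in> B" "c \<in> B"
    then show "\<exists>x\<in>B. principal (Y (fst x) - snd x) \<le> inf (principal (Y (fst b) - snd b)) (principal (Y (fst c) - snd c))"
      using anti[of "fst b" "max (fst b) (fst c)"] anti[of "fst c" "max (fst b) (fst c)"]
      by (intro bexI[of _ "(max (fst b) (fst c), snd b \<union> snd c)"]) (auto simp: B_def)
  qed
  have "F \<noteq> bot"
  proof
    assume "F = bot"
    then have "eventually (\<lambda>_. False) F" by simp
    then obtain b where "b \<in> B" "Y (fst b) - snd b = {}" unfolding ev by (auto simp: eventually_principal)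
    then have "finite (Y (fst b))" by (auto simp: B_def intro: finite_subset)
    then show False using inf by blast
  qed
  then obtain \<omega> where \<omega>: "\<omega> \<le> F" "\<omega> \<noteq> bot" "\<And>D. (\<forall>\<^sub>F x in \<omega>. x \<in> D) \<or> (\<forall>\<^sub>F x in \<omega>. x \<notin> D)"
    using ultrafilter_exists by blast
  have Y: "\<forall>\<^sub>F x in \<omega>. x \<in> Y m - E" if "finite E" for m E
  proof -
    have "\<forall>\<^sub>F x in F. x \<in> Y m - E" unfolding ev using that
      by (intro bexI[of _ "(m, E)"]) (auto simp: B_def eventually_principal)
    then show ?thesis using \<omega>(1) by (simp add: le_filter_def)
  qed
  have "\<omega> \<noteq> principal {x}" for x
    using Y[of "{x}" 0] by (auto simp: eventually_principal)
  moreover have "\<omega> \<le> principal X"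
    unfolding le_principal using Y[of "{}" 0] sub[of 0] by (auto elim!: eventually_mono)
  ultimately have "\<omega> \<in> beta_boundary X" using \<omega>(2,3) by (simp add: beta_boundary_def beta_def)
  moreover have "\<forall>m. \<forall>\<^sub>F x in \<omega>. x \<in> Y m" using Y[of "{}"] by simp
  ultimately show ?thesis by blast
qed

section \<open>Localising almost null vectors\<close>

context bg_space
begin

text \<open>For sup norms an almost maximal value \<open>v x0\<close> carries nearly the whole norm,
  and a single cutoff around \<open>x0\<close> preserves it.\<close>

lemma localisation_sup:
  assumes A: "A \<in> ops_A sc p X d" and sup: sup_type and e: "0 < \<eta>"
  shows "\<exists>s. \<forall>v\<in>lps X. lp_norm p (A v) < \<eta> * lp_norm p v \<longrightarrow>
    (\<exists>w\<in>lps X. (\<forall>x. v x = 0 \<longrightarrow> w x = 0) \<and> 0 < lp_norm p w \<and>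
      (\<forall>x y. w x \<noteq> 0 \<longrightarrow> w y \<noteq> 0 \<longrightarrow> d x y \<le> s) \<and> lp_norm p (A w) < 2 * \<eta> * lp_norm p w)"
proof -
  note AO = ops_A_D(1)[OF A]
  have e2: "0 < \<eta> / 2" using e by simp
  obtain L where L: "0 < L" "\<And>h f. slow L h \<Longrightarrow> f \<in> lps X \<Longrightarrow> lp_norm p (comm A h f) \<le> \<eta> / 2 * lp_norm p f"
    using comm_small[OF A e2] by blast
  have "\<exists>w\<in>lps X. (\<forall>x. v x = 0 \<longrightarrow> w x = 0) \<and> 0 < lp_norm p w \<and>
      (\<forall>x y. w x \<noteq> 0 \<longrightarrow> w y \<noteq> 0 \<longrightarrow> d x y \<le> 2 / L) \<and> lp_norm p (A w) < 2 * \<eta> * lp_norm p w"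
    if v: "v \<in> lps X" and small: "lp_norm p (A v) < \<eta> * lp_norm p v" for v
  proof -
    have "0 < \<eta> * lp_norm p v" using small lp_norm_nonneg[OF lp_ops_mem[OF AO v]] by linarith
    then have pos: "0 < lp_norm p v" using e by (simp add: zero_less_mult_iff)
    \<comment> \<open>The constant balances the budget: commutator and \<open>A v\<close> together
      give \<open>3 / 2 * \<eta>\<close> times the norm of \<open>v\<close>, which is
      \<open>2 * \<eta>\<close> times \<open>3 / 4\<close> of it.\<close>
    obtain x0 where x0: "3 / 4 * lp_norm p v < norm (v x0)"
    proof (rule ccontr)
      assume "\<not> thesis"
      then have "norm (v x) \<le> 3 / 4 * lp_norm p v" for x using that not_le by blast
      then have "lp_le v (3 / 4 * lp_norm p v)" using sup pos by (simp add: lp_le_def)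
      from lp_norm_le[OF this] show False using pos by simp
    qed
    then have "v x0 \<noteq> 0" using pos by auto
    then have x0X: "x0 \<in> X" using lp_space_supp[OF v] by blast
    define h where "h = cutoff x0 0 L"
    have h: "slow L h" unfolding h_def by (rule slow_cutoff[OF x0X L(1)])
    note habs = slow_abs[OF h]
    define w where "w = mul h v"
    have w: "w \<in> lps X" unfolding w_def by (rule mul_lp[OF habs v])
    have "h x0 = 1" unfolding h_def using L(1) x0X by (intro cutoff_one) auto
    then have "norm (v x0) \<le> lp_norm p w" using lp_norm_point[OF w, of x0] by (simp add: w_def mul_def)
    then have nw: "3 / 4 * lp_norm p v < lp_norm p w" using x0 by linarith
    have "A w = (\<lambda>y. comm A h v y + mul h (A v) y)" by (simp add: comm_def w_def)
    then have "lp_norm p (A w) \<le> lp_norm p (comm A h v) + lp_norm p (mul h (A v))"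
      using lp_norm_add[of _ X _ X, OF comm_mem[of A h, OF AO habs v] mul_lp[of h, OF habs lp_ops_mem[OF AO v]]] by simp
    also have "\<dots> \<le> \<eta> / 2 * lp_norm p v + 1 * lp_norm p (A v)"
      by (intro add_mono L(2)[OF h v] norm_mul[OF habs lp_ops_mem[OF AO v]])
    also have "\<dots> < \<eta> / 2 * lp_norm p v + \<eta> * lp_norm p v" using small by simp
    also have "\<dots> = 2 * \<eta> * (3 / 4 * lp_norm p v)" by simp
    also have "\<dots> \<le> 2 * \<eta> * lp_norm p w" using nw e by (intro mult_left_mono) auto
    finally have "lp_norm p (A w) < 2 * \<eta> * lp_norm p w" .
    moreover have "0 < lp_norm p w" using nw pos by linarith
    moreover have "d x y \<le> 2 / L" if xy: "w x \<noteq> 0" "w y \<noteq> 0" for x y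
    proof -
      have X: "x \<in> X" "y \<in> X" using lp_space_supp[OF w] xy by blast+
      have "h x \<noteq> 0" "h y \<noteq> 0" using xy by (auto simp: w_def mul_def)
      then have "d x0 x \<le> 1 / L" "d x0 y \<le> 1 / L"
        using cutoff_zero[OF L(1), of 0 x0] unfolding h_def by (metis add_0 not_le)+
      then show ?thesis using triangle[OF X(1) x0X X(2)] by (simp add: commute)
    qed
    moreover have "\<forall>x. v x = 0 \<longrightarrow> w x = 0" by (simp add: w_def mul_def)
    ultimately show ?thesis using w by blast
  qed
  then show ?thesis by blast
qed

text \<open>At each point the column \<open>\<phi> i x\<close> has p-norm at most 1;
  \<open>lp_le_joint\<close> and \<open>lp_le_fibre\<close> carry this over to the norms of the
  pieces.\<close>

lemma fibre_norm_mul: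
  assumes \<phi>: "\<And>x. lp_le (\<lambda>i::nat. \<phi> i x) 1" and w: "w \<in> lps X"
  shows "lp_le (\<lambda>i. lp_norm p (mul (\<phi> i) w)) (lp_norm p w)"
proof -
  have "lp_le (\<lambda>i. \<phi> i x *\<^sub>R w x) (norm (w x))" for x
    using lp_le_scale[OF \<phi>[of x], of "norm (w x)" "\<lambda>i. \<phi> i x *\<^sub>R w x"] by (simp add: mult.commute)
  moreover have "lp_le (\<lambda>x. norm (w x)) (lp_norm p w)"
    by (rule lp_le_mono[OF lp_le_norm[OF w]]) simp
  ultimately have "lp_le (\<lambda>(i, x). \<phi> i x *\<^sub>R w x) (lp_norm p w)" by (rule lp_le_joint)
  from lp_le_fibre[OF this] show ?thesis by (simp add: mul_def)
qed

text \<open>If \<open>A\<close> had lower bound \<open>2 * \<eta>\<close> on every piece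
  \<open>mul (\<phi> i) v\<close>, taking p-norms over \<open>i\<close> would bound
  \<open>2 * \<eta>\<close> times the norm of \<open>v\<close> by the norm of \<open>A v\<close>
  plus errors of total \<open>\<eta> / 2\<close> times the norm of \<open>v\<close>, against the
  hypothesis on \<open>v\<close>.\<close>

lemma localisation_fin:
  assumes A: "A \<in> ops_A sc p X d" and st: "\<not> sup_type" and e: "0 < \<eta>"
    and q: "1 \<le> q" "property_A q X d"
  shows "\<exists>s. \<forall>v\<in>lps X. lp_norm p (A v) < \<eta> * lp_norm p v \<longrightarrow>
    (\<exists>w\<in>lps X. (\<forall>x. v x = 0 \<longrightarrow> w x = 0) \<and> 0 < lp_norm p w \<and>
      (\<forall>x y. w x \<noteq> 0 \<longrightarrow> w y \<noteq> 0 \<longrightarrow> d x y \<le> s) \<and> lp_norm p (A w) < 2 * \<eta> * lp_norm p w)"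
proof -
  note AO = ops_A_D(1)[OF A]
  \<comment> \<open>Error budget \<open>\<eta> / 2\<close>: a quarter of \<open>\<eta>\<close> for
    the commutators of the band part, and an eighth each for the remainder applied to the pieces and
    for the pieces of the remainder applied to \<open>v\<close>.\<close>
  have e8: "0 < \<eta> / 8" using e by simp
  obtain U R0 where U: "U \<in> lp_ops sc p X" "local_op R0 U"
      "\<And>f. f \<in> lps X \<Longrightarrow> lp_norm p (op_diff A U f) \<le> \<eta> / 8 * lp_norm p f"
    using ops_A_D(2)[OF A e8] by blast
  define R where "R = max R0 1"
  have R: "0 < R" "local_op R U" using local_op_mono[OF U(2)] by (auto simp: R_def)
  define c where "c = op_norm p X U * (real (deg R) * real (deg R))"
  have c: "0 \<le> c" using op_norm_nonneg[OF U(1)] by (simp add: c_def)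
  define \<epsilon> where "\<epsilon> = \<eta> / 4 / (c + 1)"
  have \<epsilon>: "0 < \<epsilon>" "c * \<epsilon> \<le> \<eta> / 4" using e c mult_div_succ_le[of c "\<eta> / 4"] by (auto simp: \<epsilon>_def)
  obtain \<phi> :: "nat \<Rightarrow> 'a \<Rightarrow> real" and D where \<phi>01: "\<forall>i x. 0 \<le> \<phi> i x \<and> \<phi> i x \<le> 1"
     and \<phi>X: "\<forall>i x. x \<notin> X \<longrightarrow> \<phi> i x = 0"
     and \<phi>D: "\<forall>i. \<forall>x\<in>X. \<forall>y\<in>X. \<phi> i x \<noteq> 0 \<and> \<phi> i y \<noteq> 0 \<longrightarrow> d x y \<le> D"
     and \<phi>1: "\<forall>x. lp_le (\<lambda>i. \<phi> i x) 1"
     and \<phi>n: "\<forall>x\<in>X. \<forall>(v::'e). norm v \<le> lp_norm p (\<lambda>i. \<phi> i x *\<^sub>R v)"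
     and \<phi>v: "\<forall>x\<in>X. \<forall>y\<in>X. d x y \<le> R \<longrightarrow> lp_le (\<lambda>i. \<phi> i x - \<phi> i y) \<epsilon>"
    using isometric_partition[OF q R(1) \<epsilon>(1) st] by (elim exE conjE) (rule that)
  have habs: "\<bar>\<phi> i x\<bar> \<le> 1" for i x using \<phi>01 by simp
  have "\<exists>w\<in>lps X. (\<forall>x. v x = 0 \<longrightarrow> w x = 0) \<and> 0 < lp_norm p w \<and>
      (\<forall>x y. w x \<noteq> 0 \<longrightarrow> w y \<noteq> 0 \<longrightarrow> d x y \<le> D) \<and> lp_norm p (A w) < 2 * \<eta> * lp_norm p w"
    if v: "v \<in> lps X" and small: "lp_norm p (A v) < \<eta> * lp_norm p v" for v
  proof (rule ccontr)
    assume no: "\<not> ?thesis"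
    let ?w = "\<lambda>i. mul (\<phi> i) v"
    have w: "?w i \<in> lps X" for i by (rule mul_lp[OF habs v])
    have lower: "2 * \<eta> * lp_norm p (?w i) \<le> lp_norm p (A (?w i))" for i
    proof (rule ccontr)
      assume n: "\<not> ?thesis"
      then have "0 < 2 * \<eta> * lp_norm p (?w i)" using lp_norm_nonneg[OF lp_ops_mem[OF AO w]] by (meson not_le le_less_trans)
      then have "0 < lp_norm p (?w i)" using e by (simp add: zero_less_mult_iff)
      moreover have "d x y \<le> D" if "?w i x \<noteq> 0" "?w i y \<noteq> 0" for x y
        using \<phi>D lp_space_supp[OF v] that by (auto simp: mul_def)
      moreover have "\<forall>x. v x = 0 \<longrightarrow> ?w i x = 0" by (simp add: mul_def)
      ultimately show False using no n w[of i] not_le by blast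
    qed
    let ?D = "op_diff A U"
    have DO: "?D \<in> lp_ops sc p X" by (rule lp_ops_op_diff[OF AO U(1)])
    let ?n1 = "\<lambda>i. lp_norm p (mul (\<phi> i) (A v))" and ?n2 = "\<lambda>i. lp_norm p (comm U (\<phi> i) v)"
      and ?n3 = "\<lambda>i. \<eta> / 8 * lp_norm p (?w i)" and ?n4 = "\<lambda>i. lp_norm p (mul (\<phi> i) (?D v))"
    have n1: "lp_le ?n1 (lp_norm p (A v))" using \<phi>1 by (intro fibre_norm_mul lp_ops_mem[OF AO v]) auto
    have "lp_le ?n4 (lp_norm p (?D v))" using \<phi>1 by (intro fibre_norm_mul lp_ops_mem[OF DO v]) auto
    then have n4: "lp_le ?n4 (\<eta> / 8 * lp_norm p v)" by (rule lp_le_weaken[OF _ U(3)[OF v]])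
    have "lp_le (\<lambda>i. lp_norm p (?w i)) (lp_norm p v)" using \<phi>1 by (intro fibre_norm_mul v) auto
    then have n3: "lp_le ?n3 (\<eta> / 8 * lp_norm p v)" using e by (intro lp_le_scale) (auto simp: abs_mult)
    have n2: "lp_le ?n2 (\<eta> / 4 * lp_norm p v)"
    proof -
      \<comment> \<open>Bounding each commutator separately would lose the summation over
        \<open>i\<close>. At fixed \<open>x\<close> the whole family is bounded in p-norm over
        \<open>i\<close> by the variation \<open>\<epsilon>\<close>; the norm over \<open>x\<close>
        is taken afterwards.\<close>
      define m where "m x = (if x \<in> X then op_norm p X U * \<epsilon> * (\<Sum>y\<in>nb R x. norm (v y)) else 0)" for x
      have "lp_le (\<lambda>i. comm U (\<phi> i) v x) (m x)" for x
      proof (cases "x \<in> X")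
        case True
        have a: "lp_le (\<lambda>i. \<Sum>y\<in>nb R x. op_norm p X U * norm (v y) * \<bar>\<phi> i y - \<phi> i x\<bar>)
             (\<Sum>y\<in>nb R x. op_norm p X U * norm (v y) * \<epsilon>)"
        proof (rule lp_le_sum)
          show "finite (nb R x)" using deg[OF True] by simp
          fix y assume "y \<in> nb R x"
          then have "lp_le (\<lambda>i. \<phi> i x - \<phi> i y) \<epsilon>" using \<phi>v True by (simp add: nb_def)
          then show "lp_le (\<lambda>i. op_norm p X U * norm (v y) * \<bar>\<phi> i y - \<phi> i x\<bar>) (op_norm p X U * norm (v y) * \<epsilon>)"
            by (rule lp_le_scale) (use op_norm_nonneg[OF U(1)] in \<open>auto simp: abs_mult abs_minus_commute\<close>)
        qed
        have b: "norm (comm U (\<phi> i) v x) \<le> norm (\<Sum>y\<in>nb R x. op_norm p X U * norm (v y) * \<bar>\<phi> i y - \<phi> i x\<bar>)" for i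
          using order_trans[OF comm_point[of U R v x "\<phi> i", OF U(1) R(2) v True habs] abs_ge_self]
          by (simp add: sum_distrib_left mult.assoc mult.left_commute mult.commute)
        have c: "(\<Sum>y\<in>nb R x. op_norm p X U * norm (v y) * \<epsilon>) = m x"
          using True by (simp add: m_def sum_distrib_left mult_ac)
        show ?thesis using lp_le_mono[OF a b] unfolding c .
      next
        case False
        then have "comm U (\<phi> i) v x = 0" for i
          using lp_space_supp[OF comm_mem[of U "\<phi> i", OF U(1) habs v]] by blast
        then show ?thesis using False by (simp add: m_def lp_le_zero)
      qed
      moreover have "lp_le m (real (deg R) * real (deg R) * ((op_norm p X U * \<epsilon>) * lp_norm p v))"
      proof (rule nb_average)
        show "lp_le (\<lambda>y. (op_norm p X U * \<epsilon>) *\<^sub>R v y) ((op_norm p X U * \<epsilon>) * lp_norm p v)"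
          using \<epsilon>(1) op_norm_nonneg[OF U(1)] by (intro lp_le_scale[OF lp_le_norm[OF v]]) auto
        fix x assume "x \<in> X"
        then show "norm (m x) \<le> (\<Sum>y\<in>nb R x. norm ((op_norm p X U * \<epsilon>) *\<^sub>R v y))"
          using \<epsilon>(1) op_norm_nonneg[OF U(1)] by (simp add: m_def sum_distrib_left abs_mult sum_nonneg)
      qed (simp add: m_def)
      ultimately have "lp_le (\<lambda>(i, x). comm U (\<phi> i) v x) (real (deg R) * real (deg R) * ((op_norm p X U * \<epsilon>) * lp_norm p v))"
        by (rule lp_le_joint)
      then have "lp_le ?n2 (real (deg R) * real (deg R) * ((op_norm p X U * \<epsilon>) * lp_norm p v))"
        by (rule lp_le_fibre)
      moreover have "real (deg R) * real (deg R) * ((op_norm p X U * \<epsilon>) * lp_norm p v) \<le> \<eta> / 4 * lp_norm p v"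
        using mult_right_mono[OF \<epsilon>(2) lp_norm_nonneg[OF v]] by (simp add: c_def algebra_simps)
      ultimately show ?thesis by (rule lp_le_weaken)
    qed
    have split: "lp_norm p (A (?w i)) \<le> ?n1 i + ?n2 i + ?n3 i + ?n4 i" for i
    proof -
      have eq: "A (?w i) = (\<lambda>x. mul (\<phi> i) (A v) x + comm U (\<phi> i) v x + ?D (?w i) x - mul (\<phi> i) (?D v) x)"
        by (auto simp: comm_def op_diff_def mul_def scaleR_diff_right)
      have m1: "mul (\<phi> i) (A v) \<in> lps X" by (rule mul_lp[OF habs lp_ops_mem[OF AO v]])
      have m2: "comm U (\<phi> i) v \<in> lps X" by (rule comm_mem[OF U(1) habs v])
      have m3: "?D (?w i) \<in> lps X" by (rule lp_ops_mem[OF DO w])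
      have m4: "mul (\<phi> i) (?D v) \<in> lps X" by (rule mul_lp[OF habs lp_ops_mem[OF DO v]])
      have m12: "(\<lambda>x. mul (\<phi> i) (A v) x + comm U (\<phi> i) v x) \<in> lps X" by (rule lp_space_add[OF m1 m2])
      have m123: "(\<lambda>x. mul (\<phi> i) (A v) x + comm U (\<phi> i) v x + ?D (?w i) x) \<in> lps X" by (rule lp_space_add[OF m12 m3])
      show ?thesis unfolding eq
        using lp_norm_diff[OF m123 m4] lp_norm_add[OF m12 m3] lp_norm_add[OF m1 m2] U(3)[OF w, of i] by linarith
    qed
    have sum: "lp_le (\<lambda>i. ?n1 i + ?n2 i + ?n3 i + ?n4 i)
        (lp_norm p (A v) + \<eta> / 4 * lp_norm p v + \<eta> / 8 * lp_norm p v + \<eta> / 8 * lp_norm p v)"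
      by (intro lp_le_add n1 n2 n3 n4)
    let ?K = "lp_norm p (A v) + \<eta> / 2 * lp_norm p v"
    have mK: "lp_le (\<lambda>i. 2 * \<eta> * lp_norm p (?w i)) ?K"
    proof (rule lp_le_weaken, rule lp_le_mono[OF sum])
      fix i
      show "norm (2 * \<eta> * lp_norm p (?w i)) \<le> norm (?n1 i + ?n2 i + ?n3 i + ?n4 i)"
        using order_trans[OF lower[of i] split[of i]] e lp_norm_nonneg[OF w[of i]] by (simp add: abs_mult)
    qed simp
    \<comment> \<open>Back from the pieces to \<open>v\<close>: the order of the two norms is
      exchanged, and at every point the partition does not decrease the norm.\<close>
    have "lp_le (\<lambda>x. \<phi> i x *\<^sub>R ((2 * \<eta>) *\<^sub>R v x)) (2 * \<eta> * lp_norm p (?w i))" for i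
      using e by (intro lp_le_scale[OF lp_le_norm[OF w[of i]]]) (auto simp: mul_def abs_mult)
    from lp_le_joint[OF this mK] have "lp_le (\<lambda>(x, i). \<phi> i x *\<^sub>R ((2 * \<eta>) *\<^sub>R v x)) ?K" .
    from lp_le_fibre[OF this] have "lp_le (\<lambda>x. lp_norm p (\<lambda>i. \<phi> i x *\<^sub>R ((2 * \<eta>) *\<^sub>R v x))) ?K" .
    then have "lp_le (\<lambda>x. (2 * \<eta>) *\<^sub>R v x) ?K"
    proof (rule lp_le_mono)
      fix x
      show "norm ((2 * \<eta>) *\<^sub>R v x) \<le> norm (lp_norm p (\<lambda>i. \<phi> i x *\<^sub>R ((2 * \<eta>) *\<^sub>R v x)))"
      proof (cases "x \<in> X")
        case True
        then have "norm ((2 * \<eta>) *\<^sub>R v x) \<le> lp_norm p (\<lambda>i. \<phi> i x *\<^sub>R ((2 * \<eta>) *\<^sub>R v x))"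
          by (rule \<phi>n[rule_format])
        then show ?thesis unfolding real_norm_def by (rule order_trans[OF _ abs_ge_self])
      qed (use lp_space_supp[OF v] in simp)
    qed
    from lp_norm_le[OF this] have "2 * \<eta> * lp_norm p v \<le> ?K"
      using lp_norm_scaleR[OF v, of "2 * \<eta>"] e by simp
    then have "\<eta> * lp_norm p v + \<eta> / 2 * lp_norm p v \<le> lp_norm p (A v)" by simp
    moreover have "0 \<le> \<eta> / 2 * lp_norm p v" using e lp_norm_nonneg[OF v] by simp
    ultimately show False using small by linarith
  qed
  then show ?thesis by blast
qed

lemma localisation:
  assumes "A \<in> ops_A sc p X d" "0 < \<eta>" "1 \<le> q" "property_A q X d"
  shows "\<exists>s. \<forall>v\<in>lps X. lp_norm p (A v) < \<eta> * lp_norm p v \<longrightarrow>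
    (\<exists>w\<in>lps X. (\<forall>x. v x = 0 \<longrightarrow> w x = 0) \<and> 0 < lp_norm p w \<and>
      (\<forall>x y. w x \<noteq> 0 \<longrightarrow> w y \<noteq> 0 \<longrightarrow> d x y \<le> s) \<and> lp_norm p (A w) < 2 * \<eta> * lp_norm p w)"
  using localisation_sup[OF assms(1) _ assms(2)] localisation_fin[OF assms(1) _ assms(2-4)] by blast

text \<open>Localising repeatedly, at coarser and coarser scales inside the previous support, finds points around
  which \<open>A\<close> is almost singular at all scales simultaneously.\<close>

lemma nested_localisation:
  assumes A: "A \<in> ops_A sc p X d" and q: "1 \<le> q" "property_A q X d"
  shows "\<exists>s::nat \<Rightarrow> real. \<forall>m. \<forall>v\<in>lps X. lp_norm p (A v) < (1/2) ^ m * lp_norm p v \<longrightarrow>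
    (\<exists>x\<in>X. v x \<noteq> 0 \<and> (\<forall>k\<le>m. \<exists>w\<in>lps X. 0 < lp_norm p w \<and> (\<forall>y. w y \<noteq> 0 \<longrightarrow> y \<in> nb (s k) x) \<and>
       lp_norm p (A w) \<le> 2 * (1/2) ^ k * lp_norm p w))"
proof -
  have "\<exists>s. \<forall>v\<in>lps X. lp_norm p (A v) < (1/2) ^ k * lp_norm p v \<longrightarrow>
    (\<exists>w\<in>lps X. (\<forall>x. v x = 0 \<longrightarrow> w x = 0) \<and> 0 < lp_norm p w \<and>
      (\<forall>x y. w x \<noteq> 0 \<longrightarrow> w y \<noteq> 0 \<longrightarrow> d x y \<le> s) \<and> lp_norm p (A w) < 2 * (1/2) ^ k * lp_norm p w)" for k :: nat
    by (rule localisation[OF A _ q]) simp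
  then obtain s where s: "\<And>k v. v \<in> lps X \<Longrightarrow> lp_norm p (A v) < (1/2) ^ k * lp_norm p v \<Longrightarrow>
    \<exists>w\<in>lps X. (\<forall>x. v x = 0 \<longrightarrow> w x = 0) \<and> 0 < lp_norm p w \<and>
      (\<forall>x y. w x \<noteq> 0 \<longrightarrow> w y \<noteq> 0 \<longrightarrow> d x y \<le> s k) \<and> lp_norm p (A w) < 2 * (1/2) ^ k * lp_norm p w"
    by metis
  define Q where "Q k x \<longleftrightarrow> (\<exists>w\<in>lps X. 0 < lp_norm p w \<and> (\<forall>y. w y \<noteq> 0 \<longrightarrow> y \<in> nb (s k) x) \<and>
       lp_norm p (A w) \<le> 2 * (1/2) ^ k * lp_norm p w)" for k x
  have QI: "Q k x" if "w \<in> lps X" "0 < lp_norm p w" "\<And>x y. w x \<noteq> 0 \<Longrightarrow> w y \<noteq> 0 \<Longrightarrow> d x y \<le> s k"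
      "lp_norm p (A w) < 2 * (1/2) ^ k * lp_norm p w" "w x \<noteq> 0" for k x w
  proof -
    have "y \<in> nb (s k) x" if "w y \<noteq> 0" for y
      using \<open>\<And>x y. w x \<noteq> 0 \<Longrightarrow> w y \<noteq> 0 \<Longrightarrow> d x y \<le> s k\<close>[OF \<open>w x \<noteq> 0\<close> that]
        lp_space_supp[OF \<open>w \<in> lps X\<close>, of y] that by (auto simp: nb_def)
    then show ?thesis unfolding Q_def using that by (intro bexI[of _ w]) auto
  qed
  have "\<exists>x\<in>X. v x \<noteq> 0 \<and> (\<forall>k\<le>m. Q k x)"
    if "v \<in> lps X" "lp_norm p (A v) < (1/2) ^ m * lp_norm p v" for m v
    using that
  proof (induction m arbitrary: v)
    case 0
    obtain w where w: "w \<in> lps X" "\<And>x. v x = 0 \<Longrightarrow> w x = 0" "0 < lp_norm p w"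
        "\<And>x y. w x \<noteq> 0 \<Longrightarrow> w y \<noteq> 0 \<Longrightarrow> d x y \<le> s 0" "lp_norm p (A w) < 2 * (1/2) ^ 0 * lp_norm p w"
      using s[OF 0] by blast
    obtain x where x: "w x \<noteq> 0"
    proof (rule ccontr)
      assume "\<not> thesis"
      then have "w = (\<lambda>x. 0)" using that by blast
      then show False using w(3) by (simp add: lp_norm_zero)
    qed
    have "x \<in> X" using lp_space_supp[OF w(1)] x by blast
    moreover have "v x \<noteq> 0" using w(2) x by blast
    moreover have "Q 0 x" by (rule QI[OF w(1,3,4,5) x])
    ultimately show ?case by auto
  next
    case (Suc m)
    obtain w where w: "w \<in> lps X" "\<And>x. v x = 0 \<Longrightarrow> w x = 0" "0 < lp_norm p w"
        "\<And>x y. w x \<noteq> 0 \<Longrightarrow> w y \<noteq> 0 \<Longrightarrow> d x y \<le> s (Suc m)" "lp_norm p (A w) < 2 * (1/2) ^ Suc m * lp_norm p w"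
      using s[OF Suc.prems] by blast
    \<comment> \<open>The factor 2 lost at level \<open>Suc m\<close> is exactly what level
      \<open>m\<close> allows, so \<open>w\<close> satisfies the induction hypothesis. The radii
      \<open>s k\<close> were fixed beforehand and do not depend on \<open>m\<close>.\<close>
    have "lp_norm p (A w) < (1/2) ^ m * lp_norm p w" using w(5) by simp
    from Suc.IH[OF w(1) this] obtain x where x: "x \<in> X" "w x \<noteq> 0" "\<forall>k\<le>m. Q k x" by blast
    moreover have "Q (Suc m) x" by (rule QI[OF w(1,3,4,5) x(2)])
    ultimately show ?case using w(2) by (metis le_Suc_eq)
  qed
  then show ?thesis unfolding Q_def by blast
qed

text \<open>\<open>Y m\<close> is infinite: otherwise some vector vanishing on it would violate the
  lower bound \<open>(1/2) ^ m\<close>, and nested localisation would find a point of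
  \<open>Y m\<close> at which it is nonzero. An ultrafilter containing all \<open>Y m\<close> then
  contradicts the constant \<open>c\<close> of its own limit operator, so no uniformity in
  \<open>\<omega>\<close> is presupposed.\<close>

theorem below_at_infinity_if_limits_below:
  assumes A: "A \<in> ops_A sc p X d" and q: "1 \<le> q" "property_A q X d" and rich: "rich X d A"
    and lim: "\<And>\<omega>. \<omega> \<in> beta_boundary X \<Longrightarrow> \<exists>c>0. \<forall>u\<in>lps (limit_space X d \<omega>).
      c * lp_norm p u \<le> lp_norm p (matrix_op (limit_space X d \<omega>) (limit_matrix X d \<omega> A) u)"
  shows "\<exists>\<delta>. below_at_infinity A \<delta>"
proof (rule ccontr)
  assume no: "\<not> ?thesis"
  obtain s :: "nat \<Rightarrow> real" where s: "\<And>m v. v \<in> lps X \<Longrightarrow> lp_norm p (A v) < (1/2) ^ m * lp_norm p v \<Longrightarrow>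
    \<exists>x\<in>X. v x \<noteq> 0 \<and> (\<forall>k\<le>m. \<exists>w\<in>lps X. 0 < lp_norm p w \<and> (\<forall>y. w y \<noteq> 0 \<longrightarrow> y \<in> nb (s k) x) \<and>
       lp_norm p (A w) \<le> 2 * (1/2) ^ k * lp_norm p w)"
    using nested_localisation[OF A q] by blast
  define Q where "Q k x \<longleftrightarrow> (\<exists>w\<in>lps X. 0 < lp_norm p w \<and> (\<forall>y. w y \<noteq> 0 \<longrightarrow> y \<in> nb (s k) x) \<and>
       lp_norm p (A w) \<le> 2 * (1/2) ^ k * lp_norm p w)" for k x
  define Y where "Y m = {x \<in> X. \<forall>k\<le>m. Q k x}" for m
  have "infinite (Y m)" for m
  proof
    assume fin: "finite (Y m)"
    have "\<exists>v\<in>lps X. (\<forall>x\<in>Y m. v x = 0) \<and> \<not> (1/2) ^ m * lp_norm p v \<le> lp_norm p (A v)"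
    proof (rule ccontr)
      assume "\<not> ?thesis"
      then have "below_at_infinity A ((1/2) ^ m)"
        unfolding below_at_infinity_def using fin by (intro conjI exI[of _ "Y m"]) (auto simp: Y_def)
      then show False using no by blast
    qed
    then obtain v where v: "v \<in> lps X" "\<forall>x\<in>Y m. v x = 0" "lp_norm p (A v) < (1/2) ^ m * lp_norm p v"
      by (meson not_le)
    obtain x where "x \<in> X" "v x \<noteq> 0" "\<forall>k\<le>m. Q k x" using s[OF v(1,3)] unfolding Q_def by blast
    then show False using v(2) by (auto simp: Y_def)
  qed
  moreover have "Y m \<subseteq> X" "m \<le> n \<Longrightarrow> Y n \<subseteq> Y m" for m n by (auto simp: Y_def)
  ultimately obtain \<omega> where \<omega>: "\<omega> \<in> beta_boundary X" "\<And>m. \<forall>\<^sub>F x in \<omega>. x \<in> Y m"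
    using boundary_point_exists[of Y X] by blast
  interpret limit_operator p sc X d \<omega> A
    by unfold_locales (use \<omega>(1) A rich in \<open>auto simp: rich_def\<close>)
  obtain c where c: "0 < c" "\<And>u. u \<in> lps Xw \<Longrightarrow> c * lp_norm p u \<le> lp_norm p (\<Phi> u)"
    using lim[OF \<omega>(1)] by blast
  obtain k :: nat where k: "(1/2) ^ k < c / 4"
    using real_arch_pow_inv[of "c / 4" "1/2"] c(1) by auto
  \<comment> \<open>The absolute value supplies the nonnegative radius for
    \<open>small_vector_transfer\<close>. Two factors 2 enter, one from localisation and one from
    the transfer, whence \<open>c / 4\<close> above.\<close>
  have ev: "\<forall>\<^sub>F x in \<omega>. \<exists>v\<in>lps X. 0 < lp_norm p v \<and> (\<forall>y. v y \<noteq> 0 \<longrightarrow> y \<in> nb \<bar>s k\<bar> x) \<and>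
      lp_norm p (A v) \<le> 2 * (1/2) ^ k * lp_norm p v"
    using \<omega>(2)[of k]
  proof eventually_elim
    case (elim x)
    then have "Q k x" by (simp add: Y_def)
    moreover have "nb (s k) x \<subseteq> nb \<bar>s k\<bar> x" by (auto simp: nb_def)
    ultimately show ?case unfolding Q_def by blast
  qed
  obtain u where u: "u \<in> lps Xw" "0 < lp_norm p u" "lp_norm p (\<Phi> u) \<le> 2 * (2 * (1/2) ^ k) * lp_norm p u"
    using small_vector_transfer[OF _ _ ev] by auto
  have "2 * (2 * (1/2) ^ k) * lp_norm p u < c * lp_norm p u" using k u(2) by (intro mult_strict_right_mono) auto
  then show False using u(3) c(2)[OF u(1)] by linarith
qed

end

section \<open>The parametrix\<close>

context lp_exponent
begin

text \<open>A version of \<open>lp_le_norm\<close> for \<open>p = 0\<close> that covers functions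
  not vanishing at infinity; it is applied to families over the index of a partition.\<close>

lemma lp_le_lp_norm:
  fixes f :: "'i \<Rightarrow> 'v::banach"
  assumes "lp_le f M" shows "lp_le f (lp_norm p f)"
proof (cases sup_type)
  case True
  have "bdd_above (range (\<lambda>x. norm (f x)))" using lp_le_point[OF assms] by (meson bdd_aboveI2)
  then have *: "norm (f x) \<le> lp_norm p f" for x
    using True by (auto simp: lp_norm_def sup_type_def intro: cSUP_upper)
  have "0 \<le> lp_norm p f" using *[of undefined] norm_ge_zero[of "f undefined"] by linarith
  then show ?thesis using True * by (simp add: lp_le_def)
next
  case False
  then have "p \<noteq> 0" by (auto simp: sup_type_def)
  then have "f \<in> lp_space p UNIV" using assms by (intro lp_spaceI) auto
  then show ?thesis by (rule lp_le_norm)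
qed

end

context bg_space
begin

text \<open>Only the compression of \<open>A C\<close> to the ball is compared with the identity,
  since only finite pieces are transported from a limit space.\<close>

definition right_invertible_near :: "(('a \<Rightarrow> 'e) \<Rightarrow> ('a \<Rightarrow> 'e)) \<Rightarrow> real \<Rightarrow> real \<Rightarrow> real \<Rightarrow> 'a \<Rightarrow> bool" where
  "right_invertible_near A M r \<epsilon> x \<longleftrightarrow> (\<exists>C\<in>lp_ops sc p X. (\<forall>f\<in>lps X. lp_norm p (C f) \<le> M * lp_norm p f) \<and>
    (\<forall>f\<in>lps X. lp_norm p (\<lambda>y. proj (nb r x) (A (C (proj (nb r x) f))) y - proj (nb r x) f y) \<le> \<epsilon> * lp_norm p f))"

end

context limit_operator
begin

text \<open>\<open>C\<close> pulls back to \<open>G\<close>, applies \<open>B\<close> and pushes the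
  part on \<open>G'\<close> to \<open>X\<close>. Truncation to \<open>G'\<close> hardly affects
  \<open>\<Phi>\<close> on \<open>G\<close>, whose copy contains the ball.\<close>

lemma local_right_inverse:
  assumes B: "B \<in> lp_ops sc p Xw" and inv: "\<And>u. u \<in> lps Xw \<Longrightarrow> \<Phi> (B u) = u"
    and M: "0 \<le> M" "\<And>u. u \<in> lps Xw \<Longrightarrow> lp_norm p (B u) \<le> M * lp_norm p u"
    and r: "0 \<le> r" and e: "0 < \<epsilon>" and ev: "\<forall>\<^sub>F x in \<omega>. Q x"
  shows "\<exists>x. Q x \<and> right_invertible_near A M r \<epsilon> x"
proof -
  \<comment> \<open>Approximation and truncation each cost \<open>\<eta>\<close> times the norm of
    \<open>w\<close>, which is at most \<open>M\<close> times that of \<open>f\<close>.\<close>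
  define \<eta> where "\<eta> = \<epsilon> / 2 / (M + 1)"
  have \<eta>: "0 < \<eta>" "M * \<eta> \<le> \<epsilon> / 2" using e M(1) mult_div_succ_le[of M "\<epsilon> / 2"] by (auto simp: \<eta>_def)
  obtain G where G: "finite G" "G \<subseteq> Xw" "\<forall>\<^sub>F x in \<omega>. nbs r (img {\<omega>} x) \<subseteq> img G x"
    using cover[of "{\<omega>}" r] base_point(1) r by auto
  obtain G' where G': "finite G'" "G' \<subseteq> Xw"
      "\<And>u. u \<in> lps Xw \<Longrightarrow> lp_le (proj G (\<Phi> (coproj G' u))) (\<eta> * lp_norm p u)"
    using Phi_local_ex[OF \<eta>(1) G(1,2)] by blast
  have "\<forall>\<^sub>F x in \<omega>. Q x \<and> nb r x \<subseteq> img G x"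
    using ev G(3) base_point(2) by eventually_elim (auto simp: nbs_def img_def)
  then have "\<forall>\<^sub>F x in \<omega>. (Q x \<and> nb r x \<subseteq> img G x) \<and> good (G \<union> G') x \<and> (\<forall>u\<in>lps Xw.
    lp_norm p (\<lambda>\<alpha>. pull x G (A (push x G' u)) \<alpha> - proj G (\<Phi> (proj G' u)) \<alpha>) \<le> \<eta> * lp_norm p u)"
    using approximation[OF G(1,2) G'(1,2) \<eta>(1)] by (rule eventually_conj)
  then obtain x where x: "Q x" "nb r x \<subseteq> img G x" and gg: "good (G \<union> G') x"
    and ap: "\<forall>u\<in>lps Xw. lp_norm p (\<lambda>\<alpha>. pull x G (A (push x G' u)) \<alpha> - proj G (\<Phi> (proj G' u)) \<alpha>) \<le> \<eta> * lp_norm p u"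
    by (elim eventually_happens'[OF omega_nontrivial, elim_format] exE conjE) (rule that)
  have g: "good G x" "good G' x" using good_mono[OF gg] by auto
  define C where "C f = push x G' (B (pull x G f))" for f
  have pl: "pull x G f \<in> lps Xw" for f by (rule pull_lp[OF G(1,2)])
  have Bm: "B (pull x G f) \<in> lps Xw" for f by (rule lp_ops_mem[OF B pl])
  have Bn: "lp_norm p (B (pull x G f)) \<le> M * lp_norm p f" if "f \<in> lps X" for f
    using M(2)[OF pl, of f] mult_left_mono[OF norm_pull[OF g(1) that] M(1)] by linarith
  have Cn: "lp_norm p (C f) \<le> M * lp_norm p f" if "f \<in> lps X" for f
    using norm_push[OF g(2) Bm[of f]] Bn[OF that] by (simp add: C_def)
  have CO: "C \<in> lp_ops sc p X"
  proof (rule lp_opsI[where C = M])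
    fix f h assume "f \<in> lps X" "h \<in> lps X"
    have "pull x G (\<lambda>y. f y + h y) = (\<lambda>\<alpha>. pull x G f \<alpha> + pull x G h \<alpha>)" by (auto simp: pull_def)
    then have "B (pull x G (\<lambda>y. f y + h y)) = (\<lambda>\<alpha>. B (pull x G f) \<alpha> + B (pull x G h) \<alpha>)"
      using lp_ops_add[OF B pl pl] by simp
    then show "C (\<lambda>y. f y + h y) = (\<lambda>y. C f y + C h y)" by (auto simp: C_def push_def)
  next
    fix c f assume "f \<in> lps X"
    have "pull x G (\<lambda>y. sc c (f y)) = (\<lambda>\<alpha>. sc c (pull x G f \<alpha>))" by (auto simp: pull_def)
    then have "B (pull x G (\<lambda>y. sc c (f y))) = (\<lambda>\<alpha>. sc c (B (pull x G f) \<alpha>))"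
      using lp_ops_sc[OF B pl] by simp
    then show "C (\<lambda>y. sc c (f y)) = (\<lambda>y. sc c (C f y))" by (auto simp: C_def push_def)
  qed (use Cn push_lp[OF g(2) G'(1)] in \<open>auto simp: C_def\<close>)
  have main: "lp_norm p (\<lambda>y. proj (nb r x) (A (C (proj (nb r x) f0))) y - proj (nb r x) f0 y) \<le> \<epsilon> * lp_norm p f0"
    if f0: "f0 \<in> lps X" for f0
  proof -
    define f where "f = proj (nb r x) f0"
    have f: "f \<in> lps X" unfolding f_def by (rule proj_in_lp[OF f0])
    define w where "w = B (pull x G f)"
    have w: "w \<in> lps Xw" and wn: "lp_norm p w \<le> M * lp_norm p f" unfolding w_def by (rule Bm, rule Bn[OF f])
    have pw: "proj G' w \<in> lps Xw" and cw: "coproj G' w \<in> lps Xw" using proj_in_lp[OF w] coproj_in_lp[OF w] by auto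
    have "w = (\<lambda>\<alpha>. proj G' w \<alpha> + coproj G' w \<alpha>)" by (auto simp: proj_def coproj_apply)
    then have "\<Phi> w = (\<lambda>\<alpha>. \<Phi> (proj G' w) \<alpha> + \<Phi> (coproj G' w) \<alpha>)" using Phi_add[OF pw cw] by simp
    then have *: "pull x G f \<alpha> = \<Phi> (proj G' w) \<alpha> + \<Phi> (coproj G' w) \<alpha>" for \<alpha>
      using inv[OF pl, of f] unfolding w_def[symmetric] by metis
    have eq: "pull x G (\<lambda>y. A (C f) y - f y) =
      (\<lambda>\<alpha>. (pull x G (A (push x G' w)) \<alpha> - proj G (\<Phi> (proj G' w)) \<alpha>) - proj G (\<Phi> (coproj G' w)) \<alpha>)"
    proof
      fix \<alpha>
      show "pull x G (\<lambda>y. A (C f) y - f y) \<alpha> =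
        (pull x G (A (push x G' w)) \<alpha> - proj G (\<Phi> (proj G' w)) \<alpha>) - proj G (\<Phi> (coproj G' w)) \<alpha>"
      proof (cases "\<alpha> \<in> G")
        case True
        then have "f (V \<alpha> x) = \<Phi> (proj G' w) \<alpha> + \<Phi> (coproj G' w) \<alpha>" using *[of \<alpha>] by (simp add: pull_def)
        then show ?thesis using True by (simp add: pull_def proj_def[of G] C_def w_def)
      qed (simp add: pull_def proj_def[of G])
    qed
    have "lp_norm p (pull x G (\<lambda>y. A (C f) y - f y)) \<le>
      lp_norm p (\<lambda>\<alpha>. pull x G (A (push x G' w)) \<alpha> - proj G (\<Phi> (proj G' w)) \<alpha>) + lp_norm p (proj G (\<Phi> (coproj G' w)))"
      unfolding eq by (rule lp_norm_diff[OF lp_space_diff[OF pl proj_Phi_lp[OF G(1,2)]] proj_Phi_lp[OF G(1,2)]])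
    also have "\<dots> \<le> \<eta> * lp_norm p w + \<eta> * lp_norm p w"
      by (intro add_mono bspec[OF ap w] lp_norm_le[OF G'(3)[OF w]])
    also have "\<dots> = 2 * \<eta> * lp_norm p w" by simp
    also have "\<dots> \<le> 2 * \<eta> * (M * lp_norm p f)" using \<eta>(1) wn by (intro mult_left_mono) auto
    also have "\<dots> = (2 * (M * \<eta>)) * lp_norm p f" by simp
    also have "\<dots> \<le> \<epsilon> * lp_norm p f" using \<eta>(2) by (intro mult_right_mono lp_norm_nonneg[OF f]) auto
    also have "\<dots> \<le> \<epsilon> * lp_norm p f0" unfolding f_def using e by (intro mult_left_mono lp_norm_proj[OF f0]) auto
    finally have le: "lp_norm p (pull x G (\<lambda>y. A (C f) y - f y)) \<le> \<epsilon> * lp_norm p f0" .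
    have Af: "A (C f) \<in> lps X" by (rule lp_ops_mem[OF AO lp_ops_mem[OF CO f]])
    have "lp_norm p (\<lambda>y. proj (nb r x) (A (C f)) y - f y) \<le> lp_norm p (proj (img G x) (\<lambda>y. A (C f) y - f y))"
      by (rule lp_norm_dom[OF proj_in_lp[OF lp_space_diff[OF Af f]]])
        (use x(2) in \<open>auto simp: proj_def f_def\<close>)
    also have "\<dots> \<le> lp_norm p (pull x G (\<lambda>y. A (C f) y - f y))" by (rule norm_proj_img[OF g(1) G(1,2)])
    finally show ?thesis using le by (simp add: f_def)
  qed
  show ?thesis unfolding right_invertible_near_def
    by (intro exI[of _ x] conjI bexI[OF _ CO] ballI x(1) Cn main)
qed

end

context bg_space
begin

text \<open>A compactness argument: infinitely many bad points would carry a boundary ultrafilter,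
  along which the inverse of the limit operator provides a good one among them.\<close>

lemma local_right_inverses:
  assumes A: "A \<in> ops_A sc p X d" and rich: "rich X d A" and M: "0 \<le> M" and r: "0 \<le> r" and e: "0 < \<epsilon>"
    and inv: "\<And>\<omega>. \<omega> \<in> beta_boundary X \<Longrightarrow> \<exists>B\<in>lp_ops sc p (limit_space X d \<omega>). \<forall>u\<in>lps (limit_space X d \<omega>).
      matrix_op (limit_space X d \<omega>) (limit_matrix X d \<omega> A) (B u) = u \<and> lp_norm p (B u) \<le> M * lp_norm p u"
  shows "finite {x \<in> X. \<not> right_invertible_near A M r \<epsilon> x}"
proof (rule ccontr)
  assume "infinite {x \<in> X. \<not> right_invertible_near A M r \<epsilon> x}"
  then obtain \<omega> where \<omega>: "\<omega> \<in> beta_boundary X" "\<forall>\<^sub>F x in \<omega>. x \<in> {x \<in> X. \<not> right_invertible_near A M r \<epsilon> x}"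
    using boundary_point_exists[of "\<lambda>_. {x \<in> X. \<not> right_invertible_near A M r \<epsilon> x}" X] by blast
  interpret limit_operator p sc X d \<omega> A
    by unfold_locales (use \<omega>(1) A rich in \<open>auto simp: rich_def\<close>)
  obtain B where B: "B \<in> lp_ops sc p Xw" "\<forall>u\<in>lps Xw. \<Phi> (B u) = u \<and> lp_norm p (B u) \<le> M * lp_norm p u"
    using inv[OF \<omega>(1)] by blast
  have "\<exists>x. x \<in> {x \<in> X. \<not> right_invertible_near A M r \<epsilon> x} \<and> right_invertible_near A M r \<epsilon> x"
    by (rule local_right_inverse[OF B(1) _ M _ r e \<omega>(2)])
      (use B(2) in auto)
  then show False by blast
qed

lemma weightsD:
  assumes "weights R \<epsilon> \<mu> \<rho> D"
  shows "0 \<le> \<mu> i x" "\<bar>\<mu> i x\<bar> \<le> 1" "\<bar>\<rho> i x\<bar> \<le> 1" "finite {i. \<mu> i x \<noteq> 0}"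
    and "finite I \<Longrightarrow> lp_le (b::nat \<Rightarrow> 'e) M \<Longrightarrow> (\<Sum>i\<in>I. \<mu> i x * norm (b i)) \<le> 2 * M"
    and "x \<in> X \<Longrightarrow> y \<in> X \<Longrightarrow> d x y \<le> R \<Longrightarrow> finite I \<Longrightarrow> lp_le (b::nat \<Rightarrow> 'e) M \<Longrightarrow>
      (\<Sum>i\<in>I. \<bar>\<mu> i y - \<mu> i x\<bar> * norm (b i)) \<le> \<epsilon> * M"
    and "lp_le (\<lambda>i. \<rho> i x) 1"
    and "x \<in> X \<Longrightarrow> (\<Sum>i | \<mu> i x \<noteq> 0. \<mu> i x * \<rho> i x) = 1"
    and "x \<in> X \<Longrightarrow> y \<in> X \<Longrightarrow> \<mu> i x \<noteq> 0 \<or> \<rho> i x \<noteq> 0 \<Longrightarrow> \<mu> i y \<noteq> 0 \<or> \<rho> i y \<noteq> 0 \<Longrightarrow> d x y \<le> D"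
    and "x \<notin> X \<Longrightarrow> \<mu> i x = 0" "x \<notin> X \<Longrightarrow> \<rho> i x = 0"
proof -
  show "0 \<le> \<mu> i x" "finite {i. \<mu> i x \<noteq> 0}" "lp_le (\<lambda>i. \<rho> i x) 1"
    "x \<in> X \<Longrightarrow> (\<Sum>i | \<mu> i x \<noteq> 0. \<mu> i x * \<rho> i x) = 1"
    "x \<notin> X \<Longrightarrow> \<mu> i x = 0" "x \<notin> X \<Longrightarrow> \<rho> i x = 0"
    using assms unfolding weights_def by blast+
  have "0 \<le> \<mu> i x \<and> \<mu> i x \<le> 1 \<and> 0 \<le> \<rho> i x \<and> \<rho> i x \<le> 1" using assms unfolding weights_def by blast
  then show "\<bar>\<mu> i x\<bar> \<le> 1" "\<bar>\<rho> i x\<bar> \<le> 1" by auto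
  show "finite I \<Longrightarrow> lp_le (b::nat \<Rightarrow> 'e) M \<Longrightarrow> (\<Sum>i\<in>I. \<mu> i x * norm (b i)) \<le> 2 * M"
    and "x \<in> X \<Longrightarrow> y \<in> X \<Longrightarrow> d x y \<le> R \<Longrightarrow> finite I \<Longrightarrow> lp_le (b::nat \<Rightarrow> 'e) M \<Longrightarrow>
      (\<Sum>i\<in>I. \<bar>\<mu> i y - \<mu> i x\<bar> * norm (b i)) \<le> \<epsilon> * M"
    and "x \<in> X \<Longrightarrow> y \<in> X \<Longrightarrow> \<mu> i x \<noteq> 0 \<or> \<rho> i x \<noteq> 0 \<Longrightarrow> \<mu> i y \<noteq> 0 \<or> \<rho> i y \<noteq> 0 \<Longrightarrow> d x y \<le> D"
    using assms unfolding weights_def by blast+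
qed

lemma fibre_norms:
  assumes "\<And>i::nat. g i \<in> lps X" "lp_le (\<lambda>i. lp_norm p (g i)) C"
  shows "lp_le (\<lambda>x. lp_norm p (\<lambda>i. g i x)) C" "lp_le (\<lambda>i. g i x) (lp_norm p (\<lambda>i. g i x))"
proof -
  have j: "lp_le (\<lambda>(x, i). g i x) C" by (rule lp_le_joint[OF lp_le_norm[OF assms(1)] assms(2)])
  show "lp_le (\<lambda>x. lp_norm p (\<lambda>i. g i x)) C" by (rule lp_le_fibre[OF j])
  have "lp_le (\<lambda>i. g i x) C"
    by (rule lp_le_inj[OF j, where s = "\<lambda>i. (x, i)" and D = UNIV]) (auto simp: inj_on_def)
  then show "lp_le (\<lambda>i. g i x) (lp_norm p (\<lambda>i. g i x))" by (rule lp_le_lp_norm)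
qed

text \<open>At each \<open>x\<close> the row condition on \<open>\<mu>\<close> bounds the sum by the
  p-norm over \<open>i\<close> of the values \<open>g i x\<close>, and by Fubini these fibre norms
  have norm at most \<open>C\<close> over \<open>x\<close>.\<close>

lemma weighted_sum_bound:
  assumes W: "weights R \<epsilon> \<mu> \<rho> D" and g: "\<And>i. g i \<in> lps X" "lp_le (\<lambda>i. lp_norm p (g i)) C"
    and J: "\<And>x. finite (J x)"
  shows "lp_le (\<lambda>x. \<Sum>i\<in>J x. \<mu> i x *\<^sub>R g i x) (2 * C)"
proof (rule lp_le_scale[OF fibre_norms(1)[OF g]])
  fix x
  have "norm (\<Sum>i\<in>J x. \<mu> i x *\<^sub>R g i x) \<le> (\<Sum>i\<in>J x. \<mu> i x * norm (g i x))"
    using weightsD(1)[OF W] by (intro sum_norm_le) simp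
  also have "\<dots> \<le> 2 * lp_norm p (\<lambda>i. g i x)" by (rule weightsD(5)[OF W J fibre_norms(2)[OF g]])
  also have "\<dots> \<le> 2 * norm (lp_norm p (\<lambda>i. g i x))" by simp
  finally show "norm (\<Sum>i\<in>J x. \<mu> i x *\<^sub>R g i x) \<le> 2 * norm (lp_norm p (\<lambda>i. g i x))" .
qed simp

text \<open>The commutators involve only increments of \<open>\<mu> i\<close> over a ball. After the
  sums over \<open>i\<close> and over the ball are exchanged, the second row condition gives
  \<open>\<epsilon>\<close>, and averaging over balls costs the degree factors.\<close>

lemma weighted_comm_bound:
  assumes W: "weights R \<epsilon> \<mu> \<rho> D" and g: "\<And>i. g i \<in> lps X" "lp_le (\<lambda>i. lp_norm p (g i)) C"
    and J: "\<And>x. finite (J x)" and U: "U \<in> lp_ops sc p X" "local_op R U" and e: "0 \<le> \<epsilon>"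
  shows "lp_le (\<lambda>x. \<Sum>i\<in>J x. comm U (\<mu> i) (g i) x)
    (real (deg R) * real (deg R) * (op_norm p X U * \<epsilon> * C))"
proof (rule nb_average)
  let ?\<gamma> = "\<lambda>x. lp_norm p (\<lambda>i. g i x)"
  note nU = op_norm_nonneg[OF U(1)]
  have \<gamma>0: "0 \<le> ?\<gamma> x" for x by (rule lp_le_nonneg[OF fibre_norms(2)[OF g]])
  show "lp_le (\<lambda>x. op_norm p X U * \<epsilon> * ?\<gamma> x) (op_norm p X U * \<epsilon> * C)"
    by (rule lp_le_scale[OF fibre_norms(1)[OF g]]) (use nU e in \<open>auto simp: abs_mult\<close>)
  fix x assume x: "x \<in> X"
  have "norm (\<Sum>i\<in>J x. comm U (\<mu> i) (g i) x) \<le> (\<Sum>i\<in>J x. op_norm p X U * (\<Sum>y\<in>nb R x. \<bar>\<mu> i y - \<mu> i x\<bar> * norm (g i y)))"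
    by (intro sum_norm_le comm_point[OF U g(1) x weightsD(2)[OF W]])
  also have "\<dots> = op_norm p X U * (\<Sum>y\<in>nb R x. \<Sum>i\<in>J x. \<bar>\<mu> i y - \<mu> i x\<bar> * norm (g i y))"
    by (simp add: sum_distrib_left[symmetric] sum.swap[of _ "nb R x"])
  also have "\<dots> \<le> op_norm p X U * (\<Sum>y\<in>nb R x. \<epsilon> * ?\<gamma> y)"
    using weightsD(6)[OF W x _ _ J fibre_norms(2)[OF g]] by (intro mult_left_mono sum_mono nU) (auto simp: nb_def)
  also have "\<dots> = (\<Sum>y\<in>nb R x. norm (op_norm p X U * \<epsilon> * ?\<gamma> y))"
    using nU e \<gamma>0 by (simp add: sum_distrib_left mult.assoc abs_mult)
  finally show "norm (\<Sum>i\<in>J x. comm U (\<mu> i) (g i) x) \<le> (\<Sum>y\<in>nb R x. norm (op_norm p X U * \<epsilon> * ?\<gamma> y))" .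
next
  fix x assume "x \<notin> X"
  then show "(\<Sum>i\<in>J x. comm U (\<mu> i) (g i) x) = 0"
    using lp_space_supp[OF comm_mem[OF U(1) weightsD(2)[OF W] g(1)]] by (intro sum.neutral) auto
qed

text \<open>Locality is needed only for \<open>p = 0\<close>, where the values have to vanish at infinity.\<close>

lemma lp_ops_localI:
  assumes loc: "local_op R T" and b: "\<And>f. f \<in> lps X \<Longrightarrow> lp_le (T f) (C * lp_norm p f)"
    and off: "\<And>f x. f \<in> lps X \<Longrightarrow> x \<notin> X \<Longrightarrow> T f x = 0"
    and add: "\<And>f g. f \<in> lps X \<Longrightarrow> g \<in> lps X \<Longrightarrow> T (\<lambda>x. f x + g x) = (\<lambda>x. T f x + T g x)"
    and sc: "\<And>c f. f \<in> lps X \<Longrightarrow> T (\<lambda>x. sc c (f x)) = (\<lambda>x. sc c (T f x))"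
  shows "T \<in> lp_ops sc p X"
proof (rule lp_opsI[OF _ add sc])
  fix f assume f: "f \<in> lps X"
  show "lp_norm p (T f) \<le> C * lp_norm p f" by (rule lp_norm_le[OF b[OF f]])
  show "T f \<in> lps X"
  proof (rule lp_spaceI0[OF b[OF f] off[OF f]])
    fix \<epsilon> :: real assume p0: "p = 0" and e: "0 < \<epsilon>"
    have c: "0 < \<epsilon> / 2 / (\<bar>C\<bar> + 1)" using e by simp
    obtain H where H: "finite H" "H \<subseteq> X" "lp_le (coproj H f) (\<epsilon> / 2 / (\<bar>C\<bar> + 1))"
      using lp_space_vanish[OF f p0_ne_inf[OF p0] c] by blast
    have pf: "proj H f \<in> lps X" and cf: "coproj H f \<in> lps X" using proj_in_lp[OF f] coproj_in_lp[OF f] by auto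
    have "norm (T f x) < \<epsilon>" if x: "x \<notin> nbs R H" for x
    proof (cases "x \<in> X")
      case True
      have "f = (\<lambda>x. proj H f x + coproj H f x)" by (auto simp: proj_def coproj_apply)
      then have n1: "T f x = T (proj H f) x + T (coproj H f) x" using add[OF pf cf] by metis
      have n2: "T (proj H f) x = T (\<lambda>x. 0) x"
        using x True H(2) by (intro local_opD[OF loc pf lp_space_zero]) (auto simp: proj_def nbs_mem commute)
      have n3: "T (\<lambda>x. 0) x = 0" using sc[OF lp_space_zero, of 0] add[OF lp_space_zero lp_space_zero] by (metis add_cancel_right_right sc_zero)
      have "norm (T (coproj H f) x) \<le> C * lp_norm p (coproj H f)" by (rule lp_le_point[OF b[OF cf]])
      moreover have "C * lp_norm p (coproj H f) \<le> \<bar>C\<bar> * (\<epsilon> / 2 / (\<bar>C\<bar> + 1))"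
        using lp_norm_le[OF H(3)] lp_norm_nonneg[OF cf] by (intro mult_mono) auto
      moreover have "\<bar>C\<bar> * (\<epsilon> / 2 / (\<bar>C\<bar> + 1)) \<le> \<epsilon> / 2" using e by (intro mult_div_succ_le) auto
      ultimately have "norm (T (coproj H f) x) \<le> \<epsilon> / 2" by linarith
      then show ?thesis unfolding n1 n2 n3 using e by simp
    qed (use off[OF f] e in simp)
    then show "\<exists>F. finite F \<and> (\<forall>x. x \<notin> F \<longrightarrow> norm (T f x) < \<epsilon>)" using finite_nbs[OF H(1,2)] by blast
  qed
qed

text \<open>\<open>B\<close> is the sum of the products of \<open>\<mu> i\<close>, the local right
  inverse \<open>C i\<close> and \<open>\<rho> i\<close> over those \<open>i\<close> whose chosen
  point \<open>z i\<close> avoids the finite bad set. Up to the error of replacing \<open>A\<close>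
  by \<open>U\<close>, the difference \<open>A (B f) - f\<close> consists of commutators of
  \<open>U\<close> with the \<open>\<mu> i\<close>, local errors \<open>e i\<close> and
  \<open>- k\<close> times \<open>f\<close>; since \<open>k\<close> has finite support, the last
  term is put into \<open>K\<close>.\<close>

lemma parametrix:
  assumes A: "A \<in> ops_A sc p X d" and q: "1 \<le> q" "property_A q X d" and M: "0 \<le> M"
    and loc: "\<And>r \<epsilon>. 0 \<le> r \<Longrightarrow> 0 < \<epsilon> \<Longrightarrow> finite {x \<in> X. \<not> right_invertible_near A M r \<epsilon> x}"
  shows "\<exists>B\<in>ops_A sc p X d. op_diff (A \<circ> B) id \<in> ops_K sc p X"
proof -
  note AO = ops_A_D(1)[OF A]
  \<comment> \<open>The final budget is \<open>1 / 8\<close> for replacing \<open>A\<close> by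
    \<open>U\<close> on \<open>B f\<close>, \<open>1 / 8\<close> for the commutators and
    \<open>1 / 4\<close> for the local errors, in total the \<open>1 / 2\<close> that the Neumann
    series allows.\<close>
  define \<eta> where "\<eta> = 1 / 16 / (M + 1)"
  have \<eta>: "0 < \<eta>" "M * \<eta> \<le> 1 / 16" using M mult_div_succ_le[of M "1 / 16"] by (auto simp: \<eta>_def)
  obtain U R0 where U: "U \<in> lp_ops sc p X" "local_op R0 U"
      "\<And>f. f \<in> lps X \<Longrightarrow> lp_norm p (op_diff A U f) \<le> \<eta> * lp_norm p f"
    using ops_A_D(2)[OF A \<eta>(1)] by blast
  define R where "R = max R0 1"
  have R: "0 < R" "local_op R U" using local_op_mono[OF U(2)] by (auto simp: R_def)
  define c where "c = real (deg R) * real (deg R) * (op_norm p X U * M)"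
  have c: "0 \<le> c" using op_norm_nonneg[OF U(1)] M by (simp add: c_def)
  define \<epsilon> where "\<epsilon> = 1 / 8 / (c + 1)"
  have \<epsilon>: "0 < \<epsilon>" "c * \<epsilon> \<le> 1 / 8" using c mult_div_succ_le[of c "1 / 8"] by (auto simp: \<epsilon>_def)
  obtain \<mu> \<rho> D where W: "weights R \<epsilon> \<mu> \<rho> D" using weights_exist[OF q R(1) \<epsilon>(1)] by blast
  define r where "r = \<bar>D\<bar>"
  define F where "F = {x \<in> X. \<not> right_invertible_near A M r (1 / 16) x}"
  have F: "finite F" "F \<subseteq> X" unfolding F_def using loc[of r "1 / 16"] by (auto simp: r_def)
  define z where "z i = (SOME x. x \<in> X \<and> (\<mu> i x \<noteq> 0 \<or> \<rho> i x \<noteq> 0))" for i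
  have z: "z i \<in> X \<and> x \<in> nb r (z i)" if "\<mu> i x \<noteq> 0 \<or> \<rho> i x \<noteq> 0" for i x
  proof -
    have x: "x \<in> X" using that weightsD(10,11)[OF W] by blast
    then have "z i \<in> X \<and> (\<mu> i (z i) \<noteq> 0 \<or> \<rho> i (z i) \<noteq> 0)"
      unfolding z_def using that by (intro someI[of "\<lambda>x. x \<in> X \<and> (\<mu> i x \<noteq> 0 \<or> \<rho> i x \<noteq> 0)" x]) auto
    then show ?thesis using weightsD(9)[OF W, of "z i" x i] x that by (auto simp: nb_def r_def)
  qed
  define ok where "ok i \<longleftrightarrow> z i \<in> X - F" for i
  define C where "C i = (SOME C. C \<in> lp_ops sc p X \<and> (\<forall>f\<in>lps X. lp_norm p (C f) \<le> M * lp_norm p f) \<and>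
    (\<forall>f\<in>lps X. lp_norm p (\<lambda>y. proj (nb r (z i)) (A (C (proj (nb r (z i)) f))) y - proj (nb r (z i)) f y) \<le> 1 / 16 * lp_norm p f))"
    for i
  have C0: "C i \<in> lp_ops sc p X \<and> (\<forall>f\<in>lps X. lp_norm p (C i f) \<le> M * lp_norm p f) \<and>
    (\<forall>f\<in>lps X. lp_norm p (\<lambda>y. proj (nb r (z i)) (A (C i (proj (nb r (z i)) f))) y - proj (nb r (z i)) f y) \<le> 1 / 16 * lp_norm p f)"
    if i: "ok i" for i
  proof -
    have "right_invertible_near A M r (1 / 16) (z i)" using i unfolding ok_def F_def by blast
    then show ?thesis unfolding right_invertible_near_def C_def Bex_def by (rule someI_ex)
  qed
  have C: "C i \<in> lp_ops sc p X" if "ok i" for i using C0[OF that] by (rule conjunct1)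
  have C2: "lp_norm p (C i f) \<le> M * lp_norm p f" if "ok i" "f \<in> lps X" for i f
    using C0[OF that(1)] that(2) by blast
  have C3: "lp_norm p (\<lambda>y. proj (nb r (z i)) (A (C i (proj (nb r (z i)) f))) y - proj (nb r (z i)) f y) \<le> 1 / 16 * lp_norm p f"
    if "ok i" "f \<in> lps X" for i f using C0[OF that(1)] that(2) by blast
  \<comment> \<open>Indices with a bad point contribute 0; the part of the partition of unity that
    is lost in this way is \<open>k\<close> below.\<close>
  define g where "g i f = (if ok i then C i (mul (\<rho> i) f) else (\<lambda>x. 0))" for i f
  define I where "I x = {i. \<mu> i x \<noteq> 0}" for x
  have I: "finite (I x)" for x unfolding I_def by (rule weightsD(4)[OF W])
  have \<rho>f: "mul (\<rho> i) f \<in> lps X" if "f \<in> lps X" for i f by (rule mul_lp[OF weightsD(3)[OF W] that])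
  have \<rho>n: "lp_le (\<lambda>i. lp_norm p (mul (\<rho> i) f)) (lp_norm p f)" if "f \<in> lps X" for f
    by (rule fibre_norm_mul[OF weightsD(7)[OF W] that])
  have g: "g i f \<in> lps X" if "f \<in> lps X" for i f
    by (cases "ok i") (simp_all add: g_def lp_ops_mem[OF C \<rho>f[OF that]] lp_space_zero)
  have gi: "lp_norm p (g i f) \<le> M * lp_norm p (mul (\<rho> i) f)" if "f \<in> lps X" for i f
    using C2[OF _ \<rho>f[OF that]] M lp_norm_nonneg[OF \<rho>f[OF that]] by (simp add: g_def lp_norm_zero)
  have gn: "lp_le (\<lambda>i. lp_norm p (g i f)) (M * lp_norm p f)" if f: "f \<in> lps X" for f
    by (rule lp_le_scale[OF \<rho>n[OF f] M]) (use gi[OF f] lp_norm_nonneg[OF g[OF f]] lp_norm_nonneg[OF \<rho>f[OF f]] in simp)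
  define B where "B f = (\<lambda>x. \<Sum>i\<in>I x. \<mu> i x *\<^sub>R g i f x)" for f
  have Bn: "lp_le (B f) (2 * M * lp_norm p f)" if f: "f \<in> lps X" for f
    using weighted_sum_bound[OF W g[OF f] gn[OF f], of I] I by (simp add: B_def mult.assoc)
  have Bloc: "local_op (2 * r) B"
    unfolding local_op_def
  proof (intro ballI impI)
    fix f f' x assume f: "f \<in> lps X" "f' \<in> lps X" and x: "x \<in> X" and eq: "\<forall>y\<in>X. d x y \<le> 2 * r \<longrightarrow> f y = f' y"
    have "g i f = g i f'" if i: "i \<in> I x" for i
    proof -
      have "mul (\<rho> i) f y = mul (\<rho> i) f' y" for y
      proof (cases "\<rho> i y = 0")
        case False
        then have "z i \<in> X" "y \<in> nb r (z i)" "x \<in> nb r (z i)" using z[of i y] z[of i x] i by (auto simp: I_def)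
        then have "y \<in> X" "d x y \<le> 2 * r" using triangle[OF x \<open>z i \<in> X\<close>, of y] by (auto simp: nb_def commute)
        then show ?thesis using eq by (simp add: mul_def)
      qed (simp add: mul_def)
      then have "mul (\<rho> i) f = mul (\<rho> i) f'" by blast
      then show ?thesis by (simp add: g_def)
    qed
    then show "B f x = B f' x" by (simp add: B_def)
  qed
  have gadd: "g i (\<lambda>x. f x + f' x) = (\<lambda>x. g i f x + g i f' x)" if "f \<in> lps X" "f' \<in> lps X" for i f f'
  proof -
    have "mul (\<rho> i) (\<lambda>x. f x + f' x) = (\<lambda>x. mul (\<rho> i) f x + mul (\<rho> i) f' x)" by (simp add: mul_def scaleR_add_right)
    then show ?thesis using lp_ops_add[OF C \<rho>f[OF that(1)] \<rho>f[OF that(2)]] by (simp add: g_def)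
  qed
  have gsc: "g i (\<lambda>x. sc c (f x)) = (\<lambda>x. sc c (g i f x))" if "f \<in> lps X" for i c f
  proof -
    have "mul (\<rho> i) (\<lambda>x. sc c (f x)) = (\<lambda>x. sc c (mul (\<rho> i) f x))" by (simp add: mul_def sc_scaleR)
    then show ?thesis using lp_ops_sc[OF C \<rho>f[OF that]] by (simp add: g_def)
  qed
  have BO: "B \<in> lp_ops sc p X"
  proof (rule lp_ops_localI[OF Bloc Bn])
    fix f x assume "f \<in> lps X" "x \<notin> X"
    then show "B f x = 0" using weightsD(10)[OF W] by (simp add: B_def I_def)
  next
    fix f f' assume "f \<in> lps X" "f' \<in> lps X"
    then show "B (\<lambda>x. f x + f' x) = (\<lambda>x. B f x + B f' x)"
      by (simp add: B_def gadd scaleR_add_right sum.distrib)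
  next
    fix c f assume "f \<in> lps X"
    then show "B (\<lambda>x. sc c (f x)) = (\<lambda>x. sc c (B f x))"
      by (simp add: B_def gsc sc_sum sc_scaleR)
  qed
  have BA: "B \<in> ops_A sc p X d" by (rule ops_A_local[OF BO Bloc])
  define k where "k x = (\<Sum>i | \<mu> i x \<noteq> 0 \<and> \<not> ok i. \<mu> i x * \<rho> i x)" for x
  have k0: "k x = 0" if "x \<notin> nbs r F" for x
    unfolding k_def
  proof (rule sum.neutral, rule ballI)
    fix i assume "i \<in> {i. \<mu> i x \<noteq> 0 \<and> \<not> ok i}"
    then have "z i \<in> F" "x \<in> nb r (z i)" using z[of i x] by (auto simp: ok_def)
    then show "\<mu> i x * \<rho> i x = 0" using that by (auto simp: nbs_def)
  qed
  have fk: "finite (nbs r F)" "nbs r F \<subseteq> X" using finite_nbs[OF F] nbs_sub by auto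
  define K where "K = mul (\<lambda>x. - k x)"
  have KK: "K \<in> ops_K sc p X" unfolding K_def by (rule mul_finite_support_in_K[OF fk]) (simp add: k0)
  have "\<exists>b. \<forall>x. \<bar>- k x\<bar> \<le> b"
    using fk(1) k0 by (intro exI[of _ "\<Sum>x\<in>nbs r F. \<bar>k x\<bar>"])
      (metis abs_ge_zero abs_minus_cancel abs_zero member_le_sum sum_nonneg)
  then obtain b where b: "\<And>x. \<bar>- k x\<bar> \<le> b" by blast
  have KA: "K \<in> ops_A sc p X d" unfolding K_def by (rule ops_A_mul[OF b])
  define T where "T = op_diff (op_diff (A \<circ> B) id) K"
  have TA: "T \<in> ops_A sc p X d" unfolding T_def by (intro ops_A_op_diff ops_A_comp A BA ops_A_id KA)
  have Tsmall: "lp_norm p (T f) \<le> lp_norm p f / 2" if f: "f \<in> lps X" for f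
  proof -
    \<comment> \<open>Cutting the local error down to the ball is harmless, because it is going to
      be multiplied by \<open>\<mu> i\<close>, which is supported there.\<close>
    define e where "e i = (if ok i then proj (nb r (z i)) (\<lambda>y. U (g i f) y - mul (\<rho> i) f y) else (\<lambda>x. 0))" for i
    have gU: "U (g i f) \<in> lps X" for i by (rule lp_ops_mem[OF U(1) g[OF f]])
    have em: "e i \<in> lps X" for i
      by (cases "ok i") (simp_all add: e_def proj_in_lp[OF lp_space_diff[OF gU \<rho>f[OF f]]] lp_space_zero)
    have DO: "op_diff A U \<in> lp_ops sc p X" by (rule lp_ops_op_diff[OF AO U(1)])
    have ei: "lp_norm p (e i) \<le> 1 / 8 * lp_norm p (mul (\<rho> i) f)" for i
    proof (cases "ok i")
      case True
      let ?P = "proj (nb r (z i))"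
      have P\<rho>: "?P (mul (\<rho> i) f) = mul (\<rho> i) f"
        using z[of i] by (auto simp: proj_def mul_def fun_eq_iff)
      have eq: "e i = (\<lambda>y. (?P (A (C i (?P (mul (\<rho> i) f)))) y - ?P (mul (\<rho> i) f) y) - ?P (op_diff A U (g i f)) y)"
        unfolding P\<rho> using True z[of i] by (auto simp: e_def g_def proj_def op_diff_def mul_def fun_eq_iff)
      have Ci: "C i (?P (mul (\<rho> i) f)) \<in> lps X" by (rule lp_ops_mem[OF C[OF True] proj_in_lp[OF \<rho>f[OF f]]])
      have "lp_norm p (e i) \<le> lp_norm p (\<lambda>y. ?P (A (C i (?P (mul (\<rho> i) f)))) y - ?P (mul (\<rho> i) f) y)
           + lp_norm p (?P (op_diff A U (g i f)))"
        unfolding eq by (rule lp_norm_diff[OF lp_space_diff[OF proj_in_lp[OF lp_ops_mem[OF AO Ci]] proj_in_lp[OF \<rho>f[OF f]]]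
              proj_in_lp[OF lp_ops_mem[OF DO g[OF f]]]])
      also have "\<dots> \<le> 1 / 16 * lp_norm p (mul (\<rho> i) f) + \<eta> * (M * lp_norm p (mul (\<rho> i) f))"
      proof (rule add_mono[OF C3[OF True \<rho>f[OF f]]])
        have "lp_norm p (?P (op_diff A U (g i f))) \<le> \<eta> * lp_norm p (g i f)"
          using lp_norm_proj[OF lp_ops_mem[OF DO g[OF f]], of "nb r (z i)" i] U(3)[OF g[OF f], of i] by linarith
        also have "\<dots> \<le> \<eta> * (M * lp_norm p (mul (\<rho> i) f))" using \<eta>(1) gi[OF f] by (intro mult_left_mono) auto
        finally show "lp_norm p (?P (op_diff A U (g i f))) \<le> \<eta> * (M * lp_norm p (mul (\<rho> i) f))" .
      qed
      also have "\<dots> = (1 / 16 + M * \<eta>) * lp_norm p (mul (\<rho> i) f)" by (simp add: algebra_simps)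
      also have "\<dots> \<le> 1 / 8 * lp_norm p (mul (\<rho> i) f)"
        using \<eta>(2) by (intro mult_right_mono lp_norm_nonneg[OF \<rho>f[OF f]]) auto
      finally show ?thesis .
    qed (simp add: e_def lp_norm_zero lp_norm_nonneg[OF \<rho>f[OF f]])
    have en: "lp_le (\<lambda>i. lp_norm p (e i)) (1 / 8 * lp_norm p f)"
      by (rule lp_le_scale[OF \<rho>n[OF f]]) (use ei lp_norm_nonneg[OF em] lp_norm_nonneg[OF \<rho>f[OF f]] in simp_all)
    \<comment> \<open>All indices visible from the \<open>R\<close>-ball about \<open>x\<close>:
      near \<open>x\<close> the function \<open>B f\<close> becomes a finite sum over one fixed
      index set, which \<open>U\<close> may enter by locality.\<close>
    define J where "J x = I x \<union> (if x \<in> X then \<Union>y\<in>nb R x. I y else {})" for x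
    have J: "finite (J x)" for x using I deg by (simp add: J_def)
    define S1 where "S1 x = (\<Sum>i\<in>J x. comm U (\<mu> i) (g i f) x)" for x
    define S2 where "S2 x = (\<Sum>i\<in>J x. \<mu> i x *\<^sub>R e i x)" for x
    have S1: "lp_le S1 (1 / 8 * lp_norm p f)"
    proof -
      have "lp_le S1 (real (deg R) * real (deg R) * (op_norm p X U * \<epsilon> * (M * lp_norm p f)))"
        unfolding S1_def using weighted_comm_bound[OF W g[OF f] gn[OF f] _ U(1) R(2)] J \<epsilon>(1) by simp
      moreover have "real (deg R) * real (deg R) * (op_norm p X U * \<epsilon> * (M * lp_norm p f)) \<le> 1 / 8 * lp_norm p f"
        using mult_right_mono[OF \<epsilon>(2) lp_norm_nonneg[OF f]] by (simp add: c_def mult_ac)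
      ultimately show ?thesis by (rule lp_le_weaken)
    qed
    have S2: "lp_le S2 (2 * (1 / 8 * lp_norm p f))"
      unfolding S2_def by (rule weighted_sum_bound[OF W em en J])
    have Bf: "B f \<in> lps X" by (rule lp_ops_mem[OF BO f])
    have "lp_norm p (op_diff A U (B f)) \<le> \<eta> * (2 * M * lp_norm p f)"
      using U(3)[OF Bf] mult_left_mono[OF lp_norm_le[OF Bn[OF f]], of \<eta>] \<eta>(1) by linarith
    also have "\<dots> = 2 * (M * \<eta>) * lp_norm p f" by simp
    also have "\<dots> \<le> 1 / 8 * lp_norm p f" using \<eta>(2) by (intro mult_right_mono lp_norm_nonneg[OF f]) auto
    finally have S0: "lp_le (op_diff A U (B f)) (1 / 8 * lp_norm p f)"
      by (rule lp_le_weaken[OF lp_le_norm[OF lp_ops_mem[OF DO Bf]]])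
    have "T f x = op_diff A U (B f) x + S1 x + S2 x" for x
    proof (cases "x \<in> X")
      case True
      have \<mu>g: "mul (\<mu> i) (g i f) \<in> lps X" for i by (rule mul_lp[OF weightsD(2)[OF W] g[OF f]])
      have "U (B f) x = U (\<lambda>y. \<Sum>i\<in>J x. mul (\<mu> i) (g i f) y) x"
      proof (rule local_opD[OF R(2) Bf lp_space_sum[OF \<mu>g] True])
        fix y assume "y \<in> X" "d x y \<le> R"
        then have "I y \<subseteq> J x" using True by (auto simp: J_def nb_def)
        then show "B f y = (\<Sum>i\<in>J x. mul (\<mu> i) (g i f) y)"
          unfolding B_def mul_def using J by (intro sum.mono_neutral_left) (auto simp: I_def)
      qed
      also have "\<dots> = (\<Sum>i\<in>J x. U (mul (\<mu> i) (g i f)) x)"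
        using lp_ops_sum[OF U(1), of "J x" "\<lambda>i. mul (\<mu> i) (g i f)"] \<mu>g by simp
      also have "\<dots> = S1 x + (\<Sum>i\<in>J x. \<mu> i x *\<^sub>R U (g i f) x)"
        unfolding S1_def by (simp add: comm_def mul_def sum.distrib[symmetric])
      also have "(\<Sum>i\<in>J x. \<mu> i x *\<^sub>R U (g i f) x) = (\<Sum>i\<in>J x. \<mu> i x *\<^sub>R e i x + (if ok i then \<mu> i x * \<rho> i x else 0) *\<^sub>R f x)"
      proof (rule sum.cong[OF refl])
        fix i
        show "\<mu> i x *\<^sub>R U (g i f) x = \<mu> i x *\<^sub>R e i x + (if ok i then \<mu> i x * \<rho> i x else 0) *\<^sub>R f x"
        proof (cases "\<mu> i x = 0")
          case False
          then have "x \<in> nb r (z i)" using z by blast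
          then show ?thesis
            by (auto simp: e_def g_def proj_def mul_def scaleR_diff_right lp_ops_zero[OF U(1)])
        qed simp
      qed
      also have "\<dots> = S2 x + (\<Sum>i\<in>J x. if ok i then \<mu> i x * \<rho> i x else 0) *\<^sub>R f x"
        by (simp add: S2_def sum.distrib scaleR_left.sum)
      also have "(\<Sum>i\<in>J x. if ok i then \<mu> i x * \<rho> i x else 0) = (\<Sum>i\<in>I x. if ok i then \<mu> i x * \<rho> i x else 0)"
        using J by (intro sum.mono_neutral_right) (auto simp: I_def J_def)
      also have "\<dots> = (\<Sum>i\<in>I x. \<mu> i x * \<rho> i x) - (\<Sum>i\<in>I x. if \<not> ok i then \<mu> i x * \<rho> i x else 0)"
        by (simp add: sum_subtractf[symmetric]) (rule sum.cong, auto)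
      also have "(\<Sum>i\<in>I x. if \<not> ok i then \<mu> i x * \<rho> i x else 0) = k x"
        using I[of x] by (simp add: sum.inter_filter[symmetric] k_def I_def conj_commute)
      also have "(\<Sum>i\<in>I x. \<mu> i x * \<rho> i x) = 1" unfolding I_def by (rule weightsD(8)[OF W True])
      finally have "U (B f) x = S1 x + (S2 x + (1 - k x) *\<^sub>R f x)" .
      then show ?thesis by (simp add: T_def op_diff_def K_def mul_def algebra_simps)
    next
      case False
      have "T f x = 0" "op_diff A U (B f) x = 0"
        using lp_space_supp[OF lp_ops_mem[OF ops_A_D(1)[OF TA] f] False] lp_space_supp[OF lp_ops_mem[OF DO Bf] False] by auto
      moreover have "S1 x = 0"
        unfolding S1_def using lp_space_supp[OF comm_mem[OF U(1) weightsD(2)[OF W] g[OF f]] False] by (intro sum.neutral) auto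
      moreover have "S2 x = 0" unfolding S2_def using weightsD(10)[OF W False] by simp
      ultimately show ?thesis by simp
    qed
    then have "T f = (\<lambda>x. op_diff A U (B f) x + S1 x + S2 x)" by blast
    then have "lp_norm p (T f) \<le> 1 / 8 * lp_norm p f + 1 / 8 * lp_norm p f + 2 * (1 / 8 * lp_norm p f)"
      using lp_norm_le[OF lp_le_add[OF lp_le_add[OF S0 S1] S2]] by simp
    then show ?thesis by simp
  qed
  \<comment> \<open>From \<open>A B = I + T + K\<close> and \<open>(I + T) Vn = I\<close> follows
    \<open>A B Vn = I + K Vn\<close>.\<close>
  obtain Vn where Vn: "Vn \<in> ops_A sc p X d" "\<And>f. f \<in> lps X \<Longrightarrow> (\<lambda>x. Vn f x + T (Vn f) x) = f"
    using ops_A_neumann[OF TA Tsmall] by blast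
  have "op_diff (A \<circ> (B \<circ> Vn)) id f = (K \<circ> Vn) f" if f: "f \<in> lps X" for f
  proof
    fix x
    have a: "T (Vn f) x = A (B (Vn f)) x - Vn f x - K (Vn f) x" by (simp add: T_def op_diff_def)
    have b: "Vn f x + T (Vn f) x = f x" using fun_cong[OF Vn(2)[OF f], of x] .
    have "f x = A (B (Vn f)) x - K (Vn f) x" unfolding b[symmetric] a by simp
    then show "op_diff (A \<circ> (B \<circ> Vn)) id f x = (K \<circ> Vn) f x" by (simp add: op_diff_def)
  qed
  then have "op_diff (A \<circ> (B \<circ> Vn)) id \<in> ops_K sc p X"
    by (rule ops_K_cong[OF ops_K_comp_L[OF KK ops_A_subset_L[OF Vn(1)]]])
  moreover have "B \<circ> Vn \<in> ops_A sc p X d" by (rule ops_A_comp[OF BA Vn(1)])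
  ultimately show ?thesis by blast
qed

text \<open>A right inverse \<open>B\<close> modulo \<open>\<K>\<close> of an operator bounded below at infinity is a left inverse: with
  \<open>C = B A - I\<close> the operator \<open>A C = (A B - I) A\<close> is in \<open>\<K>\<close>, and \<open>A\<close> can be cancelled at infinity.\<close>

lemma right_inverse_two_sided:
  assumes A: "A \<in> ops_A sc p X d" and below: "below_at_infinity A \<delta>" and B: "B \<in> ops_A sc p X d"
    and K: "op_diff (A \<circ> B) id \<in> ops_K sc p X"
  shows "inverse_mod_K sc p X A B"
proof -
  note AO = ops_A_D(1)[OF A]
  define C where "C = op_diff (B \<circ> A) id"
  have CA: "C \<in> ops_A sc p X d" unfolding C_def by (intro ops_A_op_diff ops_A_comp A B ops_A_id)
  note CO = ops_A_D(1)[OF CA]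
  define N where "N = op_diff (A \<circ> B) id \<circ> A"
  have N: "N \<in> ops_K sc p X" unfolding N_def by (rule ops_K_comp_L[OF K ops_A_subset_L[OF A]])
  note NO = ops_K_D(1)[OF N]
  have AC: "A (C f) = N f" if f: "f \<in> lps X" for f
    using lp_ops_diff[OF AO lp_ops_mem[OF ops_A_D(1)[OF B] lp_ops_mem[OF AO f]] f]
    by (simp add: C_def N_def op_diff_def)
  obtain F0 where \<delta>: "0 < \<delta>" and F0: "finite F0" "F0 \<subseteq> X"
      and low: "\<And>v. v \<in> lps X \<Longrightarrow> \<forall>x\<in>F0. v x = 0 \<Longrightarrow> \<delta> * lp_norm p v \<le> lp_norm p (A v)"
    using below unfolding below_at_infinity_def by blast
  let ?nA = "op_norm p X A" and ?nC = "op_norm p X C"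
  note nA = op_norm_nonneg[OF AO] and nC = op_norm_nonneg[OF CO]
  have "C \<in> ops_K sc p X"
  proof (rule ops_K_I[OF CO])
    fix \<epsilon> :: real assume e: "0 < \<epsilon>"
    \<comment> \<open>The lower bound controls only the part of \<open>C h\<close> off
      \<open>F0\<close>. The part on \<open>F0\<close> is small because \<open>C\<close> lies in
      \<open>ops_L\<close>; it enters once directly and once through \<open>A\<close>, divided by
      \<open>\<delta>\<close>.\<close>
    define \<theta> where "\<theta> = \<epsilon> / 2 / (?nA / \<delta> + 1)"
    have \<theta>: "0 < \<theta>" using e nA \<delta> unfolding \<theta>_def by (intro divide_pos_pos add_nonneg_pos) auto
    have \<theta>2: "?nA / \<delta> * \<theta> + \<theta> \<le> \<epsilon> / 2"
    proof -
      have t: "0 \<le> ?nA / \<delta>" using nA \<delta> by simp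
      have "?nA / \<delta> * \<theta> + \<theta> = (?nA / \<delta> + 1) * \<theta>" by (simp add: distrib_right)
      also have "\<dots> = \<epsilon> / 2" 
      proof -
        have "(s + 1) * (y / (s + 1)) = y" if "0 \<le> s" for s y :: real using that by simp
        from this[OF t, of "\<epsilon> / 2"] show ?thesis by (simp only: \<theta>_def)
      qed
      finally show ?thesis by simp
    qed
    have de: "0 < \<delta> * \<epsilon> / 2" using \<delta> e by simp
    obtain G1 where G1: "finite G1" "G1 \<subseteq> X" "\<And>f. f \<in> lps X \<Longrightarrow> lp_norm p (N (coproj G1 f)) \<le> \<delta> * \<epsilon> / 2 * lp_norm p f"
      using ops_K_D(2)[OF N de] by blast
    obtain G2 where G2: "finite G2" "G2 \<subseteq> X" "\<And>f. f \<in> lps X \<Longrightarrow> lp_norm p (proj F0 (C (coproj G2 f))) \<le> \<theta> * lp_norm p f"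
      using ops_L_D(2)[OF ops_A_subset_L[OF CA] F0 \<theta>] by blast
    have "lp_norm p (C (coproj (G1 \<union> G2) f)) \<le> \<epsilon> * lp_norm p f" if f: "f \<in> lps X" for f
    proof -
      define h where "h = coproj (G1 \<union> G2) f"
      have h: "h \<in> lps X" unfolding h_def by (rule coproj_in_lp[OF f])
      have hn: "lp_norm p h \<le> lp_norm p f" unfolding h_def by (rule lp_norm_coproj[OF f])
      have h12: "coproj G1 h = h" "coproj G2 h = h" by (auto simp: h_def coproj_apply)
      have Ch: "C h \<in> lps X" by (rule lp_ops_mem[OF CO h])
      have pC: "proj F0 (C h) \<in> lps X" and cC: "coproj F0 (C h) \<in> lps X" using proj_in_lp[OF Ch] coproj_in_lp[OF Ch] by auto
      have pn: "lp_norm p (proj F0 (C h)) \<le> \<theta> * lp_norm p h" using G2(3)[OF h] h12 by simp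
      have eq: "C h = (\<lambda>x. proj F0 (C h) x + coproj F0 (C h) x)" by (auto simp: proj_def coproj_apply)
      have "coproj F0 (C h) = (\<lambda>x. C h x - proj F0 (C h) x)" by (auto simp: proj_def coproj_apply)
      then have "A (coproj F0 (C h)) = (\<lambda>x. N h x - A (proj F0 (C h)) x)"
        using lp_ops_diff[OF AO Ch pC] AC[OF h] by simp
      then have "\<delta> * lp_norm p (coproj F0 (C h)) \<le> lp_norm p (N h) + lp_norm p (A (proj F0 (C h)))"
        using low[OF cC] lp_norm_diff[OF lp_ops_mem[OF NO h] lp_ops_mem[OF AO pC]] by (simp add: coproj_apply)
      also have "\<dots> \<le> \<delta> * \<epsilon> / 2 * lp_norm p h + ?nA * (\<theta> * lp_norm p h)"
        using G1(3)[OF h] h12 op_norm_bound[OF AO pC] mult_left_mono[OF pn nA] by simp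
      finally have "lp_norm p (coproj F0 (C h)) \<le> (\<epsilon> / 2 + ?nA / \<delta> * \<theta>) * lp_norm p h"
        using \<delta> by (simp add: field_simps)
      then have "lp_norm p (C h) \<le> \<theta> * lp_norm p h + (\<epsilon> / 2 + ?nA / \<delta> * \<theta>) * lp_norm p h"
        using pn lp_norm_add[OF pC cC] unfolding eq[symmetric] by linarith
      also have "\<dots> = (\<epsilon> / 2 + (?nA / \<delta> * \<theta> + \<theta>)) * lp_norm p h" by (simp add: algebra_simps)
      also have "\<dots> \<le> \<epsilon> * lp_norm p h" using \<theta>2 by (intro mult_right_mono[OF _ lp_norm_nonneg[OF h]]) linarith
      also have "\<dots> \<le> \<epsilon> * lp_norm p f" using e hn by (intro mult_left_mono) auto
      finally show ?thesis by (simp add: h_def)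
    qed
    then show "\<exists>F. finite F \<and> F \<subseteq> X \<and> (\<forall>f\<in>lps X. lp_norm p (C (coproj F f)) \<le> \<epsilon> * lp_norm p f)"
      using G1(1,2) G2(1,2) by (intro exI[of _ "G1 \<union> G2"]) auto
  next
    fix \<epsilon> :: real assume e: "0 < \<epsilon>"
    define \<theta> where "\<theta> = \<delta> * \<epsilon> / 2 / (?nC + 1)"
    have de: "0 < \<delta> * \<epsilon> / 2" using \<delta> e by simp
    have \<theta>: "0 < \<theta>" "?nC * \<theta> \<le> \<delta> * \<epsilon> / 2"
      using de nC mult_div_succ_le[OF nC, of "\<delta> * \<epsilon> / 2"] by (auto simp: \<theta>_def)
    obtain L where L: "0 < L" "\<And>h f. slow L h \<Longrightarrow> f \<in> lps X \<Longrightarrow> lp_norm p (comm A h f) \<le> \<theta> * lp_norm p f"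
      using comm_small[OF A \<theta>(1)] by blast
    obtain F1 where F1: "finite F1" "F1 \<subseteq> X" "\<And>f. f \<in> lps X \<Longrightarrow> lp_norm p (coproj F1 (N f)) \<le> \<delta> * \<epsilon> / 2 * lp_norm p f"
      using ops_K_D(3)[OF N de] by blast
    define H where "H = F0 \<union> F1"
    have H: "finite H" "H \<subseteq> X" using F0 F1 by (auto simp: H_def)
    \<comment> \<open>\<open>h\<close> vanishes on \<open>F0\<close>, so the lower bound applies to
      \<open>mul h (C f)\<close>, and on \<open>F1\<close>, so \<open>mul h (N f)\<close> is small.
      On \<open>X\<close> it is 1 off the finite neighbourhood of \<open>H\<close>, which is the
      finite set sought.\<close>
    define h where "h x = 1 - hat H L x" for x
    have h: "slow L h" unfolding h_def by (rule slow_compl[OF slow_hat[OF H L(1)]])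
    note habs = slow_abs[OF h]
    have h0: "h x = 0" if "x \<in> H" for x using hat_one[OF H L(1) that] by (simp add: h_def)
    have h1: "h x = 1" if "x \<in> X" "x \<notin> nbs (1 / L) H" for x using hat_zero[OF H L(1) that] by (simp add: h_def)
    have "lp_norm p (coproj (nbs (1 / L) H) (C f)) \<le> \<epsilon> * lp_norm p f" if f: "f \<in> lps X" for f
    proof -
      have Cf: "C f \<in> lps X" by (rule lp_ops_mem[OF CO f])
      have Nf: "N f \<in> lps X" by (rule lp_ops_mem[OF NO f])
      have v: "mul h (C f) \<in> lps X" by (rule mul_lp[OF habs Cf])
      have "\<delta> * lp_norm p (mul h (C f)) \<le> lp_norm p (A (mul h (C f)))"
        by (rule low[OF v]) (simp add: mul_def h0 H_def)
      also have "A (mul h (C f)) = (\<lambda>y. comm A h (C f) y + mul h (N f) y)" using AC[OF f] by (simp add: comm_def)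
      also have "lp_norm p \<dots> \<le> lp_norm p (comm A h (C f)) + lp_norm p (mul h (N f))"
        by (rule lp_norm_add[of _ X _ X, OF comm_mem[of A h, OF AO habs Cf] mul_lp[OF habs Nf]])
      also have "\<dots> \<le> \<theta> * (?nC * lp_norm p f) + \<delta> * \<epsilon> / 2 * lp_norm p f"
      proof (rule add_mono)
        show "lp_norm p (comm A h (C f)) \<le> \<theta> * (?nC * lp_norm p f)"
          using L(2)[OF h Cf] mult_left_mono[OF op_norm_bound[OF CO f], of \<theta>] \<theta>(1) by linarith
        have "lp_norm p (mul h (N f)) \<le> lp_norm p (coproj F1 (N f))"
        proof (rule lp_norm_dom[OF coproj_in_lp[OF Nf]])
          fix x show "norm (mul h (N f) x) \<le> norm (coproj F1 (N f) x)"
            using h0[of x] habs[of x] mult_right_mono[of "\<bar>h x\<bar>" 1 "norm (N f x)"]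
            by (auto simp: mul_def coproj_apply H_def)
        qed
        then show "lp_norm p (mul h (N f)) \<le> \<delta> * \<epsilon> / 2 * lp_norm p f" using F1(3)[OF f] by linarith
      qed
      also have "\<dots> = (?nC * \<theta> + \<delta> * \<epsilon> / 2) * lp_norm p f" by (simp add: algebra_simps)
      also have "\<dots> \<le> (\<delta> * \<epsilon>) * lp_norm p f" using \<theta>(2) by (intro mult_right_mono lp_norm_nonneg[OF f]) auto
      finally have "lp_norm p (mul h (C f)) \<le> \<epsilon> * lp_norm p f" using \<delta> by simp
      moreover have "lp_norm p (coproj (nbs (1 / L) H) (C f)) \<le> lp_norm p (mul h (C f))"
      proof (rule lp_norm_dom[OF v])
        fix x show "norm (coproj (nbs (1 / L) H) (C f) x) \<le> norm (mul h (C f) x)"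
          using h1[of x] lp_space_supp[OF Cf, of x] by (cases "x \<in> X") (auto simp: mul_def coproj_apply)
      qed
      ultimately show ?thesis by linarith
    qed
    then show "\<exists>F. finite F \<and> F \<subseteq> X \<and> (\<forall>f\<in>lps X. lp_norm p (coproj F (C f)) \<le> \<epsilon> * lp_norm p f)"
      using finite_nbs[OF H] by (intro exI[of _ "nbs (1 / L) H"] conjI ballI nbs_sub)
  qed
  then show ?thesis using K by (simp add: inverse_mod_K_def C_def)
qed

end

section \<open>Invertibility of the limit operators\<close>

context lp_operators
begin

lemma bounded_below_surjective_inverse:
  assumes T: "T \<in> lp_ops sc p S" and \<delta>: "0 < \<delta>"
    and low: "\<And>u. u \<in> lps S \<Longrightarrow> \<delta> * lp_norm p u \<le> lp_norm p (T u)"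
    and surj: "\<And>g. g \<in> lps S \<Longrightarrow> \<exists>f\<in>lps S. T f = g"
  shows "\<exists>B\<in>lp_ops sc p S. \<forall>f\<in>lps S. B (T f) = f \<and> T (B f) = f \<and> lp_norm p (B f) \<le> 1 / \<delta> * lp_norm p f"
proof -
  have inj: "u = v" if uv: "u \<in> lps S" "v \<in> lps S" "T u = T v" for u v
  proof -
    have "T (\<lambda>x. u x - v x) = (\<lambda>x. 0)" using lp_ops_diff[OF T uv(1,2)] uv(3) by simp
    then have "\<delta> * lp_norm p (\<lambda>x. u x - v x) \<le> 0"
      using low[OF lp_space_diff[OF uv(1,2)]] by (simp add: lp_norm_zero)
    then have "lp_norm p (\<lambda>x. u x - v x) \<le> 0" using \<delta> by (simp add: mult_le_0_iff)
    then have "norm (u x - v x) \<le> 0" for x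
      using lp_norm_point[OF lp_space_diff[OF uv(1,2)], of x] by linarith
    then show ?thesis by auto
  qed
  define B where "B = inv_into (lps S) T"
  have B: "B g \<in> lps S \<and> T (B g) = g" if g: "g \<in> lps S" for g
  proof -
    have "g \<in> T ` lps S" using surj[OF g] by auto
    then show ?thesis unfolding B_def using inv_into_into[of g T "lps S"] f_inv_into_f[of g T "lps S"] by simp
  qed
  have BT: "B (T f) = f" if f: "f \<in> lps S" for f
    using inj[of "B (T f)" f] B[OF lp_ops_mem[OF T f]] f by blast
  have Bn: "lp_norm p (B g) \<le> 1 / \<delta> * lp_norm p g" if g: "g \<in> lps S" for g
    using low[of "B g"] B[OF g] \<delta> by (simp add: field_simps)
  have "B \<in> lp_ops sc p S"
  proof (rule lp_opsI[OF _ _ _ Bn])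
    fix f g assume fg: "f \<in> lps S" "g \<in> lps S"
    have "T (\<lambda>x. B f x + B g x) = (\<lambda>x. f x + g x)" using lp_ops_add[OF T, of "B f" "B g"] B fg by simp
    then show "B (\<lambda>x. f x + g x) = (\<lambda>x. B f x + B g x)"
      using BT[OF lp_space_add[of "B f" S "B g"]] B fg by simp
  next
    fix c f assume f: "f \<in> lps S"
    have "T (\<lambda>x. sc c (B f x)) = (\<lambda>x. sc c (f x))" using lp_ops_sc[OF T, of "B f" c] B[OF f] by simp
    then show "B (\<lambda>x. sc c (f x)) = (\<lambda>x. sc c (B f x))" using BT[OF sc_lp[of "B f" S c]] B[OF f] by simp
  qed (use B in auto)
  then show ?thesis using B BT Bn by blast
qed

end

context bg_space
begin

text \<open>On vectors vanishing on a suitable finite set, \<open>B A - I\<close> has norm at most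
  \<open>1 / 2\<close>, so the norm of \<open>v\<close> is at most twice that of
  \<open>B (A v)\<close>.\<close>

lemma below_if_left_inverse:
  assumes A: "A \<in> lp_ops sc p X" and B: "B \<in> lp_ops sc p X" and K: "op_diff (B \<circ> A) id \<in> ops_K sc p X"
  shows "\<exists>\<delta>. below_at_infinity A \<delta>"
proof -
  let ?K = "op_diff (B \<circ> A) id"
  note nB = op_norm_nonneg[OF B]
  define \<delta> where "\<delta> = 1 / (2 * (op_norm p X B + 1))"
  have \<delta>: "0 < \<delta>" using nB by (simp add: \<delta>_def)
  obtain F where F: "finite F" "F \<subseteq> X" "\<And>f. f \<in> lps X \<Longrightarrow> lp_norm p (?K (coproj F f)) \<le> 1 / 2 * lp_norm p f"
    using ops_K_D(2)[OF K, of "1 / 2"] by auto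
  have "\<delta> * lp_norm p v \<le> lp_norm p (A v)" if v: "v \<in> lps X" and v0: "\<forall>x\<in>F. v x = 0" for v
  proof -
    have cv: "coproj F v = v" using v0 by (auto simp: coproj_apply)
    have Av: "A v \<in> lps X" by (rule lp_ops_mem[OF A v])
    have Kv: "?K v \<in> lps X" by (rule lp_ops_mem[OF ops_K_D(1)[OF K] v])
    have "v = (\<lambda>x. B (A v) x - ?K v x)" by (simp add: op_diff_def)
    then have "lp_norm p v \<le> lp_norm p (B (A v)) + lp_norm p (?K v)"
      using lp_norm_diff[OF lp_ops_mem[OF B Av] Kv] by simp
    also have "\<dots> \<le> op_norm p X B * lp_norm p (A v) + 1 / 2 * lp_norm p v"
      using op_norm_bound[OF B Av] F(3)[OF v] cv by simp
    finally have "lp_norm p v \<le> 2 * (op_norm p X B * lp_norm p (A v))" by simp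
    also have "\<dots> \<le> 2 * (op_norm p X B + 1) * lp_norm p (A v)"
      using lp_norm_nonneg[OF Av] by (simp add: algebra_simps)
    finally show ?thesis using nB by (simp add: \<delta>_def field_simps)
  qed
  then show ?thesis unfolding below_at_infinity_def using \<delta> F(1,2) by blast
qed

end

context limit_operator
begin

text \<open>Since \<open>B\<close> is only bounded, the local solution \<open>B w\<close> may spread
  over all of \<open>X\<close>. Its part outside the copy of \<open>G'\<close> is discarded, and
  quasi-locality of \<open>A\<close> makes the loss small on \<open>G\<close>. The copy of
  \<open>g\<close> is placed far enough out to make the compact error small.\<close>

lemma approximate_solution:
  assumes B: "B \<in> lp_ops sc p X" and K: "op_diff (A \<circ> B) id \<in> ops_K sc p X" and g: "g \<in> lps Xw"
    and G: "finite G" "G \<subseteq> Xw" and e: "0 < \<epsilon>"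
  shows "\<exists>f\<in>lps Xw. lp_norm p f \<le> op_norm p X B * lp_norm p g \<and>
    lp_norm p (proj G (\<lambda>\<alpha>. \<Phi> f \<alpha> - g \<alpha>)) \<le> \<epsilon>"
proof -
  let ?K = "op_diff (A \<circ> B) id"
  note KO = ops_K_D(1)[OF K]
  define M where "M = op_norm p X B"
  have M: "0 \<le> M" using op_norm_nonneg[OF B] by (simp add: M_def)
  \<comment> \<open>Three errors carry the factor \<open>\<eta>\<close>: the compact error on
    \<open>w\<close>, bounded by the norm of \<open>g\<close>, and, bounded by \<open>M\<close>
    times that norm, the discarded part of \<open>z\<close> and the approximation of
    \<open>\<Phi> f\<close>.\<close>
  define b where "b = (1 + 2 * M) * lp_norm p g"
  have b: "0 \<le> b" using M lp_norm_nonneg[OF g] by (simp add: b_def)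
  define \<eta> where "\<eta> = \<epsilon> / (b + 1)"
  have \<eta>: "0 < \<eta>" "b * \<eta> \<le> \<epsilon>" using e b mult_div_succ_le[OF b, of \<epsilon>] by (auto simp: \<eta>_def)
  obtain R where R: "0 \<le> R" "\<And>F f. F \<subseteq> X \<Longrightarrow> f \<in> lps X \<Longrightarrow> lp_norm p (proj F (A (coproj (nbs R F) f))) \<le> \<eta> * lp_norm p f"
    using ops_A_quasilocal[OF A \<eta>(1)] by blast
  obtain F1 where F1: "finite F1" "F1 \<subseteq> X" "\<And>f. f \<in> lps X \<Longrightarrow> lp_norm p (?K (coproj F1 f)) \<le> \<eta> * lp_norm p f"
    using ops_K_D(2)[OF K \<eta>(1)] by blast
  obtain G' where G': "finite G'" "G' \<subseteq> Xw" "G \<subseteq> G'" "\<forall>\<^sub>F x in \<omega>. nbs R (img G x) \<subseteq> img G' x"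
    using cover[OF G R(1)] by blast
  have "\<forall>\<^sub>F x in \<omega>. (nbs R (img G x) \<subseteq> img G' x \<and> img G' x \<inter> F1 = {}) \<and> good (G \<union> G') x \<and> (\<forall>u\<in>lps Xw.
    lp_norm p (\<lambda>\<alpha>. pull x G (A (push x G' u)) \<alpha> - proj G (\<Phi> (proj G' u)) \<alpha>) \<le> \<eta> * lp_norm p u)"
    by (intro eventually_conj G'(4) eventually_avoids[OF G'(1,2) F1(1,2)] approximation[OF G G'(1,2) \<eta>(1)])
  then obtain x where x: "nbs R (img G x) \<subseteq> img G' x" "img G' x \<inter> F1 = {}" and gg: "good (G \<union> G') x"
    and ap: "\<forall>u\<in>lps Xw. lp_norm p (\<lambda>\<alpha>. pull x G (A (push x G' u)) \<alpha> - proj G (\<Phi> (proj G' u)) \<alpha>) \<le> \<eta> * lp_norm p u"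
    by (elim eventually_happens'[OF omega_nontrivial, elim_format] exE conjE) (rule that)
  have gd: "good G x" "good G' x" using good_mono[OF gg] by auto
  define w where "w = push x G' g"
  have w: "w \<in> lps X" unfolding w_def by (rule push_lp[OF gd(2) G'(1)])
  have wn: "lp_norm p w \<le> lp_norm p g" unfolding w_def by (rule norm_push[OF gd(2) g])
  define z where "z = B w"
  have z: "z \<in> lps X" unfolding z_def by (rule lp_ops_mem[OF B w])
  have zn: "lp_norm p z \<le> M * lp_norm p g"
    using op_norm_bound[OF B w] mult_left_mono[OF wn M] by (simp add: z_def M_def)
  define f where "f = pull x G' z"
  have f: "f \<in> lps Xw" unfolding f_def by (rule pull_lp[OF G'(1,2)])
  have fn: "lp_norm p f \<le> M * lp_norm p g" using norm_pull[OF gd(2) z] zn by (simp add: f_def)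
  have pf: "proj G' f = f" by (auto simp: f_def pull_def proj_def)
  have puf: "push x G' f = proj (img G' x) z" unfolding f_def by (rule push_pull[OF gd(2)])
  let ?c = "coproj (img G' x) z"
  have pz: "proj (img G' x) z \<in> lps X" and cz: "?c \<in> lps X" using proj_in_lp[OF z] coproj_in_lp[OF z] by auto
  have Kw: "?K w \<in> lps X" by (rule lp_ops_mem[OF KO w])
  have Acz: "A ?c \<in> lps X" by (rule lp_ops_mem[OF AO cz])
  have "proj (img G' x) z = (\<lambda>y. z y - ?c y)" by (auto simp: proj_def coproj_apply)
  then have Ap: "A (proj (img G' x) z) = (\<lambda>y. w y + ?K w y - A ?c y)"
    using lp_ops_diff[OF AO z cz] by (simp add: op_diff_def z_def)
  have plw: "pull x G w = proj G g" unfolding w_def by (rule pull_push[OF gd(2) G'(3)])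
  have eq: "pull x G (A (push x G' f)) \<alpha> - proj G g \<alpha> = pull x G (?K w) \<alpha> - pull x G (A ?c) \<alpha>" for \<alpha>
    unfolding puf Ap using fun_cong[OF plw, of \<alpha>] by (auto simp: pull_def proj_def)
  have K1: "lp_norm p (pull x G (?K w)) \<le> \<eta> * lp_norm p g"
  proof -
    have "coproj F1 w = w" using x(2) by (auto simp: coproj_apply w_def push_def fun_eq_iff)
    then have "lp_norm p (?K w) \<le> \<eta> * lp_norm p w" using F1(3)[OF w] by simp
    moreover have "\<eta> * lp_norm p w \<le> \<eta> * lp_norm p g" using \<eta>(1) wn by (intro mult_left_mono) auto
    ultimately show ?thesis using norm_pull[OF gd(1) Kw] by linarith
  qed
  have K2: "lp_norm p (pull x G (A ?c)) \<le> \<eta> * (M * lp_norm p g)"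
  proof -
    have "coproj (nbs R (img G x)) ?c = ?c" using x(1) by (auto simp: coproj_apply fun_eq_iff)
    then have "lp_norm p (proj (img G x) (A ?c)) \<le> \<eta> * lp_norm p ?c"
      using R(2)[of "img G x" ?c] gd(1) cz by (simp add: good_def)
    also have "\<dots> \<le> \<eta> * (M * lp_norm p g)"
      using \<eta>(1) order_trans[OF lp_norm_coproj[OF z] zn] by (intro mult_left_mono) auto
    finally show ?thesis using norm_pull_proj[OF gd(1) G(1), of "A ?c"] by linarith
  qed
  have pl: "pull x G h \<in> lps Xw" for h by (rule pull_lp[OF G])
  have pg: "proj G g \<in> lps Xw" by (rule proj_in_lp[OF g])
  have pP: "proj G (\<Phi> f) \<in> lps Xw" by (rule proj_Phi_lp[OF G])
  let ?a = "pull x G (A (push x G' f))"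
  have "lp_norm p (\<lambda>\<alpha>. ?a \<alpha> - proj G g \<alpha>) \<le> \<eta> * lp_norm p g + \<eta> * (M * lp_norm p g)"
    unfolding eq using lp_norm_diff[OF pl[of "?K w"] pl[of "A ?c"]] K1 K2 by linarith
  moreover have "lp_norm p (\<lambda>\<alpha>. ?a \<alpha> - proj G (\<Phi> f) \<alpha>) \<le> \<eta> * (M * lp_norm p g)"
    using bspec[OF ap f] mult_left_mono[OF fn, of \<eta>] \<eta>(1) unfolding pf by linarith
  moreover have "proj G (\<lambda>\<alpha>. \<Phi> f \<alpha> - g \<alpha>) = (\<lambda>\<alpha>. (?a \<alpha> - proj G g \<alpha>) - (?a \<alpha> - proj G (\<Phi> f) \<alpha>))"
    by (auto simp: proj_def[of G])
  then have "lp_norm p (proj G (\<lambda>\<alpha>. \<Phi> f \<alpha> - g \<alpha>)) \<le>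
      lp_norm p (\<lambda>\<alpha>. ?a \<alpha> - proj G g \<alpha>) + lp_norm p (\<lambda>\<alpha>. ?a \<alpha> - proj G (\<Phi> f) \<alpha>)"
    using lp_norm_diff[OF lp_space_diff[OF pl pg] lp_space_diff[OF pl pP], of "A (push x G' f)" "A (push x G' f)"] by simp
  ultimately have "lp_norm p (proj G (\<lambda>\<alpha>. \<Phi> f \<alpha> - g \<alpha>)) \<le>
      \<eta> * lp_norm p g + \<eta> * (M * lp_norm p g) + \<eta> * (M * lp_norm p g)"
    by linarith
  also have "\<dots> = b * \<eta>" by (simp add: b_def algebra_simps)
  finally have "lp_norm p (proj G (\<lambda>\<alpha>. \<Phi> f \<alpha> - g \<alpha>)) \<le> \<epsilon>" using \<eta>(2) by linarith
  then show ?thesis using f fn unfolding M_def by blast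
qed

text \<open>The approximate solutions are bounded and solve the equation ever better on growing
  finite sets. By \<open>local_lower_bound\<close> the difference of two late ones is small at each
  point, which gives convergence pointwise but not in norm. Hence membership of the limit in the
  space, delicate for \<open>p = 0\<close>, and the equation itself need arguments of their
  own.\<close>

lemma limit_surjective:
  assumes below: "below_at_infinity A \<delta>" and B: "B \<in> lp_ops sc p X"
    and K: "op_diff (A \<circ> B) id \<in> ops_K sc p X" and g: "g \<in> lps Xw"
  shows "\<exists>f\<in>lps Xw. \<Phi> f = g"
proof -
  have \<delta>: "0 < \<delta>" using below by (simp add: below_at_infinity_def)
  define m where "m = op_norm p X B * lp_norm p g"
  have m: "0 \<le> m" using op_norm_nonneg[OF B] lp_norm_nonneg[OF g] by (simp add: m_def)
  define fn where "fn z = (SOME f. f \<in> lps Xw \<and> lp_norm p f \<le> m \<and>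
    lp_norm p (proj (fst z) (\<lambda>\<alpha>. \<Phi> f \<alpha> - g \<alpha>)) \<le> inverse (real (Suc (snd z))))" for z
  \<comment> \<open>The finite set on which the equation is tested and the accuracy grow
    independently, so the net is indexed by a product.\<close>
  define N where "N = fin_top \<times>\<^sub>F (sequentially :: nat filter)"
  have N: "N \<noteq> bot" by (simp add: N_def prod_filter_eq_bot)
  define E where "E G n z \<longleftrightarrow> finite (fst z) \<and> G \<subseteq> fst z \<and> fst z \<subseteq> Xw \<and> n \<le> snd z" for G n and z :: "'a filter set \<times> nat"
  have evE: "eventually (E G n) N" if G: "finite G" "G \<subseteq> Xw" for G n
    unfolding N_def eventually_prod_filter
  proof (intro exI[of _ "\<lambda>G'. finite G' \<and> G \<subseteq> G' \<and> G' \<subseteq> Xw"] exI[of _ "\<lambda>k. n \<le> k"] conjI)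
    show "\<forall>\<^sub>F G' in fin_top. finite G' \<and> G \<subseteq> G' \<and> G' \<subseteq> Xw"
      unfolding eventually_finite_subsets_at_top using G by blast
    show "\<forall>\<^sub>F k in sequentially. n \<le> k" by (rule eventually_ge_at_top)
  qed (auto simp: E_def)
  have fn0: "fn z \<in> lps Xw \<and> lp_norm p (fn z) \<le> m \<and>
    lp_norm p (proj (fst z) (\<lambda>\<alpha>. \<Phi> (fn z) \<alpha> - g \<alpha>)) \<le> inverse (real (Suc (snd z)))" if "E G n z" for G n z
  proof -
    have "\<exists>f. f \<in> lps Xw \<and> lp_norm p f \<le> m \<and>
      lp_norm p (proj (fst z) (\<lambda>\<alpha>. \<Phi> f \<alpha> - g \<alpha>)) \<le> inverse (real (Suc (snd z)))"
      using approximate_solution[OF B K g, of "fst z" "inverse (real (Suc (snd z)))"] that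
      unfolding E_def m_def Bex_def by simp
    then show ?thesis unfolding fn_def by (rule someI_ex)
  qed
  have fnm: "fn z \<in> lps Xw" and fnn: "lp_norm p (fn z) \<le> m" if "E G n z" for G n z
    using fn0[OF that] by auto
  have fne: "lp_norm p (proj G (\<lambda>\<alpha>. \<Phi> (fn z) \<alpha> - g \<alpha>)) \<le> inverse (real (Suc n))" if E: "E G n z" for G n z
  proof -
    have d: "(\<lambda>\<alpha>. \<Phi> (fn z) \<alpha> - g \<alpha>) \<in> lps Xw" by (rule lp_space_diff[OF lp_ops_mem[OF Phi_ops fnm[OF E]] g])
    have "lp_norm p (proj G (\<lambda>\<alpha>. \<Phi> (fn z) \<alpha> - g \<alpha>)) \<le> lp_norm p (proj (fst z) (\<lambda>\<alpha>. \<Phi> (fn z) \<alpha> - g \<alpha>))"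
      by (rule lp_norm_dom[OF proj_in_lp[OF d]]) (use E in \<open>auto simp: proj_def E_def\<close>)
    also have "\<dots> \<le> inverse (real (Suc (snd z)))" using fn0[OF E] by blast
    also have "\<dots> \<le> inverse (real (Suc n))" using E by (intro le_imp_inverse_le) (auto simp: E_def)
    finally show ?thesis .
  qed
  have "\<exists>l. ((\<lambda>z. fn z \<gamma>) \<longlongrightarrow> l) N" for \<gamma>
  proof (cases "\<gamma> \<in> Xw")
    case True
    show ?thesis
    proof (rule cauchy_net_converges[OF N])
      fix \<epsilon> :: real assume e: "0 < \<epsilon>"
      \<comment> \<open>A difference of two approximate solutions has norm at most
        \<open>2 * m\<close>; its error term in the local lower bound thus stays within
        \<open>\<delta> * \<epsilon> / 4\<close>.\<close>
      define \<eta> where "\<eta> = \<delta> * \<epsilon> / 4 / (2 * m + 1)"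
      have \<eta>: "0 < \<eta>" "2 * m * \<eta> \<le> \<delta> * \<epsilon> / 4"
        using e \<delta> m mult_div_succ_le[of "2 * m" "\<delta> * \<epsilon> / 4"] by (auto simp: \<eta>_def)
      have "0 < \<delta> * \<epsilon> / 8" using e \<delta> by simp
      then obtain n where n: "inverse (real (Suc n)) < \<delta> * \<epsilon> / 8" using reals_Archimedean by blast
      obtain R where R: "0 \<le> R" "\<And>G0 G u. finite G0 \<Longrightarrow> G0 \<subseteq> Xw \<Longrightarrow> finite G \<Longrightarrow> G \<subseteq> Xw \<Longrightarrow>
          \<forall>\<^sub>F x in \<omega>. nbs R (img G0 x) \<subseteq> img G x \<Longrightarrow> u \<in> lps Xw \<Longrightarrow>
          \<delta> * lp_norm p (proj G0 u) \<le> lp_norm p (proj G (\<Phi> u)) + \<eta> * lp_norm p u"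
        using local_lower_bound[OF below \<eta>(1)] by blast
      have \<gamma>: "finite {\<gamma>}" "{\<gamma>} \<subseteq> Xw" using True by auto
      obtain G where G: "finite G" "G \<subseteq> Xw" "\<forall>\<^sub>F x in \<omega>. nbs R (img {\<gamma>} x) \<subseteq> img G x"
        using cover[OF \<gamma> R(1)] by blast
      have "dist (fn z \<gamma>) (fn z' \<gamma>) < \<epsilon>" if z: "E G n z" "E G n z'" for z z'
      proof -
        let ?u = "\<lambda>\<alpha>. fn z \<alpha> - fn z' \<alpha>"
        have u: "?u \<in> lps Xw" by (rule lp_space_diff[OF fnm[OF z(1)] fnm[OF z(2)]])
        have un: "lp_norm p ?u \<le> 2 * m"
          using lp_norm_diff[OF fnm[OF z(1)] fnm[OF z(2)]] fnn[OF z(1)] fnn[OF z(2)] by linarith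
        have d: "(\<lambda>\<alpha>. \<Phi> (fn y) \<alpha> - g \<alpha>) \<in> lps Xw" if "E G n y" for y
          by (rule lp_space_diff[OF lp_ops_mem[OF Phi_ops fnm[OF that]] g])
        have eq: "proj G (\<Phi> ?u) = (\<lambda>\<alpha>. proj G (\<lambda>\<alpha>. \<Phi> (fn z) \<alpha> - g \<alpha>) \<alpha> - proj G (\<lambda>\<alpha>. \<Phi> (fn z') \<alpha> - g \<alpha>) \<alpha>)"
          using lp_ops_diff[OF Phi_ops fnm[OF z(1)] fnm[OF z(2)]] by (auto simp: proj_def[of G])
        have "lp_norm p (proj G (\<Phi> ?u)) \<le> lp_norm p (proj G (\<lambda>\<alpha>. \<Phi> (fn z) \<alpha> - g \<alpha>)) + lp_norm p (proj G (\<lambda>\<alpha>. \<Phi> (fn z') \<alpha> - g \<alpha>))"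
          unfolding eq by (rule lp_norm_diff[OF proj_in_lp[OF d[OF z(1)]] proj_in_lp[OF d[OF z(2)]]])
        also have "\<dots> < \<delta> * \<epsilon> / 8 + \<delta> * \<epsilon> / 8" using fne[OF z(1)] fne[OF z(2)] n by linarith
        finally have 1: "lp_norm p (proj G (\<Phi> ?u)) < \<delta> * \<epsilon> / 4" by simp
        have "\<eta> * lp_norm p ?u \<le> \<eta> * (2 * m)" using un \<eta>(1) by (intro mult_left_mono) auto
        also have "\<dots> \<le> \<delta> * \<epsilon> / 4" using \<eta>(2) by (simp add: mult.commute)
        finally have "\<delta> * lp_norm p (proj {\<gamma>} ?u) < \<delta> * \<epsilon> / 2" using 1 R(2)[OF \<gamma> G u] by linarith
        then have "lp_norm p (proj {\<gamma>} ?u) < \<epsilon> / 2" using \<delta> by (simp add: mult_less_cancel_left_pos flip: times_divide_eq_right)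
        moreover have "norm (proj {\<gamma>} ?u \<gamma>) \<le> lp_norm p (proj {\<gamma>} ?u)" by (rule lp_norm_point[OF proj_in_lp[OF u]])
        ultimately have "norm (fn z \<gamma> - fn z' \<gamma>) < \<epsilon>" using e by (simp add: proj_def)
        then show ?thesis by (simp add: dist_norm)
      qed
      then show "\<exists>Q. eventually Q N \<and> (\<forall>z z'. Q z \<longrightarrow> Q z' \<longrightarrow> dist (fn z \<gamma>) (fn z' \<gamma>) < \<epsilon>)"
        using evE[OF G(1,2), of n] by blast
    qed
  next
    case False
    have "\<forall>\<^sub>F z in N. 0 = fn z \<gamma>"
      using evE[OF finite.emptyI empty_subsetI, of 0] by eventually_elim (use False lp_space_supp[OF fnm] in auto)
    then have "((\<lambda>z. fn z \<gamma>) \<longlongrightarrow> 0) N" by (rule Lim_transform_eventually[OF tendsto_const])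
    then show ?thesis ..
  qed
  then have "\<exists>f. \<forall>\<gamma>. ((\<lambda>z. fn z \<gamma>) \<longlongrightarrow> f \<gamma>) N" by (intro choice allI)
  then obtain f where lim: "\<And>\<gamma>. ((\<lambda>z. fn z \<gamma>) \<longlongrightarrow> f \<gamma>) N" by blast
  have "\<forall>\<^sub>F z in N. lp_le (fn z) m"
    using evE[OF finite.emptyI empty_subsetI, of 0] by eventually_elim (rule lp_le_weaken[OF lp_le_norm[OF fnm] fnn], auto)
  from lp_le_limit[OF N this lim] have fle: "lp_le f m" .
  have off: "f \<gamma> = 0" if "\<gamma> \<notin> Xw" for \<gamma>
  proof (rule tendsto_unique[OF N lim])
    have "\<forall>\<^sub>F z in N. 0 = fn z \<gamma>"
      using evE[OF finite.emptyI empty_subsetI, of 0] by eventually_elim (use that lp_space_supp[OF fnm] in auto)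
    then show "((\<lambda>z. fn z \<gamma>) \<longlongrightarrow> 0) N" by (rule Lim_transform_eventually[OF tendsto_const])
  qed
  have f: "f \<in> lps Xw"
  proof (rule lp_spaceI0[OF fle off])
    fix \<epsilon> :: real assume p0: "p = 0" and e: "0 < \<epsilon>"
    \<comment> \<open>Away from the neighbourhood \<open>H'\<close> of the essential support
      \<open>H\<close> of \<open>g\<close>, three errors of size \<open>\<theta>\<close> occur: the
      inexactness of the solution, \<open>g\<close> off \<open>H\<close>, and the term with
      \<open>\<eta>\<close>. After division by \<open>\<delta>\<close> they amount to
      \<open>3 / 4 * \<epsilon>\<close>.\<close>
    define \<theta> where "\<theta> = \<delta> * \<epsilon> / 4"
    have \<theta>: "0 < \<theta>" using e \<delta> by (simp add: \<theta>_def)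
    define \<eta> where "\<eta> = \<theta> / (m + 1)"
    have \<eta>: "0 < \<eta>" "m * \<eta> \<le> \<theta>" using \<theta> m mult_div_succ_le[of m \<theta>] by (auto simp: \<eta>_def)
    obtain H where H: "finite H" "H \<subseteq> Xw" "lp_le (coproj H g) \<theta>"
      using lp_space_vanish[OF g p0_ne_inf[OF p0] \<theta>] by blast
    obtain n where n: "inverse (real (Suc n)) < \<theta>" using reals_Archimedean[OF \<theta>] by blast
    obtain R where R: "0 \<le> R" "\<And>G0 G u. finite G0 \<Longrightarrow> G0 \<subseteq> Xw \<Longrightarrow> finite G \<Longrightarrow> G \<subseteq> Xw \<Longrightarrow>
        \<forall>\<^sub>F x in \<omega>. nbs R (img G0 x) \<subseteq> img G x \<Longrightarrow> u \<in> lps Xw \<Longrightarrow>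
        \<delta> * lp_norm p (proj G0 u) \<le> lp_norm p (proj G (\<Phi> u)) + \<eta> * lp_norm p u"
      using local_lower_bound[OF below \<eta>(1)] by blast
    obtain H' where H': "finite H'" "H' \<subseteq> Xw" "\<forall>\<^sub>F x in \<omega>. nbs R (img H x) \<subseteq> img H' x"
      using cover[OF H(1,2) R(1)] by blast
    have "norm (f \<gamma>) < \<epsilon>" if nH: "\<gamma> \<notin> H'" for \<gamma>
    proof (cases "\<gamma> \<in> Xw")
      case True
      then have \<gamma>: "finite {\<gamma>}" "{\<gamma>} \<subseteq> Xw" by auto
      obtain G where G: "finite G" "G \<subseteq> Xw" "\<forall>\<^sub>F x in \<omega>. nbs R (img {\<gamma>} x) \<subseteq> img G x"
        using cover[OF \<gamma> R(1)] by blast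
      have GH: "finite (G - H)" "G - H \<subseteq> Xw" using G by auto
      have "\<forall>\<^sub>F x in \<omega>. good (insert \<gamma> (H' \<union> H)) x"
        using True H H' by (intro eventually_good) auto
      then have nbG: "\<forall>\<^sub>F x in \<omega>. nbs R (img {\<gamma>} x) \<subseteq> img (G - H) x"
        using G(3) H'(3)
      proof eventually_elim
        case (elim x)
        have gX: "V \<gamma> x \<in> X" using elim(1) by (auto simp: good_def img_def)
        show ?case
        proof
          fix y assume y: "y \<in> nbs R (img {\<gamma>} x)"
          then obtain \<beta> where \<beta>: "\<beta> \<in> G" "y = V \<beta> x" using elim(2) by (auto simp: img_def)
          \<comment> \<open>Neighbourhoods are symmetric: were \<open>\<beta>\<close> in
            \<open>H\<close>, then \<open>\<gamma>\<close> would belong to the neighbourhood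
            \<open>H'\<close> of \<open>H\<close>.\<close>
          have "\<beta> \<notin> H"
          proof
            assume bH: "\<beta> \<in> H"
            have "d (V \<gamma> x) y \<le> R" using y by (simp add: nbs_mem img_def)
            then have "V \<gamma> x \<in> nbs R (img H x)"
              unfolding nbs_mem using gX bH \<beta>(2) by (auto simp: img_def commute)
            then have "V \<gamma> x \<in> img H' x" using elim(3) by blast
            then obtain \<beta>' where "\<beta>' \<in> H'" "V \<gamma> x = V \<beta>' x" by (auto simp: img_def)
            then have "\<gamma> = \<beta>'" using elim(1) unfolding good_def inj_on_def by blast
            then show False using nH \<open>\<beta>' \<in> H'\<close> by simp
          qed
          then show "y \<in> img (G - H) x" using \<beta> by (auto simp: img_def)
        qed
      qed
      have "norm (fn z \<gamma>) \<le> 3 / 4 * \<epsilon>" if z: "E G n z" for z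
      proof -
        note zl = fnm[OF z]
        have d: "(\<lambda>\<alpha>. \<Phi> (fn z) \<alpha> - g \<alpha>) \<in> lps Xw" by (rule lp_space_diff[OF lp_ops_mem[OF Phi_ops zl] g])
        have eq: "proj (G - H) (\<Phi> (fn z)) = (\<lambda>\<alpha>. proj (G - H) (\<lambda>\<alpha>. \<Phi> (fn z) \<alpha> - g \<alpha>) \<alpha> + proj (G - H) g \<alpha>)"
          by (auto simp: proj_def[of "G - H"])
        have "lp_norm p (proj (G - H) (\<Phi> (fn z))) \<le> lp_norm p (proj (G - H) (\<lambda>\<alpha>. \<Phi> (fn z) \<alpha> - g \<alpha>)) + lp_norm p (proj (G - H) g)"
          unfolding eq by (rule lp_norm_add[OF proj_in_lp[OF d] proj_in_lp[OF g]])
        moreover have "lp_norm p (proj (G - H) (\<lambda>\<alpha>. \<Phi> (fn z) \<alpha> - g \<alpha>)) \<le> lp_norm p (proj G (\<lambda>\<alpha>. \<Phi> (fn z) \<alpha> - g \<alpha>))"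
          by (rule lp_norm_dom[OF proj_in_lp[OF d]]) (auto simp: proj_def)
        moreover have "lp_norm p (proj (G - H) g) \<le> \<theta>"
          by (rule lp_norm_le[OF lp_le_mono[OF H(3)]]) (auto simp: proj_def coproj_apply)
        moreover have "\<eta> * lp_norm p (fn z) \<le> \<theta>"
          using mult_right_mono[OF fnn[OF z], of \<eta>] \<eta> by (simp only: mult.commute[of \<eta>]) linarith
        moreover have "\<delta> * norm (fn z \<gamma>) \<le> \<delta> * lp_norm p (proj {\<gamma>} (fn z))"
          using lp_norm_point[OF proj_in_lp[OF zl, of "{\<gamma>}"], of \<gamma>] \<delta> by (intro mult_left_mono) (auto simp: proj_def)
        ultimately have "\<delta> * norm (fn z \<gamma>) \<le> 3 * \<theta>"
          using R(2)[OF \<gamma> GH nbG zl] fne[OF z] n by linarith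
        then have "\<delta> * norm (fn z \<gamma>) \<le> \<delta> * (3 / 4 * \<epsilon>)" by (simp add: \<theta>_def)
        then show ?thesis using \<delta> by (simp only: mult_le_cancel_left_pos)
      qed
      then have "\<forall>\<^sub>F z in N. norm (fn z \<gamma>) \<le> 3 / 4 * \<epsilon>" by (rule eventually_mono[OF evE[OF G(1,2)]])
      from tendsto_upperbound[OF tendsto_norm[OF lim] this N] show ?thesis using e by simp
    qed (use off e in simp)
    then show "\<exists>F. finite F \<and> (\<forall>\<gamma>. \<gamma> \<notin> F \<longrightarrow> norm (f \<gamma>) < \<epsilon>)" using H'(1) by blast
  qed
  have "\<Phi> f \<alpha> = g \<alpha>" for \<alpha>
  proof (cases "\<alpha> \<in> Xw")
    case True
    then have \<alpha>: "finite {\<alpha>}" "{\<alpha>} \<subseteq> Xw" by auto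
    have "norm (\<Phi> f \<alpha> - g \<alpha>) \<le> 0"
    proof (rule le_of_le_add)
      show "0 \<le> 2 + 2 * m" using m by simp
      fix \<epsilon> :: real assume e: "0 < \<epsilon>"
      obtain n where n: "inverse (real (Suc n)) < \<epsilon>" using reals_Archimedean[OF e] by blast
      obtain G where G: "finite G" "G \<subseteq> Xw"
          "\<And>u. u \<in> lps Xw \<Longrightarrow> lp_le (proj {\<alpha>} (\<Phi> (coproj G u))) (\<epsilon> * lp_norm p u)"
        using Phi_local_ex[OF e \<alpha>] by blast
      \<comment> \<open>\<open>\<Phi>\<close> need not be continuous for pointwise convergence. On
        the finite set \<open>G\<close> it is, and the part off \<open>G\<close> is uniformly small
        at \<open>\<alpha>\<close>, since all vectors involved are bounded by
        \<open>m\<close>.\<close>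
      have "((\<lambda>z. \<Phi> (proj G (fn z)) \<alpha>) \<longlongrightarrow> \<Phi> (proj G f) \<alpha>) N"
        unfolding Phi_finite[OF G(1,2) True] by (intro tendsto_sum blinfun.tendsto tendsto_const lim)
      from tendstoD[OF this e] have "\<forall>\<^sub>F z in N. dist (\<Phi> (proj G (fn z)) \<alpha>) (\<Phi> (proj G f) \<alpha>) < \<epsilon>" .
      then have "\<forall>\<^sub>F z in N. dist (\<Phi> (proj G (fn z)) \<alpha>) (\<Phi> (proj G f) \<alpha>) < \<epsilon> \<and> E {\<alpha>} n z"
        using evE[OF \<alpha>] by (rule eventually_conj)
      then obtain z where z: "dist (\<Phi> (proj G (fn z)) \<alpha>) (\<Phi> (proj G f) \<alpha>) < \<epsilon>" "E {\<alpha>} n z"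
        using eventually_happens'[OF N] by blast
      note zl = fnm[OF z(2)]
      let ?u = "\<lambda>\<alpha>. f \<alpha> - fn z \<alpha>"
      have u: "?u \<in> lps Xw" by (rule lp_space_diff[OF f zl])
      have un: "lp_norm p ?u \<le> 2 * m"
        using lp_norm_diff[OF f zl] lp_norm_le[OF fle] fnn[OF z(2)] by linarith
      have split: "\<Phi> v \<alpha> = \<Phi> (proj G v) \<alpha> + \<Phi> (coproj G v) \<alpha>" if v: "v \<in> lps Xw" for v
      proof -
        have "v = (\<lambda>\<alpha>. proj G v \<alpha> + coproj G v \<alpha>)" by (auto simp: proj_def coproj_apply)
        then show ?thesis using Phi_add[OF proj_in_lp[OF v] coproj_in_lp[OF v], of G G] by metis
      qed
      have "\<Phi> ?u \<alpha> = \<Phi> f \<alpha> - \<Phi> (fn z) \<alpha>" using lp_ops_diff[OF Phi_ops f zl] by simp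
      moreover have "\<Phi> (proj G ?u) \<alpha> = \<Phi> (proj G f) \<alpha> - \<Phi> (proj G (fn z)) \<alpha>"
        unfolding Phi_finite[OF G(1,2) True] by (simp add: blinfun.diff_right sum_subtractf)
      ultimately have "\<Phi> f \<alpha> - g \<alpha> = (\<Phi> (proj G f) \<alpha> - \<Phi> (proj G (fn z)) \<alpha>) + \<Phi> (coproj G ?u) \<alpha> + (\<Phi> (fn z) \<alpha> - g \<alpha>)"
        using split[OF u] by simp
      then have "norm (\<Phi> f \<alpha> - g \<alpha>) \<le> norm (\<Phi> (proj G f) \<alpha> - \<Phi> (proj G (fn z)) \<alpha>) + norm (\<Phi> (coproj G ?u) \<alpha>) + norm (\<Phi> (fn z) \<alpha> - g \<alpha>)"
        by (simp only: norm_triangle_mono[OF norm_triangle_ineq order_refl])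
      moreover have "norm (\<Phi> (proj G f) \<alpha> - \<Phi> (proj G (fn z)) \<alpha>) \<le> \<epsilon>" using z(1) by (simp add: dist_norm norm_minus_commute)
      moreover have "norm (\<Phi> (coproj G ?u) \<alpha>) \<le> \<epsilon> * (2 * m)"
      proof -
        have "norm (\<Phi> (coproj G ?u) \<alpha>) \<le> \<epsilon> * lp_norm p ?u"
          using lp_le_point[OF G(3)[OF u], of \<alpha>] by (simp add: proj_def[of "{\<alpha>}"])
        also have "\<dots> \<le> \<epsilon> * (2 * m)" using e un by (intro mult_left_mono) auto
        finally show ?thesis .
      qed
      moreover have "norm (\<Phi> (fn z) \<alpha> - g \<alpha>) \<le> \<epsilon>"
      proof -
        have d: "(\<lambda>\<alpha>. \<Phi> (fn z) \<alpha> - g \<alpha>) \<in> lps Xw" by (rule lp_space_diff[OF lp_ops_mem[OF Phi_ops zl] g])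
        have "norm (proj {\<alpha>} (\<lambda>\<alpha>. \<Phi> (fn z) \<alpha> - g \<alpha>) \<alpha>) \<le> lp_norm p (proj {\<alpha>} (\<lambda>\<alpha>. \<Phi> (fn z) \<alpha> - g \<alpha>))"
          by (rule lp_norm_point[OF proj_in_lp[OF d]])
        then show ?thesis using fne[OF z(2)] n by (simp add: proj_def[of "{\<alpha>}"])
      qed
      moreover have "0 + \<epsilon> * (2 + 2 * m) = \<epsilon> + \<epsilon> * (2 * m) + \<epsilon>" by (simp add: distrib_left)
      ultimately show "norm (\<Phi> f \<alpha> - g \<alpha>) \<le> 0 + \<epsilon> * (2 + 2 * m)" by linarith
    qed
    then show ?thesis by simp
  qed (use lp_space_supp[OF g] in \<open>simp add: Phi_off\<close>)
  then show ?thesis using f by blast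
qed

lemma invertible_op_limit_iff:
  "invertible_op sc p Xw (limit_op sc p X d \<omega> A) \<longleftrightarrow>
    (\<exists>B\<in>lp_ops sc p Xw. \<forall>f\<in>lps Xw. B (\<Phi> f) = f \<and> \<Phi> (B f) = f)"
proof -
  have "(\<forall>f\<in>lps Xw. B (limit_op sc p X d \<omega> A f) = f \<and> limit_op sc p X d \<omega> A (B f) = f) \<longleftrightarrow>
    (\<forall>f\<in>lps Xw. B (\<Phi> f) = f \<and> \<Phi> (B f) = f)" if "B \<in> lp_ops sc p Xw" for B
    using that by (simp add: limit_op_apply lp_ops_mem)
  then show ?thesis unfolding invertible_op_def using limit_op_ops by blast
qed

lemma invertible_limit:
  assumes "below_at_infinity A \<delta>" "B \<in> lp_ops sc p X" "op_diff (A \<circ> B) id \<in> ops_K sc p X"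
  shows "invertible_op sc p Xw (limit_op sc p X d \<omega> A)"
proof -
  have \<delta>: "0 < \<delta>" using assms(1) by (simp add: below_at_infinity_def)
  show ?thesis
    unfolding invertible_op_limit_iff
    using bounded_below_surjective_inverse[OF Phi_ops \<delta> Phi_below[OF assms(1)] limit_surjective[OF assms]] by blast
qed

lemma invertible_bounded_below:
  assumes "invertible_op sc p Xw (limit_op sc p X d \<omega> A)"
  shows "\<exists>c>0. \<forall>u\<in>lps Xw. c * lp_norm p u \<le> lp_norm p (\<Phi> u)"
proof -
  obtain B where B: "B \<in> lp_ops sc p Xw" "\<forall>f\<in>lps Xw. B (\<Phi> f) = f \<and> \<Phi> (B f) = f"
    using assms unfolding invertible_op_limit_iff by blast
  note nB = op_norm_nonneg[OF B(1)]
  have "1 / (op_norm p Xw B + 1) * lp_norm p u \<le> lp_norm p (\<Phi> u)" if u: "u \<in> lps Xw" for u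
  proof -
    have Pu: "\<Phi> u \<in> lps Xw" by (rule lp_ops_mem[OF Phi_ops u])
    have "lp_norm p u \<le> op_norm p Xw B * lp_norm p (\<Phi> u)" using op_norm_bound[OF B(1) Pu] B(2) u by simp
    also have "\<dots> \<le> (op_norm p Xw B + 1) * lp_norm p (\<Phi> u)" using lp_norm_nonneg[OF Pu] by (simp add: distrib_right)
    finally show ?thesis using nB by (simp add: field_simps)
  qed
  moreover have "0 < 1 / (op_norm p Xw B + 1)" using nB by simp
  ultimately show ?thesis by blast
qed

lemma inverse_bound:
  assumes "invertible_op sc p Xw (limit_op sc p X d \<omega> A)" and below: "below_at_infinity A \<delta>"
  shows "\<exists>B\<in>lp_ops sc p Xw. \<forall>u\<in>lps Xw. \<Phi> (B u) = u \<and> lp_norm p (B u) \<le> 1 / \<delta> * lp_norm p u"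
    and "op_norm p Xw (op_inverse p Xw (limit_op sc p X d \<omega> A)) \<le> 1 / \<delta>"
proof -
  have \<delta>: "0 < \<delta>" using below by (simp add: below_at_infinity_def)
  obtain B where B: "B \<in> lp_ops sc p Xw" "\<forall>f\<in>lps Xw. B (\<Phi> f) = f \<and> \<Phi> (B f) = f"
    using assms(1) unfolding invertible_op_limit_iff by blast
  have Bn: "lp_norm p (B u) \<le> 1 / \<delta> * lp_norm p u" if u: "u \<in> lps Xw" for u
    using Phi_below[OF below lp_ops_mem[OF B(1) u]] B(2) u \<delta> by (simp add: field_simps)
  then show "\<exists>B\<in>lp_ops sc p Xw. \<forall>u\<in>lps Xw. \<Phi> (B u) = u \<and> lp_norm p (B u) \<le> 1 / \<delta> * lp_norm p u"
    using B by blast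
  let ?L = "limit_op sc p X d \<omega> A"
  \<comment> \<open>\<open>op_inverse\<close> is a chosen preimage; injectivity identifies it with
    \<open>B\<close>.\<close>
  have "op_inverse p Xw ?L u = B u" if u: "u \<in> lps Xw" for u
  proof (rule inv_into_f_eq)
    show "inj_on ?L (lp_space p Xw)"
    proof (rule inj_onI)
      fix v w assume "v \<in> lps Xw" "w \<in> lps Xw" "?L v = ?L w"
      then have "\<Phi> v = \<Phi> w" by (simp add: limit_op_apply)
      then show "v = w" using B(2) \<open>v \<in> lps Xw\<close> \<open>w \<in> lps Xw\<close> by metis
    qed
    show "B u \<in> lp_space p Xw" by (rule lp_ops_mem[OF B(1) u])
    then show "?L (B u) = u" using B(2) u by (simp add: limit_op_apply)
  qed
  then show "op_norm p Xw (op_inverse p Xw ?L) \<le> 1 / \<delta>" using \<delta> Bn by (intro op_norm_le) auto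
qed

end

theorem theorem5p1:
  fixes X :: "'a set" and d :: "'a \<Rightarrow> 'a \<Rightarrow> real"
    and sc :: "'k::real_normed_field \<Rightarrow> 'e::banach \<Rightarrow> 'e"
    and p :: ennreal and q :: real
    and A :: "('a \<Rightarrow> 'e) \<Rightarrow> ('a \<Rightarrow> 'e)"
  assumes "is_space X d"
    and "1 \<le> q" and "property_A q X d"
    and "banach_scaling sc"
    and "p = 0 \<or> 1 \<le> p"
    and "A \<in> ops_A sc p X d"
    and "rich X d A"
  shows "(invertible_at_infinity sc p X A \<longleftrightarrow> P_Fredholm sc p X A) \<and>
    (P_Fredholm sc p X A \<longleftrightarrow> (\<exists>B\<in>ops_A sc p X d. inverse_mod_K sc p X A B)) \<and>
    ((\<exists>B\<in>ops_A sc p X d. inverse_mod_K sc p X A B) \<longleftrightarrow>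
      (\<forall>\<omega>\<in>beta_boundary X. invertible_op sc p (limit_space X d \<omega>) (limit_op sc p X d \<omega> A)) \<and>
      bdd_above ((\<lambda>\<omega>. op_norm p (limit_space X d \<omega>)
        (op_inverse p (limit_space X d \<omega>) (limit_op sc p X d \<omega> A))) ` beta_boundary X)) \<and>
    ((\<forall>\<omega>\<in>beta_boundary X. invertible_op sc p (limit_space X d \<omega>) (limit_op sc p X d \<omega> A)) \<and>
      bdd_above ((\<lambda>\<omega>. op_norm p (limit_space X d \<omega>)
        (op_inverse p (limit_space X d \<omega>) (limit_op sc p X d \<omega> A))) ` beta_boundary X) \<longleftrightarrow>
      (\<forall>\<omega>\<in>beta_boundary X. invertible_op sc p (limit_space X d \<omega>) (limit_op sc p X d \<omega> A)))"
proof -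
  let ?inv = "\<forall>\<omega>\<in>beta_boundary X. invertible_op sc p (limit_space X d \<omega>) (limit_op sc p X d \<omega> A)"
  let ?bdd = "bdd_above ((\<lambda>\<omega>. op_norm p (limit_space X d \<omega>)
    (op_inverse p (limit_space X d \<omega>) (limit_op sc p X d \<omega> A))) ` beta_boundary X)"
  let ?mod = "\<exists>B\<in>ops_A sc p X d. inverse_mod_K sc p X A B"
  interpret Metric_space X d using assms(1) by (simp add: is_space_def)
  interpret bg_space p sc X d
    by unfold_locales (use assms in \<open>auto simp: is_space_def\<close>)
  note A = assms(6)
  have limop: "limit_operator p sc X d \<omega> A" if "\<omega> \<in> beta_boundary X" for \<omega>
    by unfold_locales (use that A assms(7) in \<open>auto simp: rich_def\<close>)
  \<comment> \<open>The implications run from (3) to (2), (1) and (5), and from (5) back to (3)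
    together with the bound in (4).\<close>
  have "P_Fredholm sc p X A" if ?mod
    using that ops_A_subset_L[OF A] ops_A_subset_L unfolding P_Fredholm_def by blast
  moreover have "invertible_at_infinity sc p X A" if "P_Fredholm sc p X A"
    using that ops_L_D(1) unfolding P_Fredholm_def invertible_at_infinity_def by blast
  moreover have ?inv if inf: "invertible_at_infinity sc p X A"
  proof
    fix \<omega> assume \<omega>: "\<omega> \<in> beta_boundary X"
    interpret limit_operator p sc X d \<omega> A by (rule limop[OF \<omega>])
    obtain B where B: "B \<in> lp_ops sc p X" "op_diff (A \<circ> B) id \<in> ops_K sc p X" "op_diff (B \<circ> A) id \<in> ops_K sc p X"
      using inf unfolding invertible_at_infinity_def inverse_mod_K_def by blast
    obtain \<delta> where "below_at_infinity A \<delta>" using below_if_left_inverse[OF ops_A_D(1)[OF A] B(1,3)] ..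
    then show "invertible_op sc p (limit_space X d \<omega>) (limit_op sc p X d \<omega> A)"
      by (rule invertible_limit[OF _ B(1,2)])
  qed
  moreover have "?bdd \<and> ?mod" if inv: ?inv
  proof -
    have "\<exists>\<delta>. below_at_infinity A \<delta>"
    proof (rule below_at_infinity_if_limits_below[OF A assms(2,3,7)])
      fix \<omega> assume \<omega>: "\<omega> \<in> beta_boundary X"
      interpret limit_operator p sc X d \<omega> A by (rule limop[OF \<omega>])
      show "\<exists>c>0. \<forall>u\<in>lps (limit_space X d \<omega>).
        c * lp_norm p u \<le> lp_norm p (matrix_op (limit_space X d \<omega>) (limit_matrix X d \<omega> A) u)"
        using invertible_bounded_below inv \<omega> by blast
    qed
    then obtain \<delta> where below: "below_at_infinity A \<delta>" ..
    have "op_norm p (limit_space X d \<omega>) (op_inverse p (limit_space X d \<omega>) (limit_op sc p X d \<omega> A)) \<le> 1 / \<delta>"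
      if "\<omega> \<in> beta_boundary X" for \<omega>
      using limit_operator.inverse_bound(2)[OF limop[OF that] _ below] inv that by blast
    then have ?bdd by (rule bdd_aboveI2)
    have M: "0 \<le> 1 / \<delta>" using below by (simp add: below_at_infinity_def)
    have "\<exists>B\<in>ops_A sc p X d. op_diff (A \<circ> B) id \<in> ops_K sc p X"
    proof (rule parametrix[OF A assms(2,3) M])
      fix r \<epsilon> :: real assume re: "0 \<le> r" "0 < \<epsilon>"
      show "finite {x \<in> X. \<not> right_invertible_near A (1 / \<delta>) r \<epsilon> x}"
      proof (rule local_right_inverses[OF A assms(7) M re])
        fix \<omega> assume \<omega>: "\<omega> \<in> beta_boundary X"
        show "\<exists>B\<in>lp_ops sc p (limit_space X d \<omega>). \<forall>u\<in>lps (limit_space X d \<omega>).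
          matrix_op (limit_space X d \<omega>) (limit_matrix X d \<omega> A) (B u) = u \<and> lp_norm p (B u) \<le> 1 / \<delta> * lp_norm p u"
          using limit_operator.inverse_bound(1)[OF limop[OF \<omega>] _ below] inv \<omega> by blast
      qed
    qed
    then obtain B where "B \<in> ops_A sc p X d" "op_diff (A \<circ> B) id \<in> ops_K sc p X" by blast
    then have ?mod using right_inverse_two_sided[OF A below] by blast
    with \<open>?bdd\<close> show ?thesis ..
  qed
  ultimately show ?thesis by argo
qed

end
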